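(* Let $\mathbb K$ be a field with $\operatorname{char}(\mathbb K)\notin\{2,3\}$ and let $A$ be the graded $\mathbb K$-algebra defined in the context. Consider an arbitrary $A_\infty$-structure $\mathcal A'$ on $A$ with $\mu^1_{\mathcal A'}=0$ and $\mu^2_{\mathcal A'}(x,y)=(-1)^{|y|}xy$. (1) The structure $\mathcal A'$ is equivalent, under the action of the group of gauge transformations, to an $A_\infty$-structure $\mathcal A''$ in which the structure maps $\mu^1,\mu^3,\mu^4$ and $\mu^5$ all vanish. (2) For $\mathcal A''$ as in (1), the products $\mu^6_{\mathcal A''}$ and $\mu^8_{\mathcal A''}$ are cocycles representing classes $m^6\in HH^2(A,A)^{-4}$ and $m^8\in HH^2(A,A)^{-6}$ respectively. These classes are invariants of $\mathcal A'$. Two such $A_\infty$-structures which define the same classes $(m^6,m^8)$ are gauge-equivalent. (3) Every class in $HH^2(A,A)^{-4}\times HH^2(A,A)^{-6}$ is realized as the invariant $(m^6,m^8)$ of some minimal $A_\infty$-structure on $A$ (with $\mu^2(x,y)=(-1)^{|y|}xy$). Hence gauge-equivalence classes of minimal $A_\infty$-structures on $A$ are canonically parametrized by this product of two 1-dimensional $\mathbb K$-vector spaces, and the action of $\mathbb K^*$ rescaling structure maps, defined by $\mu^d_{t\mathcal A'}=t^{d-2}\mu^d_{\mathcal A'}$, corresponds to the action $t\cdot(\alpha,\beta)=(t^4\alpha,t^6\beta)$ on $HH^2(A,A)^{-4}\times HH^2(A,A)^{-6}$.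
   Context: **The algebra $A$.** $A$ is the graded associative unital $\mathbb K$-algebra with basis $e_0,f_0,v$ in degree $0$ and $u,e_1,f_1$ in degree $1$. Here $e_0,f_0$ are orthogonal idempotents with $e_0+f_0=1$; $u=f_0ue_0$, $v=e_0vf_0$, $e_1=e_0e_1e_0$, $f_1=f_0f_1f_0$; and the only non-zero products not involving $e_0$ or $f_0$ are $uv=f_1$ and $vu=e_1$. Equivalently $A$ is the graded category with objects $a,b$, $\operatorname{Hom}(a,a)=\mathbb K\{e_0,e_1\}$, $\operatorname{Hom}(b,b)=\mathbb K\{f_0,f_1\}$, $\operatorname{Hom}(a,b)=\mathbb Ku$, $\operatorname{Hom}(b,a)=\mathbb Kv$ (the cohomology category of two objects of the Fukaya category of a once-punctured torus meeting at one point). **Hochschild cohomology.** $CC^{r+s}(A,A)^s$ is the space of degree-preserving linear maps $A^{\otimes r}\to A[s]$ which vanish on monomials one of whose factors is $1$; with the Hochschild differential $\delta$ (preserving $s$) and the Gerstenhaber bracket, $CC^{*+1}(A,A)$ is a dg Lie algebra. $HH^{*}(A,A)^s$ is the cohomology in internal degree $s$. **$A_\infty$-structures.** An $A_\infty$-structure on $A$ consists of maps $\mu^d\in CC^2(A,A)^{2-d}$, i.e. $\mu^d:A^{\otimes d}\to A[2-d]$ ($d\ge1$; normalized for $d\ge3$), satisfying $\sum_{i,j}(-1)^{|a_1|+\cdots+|a_i|-i}\mu^{d-j+1}(a_d,\dots,a_{i+j+1},\mu^j(a_{i+j},\dots,a_{i+1}),a_i,\dots,a_1)=0$. It is minimal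 if $\mu^1=0$; "minimal $A_\infty$-structure on $A$" means with $\mu^2(x,y)=(-1)^{|y|}xy$. **Gauge transformations.** A gauge transformation (formal diffeomorphism) $G$ is a sequence $g^d\in CC^1(A,A)^{1-d}$, i.e. degree-preserving maps $g^d:A^{\otimes d}\to A[1-d]$, with $g^1=\mathrm{id}$. These form a group acting on minimal $A_\infty$-structures: $G_*\mu$ is the unique $A_\infty$-structure for which $G$ is an $A_\infty$-homomorphism from $(A,\mu)$ to $(A,G_*\mu)$. Two structures are gauge-equivalent if they lie in the same orbit. *)

theory Defs
  imports "HOL-Analysis.Analysis"
begin

section \<open>The graded algebra\<close>

datatype gen = E0 | F0 | V | U | E1 | F1

lemma UNIV_gen: "(UNIV :: gen set) = {E0, F0, V, U, E1, F1}"
  using gen.exhaust by blast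

instance gen :: finite
  by standard (simp add: UNIV_gen)

type_synonym 'k alg = "'k ^ gen"

fun deg :: "gen \<Rightarrow> int" where
  "deg E0 = 0"
| "deg F0 = 0"
| "deg V = 0"
| "deg U = 1"
| "deg E1 = 1"
| "deg F1 = 1"

text \<open>
  The product of two basis vectors is either a basis vector or zero (\<open>None\<close>). The first ten
  equations encode the idempotents and \<open>u = f0 u e0\<close>, \<open>v = e0 v f0\<close>, \<open>e1 = e0 e1 e0\<close>,
  \<open>f1 = f0 f1 f0\<close>.
\<close>

fun gen_mult :: "gen \<Rightarrow> gen \<Rightarrow> gen option" where
  "gen_mult E0 E0 = Some E0"
| "gen_mult F0 F0 = Some F0"
| "gen_mult F0 U = Some U"
| "gen_mult U E0 = Some U"
| "gen_mult E0 V = Some V"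
| "gen_mult V F0 = Some V"
| "gen_mult E0 E1 = Some E1"
| "gen_mult E1 E0 = Some E1"
| "gen_mult F0 F1 = Some F1"
| "gen_mult F1 F0 = Some F1"
| "gen_mult U V = Some F1"
| "gen_mult V U = Some E1"
| "gen_mult _ _ = None"

definition alg_mult :: "'k::field alg \<Rightarrow> 'k alg \<Rightarrow> 'k alg" (infixl \<open>\<star>\<close> 70) where
  "a \<star> b = (\<chi> k. \<Sum>g\<in>UNIV. \<Sum>h\<in>UNIV. if gen_mult g h = Some k then a $ g * b $ h else 0)"

definition alg_one :: "'k::field alg" where
  "alg_one = axis E0 1 + axis F0 1"

lemma alg_one_left: "alg_one \<star> a = a"
proof -
  have "(alg_one \<star> a) $ k = a $ k" for k
    by (cases k) (simp_all add: alg_mult_def alg_one_def axis_def UNIV_gen)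
  then show ?thesis by (simp add: vec_eq_iff)
qed

lemma alg_one_right: "a \<star> alg_one = a"
proof -
  have "(a \<star> alg_one) $ k = a $ k" for k
    by (cases k) (simp_all add: alg_mult_def alg_one_def axis_def UNIV_gen)
  then show ?thesis by (simp add: vec_eq_iff)
qed

lemma alg_mult_assoc: "(a \<star> b) \<star> c = a \<star> (b \<star> c)"
proof -
  have "((a \<star> b) \<star> c) $ k = (a \<star> (b \<star> c)) $ k" for k
    by (cases k) (simp_all add: alg_mult_def UNIV_gen algebra_simps)
  then show ?thesis by (simp add: vec_eq_iff)
qed

definition homogeneous :: "int \<Rightarrow> 'k::field alg \<Rightarrow> bool" where
  "homogeneous n a \<longleftrightarrow> (\<forall>g. a $ g \<noteq> 0 \<longrightarrow> deg g = n)"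

text \<open>
  \<open>sign_by w\<close> is the linear map which multiplies a homogeneous element \<open>a\<close> by
  \<open>(-1)^(w |a|)\<close>. Signs depending on the degrees of the arguments of a multilinear map are
  written by applying such maps to the arguments, so that the formulas make sense for all, not only
  for homogeneous, arguments.
\<close>

definition sign_by :: "(int \<Rightarrow> int) \<Rightarrow> 'k::field alg \<Rightarrow> 'k alg" where
  "sign_by w a = (\<chi> g. (- 1) powi (w (deg g)) * a $ g)"


section \<open>Hochschild cochains and cohomology\<close>

text \<open>
  A linear map from the \<open>r\<close>-fold tensor power of the algebra to the algebra is a function on lists
  which is linear in each entry and which is zero on lists of length other than \<open>r\<close>; this last
  convention makes equality of functions agree with equality of linear maps.
  The list \<open>[a\<^sub>r, \<dots>, a\<^sub>1]\<close> represents the arguments \<open>(a\<^sub>r, \<dots>, a\<^sub>1)\<close> in the order written, so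
  the entries \<open>a\<^sub>i, \<dots>, a\<^sub>1\<close> are a suffix of it.
\<close>

type_synonym 'k cochain = "'k alg list \<Rightarrow> 'k alg"

definition multilinear :: "'k::field cochain \<Rightarrow> bool" where
  "multilinear \<phi> \<longleftrightarrow>
     (\<forall>us ws. Vector_Spaces.linear (*s) (*s) (\<lambda>x. \<phi> (us @ x # ws)))"

text \<open>
  Degree preserving linear maps of arity \<open>r\<close> into the algebra shifted by \<open>s\<close>, that is, maps raising
  the degree by \<open>s\<close>. The arity is an integer; if it is negative, the only such map is zero.
\<close>

definition graded_maps :: "int \<Rightarrow> int \<Rightarrow> 'k::field cochain set" where
  "graded_maps r s =
     {\<phi>. multilinear \<phi> \<and>
         (\<forall>xs. int (length xs) \<noteq> r \<longrightarrow> \<phi> xs = 0) \<and>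
         (\<forall>ds xs. list_all2 homogeneous ds xs \<longrightarrow> homogeneous (sum_list ds + s) (\<phi> xs))}"

text \<open>\<open>CC n s\<close> consists of normalized cochains of total degree \<open>n = r + s\<close>, where \<open>r\<close> is the arity.\<close>

definition CC :: "int \<Rightarrow> int \<Rightarrow> 'k::field cochain set" where
  "CC n s = {\<phi> \<in> graded_maps (n - s) s. \<forall>xs. alg_one \<in> set xs \<longrightarrow> \<phi> xs = 0}"

text \<open>
  The Gerstenhaber product of \<open>\<phi>\<close> and \<open>\<psi>\<close>, where \<open>\<psi>\<close> has total degree \<open>n\<close>:
  the sum of the terms
  \<open>(-1)^((n-1)(|a\<^sub>1|+\<dots>+|a\<^sub>i|-i)) \<phi>(a\<^sub>d,\<dots>,\<psi>(a\<^sub>i\<^sub>+\<^sub>j,\<dots>,a\<^sub>i\<^sub>+\<^sub>1),a\<^sub>i,\<dots>,a\<^sub>1)\<close>.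
  The terms in which \<open>\<psi>\<close> has the wrong number of arguments vanish.
\<close>

definition gerst_prod :: "int \<Rightarrow> 'k::field cochain \<Rightarrow> 'k cochain \<Rightarrow> 'k cochain" where
  "gerst_prod n \<phi> \<psi> xs =
     (\<Sum>(us, vs, ws)\<in>{(us, vs, ws). us @ vs @ ws = xs}.
        \<phi> (us @ \<psi> vs # map (sign_by (\<lambda>k. (n - 1) * (k - 1))) ws))"

definition gerst_bracket ::
    "int \<Rightarrow> int \<Rightarrow> 'k::field cochain \<Rightarrow> 'k cochain \<Rightarrow> 'k cochain" where
  "gerst_bracket m n \<phi> \<psi> xs =
     gerst_prod n \<phi> \<psi> xs - (- 1) powi ((m - 1) * (n - 1)) *s gerst_prod m \<psi> \<phi> xs"

definition mu2 :: "'k::field cochain" where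
  "mu2 xs = (case xs of [x, y] \<Rightarrow> x \<star> sign_by (\<lambda>k. k) y | _ \<Rightarrow> 0)"

text \<open>
  The Hochschild differential on cochains of total degree \<open>n\<close>, with the signs for which it is the
  bracket with \<open>mu2\<close>.
\<close>

definition hoch_diff :: "int \<Rightarrow> 'k::field cochain \<Rightarrow> 'k cochain" where
  "hoch_diff n \<phi> = gerst_bracket 2 n mu2 \<phi>"

definition cocycles :: "int \<Rightarrow> int \<Rightarrow> 'k::field cochain set" where
  "cocycles n s = {\<phi> \<in> CC n s. \<forall>xs. hoch_diff n \<phi> xs = 0}"

definition coboundaries :: "int \<Rightarrow> int \<Rightarrow> 'k::field cochain set" where
  "coboundaries n s = hoch_diff (n - 1) ` CC (n - 1) s"

definition HH_class :: "int \<Rightarrow> int \<Rightarrow> 'k::field cochain \<Rightarrow> 'k cochain set" where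
  "HH_class n s \<phi> = {\<psi>. (\<lambda>xs. \<psi> xs - \<phi> xs) \<in> coboundaries n s}"

definition HH :: "int \<Rightarrow> int \<Rightarrow> 'k::field cochain set set" where
  "HH n s = HH_class n s ` cocycles n s"

definition HH_scale ::
    "int \<Rightarrow> int \<Rightarrow> 'k::field \<Rightarrow> 'k cochain set \<Rightarrow> 'k cochain set" where
  "HH_scale n s t C = (\<Union>\<phi>\<in>C. HH_class n s (\<lambda>xs. t *s \<phi> xs))"

text \<open>There is a basis with one element.\<close>

definition HH_one_dimensional :: "'k::field itself \<Rightarrow> int \<Rightarrow> int \<Rightarrow> bool" where
  "HH_one_dimensional _ n s \<longleftrightarrow>
     (\<exists>c \<in> (HH n s :: 'k cochain set set). \<forall>x \<in> HH n s. \<exists>!t. x = HH_scale n s t c)"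


section \<open>\<open>A\<^sub>\<infinity>\<close>-structures and gauge transformations\<close>

text \<open>
  A structure is a family of maps, one of each arity \<open>d \<ge> 1\<close>; the component of arity zero carries no
  information and is set to zero.
\<close>

type_synonym 'k family = "nat \<Rightarrow> 'k cochain"

text \<open>
  The signs \<open>(-1)^(|a\<^sub>1|+\<dots>+|a\<^sub>i|-i)\<close> are the products of the signs \<open>(-1)^(|a\<^sub>k|-1)\<close> for
  \<open>k = 1, \<dots>, i\<close>.
\<close>

definition ainf_structure :: "'k::field family \<Rightarrow> bool" where
  "ainf_structure \<mu> \<longleftrightarrow>
     \<mu> 0 = (\<lambda>_. 0) \<and>
     (\<forall>d\<ge>1. \<mu> d \<in> graded_maps (int d) (2 - int d)) \<and>
     (\<forall>d\<ge>3. \<mu> d \<in> CC 2 (2 - int d)) \<and>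
     (\<forall>xs. (\<Sum>(us, vs, ws)\<in>{(us, vs, ws). us @ vs @ ws = xs}.
              \<mu> (length us + 1 + length ws)
                (us @ \<mu> (length vs) vs # map (sign_by (\<lambda>k. k - 1)) ws)) = 0)"

definition minimal_structures :: "'k::field family set" where
  "minimal_structures = {\<mu>. ainf_structure \<mu> \<and> \<mu> 1 = (\<lambda>_. 0) \<and> \<mu> 2 = mu2}"

text \<open>
  The identity is not a normalized cochain (it does not kill the unit), so normalization only
  concerns the components of arity at least two.
\<close>

definition gauge_transformation :: "'k::field family \<Rightarrow> bool" where
  "gauge_transformation G \<longleftrightarrow>
     G 0 = (\<lambda>_. 0) \<and>
     G 1 = (\<lambda>xs. case xs of [x] \<Rightarrow> x | _ \<Rightarrow> 0) \<and>
     (\<forall>d\<ge>2. G d \<in> CC 1 (1 - int d))"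

text \<open>
  The equations of an \<open>A\<^sub>\<infinity>\<close>-homomorphism from \<open>\<mu>\<close> to \<open>\<nu>\<close>:
  the sum of the \<open>\<nu>\<^sup>r(G(a\<^sub>d,\<dots>),\<dots>,G(\<dots>,a\<^sub>1))\<close> over all ways of cutting the list of arguments into
  nonempty blocks equals the sum of the
  \<open>(-1)^(|a\<^sub>1|+\<dots>+|a\<^sub>i|-i) G(a\<^sub>d,\<dots>,\<mu>\<^sup>j(a\<^sub>i\<^sub>+\<^sub>j,\<dots>,a\<^sub>i\<^sub>+\<^sub>1),a\<^sub>i,\<dots>,a\<^sub>1)\<close>.
\<close>

definition ainf_hom :: "'k::field family \<Rightarrow> 'k family \<Rightarrow> 'k family \<Rightarrow> bool" where
  "ainf_hom G \<mu> \<nu> \<longleftrightarrow>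
     (\<forall>xs. (\<Sum>bs\<in>{bs. concat bs = xs \<and> [] \<notin> set bs}.
              \<nu> (length bs) (map (\<lambda>b. G (length b) b) bs)) =
           (\<Sum>(us, vs, ws)\<in>{(us, vs, ws). us @ vs @ ws = xs}.
              G (length us + 1 + length ws)
                (us @ \<mu> (length vs) vs # map (sign_by (\<lambda>k. k - 1)) ws)))"

definition gauge_rel :: "('k::field family \<times> 'k family) set" where
  "gauge_rel = {(\<mu>, \<nu>). \<mu> \<in> minimal_structures \<and> \<nu> \<in> minimal_structures \<and>
                        (\<exists>G. gauge_transformation G \<and> ainf_hom G \<mu> \<nu>)}"

text \<open>\<open>reduced_form \<mu> \<mu>'\<close>: the structure \<open>\<mu>'\<close> is a representative of the gauge-equivalence class of
  \<open>\<mu>\<close> whose structure maps of arity 1, 3, 4 and 5 vanish.\<close>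

definition reduced_form :: "'k::field family \<Rightarrow> 'k family \<Rightarrow> bool" where
  "reduced_form \<mu> \<mu>' \<longleftrightarrow> (\<mu>, \<mu>') \<in> gauge_rel \<and> (\<forall>d\<in>{1, 3, 4, 5}. \<mu>' d = (\<lambda>_. 0))"

definition class_pair :: "'k::field family \<Rightarrow> 'k cochain set \<times> 'k cochain set" where
  "class_pair \<mu> = (HH_class 2 (-4) (\<mu> 6), HH_class 2 (-6) (\<mu> 8))"

definition rescale :: "'k::field \<Rightarrow> 'k family \<Rightarrow> 'k family" where
  "rescale t \<mu> d xs = t powi (int d - 2) *s \<mu> d xs"

end

theory Submission
  imports Defs
begin

text \<open>
  A family of maps is one function on lists, and composition with coderivations and coalgebra maps of
  the bar construction is expressed by sums over decompositions of lists. Gauge transformations form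
  a group, and two structures which agree up to arity \<open>d\<close> differ in arity \<open>d + 1\<close> by a Hochschild
  cocycle which a gauge transformation changes by an arbitrary coboundary. Everything then
  follows from the groups \<open>HH\<close> in negative internal degree \<open>s\<close>: total degree 1 vanishes, so that
  after composition with automorphisms homotopic to the identity a gauge transformation between reduced
  structures starts in arity 5 and does not change the classes; total degree 2 is one-dimensional for
  \<open>s = -4, -6\<close> and zero otherwise, which gives reduction and uniqueness; total degree 3 vanishes for
  \<open>s \<le> -7\<close>, which removes all obstructions to extending a pair of classes to a structure.

  The algebra is the path algebra of a cycle of length two modulo paths of length three. Its second
  bimodule syzygy is the algebra itself, twisted by the exchange of the two objects. Hence
  a Hochschild cocycle of arity \<open>r \<ge> 2\<close> is cohomologous to one determined by a cocycle of arity
  \<open>r - 2\<close> with twisted coefficients, and only arities 0, 1 and 2 have to be computed. Division by 2 and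
  by 3 occurs there: the norm \<open>x\<^sup>2 y + x y x + y x\<^sup>2\<close> yields the 3, and the twisting signs the 2.
\<close>

subsection \<open>Sums over the decompositions of a list\<close>

text \<open>The numbers 4, 6 and 8 are those of the minimal bimodule resolution: its term in
  position \<open>2 m\<close> is generated by the two paths of length \<open>3 m\<close> in
  \<open>u\<close> and \<open>v\<close>. Two shifts lower the arity by 4 and the degree by 3 and
  restore the original coefficients. The generating classes come from constants:
  \<open>u + v\<close>, which is central for the exchanged coefficients and reached after three
  shifts, and the unit, reached after four; this gives arities 6 and 8.

  The delicate point is the invariance of the classes. Between reduced structures, a gauge
  transformation that is the identity up to arity \<open>d\<close> acts by a mere coboundary only up
  to arity \<open>2 d + 1\<close>, so arity 8 demands \<open>d = 4\<close>. Vanishing cohomology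
  writes the leading term of a gauge transformation as a coboundary; removing it without moving
  either structure takes an automorphism of the structure with exactly that leading term. Quadratic
  terms are otherwise harmless: two maps of arity at least 6 compose to arity at least 11, so no
  equation in low arity links the two classes.\<close>

fun ssum :: "('a list \<Rightarrow> 'a list \<Rightarrow> 'b::comm_monoid_add) \<Rightarrow> 'a list \<Rightarrow> 'b" where
  "ssum K [] = K [] []"
| "ssum K (x # xs) = K [] (x # xs) + ssum (\<lambda>us vs. K (x # us) vs) xs"

text \<open>Declared \<open>fundef_cong\<close> because \<open>blocks\<close> recurses under
  \<open>ssum\<close>: its termination proof needs that the pieces of a cut make up the given
  list.\<close>

lemma ssum_cong [fundef_cong]:
  "xs = ys \<Longrightarrow> (\<And>us vs. us @ vs = ys \<Longrightarrow> K us vs = K' us vs) \<Longrightarrow> ssum K xs = ssum K' ys"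
proof (induction ys arbitrary: xs K K')
  case (Cons y ys)
  have "ssum (\<lambda>us vs. K (y # us) vs) ys = ssum (\<lambda>us vs. K' (y # us) vs) ys"
    by (rule Cons.IH) (auto intro: Cons.prems)
  then show ?case using Cons.prems by simp
qed simp

lemma ssum_eq_sum:
  fixes K :: "'a list \<Rightarrow> 'a list \<Rightarrow> 'b::comm_monoid_add"
  shows "ssum K xs = (\<Sum>(us, vs)\<in>{(us, vs). us @ vs = xs}. K us vs)"
  and finite_splits: "finite {(us, vs). us @ vs = xs}"
proof (induction xs arbitrary: K)
  case Nil
  have eq: "{(us, vs). us @ vs = ([] :: 'a list)} = {([], [])}" by auto
  { case 1 show ?case by (simp add: eq) }
  { case 2 show ?case by (simp add: eq) }
next
  case (Cons x xs)
  have eq: "{(us, vs). us @ vs = x # xs} =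
      insert ([], x # xs) ((\<lambda>(us, vs). (x # us, vs)) ` {(us, vs). us @ vs = xs})"
    by (auto simp: append_eq_Cons_conv)
  have inj: "inj_on (\<lambda>(us, vs). (x # us, vs)) {(us, vs). us @ vs = xs}"
    by (auto simp: inj_on_def)
  let ?f = "\<lambda>(us, vs). (x # us, vs)" and ?S = "{(us, vs). us @ vs = xs}"
  have fin: "finite (?f ` ?S)" by (intro finite_imageI Cons.IH)
  have *: "ssum K (x # xs) = (\<Sum>(us, vs)\<in>{(us, vs). us @ vs = x # xs}. K us vs)"
    for K :: "'a list \<Rightarrow> 'a list \<Rightarrow> 'b"
  proof -
    have "(\<Sum>(us, vs)\<in>?f ` ?S. K us vs) = (\<Sum>(us, vs)\<in>?S. K (x # us) vs)"
    by (subst sum.reindex[OF inj]) (simp add: comp_def case_prod_unfold)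
  moreover have "([], x # xs) \<notin> ?f ` ?S" by auto
  ultimately have "ssum K (x # xs) = (\<Sum>(us, vs)\<in>insert ([], x # xs) (?f ` ?S). K us vs)"
    using fin Cons.IH(1)[of "\<lambda>us vs. K (x # us) vs"] by simp
  then show ?thesis by (simp only: eq)
  qed
  { case 1 show ?case by (rule *) }
  { case 2 show ?case unfolding eq using fin by (rule finite.insertI) }
qed

lemma ssum_add: "ssum (\<lambda>us vs. K us vs + L us vs) xs = ssum K xs + ssum L xs"
  by (induction xs arbitrary: K L) (simp_all add: ac_simps)

lemma ssum_zero [simp]: "ssum (\<lambda>us vs. 0) xs = 0"
  by (induction xs) simp_all

lemma ssum_uminus: "ssum (\<lambda>us vs. - K us vs) xs = - ssum K xs" for K :: "_ \<Rightarrow> _ \<Rightarrow> 'b::ab_group_add"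
  by (induction xs arbitrary: K) simp_all

lemma ssum_diff: "ssum (\<lambda>us vs. K us vs - L us vs) xs = ssum K xs - ssum L xs"
  for K :: "_ \<Rightarrow> _ \<Rightarrow> 'b::ab_group_add"
  by (induction xs arbitrary: K L) (simp_all add: algebra_simps)

text \<open>Coassociativity of deconcatenation: both sides run over the decompositions into three
  pieces.\<close>

lemma ssum_assoc:
  "ssum (\<lambda>us vs. ssum (\<lambda>as bs. K as bs vs) us) xs = ssum (\<lambda>us vs. ssum (\<lambda>as bs. K us as bs) vs) xs"
proof (induction xs arbitrary: K)
  case (Cons x xs)
  show ?case by (simp add: ssum_add ac_simps Cons.IH[of "\<lambda>as bs vs. K (x # as) bs vs"])
qed simp

lemma ssum_swap:
  "ssum (\<lambda>us vs. ssum (\<lambda>as bs. K us vs as bs) ys) xs =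
   ssum (\<lambda>as bs. ssum (\<lambda>us vs. K us vs as bs) xs) ys"
  by (induction xs arbitrary: K) (simp_all add: ssum_add)

text \<open>The cut falls to the left or to the right of the marked letter. With the value of an
  inserted map as \<open>z\<close> this is the source of the Leibniz rules \<open>ins_ssum\<close>
  and \<open>tw_ssum\<close>.\<close>

lemma ssum_insert:
  "ssum K (us @ z # ws) =
   ssum (\<lambda>as bs. K as (bs @ z # ws)) us + ssum (\<lambda>as bs. K (us @ z # as) bs) ws"
  by (induction us arbitrary: K) (simp_all add: ac_simps)

lemma ssum_map: "ssum K (map f xs) = ssum (\<lambda>us vs. K (map f us) (map f vs)) xs"
  by (induction xs arbitrary: K) simp_all

lemma ssum_head: "(\<And>us vs. us \<noteq> [] \<Longrightarrow> K us vs = 0) \<Longrightarrow> ssum K xs = K [] xs"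
proof (cases xs)
  case (Cons x ys)
  assume "\<And>us vs. us \<noteq> [] \<Longrightarrow> K us vs = 0"
  then have "(\<lambda>us. K (x # us)) = (\<lambda>us vs. 0)" by (intro ext) simp
  then show ?thesis using Cons by simp
qed simp

lemma ssum_last: "(\<And>us vs. vs \<noteq> [] \<Longrightarrow> K us vs = 0) \<Longrightarrow> ssum K xs = K xs []"
  by (induction xs arbitrary: K) simp_all

lemma sum_triples:
  fixes xs :: "'b list" and K :: "_ \<Rightarrow> _ \<Rightarrow> _ \<Rightarrow> 'a::comm_monoid_add"
  shows
  "(\<Sum>(us, vs, ws)\<in>{(us, vs, ws). us @ vs @ ws = xs}. K us vs ws) =
   ssum (\<lambda>us rs. ssum (\<lambda>vs ws. K us vs ws) rs) xs"
proof -
  let ?S = "\<lambda>xs :: 'b list. {(us, vs). us @ vs = xs}"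
  have "ssum (\<lambda>us rs. ssum (\<lambda>vs ws. K us vs ws) rs) xs =
      (\<Sum>p\<in>?S xs. \<Sum>q\<in>?S (snd p). K (fst p) (fst q) (snd q))"
    unfolding ssum_eq_sum by (simp add: case_prod_beta)
  also have "\<dots> = (\<Sum>(p, q)\<in>Sigma (?S xs) (\<lambda>p. ?S (snd p)). K (fst p) (fst q) (snd q))"
    by (rule sum.Sigma) (auto simp: finite_splits)
  also have "\<dots> = (\<Sum>(us, vs, ws)\<in>{(us, vs, ws). us @ vs @ ws = xs}. K us vs ws)"
    by (rule sum.reindex_bij_witness[of _ "\<lambda>(us, vs, ws). ((us, vs @ ws), (vs, ws))"
          "\<lambda>((us, _), (vs, ws)). (us, vs, ws)"]) auto
  finally show ?thesis by simp
qed


subsection \<open>Multilinear maps\<close>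

definition lin :: "('k::field alg \<Rightarrow> 'k alg) \<Rightarrow> bool" where
  "lin f \<longleftrightarrow> (\<forall>x y. f (x + y) = f x + f y) \<and> (\<forall>c x. f (c *s x) = c *s f x)"

lemma linear_iff_lin: "Vector_Spaces.linear (*s) (*s) f \<longleftrightarrow> lin f"
  unfolding lin_def Vector_Spaces.linear_iff by (auto simp: vec.vector_space_axioms)

lemma multilinear_iff_lin: "multilinear \<phi> \<longleftrightarrow> (\<forall>us ws. lin (\<lambda>x. \<phi> (us @ x # ws)))"
  by (simp add: multilinear_def linear_iff_lin)

lemma linI: "(\<And>x y. f (x + y) = f x + f y) \<Longrightarrow> (\<And>c x. f (c *s x) = c *s f x) \<Longrightarrow> lin f"
  by (simp add: lin_def)

lemma lin_add: "lin f \<Longrightarrow> f (x + y) = f x + f y"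
  and lin_scale: "lin f \<Longrightarrow> f (c *s x) = c *s f x"
  by (simp_all add: lin_def)

lemma lin_0: "lin f \<Longrightarrow> f 0 = 0"
  using lin_scale[of f 0 0] by simp

lemma lin_uminus: "lin f \<Longrightarrow> f (- x) = - f x"
  using lin_scale[of f "-1" x] by simp

lemma lin_diff: "lin f \<Longrightarrow> f (x - y) = f x - f y"
  using lin_add[of f x "- y"] lin_uminus[of f y] by simp

lemma lin_sum: "lin f \<Longrightarrow> f (\<Sum>i\<in>I. g i) = (\<Sum>i\<in>I. f (g i))"
  by (induction I rule: infinite_finite_induct) (simp_all add: lin_0 lin_add)

lemma lin_ssum: "lin f \<Longrightarrow> f (ssum K xs) = ssum (\<lambda>us vs. f (K us vs)) xs"
  by (induction xs arbitrary: K) (simp_all add: lin_add)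

lemma lin_id [simp]: "lin (\<lambda>x. x)"
  and lin_const_0 [simp]: "lin (\<lambda>x. 0)"
  by (simp_all add: lin_def)

lemma lin_compose: "lin f \<Longrightarrow> lin g \<Longrightarrow> lin (\<lambda>x. f (g x))"
  and lin_plus: "lin f \<Longrightarrow> lin g \<Longrightarrow> lin (\<lambda>x. f x + g x)"
  and lin_minus: "lin f \<Longrightarrow> lin g \<Longrightarrow> lin (\<lambda>x. f x - g x)"
  and lin_neg: "lin f \<Longrightarrow> lin (\<lambda>x. - f x)"
  and lin_cmult: "lin f \<Longrightarrow> lin (\<lambda>x. c *s f x)"
  by (simp_all add: lin_def vector_add_ldistrib vec.scale_right_diff_distrib ac_simps)

lemma lin_ssumI: "(\<And>us vs. us @ vs = xs \<Longrightarrow> lin (\<lambda>x. K x us vs)) \<Longrightarrow> lin (\<lambda>x. ssum (K x) xs)"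
  by (induction xs arbitrary: K) (auto intro!: lin_plus)

lemma lin_sumI: "(\<And>i. i \<in> I \<Longrightarrow> lin (\<lambda>x. K x i)) \<Longrightarrow> lin (\<lambda>x. \<Sum>i\<in>I. K x i)"
  by (induction I rule: infinite_finite_induct) (auto intro!: lin_plus)

lemma mlin_lin: "multilinear F \<Longrightarrow> lin (\<lambda>x. F (us @ x # ws))"
  and mlin_lin_Cons: "multilinear F \<Longrightarrow> lin (\<lambda>x. F (x # ws))"
proof -
  assume F: "multilinear F"
  show 1: "lin (\<lambda>x. F (us @ x # ws))" for us ws using F by (simp add: multilinear_iff_lin)
  show "lin (\<lambda>x. F (x # ws))" using 1[of "[]"] by simp
qed

lemma mlin_0: "multilinear F \<Longrightarrow> F (us @ 0 # ws) = 0"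
  and mlin_0_Cons: "multilinear F \<Longrightarrow> F (0 # ws) = 0"
  by (rule lin_0[OF mlin_lin], assumption) (rule lin_0[OF mlin_lin_Cons])

lemma mlin_Cons: "multilinear F \<Longrightarrow> multilinear (\<lambda>l. F (x # l))"
  unfolding multilinear_iff_lin append_Cons[symmetric] by blast

lemma mlin_append: "multilinear F \<Longrightarrow> multilinear (\<lambda>l. F (us @ l))"
  unfolding multilinear_iff_lin append_assoc[symmetric] by blast

lemma mlin_append_right: "multilinear F \<Longrightarrow> multilinear (\<lambda>l. F (l @ us))"
  unfolding multilinear_iff_lin append_assoc append_Cons by blast

lemma mlin_compose: "lin f \<Longrightarrow> multilinear F \<Longrightarrow> multilinear (\<lambda>l. f (F l))"
  unfolding multilinear_iff_lin by (intro allI) (rule lin_compose[of f], auto)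

lemma mlin_map: "lin f \<Longrightarrow> multilinear F \<Longrightarrow> multilinear (\<lambda>l. F (map f l))"
  unfolding multilinear_iff_lin map_append list.map
  by (intro allI) (rule lin_compose[of "\<lambda>y. F (_ @ y # _)" f], auto)

lemma mlin_slot: "multilinear F \<Longrightarrow> multilinear G \<Longrightarrow> multilinear (\<lambda>l. F (us @ G l # ws))"
  by (rule mlin_compose[OF mlin_lin])

lemma mlin_plus: "multilinear F \<Longrightarrow> multilinear G \<Longrightarrow> multilinear (\<lambda>l. F l + G l)"
  and mlin_minus: "multilinear F \<Longrightarrow> multilinear G \<Longrightarrow> multilinear (\<lambda>l. F l - G l)"
  and mlin_neg: "multilinear F \<Longrightarrow> multilinear (\<lambda>l. - F l)"
  and mlin_cmult: "multilinear F \<Longrightarrow> multilinear (\<lambda>l. c *s F l)"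
  and mlin_zero [simp]: "multilinear (\<lambda>l. 0)"
  unfolding multilinear_iff_lin by (auto intro: lin_plus lin_minus lin_neg lin_cmult)

lemma mlin_ssum:
  assumes "\<And>vs. multilinear (\<lambda>us. K us vs)" "\<And>us. multilinear (\<lambda>vs. K us vs)"
  shows "multilinear (ssum K)"
  unfolding multilinear_iff_lin ssum_insert
  by (intro allI lin_plus lin_ssumI) (rule mlin_lin[OF assms(2)], rule mlin_lin[OF assms(1)])


subsection \<open>Coderivations and coalgebra maps\<close>

text \<open>
  \<open>ins S F N\<close> is \<open>F\<close> composed with the coderivation of the tensor coalgebra induced by \<open>N\<close>, where
  \<open>S\<close> is the sign by which \<open>N\<close> passes an argument, and \<open>blocks F G\<close> is \<open>F\<close> composed with the
  coalgebra map induced by \<open>G\<close>. A family of maps, one for each arity, is one function on lists.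
\<close>

definition ins ::
    "('k::field alg \<Rightarrow> 'k alg) \<Rightarrow> 'k cochain \<Rightarrow> 'k cochain \<Rightarrow> 'k cochain" where
  "ins S F N xs = ssum (\<lambda>us rs. ssum (\<lambda>vs ws. F (us @ N vs # map S ws)) rs) xs"

function blocks :: "'k::field cochain \<Rightarrow> 'k cochain \<Rightarrow> 'k cochain" where
  "blocks F G [] = F []"
| "blocks F G (x # xs) = ssum (\<lambda>bs rs. blocks (\<lambda>l. F (G (x # bs) # l)) G rs) xs"
  by pat_completeness auto
termination
  by (relation "Wellfounded.measure (\<lambda>(F, G, xs). length xs)") auto

declare blocks.simps(2) [simp del]

lemma ins_Nil: "ins S F N [] = F [N []]"
  by (simp add: ins_def)

lemma ins_Cons:
  "ins S F N (x # xs) = ssum (\<lambda>vs ws. F (N vs # map S ws)) (x # xs) + ins S (\<lambda>l. F (x # l)) N xs"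
  by (simp add: ins_def)

lemma ins_Cons':
  assumes "multilinear F" "N [] = 0"
  shows "ins S F N (x # xs) =
    ssum (\<lambda>vs ws. F (N (x # vs) # map S ws)) xs + ins S (\<lambda>l. F (x # l)) N xs"
  by (simp add: ins_Cons assms mlin_0_Cons)

lemma ins_add_left: "ins S (\<lambda>l. F l + G l) N xs = ins S F N xs + ins S G N xs"
  by (simp add: ins_def ssum_add)

lemma ins_diff_left: "ins S (\<lambda>l. F l - G l) N xs = ins S F N xs - ins S G N xs"
  by (simp add: ins_def ssum_diff)

lemma ins_zero_left [simp]: "ins S (\<lambda>l. 0) N xs = 0"
  by (simp add: ins_def)

lemma ins_zero_right [simp]: "multilinear F \<Longrightarrow> ins S F (\<lambda>l. 0) xs = 0"
  by (simp add: ins_def mlin_0)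

lemma ins_lin: "lin f \<Longrightarrow> ins S (\<lambda>l. f (F l)) N xs = f (ins S F N xs)"
  by (simp add: ins_def lin_ssum)

text \<open>Co-Leibniz rule. If \<open>N\<close> acts in the left piece it has passed the letters of
  the right piece, which therefore carry the sign \<open>S\<close>.\<close>

lemma ins_ssum:
  "ins S (\<lambda>l. ssum K l) N xs =
   ssum (\<lambda>as bs. ins S (\<lambda>l. K l (map S bs)) N as + ins S (\<lambda>l. K as l) N bs) xs"
proof -
  have "ins S (\<lambda>l. ssum K l) N xs =
     ssum (\<lambda>us rs. ssum (\<lambda>vs ws. ssum (\<lambda>as bs. K as (bs @ N vs # map S ws)) us) rs) xs +
     ssum (\<lambda>us rs. ssum (\<lambda>vs ws. ssum (\<lambda>as bs. K (us @ N vs # map S as) (map S bs)) ws) rs) xs"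
    by (simp add: ins_def ssum_insert ssum_add ssum_map)
  also have "ssum (\<lambda>us rs. ssum (\<lambda>vs ws. ssum (\<lambda>as bs. K as (bs @ N vs # map S ws)) us) rs) xs =
     ssum (\<lambda>as r. ssum (\<lambda>bs rs. ssum (\<lambda>vs ws. K as (bs @ N vs # map S ws)) rs) r) xs"
    by (subst ssum_swap) (rule ssum_assoc)
  also have "\<dots> = ssum (\<lambda>as bs. ins S (\<lambda>l. K as l) N bs) xs"
    by (simp add: ins_def)
  also have "ssum (\<lambda>us rs. ssum (\<lambda>vs ws. ssum (\<lambda>as bs. K (us @ N vs # map S as) (map S bs)) ws) rs) xs =
     ssum (\<lambda>as bs. ssum (\<lambda>us rs. ssum (\<lambda>vs ws. K (us @ N vs # map S ws) (map S bs)) rs) as) xs"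
    by (simp only: ssum_assoc)
  also have "\<dots> = ssum (\<lambda>as bs. ins S (\<lambda>l. K l (map S bs)) N as) xs"
    by (simp add: ins_def)
  finally show ?thesis by (simp add: ssum_add add.commute)
qed

lemma blocks_add_left: "blocks (\<lambda>l. F l + F' l) G xs = blocks F G xs + blocks F' G xs"
  by (induction F G xs arbitrary: F' rule: blocks.induct)
    (simp_all add: blocks.simps(2) ssum_add[symmetric] cong: ssum_cong)

lemma blocks_add_left': "blocks (\<lambda>l. F l + F' l) G = (\<lambda>xs. blocks F G xs + blocks F' G xs)"
  by (rule ext) (rule blocks_add_left)

lemma blocks_zero_left [simp]: "blocks (\<lambda>l. 0) G = (\<lambda>xs. 0)"
proof
  show "blocks (\<lambda>l. 0) G xs = 0" for xs
  proof (induction xs rule: length_induct)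
    case (1 xs)
    then show ?case
      by (cases xs) (auto simp: blocks.simps(2) intro!: ssum_zero[THEN trans[rotated]] ssum_cong)
  qed
qed

lemma blocks_lin: "lin f \<Longrightarrow> blocks (\<lambda>l. f (F l)) G xs = f (blocks F G xs)"
  by (induction F G xs rule: blocks.induct)
    (simp_all add: blocks.simps(2) lin_ssum cong: ssum_cong)

lemma blocks_uminus_left: "blocks (\<lambda>l. - F l) G xs = - blocks F G xs"
  by (rule blocks_lin[of uminus]) (simp add: lin_def)

lemma blocks_diff_left: "blocks (\<lambda>l. F l - F' l) G xs = blocks F G xs - blocks F' G xs"
  using blocks_add_left[of F "\<lambda>l. - F' l" G xs] by (simp add: blocks_uminus_left)

lemma blocks_ssum_left:
  "blocks (\<lambda>l. ssum (\<lambda>us vs. F us vs l) ys) G xs = ssum (\<lambda>us vs. blocks (F us vs) G xs) ys"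
  by (induction ys arbitrary: F) (simp_all add: blocks_add_left)

lemma lin_blocks: "(\<And>l. lin (\<lambda>x. F x l)) \<Longrightarrow> lin (\<lambda>x. blocks (F x) G xs)"
proof (induction xs arbitrary: F rule: length_induct)
  case (1 xs)
  show ?case
  proof (cases xs)
    case (Cons y ys)
    show ?thesis unfolding Cons blocks.simps
      by (rule lin_ssumI) (rule 1(1)[rule_format], use Cons 1(2) in auto)
  qed (use 1 in auto)
qed

lemma mlin_ins:
  assumes "multilinear F" "multilinear N" "lin S"
  shows "multilinear (ins S F N)"
  unfolding ins_def
proof (rule mlin_ssum)
  show "multilinear (\<lambda>us. ssum (\<lambda>vs ws. F (us @ N vs # map S ws)) rs)" for rs
    unfolding multilinear_iff_lin
    by (intro allI lin_ssumI) (simp add: mlin_lin assms(1))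
  show "multilinear (\<lambda>rs. ssum (\<lambda>vs ws. F (us @ N vs # map S ws)) rs)" for us
  proof (rule mlin_ssum)
    show "multilinear (\<lambda>vs. F (us @ N vs # map S ws))" for ws
      by (intro mlin_slot assms)
    show "multilinear (\<lambda>ws. F (us @ N vs # map S ws))" for vs
      by (intro mlin_map[of S "\<lambda>l. F (us @ N vs # l)"] assms)
        (use mlin_append[OF assms(1), of "us @ [N vs]"] in simp)
  qed
qed

lemma mlin_blocks:
  assumes "multilinear G"
  shows "multilinear F \<Longrightarrow> multilinear (blocks F G)"
proof -
  have "multilinear F \<Longrightarrow> length us + length ws = n \<Longrightarrow> lin (\<lambda>x. blocks F G (us @ x # ws))" for F us ws n
  proof (induction n arbitrary: F us ws rule: less_induct)
    case (less n)
    note F = less.prems(1)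
    have F': "multilinear (\<lambda>l. F (y # l))" for y using F by (rule mlin_Cons)
    show ?case
    proof (cases us)
      case Nil
      have "lin (\<lambda>x. ssum (\<lambda>bs rs. blocks (\<lambda>l. F (G (x # bs) # l)) G rs) ws)"
        by (intro lin_ssumI lin_blocks lin_compose[OF mlin_lin_Cons[OF F]] mlin_lin_Cons assms)
      then show ?thesis by (simp add: Nil blocks.simps)
    next
      case (Cons y us')
      have "lin (\<lambda>x. ssum (\<lambda>as bs. blocks (\<lambda>l. F (G (y # as) # l)) G (bs @ x # ws)) us' +
                    ssum (\<lambda>as bs. blocks (\<lambda>l. F (G (y # us' @ x # as) # l)) G bs) ws)"
      proof (intro lin_plus lin_ssumI lin_blocks)
        fix as bs assume ab: "as @ bs = us'"
        show "lin (\<lambda>x. blocks (\<lambda>l. F (G (y # as) # l)) G (bs @ x # ws))"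
          by (rule less.IH[of "length bs + length ws"]) (use less.prems Cons ab F' in auto)
      next
        fix as bs l
        show "lin (\<lambda>x. F (G (y # us' @ x # as) # l))"
          using lin_compose[OF mlin_lin_Cons[OF F] mlin_lin[OF assms, of "y # us'"]] by simp
      qed
      then show ?thesis by (simp add: Cons blocks.simps ssum_insert)
    qed
  qed
  then show "multilinear F \<Longrightarrow> multilinear (blocks F G)"
    unfolding multilinear_iff_lin[of "blocks F G"] by blast
qed

text \<open>The map induced by \<open>G\<close> is a map of coalgebras: cutting the list of blocks
  is the same as cutting the arguments and forming blocks on both sides.\<close>

lemma blocks_ssum:
  "blocks (\<lambda>l. ssum K l) G xs = ssum (\<lambda>as bs. blocks (\<lambda>l. blocks (\<lambda>l'. K l l') G bs) G as) xs"
proof (induction xs arbitrary: K rule: length_induct)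
  case (1 xs)
  show ?case
  proof (cases xs)
    case (Cons x ys)
    have "blocks (\<lambda>l. ssum K l) G (x # ys) =
       ssum (\<lambda>bs rs. blocks (\<lambda>l. K [] (G (x # bs) # l)) G rs) ys +
       ssum (\<lambda>bs rs. blocks (\<lambda>l. ssum (\<lambda>us vs. K (G (x # bs) # us) vs) l) G rs) ys"
      by (simp add: blocks.simps blocks_add_left' ssum_add)
    also have "ssum (\<lambda>bs rs. blocks (\<lambda>l. ssum (\<lambda>us vs. K (G (x # bs) # us) vs) l) G rs) ys =
       ssum (\<lambda>bs rs. ssum (\<lambda>r1 r2. blocks (\<lambda>l. blocks (\<lambda>l'. K (G (x # bs) # l) l') G r2) G r1) rs) ys"
      by (rule ssum_cong[OF refl], rule 1(1)[rule_format]) (use Cons in auto)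
    also have "\<dots> = ssum (\<lambda>as bs. blocks (\<lambda>l. blocks (\<lambda>l'. K l l') G bs) G (x # as)) ys"
      by (simp add: blocks.simps ssum_assoc)
    finally show ?thesis by (simp add: Cons blocks.simps)
  qed simp
qed

text \<open>The blocks of \<open>H\<close> that enter the first block of \<open>G\<close> are
  regrouped by \<open>ssum_assoc\<close> into the first value of \<open>blocks G H\<close>; the
  induction treats the rest of the list.\<close>

lemma blocks_assoc:
  assumes "multilinear F"
  shows "blocks (blocks F G) H xs = blocks F (blocks G H) xs"
  using assms
proof (induction xs arbitrary: F rule: length_induct)
  case (1 xs)
  note F = 1(2)
  show ?case
  proof (cases xs)
    case (Cons x ys)
    have "blocks (blocks F G) H xs =
      ssum (\<lambda>bs rs. blocks (\<lambda>l. ssum (\<lambda>us vs. blocks (\<lambda>l. F (G (H (x # bs) # us) # l)) G vs) l) H rs) ys"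
      by (simp add: Cons blocks.simps)
    also have "\<dots> = ssum (\<lambda>bs rs. ssum (\<lambda>r1 r2.
        blocks (\<lambda>us. blocks (blocks (\<lambda>l. F (G (H (x # bs) # us) # l)) G) H r2) H r1) rs) ys"
      by (simp only: blocks_ssum)
    also have "\<dots> = ssum (\<lambda>bs rs. ssum (\<lambda>r1 r2.
        blocks (\<lambda>us. blocks (\<lambda>l. F (G (H (x # bs) # us) # l)) (blocks G H) r2) H r1) rs) ys"
    proof (intro ssum_cong refl)
      fix bs rs r1 r2 assume *: "bs @ rs = ys" "r1 @ r2 = rs"
      then have "length r2 < length xs" using Cons by auto
      then have "blocks (blocks (\<lambda>l. F (z # l)) G) H r2 = blocks (\<lambda>l. F (z # l)) (blocks G H) r2" for z
        using 1(1) mlin_Cons[OF F] by blast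
      then show "blocks (\<lambda>us. blocks (blocks (\<lambda>l. F (G (H (x # bs) # us) # l)) G) H r2) H r1 =
        blocks (\<lambda>us. blocks (\<lambda>l. F (G (H (x # bs) # us) # l)) (blocks G H) r2) H r1" by simp
    qed
    also have "\<dots> = ssum (\<lambda>bs rs. ssum (\<lambda>r1 r2.
        blocks (\<lambda>l. F (blocks (\<lambda>us. G (H (x # bs) # us)) H r1 # l)) (blocks G H) r2) rs) ys"
      by (intro ssum_cong refl, rule blocks_lin[of "\<lambda>z. blocks (\<lambda>l. F (z # l)) (blocks G H) _"] lin_blocks)
        (intro lin_blocks mlin_lin_Cons F)
    also have "\<dots> = ssum (\<lambda>as r2. ssum (\<lambda>bs r1.
        blocks (\<lambda>l. F (blocks (\<lambda>us. G (H (x # bs) # us)) H r1 # l)) (blocks G H) r2) as) ys"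
      by (simp only: ssum_assoc)
    also have "\<dots> = ssum (\<lambda>as r2. blocks (\<lambda>l. F (blocks G H (x # as) # l)) (blocks G H) r2) ys"
      by (simp add: blocks.simps(2)[of G] lin_ssum[OF lin_blocks[OF mlin_lin_Cons[OF F]], symmetric])
    finally show ?thesis by (simp add: Cons blocks.simps)
  qed simp
qed

section \<open>The identity as a family\<close>

definition unit_map :: "'k::field cochain" where
  "unit_map xs = (case xs of [x] \<Rightarrow> x | _ \<Rightarrow> 0)"

lemma unit_map_simps [simp]:
  "unit_map [] = 0" "unit_map [x] = x" "unit_map (x # y # xs) = 0"
  by (simp_all add: unit_map_def)

lemma unit_map_eq_0: "length xs \<noteq> 1 \<Longrightarrow> unit_map xs = 0"
  by (auto simp: unit_map_def split: list.split)

lemma unit_map_Cons: "unit_map (x # xs) = (if xs = [] then x else 0)"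
  by (cases xs) auto

lemma blocks_unit_right:
  assumes "multilinear F"
  shows "blocks F unit_map xs = F xs"
  using assms
proof (induction xs arbitrary: F)
  case (Cons x xs)
  have "blocks F unit_map (x # xs) = blocks (\<lambda>l. F (unit_map [x] # l)) unit_map xs"
    unfolding blocks.simps by (rule ssum_head) (simp add: unit_map_Cons mlin_0_Cons Cons.prems)
  then show ?case using Cons.IH[OF mlin_Cons[OF Cons.prems]] by simp
qed simp

lemma mlin_unit_map: "multilinear unit_map"
  unfolding multilinear_iff_lin
proof (intro allI)
  fix us ws :: "'a alg list"
  show "lin (\<lambda>x. unit_map (us @ x # ws))"
    by (cases us; cases ws; cases "tl us") (auto simp: unit_map_def)
qed

lemma blocks_unit_left: "G [] = 0 \<Longrightarrow> blocks unit_map G xs = G xs"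
proof (cases xs)
  case (Cons x ys)
  have "blocks unit_map G (x # ys) = blocks (\<lambda>l. unit_map (G (x # ys) # l)) G []"
    unfolding blocks.simps(2)
  proof (rule ssum_last)
    fix us vs :: "'a alg list" assume "vs \<noteq> []"
    then obtain z zs where "vs = z # zs" by (cases vs) auto
    then show "blocks (\<lambda>l. unit_map (G (x # us) # l)) G vs = 0" by (simp add: blocks.simps)
  qed
  then show ?thesis by (simp add: Cons)
qed simp

lemma ins_unit_left:
  assumes "N [] = 0"
  shows "ins S unit_map N xs = N xs"
proof -
  have 1: "ssum (\<lambda>vs ws. unit_map (N vs # map S ws)) ys = N ys" for ys
    using ssum_last[of "\<lambda>vs ws. unit_map (N vs # map S ws)" ys] by (auto simp: unit_map_Cons)
  have 2: "ssum (\<lambda>vs ws. unit_map (x # us @ N vs # map S ws)) ys = 0" for x us ys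
    by (cases us) simp_all
  show ?thesis
    unfolding ins_def by (subst ssum_head) (auto simp: 1 2 neq_Nil_conv)
qed


subsection \<open>Signs and degrees\<close>

abbreviation tau :: "'k::field alg \<Rightarrow> 'k alg" where
  "tau \<equiv> sign_by (\<lambda>k. k - 1)"

text \<open>In arity \<open>d\<close> the degree is raised by \<open>n - d\<close>, so that one
  total degree governs all arities: 2 for structures, 1 for gauge transformations, 0 for
  homotopies.\<close>

definition fam :: "int \<Rightarrow> 'k::field cochain \<Rightarrow> bool" where
  "fam n F \<longleftrightarrow> multilinear F \<and>
     (\<forall>ds xs. list_all2 homogeneous ds xs \<longrightarrow>
        homogeneous (sum_list ds + n - int (length xs)) (F xs))"

lemma fam_mlin: "fam n F \<Longrightarrow> multilinear F"
  by (simp add: fam_def)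

lemma lin_sign_by: "lin (sign_by w)"
  by (simp add: lin_def sign_by_def vec_eq_iff algebra_simps)

lemma sign_by_homogeneous: "homogeneous d x \<Longrightarrow> sign_by w x = (- 1) powi (w d) *s x"
  by (auto simp: sign_by_def homogeneous_def vec_eq_iff)

lemma homogeneous_scale: "homogeneous d x \<Longrightarrow> homogeneous d (c *s x)"
  and homogeneous_0 [simp]: "homogeneous d 0"
  by (auto simp: homogeneous_def)

lemma homogeneous_sign_by: "homogeneous d x \<Longrightarrow> homogeneous d (sign_by w x)"
  by (auto simp: homogeneous_def sign_by_def)

lemma homogeneous_add: "homogeneous d x \<Longrightarrow> homogeneous d y \<Longrightarrow> homogeneous d (x + y)"
  by (auto simp: homogeneous_def) (metis add.right_neutral)

lemma homogeneous_uminus: "homogeneous d x \<Longrightarrow> homogeneous d (- x)"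
  by (auto simp: homogeneous_def)

lemma homogeneous_diff: "homogeneous d x \<Longrightarrow> homogeneous d y \<Longrightarrow> homogeneous d (x - y)"
  using homogeneous_add[of d x "- y"] homogeneous_uminus[of d y] by simp

lemma homogeneous_sum: "(\<And>i. i \<in> I \<Longrightarrow> homogeneous d (f i)) \<Longrightarrow> homogeneous d (\<Sum>i\<in>I. f i)"
  by (induction I rule: infinite_finite_induct) (auto intro: homogeneous_add)

lemma homogeneous_ssum:
  "(\<And>us vs. us @ vs = xs \<Longrightarrow> homogeneous d (K us vs)) \<Longrightarrow> homogeneous d (ssum K xs)"
  unfolding ssum_eq_sum by (rule homogeneous_sum) auto

lemma homogeneous_axis: "homogeneous (deg g) (axis g c)"
  by (auto simp: homogeneous_def axis_def)

lemma neg_one_powi: "(- 1 :: 'k::field) powi m = (if even m then 1 else - 1)"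
  by (simp add: power_int_minus_left)

lemma tau_tau [simp]: "tau (tau x) = x"
  by (simp add: sign_by_def vec_eq_iff neg_one_powi)

lemma map_tau_tau [simp]: "map (\<lambda>x. tau (tau x)) xs = xs" "map (tau \<circ> tau) xs = xs"
  by (simp_all add: comp_def)

lemma sum_axis: "(\<Sum>g\<in>UNIV. x $ g *s axis g 1) = x"
  for x :: "'k::field ^ 'n::finite"
  by (rule basis_expansion)

lemma mlin_eq_axis:
  assumes "multilinear F" "multilinear G" "\<And>gs. F (map (\<lambda>g. axis g 1) gs) = G (map (\<lambda>g. axis g 1) gs)"
  shows "F xs = G xs"
proof -
  have "F (map (\<lambda>g. axis g 1) gs @ xs) = G (map (\<lambda>g. axis g 1) gs @ xs)" for gs
  proof (induction xs arbitrary: gs)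
    case (Cons x xs)
    let ?c = "map (\<lambda>g. axis g 1) gs"
    have exp: "H (?c @ x # xs) = (\<Sum>g\<in>UNIV. x $ g *s H (map (\<lambda>g. axis g 1) (gs @ [g]) @ xs))"
      if "multilinear H" for H :: "'a cochain"
    proof -
      have "H (?c @ x # xs) = H (?c @ (\<Sum>g\<in>UNIV. x $ g *s axis g 1) # xs)"
        by (simp only: sum_axis)
      also have "\<dots> = (\<Sum>g\<in>UNIV. x $ g *s H (?c @ axis g 1 # xs))"
        by (simp only: lin_sum[OF mlin_lin[OF that, of ?c xs]] lin_scale[OF mlin_lin[OF that, of ?c xs]])
      finally show ?thesis by simp
    qed
    show ?case by (simp only: exp[OF assms(1)] exp[OF assms(2)] Cons.IH)
  qed (use assms(3) in simp)
  from this[of "[]"] show ?thesis by simp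
qed

lemma mlin_map_scale:
  assumes "multilinear F"
  shows "F (us @ map (\<lambda>(c, x). c *s x) cxs) = prod_list (map fst cxs) *s F (us @ map snd cxs)"
proof (induction cxs arbitrary: us)
  case (Cons cx cxs)
  obtain c x where cx: "cx = (c, x)" by force
  have "F (us @ (c *s x) # map (\<lambda>(c, x). c *s x) cxs) = c *s F ((us @ [x]) @ map (\<lambda>(c, x). c *s x) cxs)"
    using lin_scale[OF mlin_lin[OF assms, of us]] by simp
  then show ?case using Cons.IH[of "us @ [x]"] by (simp add: cx vector_smult_assoc)
qed simp

lemma tau_axis: "tau (axis g 1) = (- 1) powi (deg g - 1) *s axis g 1"
  by (rule sign_by_homogeneous[OF homogeneous_axis])

lemma prod_list_powi:
  "prod_list (map (\<lambda>g. (- 1 :: 'k::field) powi f g) gs) = (- 1) powi (\<Sum>g\<leftarrow>gs. f g)"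
  by (induction gs) (simp_all add: power_int_add)

text \<open>\<open>tau\<close> is the sign of the shifted degree, for which a family of total degree
  \<open>n\<close> has degree \<open>n - 1\<close>. By multilinearity it suffices to compare basis
  vectors, which are homogeneous.\<close>

lemma fam_tau:
  fixes F :: "'k::field cochain"
  assumes "fam n F"
  shows "tau (F xs) = (- 1) powi (n - 1) *s F (map tau xs)"
proof (rule mlin_eq_axis[of "\<lambda>xs. tau (F xs)"])
  note F = fam_mlin[OF assms]
  show "multilinear (\<lambda>xs. tau (F xs))" by (rule mlin_compose[OF lin_sign_by F])
  show "multilinear (\<lambda>xs. (- 1) powi (n - 1) *s F (map tau xs))"
    by (rule mlin_cmult[OF mlin_map[OF lin_sign_by F]])
  fix gs
  let ?b = "\<lambda>g. axis g 1 :: 'k alg" and ?s = "(\<Sum>g\<leftarrow>gs. deg g) - int (length gs)"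
  have "list_all2 homogeneous (map deg gs) (map ?b gs)"
    by (simp add: list_all2_conv_all_nth homogeneous_axis)
  then have "homogeneous ((\<Sum>g\<leftarrow>gs. deg g) + n - int (length gs)) (F (map ?b gs))"
    using assms unfolding fam_def by fastforce
  then have 1: "tau (F (map ?b gs)) = (- 1) powi (?s + (n - 1)) *s F (map ?b gs)"
    by (simp add: sign_by_homogeneous algebra_simps)
  have 2: "(\<Sum>g\<leftarrow>gs. deg g - 1) = ?s" by (induction gs) simp_all
  have "F (map tau (map ?b gs)) = (- 1) powi ?s *s F (map ?b gs)"
    using mlin_map_scale[OF F, of "[]" "map (\<lambda>g. ((- 1) powi (deg g - 1), ?b g)) gs"]
    by (simp add: comp_def tau_axis prod_list_powi 2)
  then show "tau (F (map ?b gs)) = (- 1) powi (n - 1) *s F (map tau (map ?b gs))"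
    unfolding 1 by (simp add: vector_smult_assoc power_int_add mult.commute)
qed

lemma fam_tau_odd: "fam n F \<Longrightarrow> odd n \<Longrightarrow> F (map tau xs) = tau (F xs)"
  and fam_tau_even: "fam n F \<Longrightarrow> even n \<Longrightarrow> F (map tau xs) = - tau (F xs)"
  by (simp_all add: fam_tau neg_one_powi vector_sneg_minus1[symmetric])

lemma fam_add: "fam n F \<Longrightarrow> fam n G \<Longrightarrow> fam n (\<lambda>l. F l + G l)"
  and fam_diff: "fam n F \<Longrightarrow> fam n G \<Longrightarrow> fam n (\<lambda>l. F l - G l)"
  and fam_uminus: "fam n F \<Longrightarrow> fam n (\<lambda>l. - F l)"
  and fam_zero [simp]: "fam n (\<lambda>l. 0)"
  by (auto simp: fam_def mlin_plus mlin_minus mlin_neg homogeneous_add homogeneous_diff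
      homogeneous_uminus)

lemma fam_ins:
  assumes "fam m F" "fam n N"
  shows "fam (m + n - 1) (ins (sign_by w) F N)"
  unfolding fam_def
proof (intro conjI allI impI)
  show "multilinear (ins (sign_by w) F N)"
    by (intro mlin_ins fam_mlin[OF assms(1)] fam_mlin[OF assms(2)] lin_sign_by)
  fix ds xs assume h: "list_all2 homogeneous ds (xs :: 'a alg list)"
  show "homogeneous (sum_list ds + (m + n - 1) - int (length xs)) (ins (sign_by w) F N xs)"
    unfolding ins_def
  proof (intro homogeneous_ssum)
    fix us rs vs ws assume 1: "us @ rs = xs" "vs @ ws = rs"
    from h obtain du dv dw where d: "ds = du @ dv @ dw" "list_all2 homogeneous du us"
        "list_all2 homogeneous dv vs" "list_all2 homogeneous dw ws"
      unfolding 1[symmetric] list_all2_append2 by blast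
    have "list_all2 homogeneous dw (map (sign_by w) ws)"
      using d(4) by (auto simp: list_all2_conv_all_nth homogeneous_sign_by)
    moreover have "homogeneous (sum_list dv + n - int (length vs)) (N vs)"
      using assms(2) d(3) by (simp add: fam_def)
    ultimately have "list_all2 homogeneous (du @ (sum_list dv + n - int (length vs)) # dw)
        (us @ N vs # map (sign_by w) ws)"
      using d(2) by (simp add: list_all2_appendI)
    then have "homogeneous (sum_list (du @ (sum_list dv + n - int (length vs)) # dw) + m -
        int (length (us @ N vs # map (sign_by w) ws))) (F (us @ N vs # map (sign_by w) ws))"
      using assms(1) unfolding fam_def by blast
    then show "homogeneous (sum_list ds + (m + n - 1) - int (length xs)) (F (us @ N vs # map (sign_by w) ws))"
      unfolding d(1) 1[symmetric] by (simp add: algebra_simps)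
  qed
qed

lemma homogeneous_blocks:
  assumes "fam 1 G" "list_all2 homogeneous ds xs"
    and "\<And>es ys. list_all2 homogeneous es ys \<Longrightarrow> homogeneous (sum_list es + n - int (length ys)) (F ys)"
  shows "homogeneous (sum_list ds + n - int (length xs)) (blocks F G xs)"
  using assms(2,3)
proof (induction xs arbitrary: F ds n rule: length_induct)
  case (1 xs)
  show ?case
  proof (cases xs)
    case (Cons x ys)
    show ?thesis unfolding Cons blocks.simps
    proof (rule homogeneous_ssum)
      fix bs rs assume b: "bs @ rs = ys"
      from 1(2) obtain d db dr where d: "ds = (d # db) @ dr" "list_all2 homogeneous (d # db) (x # bs)"
          "list_all2 homogeneous dr rs"
        unfolding Cons b[symmetric] by (auto simp: list_all2_Cons2 list_all2_append2)
      let ?e = "sum_list (d # db) + 1 - int (length (x # bs))"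
      have e: "homogeneous ?e (G (x # bs))"
        using assms(1) d(2) unfolding fam_def by blast
      have F: "homogeneous (sum_list es + (?e + n - 1) - int (length zs)) (F (G (x # bs) # zs))"
        if "list_all2 homogeneous es zs" for es zs
        using 1(3)[of "?e # es" "G (x # bs) # zs"] e that by (simp add: algebra_simps)
      have "homogeneous (sum_list dr + (?e + n - 1) - int (length rs))
          (blocks (\<lambda>l. F (G (x # bs) # l)) G rs)"
        by (intro 1(1)[rule_format] d(3) F) (use Cons b in auto)
      then show "homogeneous (sum_list ds + n - int (length (x # ys))) (blocks (\<lambda>l. F (G (x # bs) # l)) G rs)"
        unfolding d(1) b[symmetric] by (simp add: algebra_simps)
    qed
  qed (use 1 in force)
qed

lemma fam_blocks: "fam n F \<Longrightarrow> fam 1 G \<Longrightarrow> fam n (blocks F G)"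
  unfolding fam_def[of n]
  by (auto intro!: mlin_blocks fam_mlin[of 1 G] homogeneous_blocks)

lemma fam_unit_map: "fam 1 unit_map"
  unfolding fam_def
proof (intro conjI allI impI mlin_unit_map)
  fix ds xs assume "list_all2 homogeneous ds (xs :: 'a alg list)"
  then show "homogeneous (sum_list ds + 1 - int (length xs)) (unit_map xs)"
    by (cases "length xs = 1") (auto simp: length_Suc_conv list_all2_Cons2 unit_map_eq_0)
qed


subsection \<open>Compositions of coderivations and coalgebra maps\<close>

lemma ins_tau:
  assumes "\<And>vs. tau (N vs) = c *s N (map tau vs)" "multilinear F"
  shows "ins tau (\<lambda>l. F (map tau l)) N xs = c *s ins tau F N (map tau xs)"
proof -
  have "F (map tau us @ tau (N vs) # ws) = c *s F (map tau us @ N (map tau vs) # ws)" for us vs ws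
    using assms(1) lin_scale[OF mlin_lin[OF assms(2)]] by simp
  then show ?thesis
    by (simp add: ins_def ssum_map lin_ssum[of "(*s) c"] lin_cmult)
qed

text \<open>Two insertions in disjoint places occur in both orders with opposite signs, because
  \<open>M\<close> anticommutes with \<open>tau\<close>, and cancel. The nested ones remain and form
  the coderivation of \<open>ins tau M M\<close>, which has even shifted degree and so passes
  letters without a sign; hence \<open>id\<close>.\<close>

theorem ins_square:
  fixes M :: "'k::field cochain"
  assumes F: "multilinear F" and M: "fam 2 M" "M [] = 0"
  shows "ins tau (ins tau F M) M xs = ins id F (ins tau M M) xs"
  using F
proof (induction xs arbitrary: F)
  case Nil
  then show ?case using M by (simp add: ins_Nil mlin_0_Cons[OF fam_mlin[OF M(1)]]
        mlin_0_Cons ins_Cons)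
next
  case (Cons x xs)
  note F = Cons.prems
  let ?P = "ins tau M M"
  have P0: "?P [] = 0" using M mlin_0_Cons[OF fam_mlin[OF M(1)]] by (simp add: ins_Nil)
  have mM: "multilinear M" by (rule fam_mlin[OF M(1)])
  have Mt: "M (map tau vs) = - tau (M vs)" for vs by (rule fam_tau_even[OF M(1)]) simp
  have FM: "multilinear (ins tau F M)" by (intro mlin_ins F mM lin_sign_by)
  have step: "ins tau F M (y # l) =
      ssum (\<lambda>us vs. F (M (y # us) # map tau vs)) l + ins tau (\<lambda>l. F (y # l)) M l" for y l
    by (rule ins_Cons'[where N = M, OF F M(2)])
  have A: "ssum (\<lambda>vs ws. ins tau F M (M (x # vs) # map tau ws)) xs =
      ssum (\<lambda>vs ws. ssum (\<lambda>as bs. F (M (M (x # vs) # map tau as) # bs)) ws) xs +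
      ssum (\<lambda>vs ws. ins tau (\<lambda>l. F (M (x # vs) # l)) M (map tau ws)) xs"
    by (simp add: step ssum_add ssum_map)
  have "ins tau (\<lambda>l. ssum (\<lambda>us vs. F (M (x # us) # map tau vs)) l) M xs =
      ssum (\<lambda>as bs. ins tau (\<lambda>l. F (M (x # l) # bs)) M as) xs +
      ssum (\<lambda>as bs. ins tau (\<lambda>l. F (M (x # as) # map tau l)) M bs) xs"
    by (simp add: ins_ssum ssum_add)
  also have "ssum (\<lambda>as bs. ins tau (\<lambda>l. F (M (x # as) # map tau l)) M bs) xs =
      - ssum (\<lambda>as bs. ins tau (\<lambda>l. F (M (x # as) # l)) M (map tau bs)) xs"
    using Mt by (simp add: ins_tau[of M "-1" "\<lambda>l. F (_ # l)"] mlin_Cons[OF F] ssum_uminus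
        flip: vector_sneg_minus1)
  also have "ssum (\<lambda>as bs. ins tau (\<lambda>l. F (M (x # l) # bs)) M as) xs =
      ssum (\<lambda>as bs. F (ins tau (\<lambda>l. M (x # l)) M as # bs)) xs"
    by (simp add: ins_lin[OF mlin_lin_Cons[OF F]])
  finally have B: "ins tau (\<lambda>l. ssum (\<lambda>us vs. F (M (x # us) # map tau vs)) l) M xs =
      ssum (\<lambda>as bs. F (ins tau (\<lambda>l. M (x # l)) M as # bs)) xs -
      ssum (\<lambda>as bs. ins tau (\<lambda>l. F (M (x # as) # l)) M (map tau bs)) xs" by simp
  have "ins tau (ins tau F M) M (x # xs) =
      ssum (\<lambda>vs ws. ins tau F M (M (x # vs) # map tau ws)) xs +
      ins tau (\<lambda>l. ins tau F M (x # l)) M xs"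
    by (rule ins_Cons'[where N = M, OF FM M(2)])
  also have "\<dots> = ssum (\<lambda>vs ws. ssum (\<lambda>as bs. F (M (M (x # vs) # map tau as) # bs)) ws) xs +
      ssum (\<lambda>as bs. F (ins tau (\<lambda>l. M (x # l)) M as # bs)) xs +
      ins tau (ins tau (\<lambda>l. F (x # l)) M) M xs"
    by (subst A) (simp add: step ins_add_left B)
  also have "ssum (\<lambda>vs ws. ssum (\<lambda>as bs. F (M (M (x # vs) # map tau as) # bs)) ws) xs =
      ssum (\<lambda>cs bs. F (ssum (\<lambda>vs as. M (M (x # vs) # map tau as)) cs # bs)) xs"
    by (simp add: ssum_assoc[symmetric] lin_ssum[OF mlin_lin_Cons[OF F]])
  also have "ssum (\<lambda>cs bs. F (ssum (\<lambda>vs as. M (M (x # vs) # map tau as)) cs # bs)) xs +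
      ssum (\<lambda>as bs. F (ins tau (\<lambda>l. M (x # l)) M as # bs)) xs =
      ssum (\<lambda>cs bs. F (?P (x # cs) # map id bs)) xs"
    by (simp add: ins_Cons'[where N = M, OF mM M(2)] lin_add[OF mlin_lin_Cons[OF F]] ssum_add)
  also have "ins tau (ins tau (\<lambda>l. F (x # l)) M) M xs = ins id (\<lambda>l. F (x # l)) ?P xs"
    by (rule Cons.IH[OF mlin_Cons[OF F]])
  finally show ?case by (simp only: ins_Cons'[where N = ?P, OF F P0])
qed

lemma blocks_tau:
  assumes "\<And>vs. G (map tau vs) = tau (G vs)"
  shows "blocks (\<lambda>l. F (map tau l)) G xs = blocks F G (map tau xs)"
proof (induction xs arbitrary: F rule: length_induct)
  case (1 xs)
  show ?case
  proof (cases xs)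
    case (Cons x ys)
    have "blocks (\<lambda>l. F (map tau (G (x # bs) # l))) G rs = blocks (\<lambda>l. F (G (tau x # map tau bs) # l)) G (map tau rs)"
      if "bs @ rs = ys" for bs rs
      using 1[rule_format, of rs "\<lambda>l. F (tau (G (x # bs)) # l)"] that Cons assms[of "x # bs"] by auto
    then show ?thesis unfolding Cons blocks.simps list.map ssum_map by (intro ssum_cong refl) simp
  qed simp
qed

text \<open>Coderivations over a coalgebra map are determined by their projections to the
  cogenerators, and \<open>eq\<close> is the equality of these projections. The induction carries it
  to an arbitrary \<open>F\<close> by splitting off the first block.\<close>

theorem blocks_intertwine:
  fixes M N :: "'k::field cochain"
  assumes F: "multilinear F" and M: "fam 2 M" "M [] = 0" and N: "fam 2 N" "N [] = 0"
    and G: "fam 1 G" and eq: "\<And>ys. length ys \<le> length xs \<Longrightarrow> blocks N G ys = ins tau G M ys"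
  shows "blocks (ins tau F N) G xs = ins tau (blocks F G) M xs"
  using F eq
proof (induction xs arbitrary: F rule: length_induct)
  case (1 xs)
  note F = 1(2)
  have mG: "multilinear G" and mN: "multilinear N" by (rule fam_mlin[OF G], rule fam_mlin[OF N(1)])
  have Gt: "G (map tau vs) = tau (G vs)" for vs by (rule fam_tau_odd[OF G]) simp
  have FG: "multilinear (blocks F G)" by (intro mlin_blocks mG F)
  have lF: "lin (\<lambda>z. blocks (\<lambda>l. F (z # l)) G r)" for r by (intro lin_blocks mlin_lin_Cons F)
  show ?case
  proof (cases xs)
    case Nil
    then show ?thesis using M N F FG G by (simp add: ins_Nil mlin_0_Cons)
  next
    case (Cons x ys)
    have "blocks (ins tau F N) G (x # ys) =
        ssum (\<lambda>bs rs. blocks (\<lambda>l. ssum (\<lambda>us vs. F (N (G (x # bs) # us) # map tau vs)) l) G rs) ys +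
        ssum (\<lambda>bs rs. blocks (\<lambda>l. ins tau (\<lambda>l. F (G (x # bs) # l)) N l) G rs) ys"
      by (simp add: blocks.simps ins_Cons'[where N = N, OF F N(2)] blocks_add_left' ssum_add)
    also have "ssum (\<lambda>bs rs. blocks (\<lambda>l. ssum (\<lambda>us vs. F (N (G (x # bs) # us) # map tau vs)) l) G rs) ys =
        ssum (\<lambda>bs rs. ssum (\<lambda>r1 r2. blocks (\<lambda>us. blocks (\<lambda>vs. F (N (G (x # bs) # us) # vs)) G (map tau r2)) G r1) rs) ys"
      by (simp add: blocks_ssum blocks_tau[where G = G, OF Gt, of "\<lambda>l. F (_ # l)"])
    also have "\<dots> = ssum (\<lambda>bs rs. ssum (\<lambda>r1 r2. blocks (\<lambda>l. F (blocks (\<lambda>us. N (G (x # bs) # us)) G r1 # l)) G (map tau r2)) rs) ys"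
      by (intro ssum_cong refl) (rule blocks_lin[OF lF])
    also have "\<dots> = ssum (\<lambda>cs r. blocks (\<lambda>l. F (blocks N G (x # cs) # l)) G (map tau r)) ys"
      by (simp add: blocks.simps(2)[of N] lin_ssum[OF lF] ssum_assoc)
    also have "\<dots> = ssum (\<lambda>cs r. blocks (\<lambda>l. F (ins tau G M (x # cs) # l)) G (map tau r)) ys"
      by (intro ssum_cong refl) (use 1(3) Cons in auto)
    also have "ssum (\<lambda>bs rs. blocks (\<lambda>l. ins tau (\<lambda>l. F (G (x # bs) # l)) N l) G rs) ys =
        ssum (\<lambda>bs rs. ins tau (blocks (\<lambda>l. F (G (x # bs) # l)) G) M rs) ys"
    proof (intro ssum_cong refl)
      fix bs rs assume "bs @ rs = ys"
      then show "blocks (\<lambda>l. ins tau (\<lambda>l. F (G (x # bs) # l)) N l) G rs =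
          ins tau (blocks (\<lambda>l. F (G (x # bs) # l)) G) M rs"
        using 1(1)[rule_format, of rs "\<lambda>l. F (G (x # bs) # l)"] 1(3) Cons mlin_Cons[OF F] by auto
    qed
    finally have L: "blocks (ins tau F N) G (x # ys) =
        ssum (\<lambda>cs r. blocks (\<lambda>l. F (ins tau G M (x # cs) # l)) G (map tau r)) ys +
        ssum (\<lambda>bs rs. ins tau (blocks (\<lambda>l. F (G (x # bs) # l)) G) M rs) ys" .
    have "ins tau (blocks F G) M (x # ys) =
        ssum (\<lambda>us vs. ssum (\<lambda>as bs. blocks (\<lambda>l. F (G (M (x # us) # map tau as) # l)) G (map tau bs)) vs) ys +
        ins tau (\<lambda>l. ssum (\<lambda>as bs. blocks (\<lambda>l. F (G (x # as) # l)) G bs) l) M ys"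
      by (simp add: ins_Cons'[where N = M, OF FG M(2)] blocks.simps ssum_map)
    also have "ins tau (\<lambda>l. ssum (\<lambda>as bs. blocks (\<lambda>l. F (G (x # as) # l)) G bs) l) M ys =
        ssum (\<lambda>as bs. blocks (\<lambda>l. F (ins tau (\<lambda>l. G (x # l)) M as # l)) G (map tau bs)) ys +
        ssum (\<lambda>as bs. ins tau (blocks (\<lambda>l. F (G (x # as) # l)) G) M bs) ys"
      by (simp add: ins_ssum ssum_add ins_lin[OF lF, of tau "\<lambda>l. G (x # l)"])
    also have "ssum (\<lambda>us vs. ssum (\<lambda>as bs. blocks (\<lambda>l. F (G (M (x # us) # map tau as) # l)) G (map tau bs)) vs) ys =
        ssum (\<lambda>cs r. blocks (\<lambda>l. F (ssum (\<lambda>us as. G (M (x # us) # map tau as)) cs # l)) G (map tau r)) ys"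
      by (simp add: lin_ssum[OF lF] ssum_assoc)
    finally show ?thesis unfolding Cons L
      by (simp add: ins_Cons'[where N = M, OF mG M(2)] lin_add[OF lF] ssum_add)
  qed
qed


subsection \<open>Recursion over the length of lists\<close>

definition trunc :: "nat \<Rightarrow> 'k::field cochain \<Rightarrow> 'k cochain" where
  "trunc n f xs = (if length xs < n then f xs else 0)"

lemma trunc_fixpoint:
  fixes \<Phi> :: "'k::field cochain \<Rightarrow> 'k cochain"
  assumes "\<And>f g xs. (\<And>ys. length ys < length xs \<Longrightarrow> f ys = g ys) \<Longrightarrow> \<Phi> f xs = \<Phi> g xs"
  obtains f where "\<And>xs. f xs = \<Phi> f xs"
proof -
  let ?R = "Wellfounded.measure (length :: 'k alg list \<Rightarrow> nat)"
  define f where "f = wfrec ?R \<Phi>"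
  have "f xs = \<Phi> f xs" for xs
  proof -
    have "f xs = \<Phi> (Wfrec.cut f ?R xs) xs"
      unfolding f_def by (rule wfrec) simp
    also have "\<dots> = \<Phi> f xs" by (rule assms) (simp add: Wfrec.cut_apply)
    finally show ?thesis .
  qed
  then show ?thesis by (rule that)
qed

lemma mlin_trunc: "multilinear F \<Longrightarrow> multilinear (trunc n F)"
proof -
  have "lin (\<lambda>x. if c then f x else 0)" if "lin f" for c and f :: "'a alg \<Rightarrow> 'a alg"
    using that by (cases c) simp_all
  then show "multilinear F \<Longrightarrow> multilinear (trunc n F)"
    unfolding multilinear_iff_lin trunc_def by simp
qed

lemma fam_trunc: "fam m F \<Longrightarrow> fam m (trunc n F)"
  by (simp add: fam_def mlin_trunc) (simp add: trunc_def)

lemma fam_of_trunc: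
  assumes "\<And>n. fam m (trunc n F)"
  shows "fam m F"
  unfolding fam_def
proof (intro conjI allI impI)
  show "multilinear F"
    unfolding multilinear_iff_lin
  proof (intro allI)
    fix us ws :: "'a alg list"
    show "lin (\<lambda>x. F (us @ x # ws))"
      using mlin_lin[OF fam_mlin[OF assms[of "length us + length ws + 2"]], of us ws]
      by (simp add: trunc_def)
  qed
  fix ds and xs :: "'a alg list" assume "list_all2 homogeneous ds xs"
  then have "homogeneous (sum_list ds + m - int (length xs)) (trunc (Suc (length xs)) F xs)"
    using assms[of "Suc (length xs)"] unfolding fam_def by blast
  then show "homogeneous (sum_list ds + m - int (length xs)) (F xs)"
    by (simp add: trunc_def)
qed

text \<open>\<open>\<Phi>\<close> preserves families, but the fixed point is not yet known to be
  one. By locality its truncation at \<open>n + 1\<close> depends only on its truncation at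
  \<open>n\<close>, so the property climbs through the truncations.\<close>

lemma fam_fixpoint:
  assumes fp: "\<And>xs. f xs = \<Phi> f xs"
    and loc: "\<And>f g xs. (\<And>ys. length ys < length xs \<Longrightarrow> f ys = g ys) \<Longrightarrow> \<Phi> f xs = \<Phi> g xs"
    and fam: "\<And>g. fam m g \<Longrightarrow> fam m (\<Phi> g)"
  shows "fam m f"
proof (rule fam_of_trunc)
  show "fam m (trunc n f)" for n
  proof (induction n)
    case 0
    have "trunc 0 f = (\<lambda>_. 0)" by (simp add: trunc_def fun_eq_iff)
    then show ?case by simp
  next
    case (Suc n)
    have "trunc (Suc n) f = trunc (Suc n) (\<Phi> (trunc n f))"
      unfolding trunc_def[of "Suc n"]
    proof
      fix xs
      have "\<Phi> f xs = \<Phi> (trunc n f) xs" if "length xs < Suc n"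
        by (rule loc) (use that in \<open>simp add: trunc_def\<close>)
      then show "(if length xs < Suc n then f xs else 0) =
          (if length xs < Suc n then \<Phi> (trunc n f) xs else 0)"
        using fp[of xs] by simp
    qed
    then show ?case using fam_trunc[OF fam[OF Suc]] by simp
  qed
qed

lemma blocks_cong_le:
  "(\<And>ys. length ys \<le> length xs \<Longrightarrow> G ys = G' ys) \<Longrightarrow> blocks F G xs = blocks F G' xs"
proof (induction xs arbitrary: F rule: length_induct)
  case (1 xs)
  show ?case
  proof (cases xs)
    case (Cons x ys)
    have "blocks (\<lambda>l. F (G (x # bs) # l)) G rs = blocks (\<lambda>l. F (G' (x # bs) # l)) G' rs"
      if "bs @ rs = ys" for bs rs
    proof -
      have "G (x # bs) = G' (x # bs)" using 1(2)[of "x # bs"] that Cons by auto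
      moreover have "blocks F G rs = blocks F G' rs" for F
        by (rule 1(1)[rule_format]) (use that Cons 1(2) in auto)
      ultimately show ?thesis by simp
    qed
    then show ?thesis unfolding Cons blocks.simps by (intro ssum_cong refl)
  qed simp
qed

text \<open>The only term that evaluates \<open>G\<close> on all of \<open>xs\<close> is the one
  with a single block, and \<open>E\<close> kills it. This makes the recursion for the inverse
  well-founded.\<close>

lemma blocks_cong_less:
  assumes "\<And>z. E [z] = 0" "\<And>ys. length ys < length xs \<Longrightarrow> G ys = G' ys"
  shows "blocks E G xs = blocks E G' xs"
proof (cases xs)
  case (Cons x ys)
  have "blocks (\<lambda>l. E (G (x # bs) # l)) G rs = blocks (\<lambda>l. E (G' (x # bs) # l)) G' rs"
    if "bs @ rs = ys" for bs rs
  proof (cases "rs = []")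
    case False
    have "G (x # bs) = G' (x # bs)" using assms(2)[of "x # bs"] that Cons False by auto
    moreover have "blocks F G rs = blocks F G' rs" for F
      by (rule blocks_cong_le) (use that Cons assms(2) in auto)
    ultimately show ?thesis by simp
  qed (simp add: assms(1))
  then show ?thesis unfolding Cons blocks.simps by (intro ssum_cong refl)
qed simp


subsection \<open>Gauge transformations form a group acting on minimal structures\<close>

definition normalized :: "'k::field cochain \<Rightarrow> bool" where
  "normalized F \<longleftrightarrow> (\<forall>xs. alg_one \<in> set xs \<longrightarrow> F xs = 0)"

definition gau :: "'k::field cochain \<Rightarrow> bool" where
  "gau G \<longleftrightarrow> fam 1 G \<and> G [] = 0 \<and> (\<forall>x. G [x] = x) \<and>
     (\<forall>xs. alg_one \<in> set xs \<longrightarrow> G xs = unit_map xs)"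

definition str :: "'k::field cochain \<Rightarrow> bool" where
  "str M \<longleftrightarrow> fam 2 M \<and> M [] = 0 \<and> (\<forall>x. M [x] = 0) \<and> (\<forall>x y. M [x, y] = mu2 [x, y]) \<and>
     (\<forall>xs. alg_one \<in> set xs \<longrightarrow> M xs = mu2 xs) \<and> (\<forall>xs. ins tau M M xs = 0)"

definition hom :: "'k::field cochain \<Rightarrow> 'k cochain \<Rightarrow> 'k cochain \<Rightarrow> bool" where
  "hom G M N \<longleftrightarrow> (\<forall>xs. blocks N G xs = ins tau G M xs)"

lemma gauD:
  assumes "gau G"
  shows "fam 1 G" "multilinear G" "G [] = 0" "G [x] = x"
    "alg_one \<in> set xs \<Longrightarrow> G xs = unit_map xs"
  using assms fam_mlin[of 1 G] by (auto simp: gau_def)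

lemma strD:
  assumes "str M"
  shows "fam 2 M" "multilinear M" "M [] = 0" "M [x] = 0" "M [x, y] = mu2 [x, y]"
    "alg_one \<in> set xs \<Longrightarrow> M xs = mu2 xs" "ins tau M M xs = 0"
  using assms fam_mlin[of 2 M] by (auto simp: str_def)

lemma normalized_Cons: "normalized F \<Longrightarrow> normalized (\<lambda>l. F (x # l))"
  by (auto simp: normalized_def)

lemma blocks_normalized:
  assumes "multilinear E" "normalized E" "\<And>x. H [x] = x"
    "\<And>ys. alg_one \<in> set ys \<Longrightarrow> H ys = unit_map ys"
  shows "normalized (blocks E H)"
proof -
  have "blocks E H xs = 0" if "alg_one \<in> set xs" "multilinear E" "normalized E" for xs E
    using that
  proof (induction xs arbitrary: E rule: length_induct)
    case (1 xs)
    show ?case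
    proof (cases xs)
      case (Cons x ys)
      have "blocks (\<lambda>l. E (H (x # bs) # l)) H rs = 0" if b: "bs @ rs = ys" for bs rs
      proof (cases "alg_one \<in> set (x # bs)")
        case True
        have "E (H (x # bs) # l) = 0" for l
        proof (cases "bs = []")
          case True
          then show ?thesis using \<open>alg_one \<in> set (x # bs)\<close> assms(3) 1(4) by (simp add: normalized_def)
        next
          case False
          then have "H (x # bs) = 0" using assms(4)[OF True] by (simp add: unit_map_Cons)
          then show ?thesis using mlin_0_Cons[OF 1(3)] by simp
        qed
        then show ?thesis by simp
      next
        case False
        then have "alg_one \<in> set rs" using 1(2) b Cons by auto
        moreover have "length rs < length xs" using b Cons by auto
        ultimately show ?thesis
          using 1(1) mlin_Cons[OF 1(3)] normalized_Cons[OF 1(4)] by blast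
      qed
      then show ?thesis unfolding Cons blocks.simps
        by (intro trans[OF ssum_cong[OF refl] ssum_zero])
    qed (use 1 in simp)
  qed
  then show ?thesis using assms(1,2) unfolding normalized_def by blast
qed

lemma gau_unit_map: "gau unit_map"
  by (simp add: gau_def fam_unit_map)

lemma gau_minus_unit:
  assumes "gau G"
  shows "fam 1 (\<lambda>l. G l - unit_map l)" "normalized (\<lambda>l. G l - unit_map l)"
    "multilinear (\<lambda>l. G l - unit_map l)" "G [x] - unit_map [x] = 0"
  using gauD[OF assms] by (auto simp: fam_diff fam_unit_map normalized_def mlin_minus mlin_unit_map)

lemma blocks_minus_unit:
  assumes "H [] = 0"
  shows "blocks G H xs = blocks (\<lambda>l. G l - unit_map l) H xs + H xs"
  using blocks_unit_left[of H xs] assms by (simp add: blocks_diff_left)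

lemma gau_blocks:
  assumes "gau G" "gau H"
  shows "gau (blocks G H)"
proof -
  note G = gauD[OF assms(1)] and H = gauD[OF assms(2)]
  have "normalized (blocks (\<lambda>l. G l - unit_map l) H)"
    by (rule blocks_normalized) (use gau_minus_unit[OF assms(1)] H in auto)
  then have "blocks G H xs = unit_map xs" if "alg_one \<in> set xs" for xs
    using blocks_minus_unit[of H G xs] H(3) H(5)[OF that] that by (simp add: normalized_def)
  then show ?thesis
    unfolding gau_def using G H by (auto simp: fam_blocks blocks.simps)
qed

text \<open>With \<open>E = G - unit_map\<close> the equation for \<open>H\<close> reads
  \<open>H = unit_map - blocks E H\<close>, and \<open>E\<close> vanishes in arity one, so the right
  side uses \<open>H\<close> on shorter lists only.\<close>

lemma gau_right_inverse:
  assumes "gau G"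
  obtains H where "gau H" "\<And>xs. blocks G H xs = unit_map xs"
proof -
  note G = gauD[OF assms]
  define E where "E = (\<lambda>l. G l - unit_map l)"
  have E: "fam 1 E" "normalized E" "multilinear E" "E [x] = 0" for x
    using gau_minus_unit[OF assms] by (simp_all add: E_def)
  let ?\<Phi> = "\<lambda>H xs. unit_map xs - blocks E H xs"
  have loc: "?\<Phi> f xs = ?\<Phi> g xs" if "\<And>ys. length ys < length xs \<Longrightarrow> f ys = g ys" for f g xs
    using blocks_cong_less[of E xs f g] E(4) that by simp
  obtain H where H: "\<And>xs. H xs = unit_map xs - blocks E H xs"
    using trunc_fixpoint[of ?\<Phi>] loc by blast
  have H0: "H [] = 0" using H[of "[]"] G(3) by (simp add: E_def)
  have H1: "H [x] = x" for x using H[of "[x]"] E(4) by (simp add: blocks.simps)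
  have fH: "fam 1 H"
    by (rule fam_fixpoint[of H ?\<Phi>, OF H loc]) (auto intro!: fam_diff fam_unit_map fam_blocks E)
  have HG: "blocks G H xs = unit_map xs" for xs
    using blocks_minus_unit[of H G xs, OF H0] H[of xs] by (simp add: E_def)
  have "H xs = unit_map xs" if "alg_one \<in> set xs" for xs
    using that
  proof (induction xs rule: length_induct)
    case (1 xs)
    \<comment> \<open>Normalization of \<open>H\<close> is known on shorter lists only;
      \<open>H'\<close> repairs the longer ones so that \<open>blocks_normalized\<close> applies,
      and \<open>blocks E\<close> does not see the difference.\<close>
    define H' where "H' = (\<lambda>ys. if length ys < length xs then H ys else unit_map ys)"
    have "normalized (blocks E H')"
    proof (rule blocks_normalized[OF E(3,2)])
      show "H' [x] = x" for x by (simp add: H'_def H1)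
      show "H' ys = unit_map ys" if "alg_one \<in> set ys" for ys
        using that 1 by (auto simp: H'_def)
    qed
    moreover have "blocks E H xs = blocks E H' xs"
      by (rule blocks_cong_less) (auto simp: E(4) H'_def)
    ultimately show ?case using H[of xs] 1(2) by (simp add: normalized_def)
  qed
  then have "gau H" using fH H0 H1 by (simp add: gau_def)
  then show ?thesis using HG that by blast
qed

text \<open>Right inverses suffice: by associativity the right inverse of \<open>H\<close> is
  \<open>G\<close> itself.\<close>

lemma gau_inverse:
  assumes "gau G"
  obtains H where "gau H" "blocks G H = unit_map" "blocks H G = unit_map"
proof -
  obtain H where H: "gau H" "\<And>xs. blocks G H xs = unit_map xs"
    using gau_right_inverse[OF assms] by blast
  obtain K where K: "gau K" "\<And>xs. blocks H K xs = unit_map xs"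
    using gau_right_inverse[OF H(1)] by blast
  have GH: "blocks G H = unit_map" and HK: "blocks H K = unit_map"
    using H(2) K(2) by auto
  have "G xs = K xs" for xs
  proof -
    have "G xs = blocks G (blocks H K) xs" by (simp add: HK blocks_unit_right gauD[OF assms])
    also have "\<dots> = blocks unit_map K xs" by (simp add: blocks_assoc[symmetric] gauD[OF assms] GH)
    also have "\<dots> = K xs" by (simp add: blocks_unit_left gauD[OF K(1)])
    finally show ?thesis .
  qed
  then have "G = K" by auto
  then show ?thesis using that H(1) GH HK by blast
qed

lemma blocks_cancel:
  assumes "gau G" "multilinear F" "multilinear F'" "\<And>xs. blocks F G xs = blocks F' G xs"
  shows "F xs = F' xs"
proof -
  obtain H where H: "gau H" "blocks G H = unit_map" using gau_inverse[OF assms(1)] by blast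
  have "blocks F G = blocks F' G" using assms(4) by auto
  then have "blocks F (blocks G H) xs = blocks F' (blocks G H) xs"
    using assms(2,3) by (metis blocks_assoc)
  then show ?thesis by (simp add: H(2) blocks_unit_right assms(2,3))
qed

lemma hom_intertwine:
  assumes "hom G M N" "gau G" "str M" "str N" "multilinear F"
  shows "blocks (ins tau F N) G = ins tau (blocks F G) M"
  by (rule ext, rule blocks_intertwine)
    (use assms gauD[of G] strD[of M] strD[of N] in \<open>auto simp: hom_def\<close>)

lemma hom_unit: "str M \<Longrightarrow> hom unit_map M M"
  by (simp add: hom_def blocks_unit_right strD ins_unit_left)

lemma hom_compose:
  assumes "hom G M N" "hom H N P" "gau G" "gau H" "str M" "str N" "str P"
  shows "hom (blocks H G) M P"
proof -
  have "blocks P (blocks H G) xs = ins tau (blocks H G) M xs" for xs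
  proof -
    have "blocks P H = ins tau H N" using assms(2) by (auto simp: hom_def)
    then have "blocks P (blocks H G) xs = blocks (ins tau H N) G xs"
      by (simp add: blocks_assoc[symmetric] strD[OF assms(7)])
    then show ?thesis using hom_intertwine[OF assms(1,3,5,6) gauD(2)[OF assms(4)]] by simp
  qed
  then show ?thesis by (simp add: hom_def)
qed

lemma hom_inverse:
  assumes "hom G M N" "gau G" "gau H" "str M" "str N" "blocks G H = unit_map" "blocks H G = unit_map"
  shows "hom H N M"
proof -
  have "blocks (ins tau H N) G = ins tau unit_map M"
    using hom_intertwine[OF assms(1,2,4,5) gauD(2)[OF assms(3)]] assms(7) by simp
  then have eq: "blocks (ins tau H N) G = M" by (simp add: fun_eq_iff ins_unit_left strD[OF assms(4)])
  have mHN: "multilinear (ins tau H N)"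
    by (intro mlin_ins lin_sign_by gauD(2)[OF assms(3)] strD(2)[OF assms(5)])
  have "blocks M H xs = ins tau H N xs" for xs
    using blocks_assoc[OF mHN, of G H xs] by (simp add: eq assms(6) blocks_unit_right[OF mHN])
  then show ?thesis by (simp add: hom_def)
qed

text \<open>The value on \<open>us @ alg_one # ws\<close> of both sides of the equation of a homomorphism.\<close>

definition unit_value :: "'k::field cochain \<Rightarrow> 'k alg list \<Rightarrow> 'k alg list \<Rightarrow> 'k alg" where
  "unit_value X us ws =
     (if us = [] then (if ws = [] then 0 else - X (map tau ws)) else if ws = [] then X us else 0)"

lemma sign_one: "sign_by (\<lambda>k. k) x = - tau x"
  by (simp add: sign_by_def vec_eq_iff neg_one_powi)

lemma tau_alg_one: "tau alg_one = - (alg_one :: 'k::field alg)"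
proof -
  have "tau alg_one $ g = (- alg_one :: 'k alg) $ g" for g
    by (cases g) (simp_all add: sign_by_def alg_one_def axis_def neg_one_powi)
  then show ?thesis by (simp add: vec_eq_iff)
qed

lemma mu2_simps:
  "mu2 [] = 0" "mu2 [x] = 0" "mu2 (x # y # z # zs) = 0" "mu2 [x, y] = x \<star> (- tau y)"
  by (simp_all add: mu2_def sign_one)

lemma mu2_eq_0: "length xs \<noteq> 2 \<Longrightarrow> mu2 xs = 0"
  by (auto simp: mu2_def split: list.split)

lemma lin_alg_mult_left: "lin (\<lambda>a. a \<star> b)"
  and lin_alg_mult_right: "lin (\<lambda>b. a \<star> b)"
  by (auto simp: lin_def alg_mult_def vec_eq_iff sum.distrib[symmetric] sum_distrib_left algebra_simps
      intro!: sum.cong)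

lemma mu2_unit: "mu2 [alg_one, y] = - tau y" "mu2 [x, alg_one] = x"
  by (simp_all add: mu2_simps alg_one_left tau_alg_one alg_one_right)

lemma mlin_mu2: "multilinear mu2"
  unfolding multilinear_iff_lin
proof (intro allI)
  fix us ws :: "'a alg list"
  consider "length us + length ws \<noteq> 1" | z where "us = [z]" "ws = []" | z where "us = []" "ws = [z]"
    by (cases us; cases ws) auto
  then show "lin (\<lambda>x. mu2 (us @ x # ws))"
  proof cases
    case 1
    then show ?thesis by (simp add: mu2_eq_0)
  next
    case 2
    then show ?thesis
      by (simp add: mu2_simps) (intro lin_compose[OF lin_alg_mult_right] lin_neg lin_sign_by)
  next
    case 3
    then show ?thesis by (simp add: mu2_simps lin_alg_mult_left)
  qed
qed

text \<open>Since \<open>X\<close> is normalized, the unit must be absorbed by the inserted map, and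
  there only \<open>mu2\<close> accepts it. Multiplying it into its left and into its right
  neighbour gives opposite signs; what is left comes from the ends of the list.\<close>

lemma ins_unit_value:
  assumes X: "multilinear X" "normalized X"
    and M: "M [] = 0" "\<And>x. M [x] = 0" "\<And>xs. alg_one \<in> set xs \<Longrightarrow> M xs = mu2 xs"
  shows "ins tau X M (us @ alg_one # ws) = unit_value X us ws"
  using X
proof (induction us arbitrary: X)
  case Nil
  have "(\<lambda>l. X (alg_one # l)) = (\<lambda>l. 0)" using Nil(2) by (auto simp: normalized_def)
  then have 1: "ins tau X M (alg_one # ws) = ssum (\<lambda>vs ws. X (M (alg_one # vs) # map tau ws)) ws"
    by (simp add: ins_Cons'[where N = M, OF Nil(1) M(1)])
  show ?case
  proof (cases ws)
    case Nil
    then show ?thesis using 1 by (simp add: M(2) mlin_0_Cons[OF \<open>multilinear X\<close>] unit_value_def)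
  next
    case (Cons y zs)
    have "ssum (\<lambda>vs ws. X (M (alg_one # y # vs) # map tau ws)) zs = X (M [alg_one, y] # map tau zs)"
      by (rule ssum_head) (auto simp: M(3) neq_Nil_conv mu2_simps mlin_0_Cons[OF \<open>multilinear X\<close>])
    also have "\<dots> = - X (map tau ws)"
      using lin_uminus[OF mlin_lin_Cons[OF \<open>multilinear X\<close>]] by (simp add: M(3) mu2_unit Cons)
    finally show ?thesis
      using 1 by (simp add: Cons M(2) mlin_0_Cons[OF \<open>multilinear X\<close>] unit_value_def)
  qed
next
  case (Cons x us)
  note X = Cons.prems
  have z: "X (M (x # as) # map tau (bs @ alg_one # ws)) = 0" for as bs
    using lin_uminus[OF mlin_lin[OF X(1), of "M (x # as) # map tau bs"]] X(2)
    by (simp add: tau_alg_one normalized_def)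
  have "ssum (\<lambda>vs ws. X (M (x # vs) # map tau ws)) (us @ alg_one # ws) =
      ssum (\<lambda>as bs. X (M (x # us @ alg_one # as) # map tau bs)) ws"
    by (simp only: ssum_insert z ssum_zero) simp
  also have "\<dots> = X (M (x # us @ [alg_one]) # map tau ws)"
    by (rule trans[OF ssum_head]) (auto simp: M(3) mu2_eq_0 mlin_0_Cons[OF X(1)])
  finally have "ins tau X M (x # us @ alg_one # ws) =
      X (mu2 (x # us @ [alg_one]) # map tau ws) + unit_value (\<lambda>l. X (x # l)) us ws"
    using Cons.IH[OF mlin_Cons[OF X(1)] normalized_Cons[OF X(2)]]
    by (simp add: ins_Cons'[where N = M, OF X(1) M(1)] M(3))
  moreover have "X (mu2 (x # us @ [alg_one]) # map tau ws) = (if us = [] then X (x # map tau ws) else 0)"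
    by (auto simp: mu2_unit mu2_eq_0 mlin_0_Cons[OF X(1)])
  ultimately show ?case by (auto simp: unit_value_def)
qed

lemma blocks_mu2:
  assumes "G [] = 0"
  shows "blocks mu2 G xs = ssum (\<lambda>us vs. mu2 [G us, G vs]) xs"
proof -
  have lm: "mu2 [0, y] = 0" for y :: "'a alg" by (rule mlin_0_Cons[OF mlin_mu2])
  have lm': "mu2 [y, 0] = 0" for y :: "'a alg" using mlin_0[OF mlin_mu2, of "[y]" "[]"] by simp
  have 2: "blocks (\<lambda>l. mu2 (a # b # l)) G rs = (if rs = [] then mu2 [a, b] else 0)" for a b rs
  proof (cases rs)
    case (Cons r rs')
    then show ?thesis by (simp add: blocks.simps mu2_simps)
  qed simp
  have 1: "blocks (\<lambda>l. mu2 (a # l)) G rs = mu2 [a, G rs]" for a rs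
  proof (cases rs)
    case (Cons r rs')
    have "blocks (\<lambda>l. mu2 (a # l)) G rs = mu2 [a, G (r # rs')]"
      unfolding Cons blocks.simps 2 by (rule trans[OF ssum_last]) auto
    then show ?thesis by (simp add: Cons)
  qed (simp add: assms lm' mu2_simps(2))
  then have "blocks (\<lambda>l. mu2 (a # l)) G = (\<lambda>rs. mu2 [a, G rs])" for a by auto
  then show ?thesis by (cases xs) (simp_all add: mu2_simps(1) blocks.simps assms lm)
qed

lemma blocks_mu2_unit:
  assumes "gau G"
  shows "blocks mu2 G (us @ alg_one # ws) = unit_value G us ws"
proof -
  note G = gauD[OF assms]
  have lm: "mu2 [0, y] = 0" for y :: "'a alg" by (rule mlin_0_Cons[OF mlin_mu2])
  have lm': "mu2 [y, 0] = 0" for y :: "'a alg" using mlin_0[OF mlin_mu2, of "[y]" "[]"] by simp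
  have z: "G (as @ alg_one # bs) = (if as = [] \<and> bs = [] then alg_one else 0)" for as bs
    using G(5)[of "as @ alg_one # bs"] by (cases as) (auto simp: unit_map_Cons)
  have "blocks mu2 G (us @ alg_one # ws) =
      ssum (\<lambda>as bs. mu2 [G as, G (bs @ alg_one # ws)]) us +
      ssum (\<lambda>as bs. mu2 [G (us @ alg_one # as), G bs]) ws"
    by (simp add: blocks_mu2[where G = G, OF G(3)] ssum_insert)
  also have "ssum (\<lambda>as bs. mu2 [G as, G (bs @ alg_one # ws)]) us =
      (if ws = [] then G us else 0)"
    unfolding z by (rule trans[OF ssum_last]) (auto simp: lm' mu2_unit)
  also have "ssum (\<lambda>as bs. mu2 [G (us @ alg_one # as), G bs]) ws = (if us = [] then - tau (G ws) else 0)"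
    unfolding z by (rule trans[OF ssum_head]) (auto simp: lm mu2_unit)
  finally show ?thesis
    using fam_tau_odd[OF G(1)] G(3) lin_0[OF lin_sign_by] by (auto simp: unit_value_def)
qed

lemma mu2_unit_value: "mu2 (us @ alg_one # ws) = unit_value unit_map us ws"
  using blocks_mu2_unit[OF gau_unit_map, of us ws] by (simp add: blocks_unit_right[OF mlin_mu2])

lemma unit_value_add: "unit_value (\<lambda>l. X l + Y l) us ws = unit_value X us ws + unit_value Y us ws"
  by (simp add: unit_value_def)

text \<open>Used in \<open>transfer\<close>: it makes the transported structure differ from
  \<open>mu2\<close> by a normalized family.\<close>

lemma ins_eq_blocks_mu2:
  assumes "gau G" "str M" "alg_one \<in> set xs"
  shows "ins tau G M xs = blocks mu2 G xs"
proof -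
  let ?X = "\<lambda>l. G l - unit_map l"
  obtain us ws where xs: "xs = us @ alg_one # ws" using assms(3) by (meson split_list)
  have G_eq: "G = (\<lambda>l. unit_map l + ?X l)" by simp
  have "ins tau G M xs = M xs + ins tau ?X M xs"
    by (subst G_eq, subst ins_add_left) (simp add: ins_unit_left strD[OF assms(2)])
  also have "ins tau ?X M xs = unit_value ?X us ws"
    unfolding xs by (rule ins_unit_value) (use gau_minus_unit[OF assms(1)] strD[OF assms(2)] in auto)
  also have "M xs = unit_value unit_map us ws"
    using strD(6)[OF assms(2,3)] by (simp add: xs mu2_unit_value)
  finally have "ins tau G M xs = unit_value G us ws"
    by (simp only: unit_value_add[symmetric] G_eq[symmetric])
  then show ?thesis by (simp add: xs blocks_mu2_unit[OF assms(1)])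
qed

text \<open>The new structure is forced to be \<open>ins tau G M\<close> composed with the inverse
  of \<open>G\<close>. That it squares to zero may be checked after composition with
  \<open>G\<close>, by \<open>blocks_cancel\<close>.\<close>

lemma transfer:
  assumes G: "gau G" and M: "str M"
  obtains N where "str N" "hom G M N"
proof -
  note G' = gauD[OF G] and M' = strD[OF M]
  obtain H where H: "gau H" "blocks G H = unit_map" "blocks H G = unit_map"
    using gau_inverse[OF G] by blast
  note H' = gauD[OF H(1)]
  define Q where "Q = ins tau G M"
  define N where "N = blocks Q H"
  have fQ: "fam 2 Q" using fam_ins[OF G'(1) M'(1)] by (simp add: Q_def)
  then have mQ: "multilinear Q" by (rule fam_mlin)
  have fN: "fam 2 N" unfolding N_def by (rule fam_blocks[OF fQ H'(1)])
  have N0: "N [] = 0" by (simp add: N_def Q_def ins_Nil M'(3) mlin_0_Cons[OF G'(2)])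
  have hom: "blocks N G xs = Q xs" for xs
    using blocks_assoc[OF mQ, of H G xs] by (simp add: N_def H(3) blocks_unit_right[OF mQ])
  have N1: "N [x] = 0" for x
    using hom[of "[x]"] by (simp add: blocks.simps Q_def ins_Cons ins_Nil G' M' mlin_0_Cons[OF G'(2)]
        mlin_0[OF G'(2), of "[x]" "[]", simplified])
  have N2: "N [x, y] = mu2 [x, y]" for x y
  proof -
    have "mu2 [0, z] = 0" "mu2 [z, 0] = 0" for z :: "'a alg"
      using mlin_0_Cons[OF mlin_mu2] mlin_0[OF mlin_mu2, of "[z]" "[]"] by auto
    then have "blocks N G [x, y] = N [x, y] + N [G [x, y]]"
      by (simp add: blocks.simps G')
    moreover have "Q [x, y] = M [x, y]"
      using M' G' mlin_0[OF G'(2), of "[x]"] mlin_0[OF G'(2), of "[x, y]" "[]"]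
      by (simp add: Q_def ins_Cons ins_Nil mlin_0_Cons[OF G'(2)])
    ultimately show ?thesis using hom[of "[x, y]"] N1 M'(5) by simp
  qed
  have NN: "ins tau N N xs = 0" for xs
  proof -
    have mNN: "multilinear (ins tau N N)" by (intro mlin_ins lin_sign_by fam_mlin[OF fN])
    have "blocks (ins tau N N) G xs = ins tau (blocks N G) M xs" for xs
      by (rule blocks_intertwine[OF fam_mlin[OF fN] M'(1,3) fN N0 G'(1)]) (simp add: hom Q_def)
    moreover have "blocks N G = Q" using hom by auto
    moreover have "ins tau Q M xs = ins id G (ins tau M M) xs" for xs
      unfolding Q_def by (rule ins_square[OF G'(2) M'(1,3)])
    moreover have "ins tau M M = (\<lambda>l. 0)" using M'(7) by auto
    ultimately have "blocks (ins tau N N) G xs = blocks (\<lambda>l. 0) G xs" for xs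
      by (simp add: G'(2))
    then show ?thesis by (intro blocks_cancel[OF G mNN mlin_zero])
  qed
  have "N xs = mu2 xs" if "alg_one \<in> set xs" for xs
  proof -
    let ?D = "\<lambda>l. Q l - blocks mu2 G l"
    have "multilinear ?D" by (intro mlin_minus mQ mlin_blocks G'(2) mlin_mu2)
    moreover have "normalized ?D"
      using ins_eq_blocks_mu2[OF G M] by (simp add: normalized_def Q_def)
    ultimately have "normalized (blocks ?D H)" using H' by (intro blocks_normalized) auto
    moreover have "blocks ?D H xs = N xs - mu2 xs"
      by (simp add: blocks_diff_left N_def blocks_assoc mlin_mu2 H(2) blocks_unit_right)
    ultimately show ?thesis using that by (simp add: normalized_def)
  qed
  then have "str N" using fN N0 N1 N2 NN by (simp add: str_def)
  moreover have "hom G M N" using hom by (simp add: hom_def Q_def)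
  ultimately show ?thesis by (rule that)
qed


subsection \<open>Automorphisms homotopic to the identity\<close>

text \<open>
  For an odd \<open>T\<close>, the map \<open>F \<mapsto> tw K T F\<close> is the composition with the coderivation over the pair of
  coalgebra maps \<open>(K, id)\<close> induced by \<open>T\<close>. The equation \<open>K = id - (M T + T M)\<close>
  determines \<open>K\<close> recursively, and \<open>K\<close> is an automorphism of \<open>M\<close>. This takes the place of the exponential
  of an inner derivation, which is not available in positive characteristic.
\<close>

definition tw ::
    "'k::field cochain \<Rightarrow> 'k cochain \<Rightarrow> 'k cochain \<Rightarrow> 'k cochain" where
  "tw K T F xs = ssum (\<lambda>us rs. ssum (\<lambda>vs ws. blocks (\<lambda>l. F (l @ T vs # map tau ws)) K us) rs) xs"

lemma tw_zero [simp]: "tw K T (\<lambda>l. 0) xs = 0"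
  by (simp add: tw_def)

lemma tw_add: "tw K T (\<lambda>l. F l + G l) xs = tw K T F xs + tw K T G xs"
  by (simp add: tw_def blocks_add_left ssum_add)

lemma tw_lin: "lin f \<Longrightarrow> tw K T (\<lambda>l. f (F l)) xs = f (tw K T F xs)"
  by (simp add: tw_def blocks_lin[of f] lin_ssum)

lemma lin_tw: "(\<And>l. lin (\<lambda>x. F x l)) \<Longrightarrow> lin (\<lambda>x. tw K T (F x) xs)"
  unfolding tw_def by (intro lin_ssumI lin_blocks)

lemma tw_Nil: "T [] = 0 \<Longrightarrow> multilinear F \<Longrightarrow> tw K T F [] = 0"
  by (simp add: tw_def mlin_0_Cons)

lemma tw_Cons:
  assumes "multilinear F" "T [] = 0"
  shows "tw K T F (x # xs) = ssum (\<lambda>us vs. F (T (x # us) # map tau vs)) xs +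
    ssum (\<lambda>bs rs. tw K T (\<lambda>l. F (K (x # bs) # l)) rs) xs"
proof -
  have "tw K T F (x # xs) = ssum (\<lambda>us vs. F (T (x # us) # map tau vs)) xs +
     ssum (\<lambda>us rs. ssum (\<lambda>vs ws. ssum (\<lambda>bs cs.
        blocks (\<lambda>l. F (K (x # bs) # l @ T vs # map tau ws)) K cs) us) rs) xs"
    by (simp add: tw_def blocks.simps assms mlin_0_Cons)
  also have "ssum (\<lambda>us rs. ssum (\<lambda>vs ws. ssum (\<lambda>bs cs.
        blocks (\<lambda>l. F (K (x # bs) # l @ T vs # map tau ws)) K cs) us) rs) xs =
     ssum (\<lambda>us rs. ssum (\<lambda>bs cs. ssum (\<lambda>vs ws.
        blocks (\<lambda>l. F (K (x # bs) # l @ T vs # map tau ws)) K cs) rs) us) xs"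
    by (rule ssum_cong[OF refl], rule ssum_swap)
  also have "\<dots> = ssum (\<lambda>bs rs. tw K T (\<lambda>l. F (K (x # bs) # l)) rs) xs"
    by (simp only: ssum_assoc) (simp add: tw_def)
  finally show ?thesis .
qed

lemma mlin_tw:
  assumes "multilinear F" "multilinear T" "multilinear K"
  shows "multilinear (tw K T F)"
  unfolding tw_def
proof (rule mlin_ssum)
  have 1: "multilinear (\<lambda>l. F (l @ ws))" for ws
    by (rule mlin_append_right[OF assms(1)])
  show "multilinear (\<lambda>us. ssum (\<lambda>vs ws. blocks (\<lambda>l. F (l @ T vs # map tau ws)) K us) rs)" for rs
    unfolding multilinear_iff_lin
    by (intro allI lin_ssumI) (rule mlin_lin[OF mlin_blocks[OF assms(3) 1]])
  show "multilinear (\<lambda>rs. ssum (\<lambda>vs ws. blocks (\<lambda>l. F (l @ T vs # map tau ws)) K us) rs)" for us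
  proof (rule mlin_ssum)
    show "multilinear (\<lambda>vs. blocks (\<lambda>l. F (l @ T vs # map tau ws)) K us)" for ws
      by (rule mlin_compose[OF lin_blocks assms(2)]) (rule mlin_lin[OF assms(1)])
    show "multilinear (\<lambda>ws. blocks (\<lambda>l. F (l @ T vs # map tau ws)) K us)" for vs
      unfolding multilinear_iff_lin
    proof (intro allI lin_blocks)
      fix as bs l
      show "lin (\<lambda>x. F (l @ T vs # map tau (as @ x # bs)))"
        using lin_compose[OF mlin_lin[OF assms(1), of "l @ T vs # map tau as"] lin_sign_by] by simp
    qed
  qed
qed

lemma fam_tw:
  assumes F: "fam m F" and T: "fam 0 T" and K: "fam 1 K"
  shows "fam (m - 1) (tw K T F)"
  unfolding fam_def
proof (intro conjI allI impI)
  show "multilinear (tw K T F)" by (intro mlin_tw fam_mlin[OF F] fam_mlin[OF T] fam_mlin[OF K])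
  fix ds xs assume h: "list_all2 homogeneous ds (xs :: 'a alg list)"
  show "homogeneous (sum_list ds + (m - 1) - int (length xs)) (tw K T F xs)"
    unfolding tw_def
  proof (intro homogeneous_ssum)
    fix us rs vs ws assume 1: "us @ rs = xs" "vs @ ws = rs"
    from h obtain du dv dw where d: "ds = du @ dv @ dw" "list_all2 homogeneous du us"
        "list_all2 homogeneous dv vs" "list_all2 homogeneous dw ws"
      unfolding 1[symmetric] list_all2_append2 by blast
    let ?t = "sum_list dv - int (length vs)"
    have w: "list_all2 homogeneous dw (map tau ws)"
      using d(4) by (auto simp: list_all2_conv_all_nth homogeneous_sign_by)
    have t: "homogeneous ?t (T vs)"
      using T d(3) unfolding fam_def by fastforce
    have "homogeneous (sum_list du + (?t + sum_list dw + m - 1 - int (length ws)) - int (length us))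
        (blocks (\<lambda>l. F (l @ T vs # map tau ws)) K us)"
    proof (rule homogeneous_blocks[OF K d(2)])
      fix es ys assume "list_all2 homogeneous es (ys :: 'a alg list)"
      then have "list_all2 homogeneous (es @ ?t # dw) (ys @ T vs # map tau ws)"
        using w t by (simp add: list_all2_appendI)
      then have "homogeneous (sum_list (es @ ?t # dw) + m - int (length (ys @ T vs # map tau ws)))
          (F (ys @ T vs # map tau ws))"
        using F unfolding fam_def by blast
      then show "homogeneous (sum_list es + (?t + sum_list dw + m - 1 - int (length ws)) - int (length ys))
          (F (ys @ T vs # map tau ws))"
        by (simp add: algebra_simps)
    qed
    then show "homogeneous (sum_list ds + (m - 1) - int (length xs))
        (blocks (\<lambda>l. F (l @ T vs # map tau ws)) K us)"
      unfolding d(1) 1[symmetric] by (simp add: algebra_simps)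
  qed
qed

lemma tw_tau:
  assumes "\<And>vs. T (map tau vs) = - tau (T vs)" "\<And>vs. K (map tau vs) = tau (K vs)" "multilinear F"
  shows "tw K T (\<lambda>l. F (map tau l)) xs = - tw K T F (map tau xs)"
proof -
  have "blocks (\<lambda>l. F (l @ T (map tau vs) # ws)) K (map tau us) =
      - blocks (\<lambda>l. F (map tau l @ tau (T vs) # ws)) K us" for us vs ws
    using blocks_tau[where G = K, OF assms(2), of "\<lambda>l. F (l @ T (map tau vs) # ws)" us]
      lin_uminus[OF mlin_lin[OF assms(3)]]
    by (simp add: assms(1) blocks_uminus_left)
  then show ?thesis by (simp add: tw_def ssum_map ssum_uminus)
qed

text \<open>Leibniz rule over the pair of coalgebra maps \<open>(K, id)\<close>: letters to the left
  of \<open>T\<close> are collected by \<open>K\<close>, letters to its right only receive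
  signs.\<close>

lemma tw_ssum:
  "tw K T (\<lambda>l. ssum J l) xs =
   ssum (\<lambda>as bs. tw K T (\<lambda>l. J l (map tau bs)) as + blocks (\<lambda>l. tw K T (J l) bs) K as) xs"
proof -
  have "tw K T (\<lambda>l. ssum J l) xs =
     ssum (\<lambda>us rs. ssum (\<lambda>vs ws. ssum (\<lambda>as bs.
        blocks (\<lambda>l. blocks (\<lambda>l'. J l (l' @ T vs # map tau ws)) K bs) K as) us) rs) xs +
     ssum (\<lambda>us rs. ssum (\<lambda>vs ws. ssum (\<lambda>as bs.
        blocks (\<lambda>l. J (l @ T vs # map tau as) (map tau bs)) K us) ws) rs) xs"
    by (simp add: tw_def ssum_insert ssum_add ssum_map blocks_add_left blocks_ssum blocks_ssum_left)
  also have "ssum (\<lambda>us rs. ssum (\<lambda>vs ws. ssum (\<lambda>as bs.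
        blocks (\<lambda>l. blocks (\<lambda>l'. J l (l' @ T vs # map tau ws)) K bs) K as) us) rs) xs =
     ssum (\<lambda>as r. ssum (\<lambda>bs rs. ssum (\<lambda>vs ws.
        blocks (\<lambda>l. blocks (\<lambda>l'. J l (l' @ T vs # map tau ws)) K bs) K as) rs) r) xs"
    by (subst ssum_swap) (rule ssum_assoc)
  also have "\<dots> = ssum (\<lambda>as bs. blocks (\<lambda>l. tw K T (J l) bs) K as) xs"
    by (simp add: tw_def blocks_ssum_left)
  also have "ssum (\<lambda>us rs. ssum (\<lambda>vs ws. ssum (\<lambda>as bs.
        blocks (\<lambda>l. J (l @ T vs # map tau as) (map tau bs)) K us) ws) rs) xs =
     ssum (\<lambda>as bs. ssum (\<lambda>us rs. ssum (\<lambda>vs ws.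
        blocks (\<lambda>l. J (l @ T vs # map tau ws) (map tau bs)) K us) rs) as) xs"
    by (simp only: ssum_assoc)
  also have "\<dots> = ssum (\<lambda>as bs. tw K T (\<lambda>l. J l (map tau bs)) as) xs"
    by (simp add: tw_def)
  finally show ?thesis by (simp add: ssum_add add.commute)
qed

locale homotopy =
  fixes M T K :: "'k::field cochain"
  assumes M: "fam 2 M" "M [] = 0" "\<And>xs. ins tau M M xs = 0"
    and T: "fam 0 T" "T [] = 0"
    and K: "fam 1 K" "K [] = 0"
    and K_eq: "\<And>xs. K xs = unit_map xs - tw K T M xs - ins tau T M xs"
begin

lemma mlins: "multilinear M" "multilinear T" "multilinear K"
  using M(1) T(1) K(1) by (auto dest: fam_mlin)

lemma taus: "M (map tau vs) = - tau (M vs)" "T (map tau vs) = - tau (T vs)" "K (map tau vs) = tau (K vs)"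
  using fam_tau_even[OF M(1)] fam_tau_even[OF T(1)] fam_tau_odd[OF K(1)] by auto

lemma MM: "ins tau M M = (\<lambda>l. 0)"
  using M(3) by auto

lemma ins_K: "ins tau K M xs = M xs - ins tau (tw K T M) M xs"
proof -
  have "ins tau (ins tau T M) M xs = 0"
    using ins_square[OF mlins(2) M(1,2), of xs] mlins(2) by (simp add: MM)
  moreover have "ins tau K M xs = ins tau (\<lambda>l. unit_map l - tw K T M l - ins tau T M l) M xs"
    by (rule arg_cong[of _ _ "\<lambda>K. ins tau K M xs"]) (rule ext, rule K_eq)
  ultimately show ?thesis by (simp add: ins_diff_left ins_unit_left M(2))
qed

text \<open>\<open>K_eq\<close> is this identity for \<open>F = unit_map\<close>. In the induction
  for general \<open>F\<close> the terms with separated insertions cancel, except that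
  \<open>blocks M K\<close> has to be compared with \<open>ins tau K M\<close> on shorter lists;
  these agree by the induction hypothesis for \<open>F = M\<close>, where both are
  \<open>M - M T M\<close>.\<close>

lemma blocks_K:
  "multilinear F \<Longrightarrow> blocks F K xs = F xs - tw K T (ins tau F M) xs - ins tau (tw K T F) M xs"
proof (induction xs arbitrary: F rule: length_induct)
  case (1 xs)
  note F = 1(2)
  note IH = 1(1)[rule_format]
  have FM: "multilinear (ins tau F M)" by (intro mlin_ins F mlins lin_sign_by)
  have tF: "multilinear (tw K T F)" by (intro mlin_tw F mlins)
  have lF: "lin (\<lambda>z. F (z # r))" for r by (rule mlin_lin_Cons[OF F])
  have ltF: "lin (\<lambda>z. tw K T (\<lambda>l. F (z # l)) r)" for r by (intro lin_tw lF)
  show ?case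
  proof (cases xs)
    case Nil
    have "multilinear (tw K T F)" by (intro mlin_tw F mlins)
    then show ?thesis
      using FM F T(2) M(2) by (simp add: Nil tw_Nil ins_Nil mlin_0_Cons)
  next
    case (Cons x ys)
    define S1 where "S1 = ssum (\<lambda>bs rs. F (tw K T M (x # bs) # rs)) ys"
    define S2 where "S2 = ssum (\<lambda>bs rs. F (ins tau T M (x # bs) # rs)) ys"
    define S3 where "S3 = ssum (\<lambda>bs rs. tw K T (ins tau (\<lambda>l. F (K (x # bs) # l)) M) rs) ys"
    define S4 where "S4 = ssum (\<lambda>bs rs. ins tau (tw K T (\<lambda>l. F (K (x # bs) # l))) M rs) ys"
    define S5 where "S5 = ssum (\<lambda>us vs. ins tau (\<lambda>l. F (T (x # us) # l)) M (map tau vs)) ys"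
    define S6 where "S6 = ssum (\<lambda>cs rs. tw K T (\<lambda>l. F (blocks M K (x # cs) # l)) (map tau rs)) ys"
    have S6: "S6 = ssum (\<lambda>cs rs. tw K T (\<lambda>l. F (ins tau K M (x # cs) # l)) (map tau rs)) ys"
      unfolding S6_def
    proof (intro ssum_cong refl)
      fix cs rs assume c: "cs @ rs = ys"
      show "tw K T (\<lambda>l. F (blocks M K (x # cs) # l)) (map tau rs) =
          tw K T (\<lambda>l. F (ins tau K M (x # cs) # l)) (map tau rs)"
      \<comment> \<open>For empty \<open>rs\<close> the list \<open>x # cs\<close> is all of
        \<open>xs\<close>, out of reach of the induction hypothesis; there \<open>T [] = 0\<close>
        makes both sides vanish.\<close>
      proof (cases rs)
        case Nil
        then show ?thesis using T(2) mlin_Cons[OF F] by (simp add: tw_Nil)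
      next
        case (Cons r rs')
        have "blocks M K (x # cs) = ins tau K M (x # cs)"
          using IH[of "x # cs" M] \<open>xs = x # ys\<close> c Cons mlins(1)
          by (auto simp: ins_K MM)
        then show ?thesis by simp
      qed
    qed
    have "blocks F K xs = ssum (\<lambda>bs rs. F (K (x # bs) # rs) -
        tw K T (ins tau (\<lambda>l. F (K (x # bs) # l)) M) rs -
        ins tau (tw K T (\<lambda>l. F (K (x # bs) # l))) M rs) ys"
      unfolding Cons blocks.simps
      by (intro ssum_cong refl IH mlin_Cons F) (use Cons in auto)
    also have "\<dots> = ssum (\<lambda>bs rs. F (K (x # bs) # rs)) ys - S3 - S4"
      by (simp add: ssum_diff S3_def S4_def)
    also have "ssum (\<lambda>bs rs. F (K (x # bs) # rs)) ys =
        ssum (\<lambda>bs rs. F (unit_map (x # bs) # rs)) ys - S1 - S2"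
      by (subst K_eq) (simp add: lin_diff[OF lF] ssum_diff S1_def S2_def)
    also have "ssum (\<lambda>bs rs. F (unit_map (x # bs) # rs)) ys = F xs"
      by (rule trans[OF ssum_head]) (auto simp: unit_map_Cons mlin_0_Cons[OF F] Cons)
    finally have L: "blocks F K xs = F xs - S1 - S2 - S3 - S4" .

    have FM_Cons: "ins tau F M (y # l) = ssum (\<lambda>us vs. F (M (y # us) # map tau vs)) l +
        ins tau (\<lambda>l. F (y # l)) M l" for y l
      by (rule ins_Cons'[where N = M, OF F M(2)])
    have a: "tw K T (\<lambda>l. ssum (\<lambda>us vs. F (M (K (x # bs) # us) # map tau vs)) l) rs =
        ssum (\<lambda>r1 r2. F (tw K T (\<lambda>l. M (K (x # bs) # l)) r1 # r2)) rs -
        ssum (\<lambda>r1 r2. tw K T (\<lambda>l. F (blocks (\<lambda>p. M (K (x # bs) # p)) K r1 # l)) (map tau r2)) rs"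
      for bs rs
    proof -
      have "tw K T (\<lambda>q. F (z # map tau q)) r2 = - tw K T (\<lambda>l. F (z # l)) (map tau r2)" for z r2
        by (rule tw_tau[of T K "\<lambda>l. F (z # l)"]) (intro taus mlin_Cons F)+
      then have "tw K T (\<lambda>l. ssum (\<lambda>us vs. F (M (K (x # bs) # us) # map tau vs)) l) rs =
        ssum (\<lambda>r1 r2. tw K T (\<lambda>l. F (M (K (x # bs) # l) # r2)) r1) rs -
        ssum (\<lambda>r1 r2. blocks (\<lambda>p. tw K T (\<lambda>l. F (M (K (x # bs) # p) # l)) (map tau r2)) K r1) rs"
        by (simp add: tw_ssum ssum_diff blocks_uminus_left)
      then show ?thesis
        by (simp add: tw_lin[OF lF] blocks_lin[OF ltF])
    qed
    have "tw K T (ins tau F M) xs =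
        ssum (\<lambda>us vs. ssum (\<lambda>p q. F (M (T (x # us) # map tau p) # q)) vs) ys + S5 +
        (ssum (\<lambda>bs rs. ssum (\<lambda>r1 r2. F (tw K T (\<lambda>l. M (K (x # bs) # l)) r1 # r2)) rs) ys -
         ssum (\<lambda>bs rs. ssum (\<lambda>r1 r2. tw K T (\<lambda>l. F (blocks (\<lambda>p. M (K (x # bs) # p)) K r1 # l)) (map tau r2)) rs) ys)
        + S3"
      by (simp add: Cons tw_Cons[where T = T, OF FM T(2)] FM_Cons tw_add a ssum_add ssum_diff ssum_map
          S3_def S5_def)
    also have "ssum (\<lambda>us vs. ssum (\<lambda>p q. F (M (T (x # us) # map tau p) # q)) vs) ys =
        ssum (\<lambda>cs q. F (ssum (\<lambda>us p. M (T (x # us) # map tau p)) cs # q)) ys"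
      by (simp add: lin_ssum[OF lF] ssum_assoc)
    also have "ssum (\<lambda>bs rs. ssum (\<lambda>r1 r2. F (tw K T (\<lambda>l. M (K (x # bs) # l)) r1 # r2)) rs) ys =
        ssum (\<lambda>cs q. F (ssum (\<lambda>bs r. tw K T (\<lambda>l. M (K (x # bs) # l)) r) cs # q)) ys"
      by (simp add: lin_ssum[OF lF] ssum_assoc)
    also have "ssum (\<lambda>bs rs. ssum (\<lambda>r1 r2. tw K T (\<lambda>l. F (blocks (\<lambda>p. M (K (x # bs) # p)) K r1 # l)) (map tau r2)) rs) ys = S6"
      by (simp add: S6_def blocks.simps(2)[of M] lin_ssum[OF ltF] ssum_assoc)
    finally have R1: "tw K T (ins tau F M) xs = S1 + S5 - S6 + S3"
      by (simp add: S1_def tw_Cons[where T = T, OF mlins(1) T(2)] lin_add[OF lF] ssum_add)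

    have tF_Cons: "tw K T F (y # l) = ssum (\<lambda>us vs. F (T (y # us) # map tau vs)) l +
        ssum (\<lambda>bs rs. tw K T (\<lambda>l. F (K (y # bs) # l)) rs) l" for y l
      by (rule tw_Cons[where T = T, OF F T(2)])
    have b: "ins tau (\<lambda>l. F (z # map tau l)) M r = - ins tau (\<lambda>l. F (z # l)) M (map tau r)" for z r
      using ins_tau[of M "-1" "\<lambda>l. F (z # l)"] mlin_Cons[OF F] taus(1)
      by (simp flip: vector_sneg_minus1)
    have "ins tau (tw K T F) M xs =
        ssum (\<lambda>us vs. ssum (\<lambda>p q. F (T (M (x # us) # map tau p) # q)) vs) ys +
        ssum (\<lambda>us vs. ssum (\<lambda>p q. tw K T (\<lambda>l. F (K (M (x # us) # map tau p) # l)) (map tau q)) vs) ys +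
        ins tau (\<lambda>l. ssum (\<lambda>us vs. F (T (x # us) # map tau vs)) l) M ys +
        ins tau (\<lambda>l. ssum (\<lambda>bs rs. tw K T (\<lambda>l. F (K (x # bs) # l)) rs) l) M ys"
      by (simp add: Cons ins_Cons'[where N = M, OF tF M(2)] tF_Cons ssum_add ssum_map ins_add_left)
    also have "ins tau (\<lambda>l. ssum (\<lambda>us vs. F (T (x # us) # map tau vs)) l) M ys =
        ssum (\<lambda>as bs. F (ins tau (\<lambda>l. T (x # l)) M as # bs)) ys - S5"
      by (simp add: ins_ssum ssum_add ssum_diff ssum_uminus b ins_lin[OF lF] S5_def)
    also have "ins tau (\<lambda>l. ssum (\<lambda>bs rs. tw K T (\<lambda>l. F (K (x # bs) # l)) rs) l) M ys =
        ssum (\<lambda>as bs. tw K T (\<lambda>l. F (ins tau (\<lambda>l. K (x # l)) M as # l)) (map tau bs)) ys + S4"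
      by (simp add: ins_ssum ssum_add ins_lin[OF ltF, of tau "\<lambda>l. K (x # l)"] S4_def)
    also have "ssum (\<lambda>us vs. ssum (\<lambda>p q. F (T (M (x # us) # map tau p) # q)) vs) ys =
        ssum (\<lambda>cs q. F (ssum (\<lambda>us p. T (M (x # us) # map tau p)) cs # q)) ys"
      by (simp add: lin_ssum[OF lF] ssum_assoc)
    also have "ssum (\<lambda>us vs. ssum (\<lambda>p q. tw K T (\<lambda>l. F (K (M (x # us) # map tau p) # l)) (map tau q)) vs) ys =
        ssum (\<lambda>cs q. tw K T (\<lambda>l. F (ssum (\<lambda>us p. K (M (x # us) # map tau p)) cs # l)) (map tau q)) ys"
      by (simp add: lin_ssum[OF ltF] ssum_assoc)
    finally have R2: "ins tau (tw K T F) M xs = S2 - S5 + S6 + S4"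
      by (simp add: S6 S2_def ins_Cons'[where N = M, OF mlins(2) M(2)]
          ins_Cons'[where N = M, OF mlins(3) M(2)] lin_add[OF lF] tw_add ssum_add)
    show ?thesis unfolding L R1 R2 by simp
  qed
qed

text \<open>As \<open>M\<close> squares to zero, multiplying \<open>1 - (M T + T M)\<close> by
  \<open>M\<close> on either side gives \<open>M - M T M\<close>.\<close>

lemma hom_K: "hom K M M"
  using blocks_K[OF mlins(1)] by (simp add: hom_def ins_K MM)

end

section \<open>Values of the automorphism on lists containing the unit\<close>

lemma blocks_mu2_snoc:
  assumes "K [] = 0"
  shows "blocks (\<lambda>l. mu2 (l @ z # ws)) K us =
    (if us = [] then mu2 [z, unit_map ws] else 0) + (if ws = [] then mu2 [K us, z] else 0)"
proof -
  have lm: "mu2 [0, y] = 0" "mu2 [y, 0] = 0" for y :: "'a alg"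
    using mlin_0_Cons[OF mlin_mu2] mlin_0[OF mlin_mu2, of "[y]" "[]"] by auto
  show ?thesis
  proof (cases us)
    case Nil
    then show ?thesis using assms lm by (cases ws rule: remdups_adj.cases) (auto simp: mu2_simps)
  next
    case (Cons y ys)
    have "blocks (\<lambda>l. mu2 (a # l @ z # ws)) K rs = (if rs = [] \<and> ws = [] then mu2 [a, z] else 0)" for a rs
      by (cases rs) (auto simp: blocks.simps mu2_eq_0)
    then have "blocks (\<lambda>l. mu2 (a # l @ z # ws)) K = (\<lambda>rs. if rs = [] \<and> ws = [] then mu2 [a, z] else 0)" for a
      by auto
    then have "blocks (\<lambda>l. mu2 (l @ z # ws)) K us =
        ssum (\<lambda>bs rs. if rs = [] \<and> ws = [] then mu2 [K (y # bs), z] else 0) ys"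
      by (simp add: Cons blocks.simps)
    also have "\<dots> = (if ws = [] then mu2 [K us, z] else 0)"
      by (rule trans[OF ssum_last]) (auto simp: Cons)
    finally show ?thesis by (simp add: Cons)
  qed
qed

lemma tw_mu2:
  assumes "K [] = 0"
  shows "tw K T mu2 xs =
    ssum (\<lambda>us vs. mu2 [T us, unit_map (map tau vs)]) xs + ssum (\<lambda>us vs. mu2 [K us, T vs]) xs"
proof -
  have "ssum (\<lambda>us rs. ssum (\<lambda>vs ws. if us = [] then mu2 [T vs, unit_map (map tau ws)] else 0) rs) xs =
      ssum (\<lambda>us vs. mu2 [T us, unit_map (map tau vs)]) xs"
    by (rule trans[OF ssum_head]) auto
  moreover have "ssum (\<lambda>us rs. ssum (\<lambda>vs ws. if ws = [] then mu2 [K us, T vs] else 0) rs) xs =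
      ssum (\<lambda>us vs. mu2 [K us, T vs]) xs"
    by (intro ssum_cong refl trans[OF ssum_last]) auto
  ultimately show ?thesis
    by (simp add: tw_def blocks_mu2_snoc[where K = K, OF assms] ssum_add)
qed

text \<open>\<open>K\<close> is assumed normalized on shorter lists only, because this is applied
  inside the induction that establishes the normalization of \<open>K\<close>.\<close>

lemma tw_normalized:
  assumes E: "multilinear E" "normalized E" and T: "normalized T" "T [] = 0"
    and K: "\<And>x. K [x] = x"
    "\<And>ys. length ys < length xs \<Longrightarrow> alg_one \<in> set ys \<Longrightarrow> K ys = unit_map ys"
    and xs: "alg_one \<in> set xs"
  shows "tw K T E xs = 0"
proof -
  have "blocks (\<lambda>l. E (l @ T vs # map tau ws)) K us = 0" if s: "us @ vs @ ws = xs" for us vs ws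
  proof -
    have "alg_one \<in> set us \<or> alg_one \<in> set vs \<or> alg_one \<in> set ws"
      using xs unfolding s[symmetric] by simp
    then consider "vs = []" | "alg_one \<in> set vs" | "alg_one \<in> set ws" | "alg_one \<in> set us" "vs \<noteq> []"
      using xs s by auto
    then show ?thesis
    proof cases
      case 1
      then show ?thesis by (simp add: T mlin_0[OF E(1)])
    next
      case 2
      then show ?thesis using T by (simp add: normalized_def mlin_0[OF E(1)])
    next
      case 3
      then obtain as bs where ws: "ws = as @ alg_one # bs" by (meson split_list)
      have "E (l @ T vs # map tau ws) = 0" for l
        using lin_uminus[OF mlin_lin[OF E(1), of "l @ T vs # map tau as"]] E(2)
        by (simp add: ws tau_alg_one normalized_def)
      then show ?thesis by simp
    next
      case 4
      define K' where "K' = (\<lambda>ys. if length ys < length xs then K ys else unit_map ys)"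
      have "normalized (blocks (\<lambda>l. E (l @ T vs # map tau ws)) K')"
      proof (rule blocks_normalized)
        show "multilinear (\<lambda>l. E (l @ T vs # map tau ws))" by (rule mlin_append_right[OF E(1)])
      qed (use E(2) K in \<open>auto simp: normalized_def K'_def\<close>)
      moreover have "blocks (\<lambda>l. E (l @ T vs # map tau ws)) K us =
          blocks (\<lambda>l. E (l @ T vs # map tau ws)) K' us"
        by (rule blocks_cong_le) (use 4 s in \<open>cases vs; auto simp: K'_def\<close>)
      ultimately show ?thesis using 4 by (simp add: normalized_def)
    qed
  qed
  then show ?thesis unfolding tw_def
    by (intro trans[OF ssum_cong[OF refl] ssum_zero] trans[OF ssum_cong[OF refl] ssum_zero]) auto
qed

lemma homotopy_automorphism:
  assumes M: "str M" and T: "fam 0 T" "normalized T" "T [] = 0"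
  obtains K where "gau K" "hom K M M" "\<And>xs. K xs = unit_map xs - tw K T M xs - ins tau T M xs"
proof -
  note M' = strD[OF M]
  have mT: "multilinear T" by (rule fam_mlin[OF T(1)])
  let ?\<Phi> = "\<lambda>K xs. unit_map xs - tw K T M xs - ins tau T M xs"
  \<comment> \<open>\<open>K\<close> is applied only to the letters left of the arguments of
    \<open>T\<close>, and \<open>T [] = 0\<close> leaves fewer letters than in
    \<open>xs\<close>.\<close>
  have loc: "?\<Phi> f xs = ?\<Phi> g xs" if "\<And>ys. length ys < length xs \<Longrightarrow> f ys = g ys" for f g xs
  proof -
    have "blocks (\<lambda>l. M (l @ T vs # map tau ws)) f us = blocks (\<lambda>l. M (l @ T vs # map tau ws)) g us"
      if "us @ vs @ ws = xs" for us vs ws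
    proof (cases "vs = []")
      case True
      then show ?thesis by (simp add: T mlin_0[OF M'(2)])
    next
      case False
      then show ?thesis
        by (intro blocks_cong_le \<open>\<And>ys. length ys < length xs \<Longrightarrow> f ys = g ys\<close>)
          (use that False in \<open>cases vs; auto\<close>)
    qed
    then have "tw f T M xs = tw g T M xs" unfolding tw_def by (intro ssum_cong refl) auto
    then show ?thesis by simp
  qed
  obtain K where K: "\<And>xs. K xs = ?\<Phi> K xs"
    using trunc_fixpoint[of ?\<Phi>] loc by blast
  have \<Phi>: "fam 1 (?\<Phi> g)" if "fam 1 g" for g
    using fam_diff[OF fam_diff[OF fam_unit_map fam_tw[OF M'(1) T(1) that, simplified]]
        fam_ins[OF T(1) M'(1), simplified]] by simp
  have fK: "fam 1 K"
    by (rule fam_fixpoint[of K ?\<Phi>]) (rule K, rule loc, assumption, rule \<Phi>)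
  have K0: "K [] = 0"
    using K[of "[]"] T(3) M' by (simp add: tw_Nil[of T M] ins_Nil mlin_0_Cons[OF mT])
  have K1: "K [x] = x" for x
    using K[of "[x]"] T(3) M' mlin_0[OF mT, of "[x]" "[]"] mlin_0[OF mlin_mu2, of "[K [x]]" "[]"]
    by (simp add: tw_def ins_Cons ins_Nil mlin_0_Cons[OF mT] mlin_0_Cons[OF M'(2)] K0 blocks.simps)
  interpret h: homotopy M T K
    by unfold_locales (use M' T fK K0 K in auto)
  have "K xs = unit_map xs" if "alg_one \<in> set xs" for xs
    using that
  proof (induction xs rule: length_induct)
    case (1 xs)
    obtain us ws where xs: "xs = us @ alg_one # ws" using 1(2) by (meson split_list)
    have lm: "mu2 [0, y] = 0" "mu2 [y, 0] = 0" for y :: "'a alg"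
      using mlin_0_Cons[OF mlin_mu2] mlin_0[OF mlin_mu2, of "[y]" "[]"] by auto
    show ?case
    proof (cases "us = [] \<and> ws = []")
      case True
      then show ?thesis by (simp add: xs K1)
    next
      case False
      \<comment> \<open>\<open>M - mu2\<close> contributes nothing on a list containing the unit.
        The products with the unit at the ends of the list that \<open>mu2\<close> contributes to
        \<open>tw K T M\<close> cancel those in \<open>ins tau T M\<close>.\<close>
      have "tw K T (\<lambda>l. M l - mu2 l) xs = 0"
      proof (rule tw_normalized[OF _ _ T(2,3)])
        show "normalized (\<lambda>l. M l - mu2 l)" using M' by (simp add: normalized_def)
      qed (use K1 1 M' in \<open>auto simp: mlin_minus mlin_mu2\<close>)
      moreover have "tw K T (\<lambda>l. (M l - mu2 l) + mu2 l) xs = tw K T (\<lambda>l. M l - mu2 l) xs + tw K T mu2 xs"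
        by (rule tw_add)
      ultimately have 2: "tw K T M xs = tw K T mu2 xs" by simp
      have Tz: "T (as @ alg_one # bs) = 0" for as bs using T(2) by (simp add: normalized_def)
      have uz: "unit_map (map tau (as @ alg_one # bs)) = (if as = [] \<and> bs = [] then - alg_one else 0)"
        for as bs :: "'a alg list"
        by (cases as) (auto simp: unit_map_Cons tau_alg_one)
      have 3: "ssum (\<lambda>as bs. mu2 [T as, unit_map (map tau bs)]) xs = (if ws = [] then - T us else 0)"
      proof -
        have "mu2 [x, - alg_one] = - x" for x :: "'a alg"
          using lin_uminus[OF mlin_lin[OF mlin_mu2, of "[x]" "[]"], of alg_one] by (simp add: mu2_unit)
        then have "ssum (\<lambda>as bs. mu2 [T as, unit_map (map tau (bs @ alg_one # ws))]) us =
            (if ws = [] then - T us else 0)"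
          unfolding uz by (intro trans[OF ssum_last]) (auto simp: lm)
        then show ?thesis by (simp add: xs ssum_insert Tz lm)
      qed
      have Kz: "K (us @ alg_one # as) = (if us = [] \<and> as = [] then alg_one else 0)"
        if "as @ bs = ws" "bs \<noteq> []" for as bs
        using 1(1)[rule_format, of "us @ alg_one # as"] that
        by (cases us) (auto simp: xs unit_map_Cons)
      have 4: "ssum (\<lambda>as bs. mu2 [K as, T bs]) xs = (if us = [] then T (map tau ws) else 0)"
      proof -
        have "ssum (\<lambda>as bs. mu2 [K (us @ alg_one # as), T bs]) ws =
            ssum (\<lambda>as bs. if us = [] \<and> as = [] then T (map tau bs) else 0) ws"
        proof (intro ssum_cong refl)
          fix as bs assume ab: "as @ bs = ws"
          show "mu2 [K (us @ alg_one # as), T bs] = (if us = [] \<and> as = [] then T (map tau bs) else 0)"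
          proof (cases "bs = []")
            case True
            then show ?thesis using lm T(3) by simp
          next
            case False
            then show ?thesis using Kz[OF ab] lm fam_tau_even[OF T(1)] by (auto simp: mu2_unit)
          qed
        qed
        also have "\<dots> = (if us = [] then T (map tau ws) else 0)"
          by (rule trans[OF ssum_head]) auto
        finally show ?thesis by (simp add: xs ssum_insert Tz lm)
      qed
      have "ins tau T M xs = unit_value T us ws"
        unfolding xs by (rule ins_unit_value) (use T M' mT in auto)
      moreover have "unit_map xs = 0" using False by (cases us) (auto simp: xs unit_map_Cons)
      ultimately show ?thesis
        using K[of xs] 2 3 4 False T(3) by (auto simp: tw_mu2[where K = K, OF K0] unit_value_def)
    qed
  qed
  then have "gau K" using fK K0 K1 by (simp add: gau_def)
  then show ?thesis using h.hom_K K that by blast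
qed


subsection \<open>Cochains as families\<close>

lemma CC_iff:
  "\<phi> \<in> CC n s \<longleftrightarrow> fam n \<phi> \<and> (\<forall>xs. int (length xs) \<noteq> n - s \<longrightarrow> \<phi> xs = 0) \<and> normalized \<phi>"
proof -
  have "(\<forall>ds xs. list_all2 homogeneous ds xs \<longrightarrow> homogeneous (sum_list ds + s) (\<phi> xs)) \<longleftrightarrow>
      (\<forall>ds xs. list_all2 homogeneous ds xs \<longrightarrow>
        homogeneous (sum_list ds + n - int (length xs)) (\<phi> xs))"
    if z: "\<forall>xs. int (length xs) \<noteq> n - s \<longrightarrow> \<phi> xs = 0"
  proof -
    have "homogeneous (sum_list ds + s) (\<phi> xs) = homogeneous (sum_list ds + n - int (length xs)) (\<phi> xs)"
      for ds xs
    proof (cases "int (length xs) = n - s")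
      case True
      then have "sum_list ds + s = sum_list ds + n - int (length xs)" by simp
      then show ?thesis by (simp only:)
    qed (use z in simp)
    then show ?thesis by simp
  qed
  then show ?thesis unfolding CC_def graded_maps_def fam_def normalized_def by blast
qed

lemma CC_D:
  assumes "\<phi> \<in> CC n s"
  shows "fam n \<phi>" "multilinear \<phi>" "int (length xs) \<noteq> n - s \<Longrightarrow> \<phi> xs = 0" "normalized \<phi>"
    "alg_one \<in> set xs \<Longrightarrow> \<phi> xs = 0"
  using assms fam_mlin[of n \<phi>] by (auto simp: CC_iff normalized_def)

definition piece :: "nat \<Rightarrow> 'k::field cochain \<Rightarrow> 'k cochain" where
  "piece d F = (\<lambda>xs. if length xs = d then F xs else 0)"

lemma mlin_piece: "multilinear F \<Longrightarrow> multilinear (piece d F)"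
proof -
  have "lin (\<lambda>x. if c then f x else 0)" if "lin f" for c and f :: "'a alg \<Rightarrow> 'a alg"
    using that by (cases c) simp_all
  then show "multilinear F \<Longrightarrow> multilinear (piece d F)"
    unfolding multilinear_iff_lin piece_def by simp
qed

lemma fam_piece: "fam n F \<Longrightarrow> fam n (piece d F)"
  by (auto simp: fam_def mlin_piece) (auto simp: piece_def)

lemma piece_CC:
  assumes "fam n F" "\<And>xs. length xs = d \<Longrightarrow> alg_one \<in> set xs \<Longrightarrow> F xs = 0" "s = n - int d"
  shows "piece d F \<in> CC n s"
  unfolding CC_iff using fam_piece[OF assms(1)] assms(2,3)
  by (auto simp: piece_def normalized_def)

lemma CC_add: "\<phi> \<in> CC n s \<Longrightarrow> \<psi> \<in> CC n s \<Longrightarrow> (\<lambda>xs. \<phi> xs + \<psi> xs) \<in> CC n s"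
  and CC_diff: "\<phi> \<in> CC n s \<Longrightarrow> \<psi> \<in> CC n s \<Longrightarrow> (\<lambda>xs. \<phi> xs - \<psi> xs) \<in> CC n s"
  and CC_zero: "(\<lambda>xs. 0) \<in> CC n s"
  by (auto simp: CC_iff normalized_def fam_add fam_diff fam_uminus)

lemma CC_scale: "\<phi> \<in> CC n s \<Longrightarrow> (\<lambda>xs. c *s \<phi> xs) \<in> CC n s"
  by (auto simp: CC_iff normalized_def fam_def mlin_cmult homogeneous_scale)


subsection \<open>The Hochschild differential\<close>

abbreviation sg :: "int \<Rightarrow> 'k::field alg \<Rightarrow> 'k alg" where
  "sg n \<equiv> sign_by (\<lambda>k. (n - 1) * (k - 1))"

lemma sg_even: "even n \<Longrightarrow> sg n = tau"
  and sg_odd: "odd n \<Longrightarrow> sg n = id"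
  by (auto simp: sign_by_def vec_eq_iff neg_one_powi fun_eq_iff)

lemma gerst_prod_ins: "gerst_prod n \<phi> \<psi> xs = ins (sg n) \<phi> \<psi> xs"
  unfolding gerst_prod_def ins_def by (rule sum_triples)

lemma hoch_diff_ins:
  "hoch_diff n \<phi> xs = ins (sg n) mu2 \<phi> xs - (- 1) powi (n - 1) *s ins tau \<phi> mu2 xs"
  by (simp add: hoch_diff_def gerst_bracket_def gerst_prod_ins)

lemma hoch_diff_even: "even n \<Longrightarrow> hoch_diff n \<phi> xs = ins tau mu2 \<phi> xs + ins tau \<phi> mu2 xs"
  and hoch_diff_odd: "odd n \<Longrightarrow> hoch_diff n \<phi> xs = ins id mu2 \<phi> xs - ins tau \<phi> mu2 xs"
  by (simp_all add: hoch_diff_ins sg_even sg_odd neg_one_powi vector_sneg_minus1[symmetric])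

lemma mu2_0 [simp]: "mu2 [0, y] = 0" "mu2 [y, 0] = 0"
  using mlin_0_Cons[OF mlin_mu2] mlin_0[OF mlin_mu2, of "[y]" "[]"] by auto

lemma mu2_slot:
  "mu2 (us @ z # ws) = (if us = [] then mu2 [z, unit_map ws] else 0) +
     (if ws = [] then mu2 [unit_map us, z] else 0)"
proof -
  consider "length us + length ws \<noteq> 1" | y where "us = [y]" "ws = []" | y where "us = []" "ws = [y]"
    by (cases us; cases ws) auto
  then show ?thesis
  proof cases
    case 1
    then have "us = [] \<Longrightarrow> unit_map ws = 0" "ws = [] \<Longrightarrow> unit_map us = 0"
      using unit_map_eq_0 by auto
    then show ?thesis using 1 by (simp add: mu2_eq_0)
  qed auto
qed

lemma ins_mu2:
  "ins S mu2 \<phi> xs = ssum (\<lambda>us vs. mu2 [\<phi> us, unit_map (map S vs)] + mu2 [unit_map us, \<phi> vs]) xs"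
proof -
  have "ssum (\<lambda>us rs. ssum (\<lambda>vs ws. if us = [] then mu2 [\<phi> vs, unit_map (map S ws)] else 0) rs) xs =
      ssum (\<lambda>us vs. mu2 [\<phi> us, unit_map (map S vs)]) xs"
    by (rule trans[OF ssum_head]) auto
  moreover have "ssum (\<lambda>us rs. ssum (\<lambda>vs ws. if ws = [] then mu2 [unit_map us, \<phi> vs] else 0) rs) xs =
      ssum (\<lambda>us vs. mu2 [unit_map us, \<phi> vs]) xs"
    by (intro ssum_cong refl trans[OF ssum_last]) auto
  ultimately show ?thesis by (simp add: ins_def mu2_slot ssum_add)
qed

lemma ins_add_right: "multilinear F \<Longrightarrow> ins S F (\<lambda>l. N l + N' l) xs = ins S F N xs + ins S F N' xs"
  by (simp add: ins_def lin_add[OF mlin_lin] ssum_add)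

lemma ins_diff_right: "multilinear F \<Longrightarrow> ins S F (\<lambda>l. N l - N' l) xs = ins S F N xs - ins S F N' xs"
  by (simp add: ins_def lin_diff[OF mlin_lin] ssum_diff)

lemma ins_scale_right: "multilinear F \<Longrightarrow> ins S F (\<lambda>l. c *s N l) xs = c *s ins S F N xs"
  by (simp add: ins_def lin_scale[OF mlin_lin] lin_ssum[of "(*s) c"] lin_cmult)

lemma ins_scale_left: "ins S (\<lambda>l. c *s F l) N xs = c *s ins S F N xs"
  by (rule ins_lin[of "(*s) c"]) (simp add: lin_cmult)

lemma hoch_diff_add: "hoch_diff n (\<lambda>l. \<phi> l + \<psi> l) xs = hoch_diff n \<phi> xs + hoch_diff n \<psi> xs"
  and hoch_diff_diff: "hoch_diff n (\<lambda>l. \<phi> l - \<psi> l) xs = hoch_diff n \<phi> xs - hoch_diff n \<psi> xs"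
  and hoch_diff_scale: "hoch_diff n (\<lambda>l. c *s \<phi> l) xs = c *s hoch_diff n \<phi> xs"
  and hoch_diff_zero: "hoch_diff n (\<lambda>l. 0) xs = 0"
  by (simp_all add: hoch_diff_ins ins_add_right ins_diff_right ins_add_left ins_diff_left mlin_mu2
      ins_scale_left ins_scale_right vector_add_ldistrib vec.scale_right_diff_distrib
      vector_smult_assoc mult.commute)

lemma hoch_diff_cong:
  assumes "multilinear \<phi>" "multilinear \<psi>" "\<And>ys. length ys + 1 = length xs \<Longrightarrow> \<phi> ys = \<psi> ys"
  shows "hoch_diff n \<phi> xs = hoch_diff n \<psi> xs"
proof -
  have "mu2 [\<phi> us, unit_map (map (sg n) vs)] + mu2 [unit_map us, \<phi> vs] =
      mu2 [\<psi> us, unit_map (map (sg n) vs)] + mu2 [unit_map us, \<psi> vs]" if "us @ vs = xs" for us vs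
  proof -
    have "mu2 [\<phi> us, unit_map (map (sg n) vs)] = mu2 [\<psi> us, unit_map (map (sg n) vs)]"
    proof (cases "length vs = 1")
      case True
      then show ?thesis using assms(3)[of us] that by auto
    qed (simp add: unit_map_eq_0)
    moreover have "mu2 [unit_map us, \<phi> vs] = mu2 [unit_map us, \<psi> vs]"
    proof (cases "length us = 1")
      case True
      then show ?thesis using assms(3)[of vs] that by auto
    qed (simp add: unit_map_eq_0)
    ultimately show ?thesis by simp
  qed
  then have 1: "ins (sg n) mu2 \<phi> xs = ins (sg n) mu2 \<psi> xs"
    unfolding ins_mu2 by (intro ssum_cong refl)
  have "\<phi> (us @ mu2 vs # map tau ws) = \<psi> (us @ mu2 vs # map tau ws)" if "us @ vs @ ws = xs" for us vs ws
  proof (cases "length vs = 2")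
    case True
    then show ?thesis using assms(3)[of "us @ mu2 vs # map tau ws"] that by auto
  qed (simp add: mu2_eq_0 mlin_0 assms)
  then have "ins tau \<phi> mu2 xs = ins tau \<psi> mu2 xs"
    unfolding ins_def by (intro ssum_cong refl) auto
  then show ?thesis using 1 by (simp add: hoch_diff_ins)
qed

lemma hoch_diff_piece:
  "multilinear \<phi> \<Longrightarrow> hoch_diff n (piece d \<phi>) xs = (if length xs = Suc d then hoch_diff n \<phi> xs else 0)"
  using hoch_diff_cong[OF mlin_piece, of \<phi> \<phi> xs d n] hoch_diff_cong[OF mlin_piece mlin_zero, of \<phi> xs d n]
  by (auto simp: piece_def hoch_diff_zero)

lemma alg_mult_nth: "(a \<star> b) $ g =
    (case g of E0 \<Rightarrow> a $ E0 * b $ E0 | F0 \<Rightarrow> a $ F0 * b $ F0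
     | V \<Rightarrow> a $ E0 * b $ V + a $ V * b $ F0 | U \<Rightarrow> a $ F0 * b $ U + a $ U * b $ E0
     | E1 \<Rightarrow> a $ E0 * b $ E1 + a $ E1 * b $ E0 + a $ V * b $ U
     | F1 \<Rightarrow> a $ F0 * b $ F1 + a $ F1 * b $ F0 + a $ U * b $ V)"
  by (cases g) (simp_all add: alg_mult_def UNIV_gen)

lemma sign_by_nth: "sign_by w a $ g = (- 1) powi (w (deg g)) * a $ g"
  by (simp add: sign_by_def)

lemma tau_mult: "tau (a \<star> b) = - (tau a \<star> tau b)" for a :: "'k::field alg"
proof -
  have "tau (a \<star> b) $ g = (- (tau a \<star> tau b)) $ g" for g
    by (cases g) (simp_all add: alg_mult_nth sign_by_nth neg_one_powi)
  then show ?thesis by (simp add: vec_eq_iff)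
qed

lemma alg_mult_uminus: "(- a) \<star> b = - (a \<star> b)" "a \<star> (- b) = - (a \<star> b)"
  by (rule lin_uminus[OF lin_alg_mult_left], rule lin_uminus[OF lin_alg_mult_right])

lemma mu2_pair: "mu2 [x, y] = - (x \<star> tau y)"
  by (simp add: mu2_simps alg_mult_uminus)

lemma homogeneous_mult:
  assumes "homogeneous d a" "homogeneous e b"
  shows "homogeneous (d + e) (a \<star> b)"
proof -
  have "deg g = d + e" if "(a \<star> b) $ g \<noteq> 0" for g
  proof -
    have "\<exists>g1 g2. a $ g1 \<noteq> 0 \<and> b $ g2 \<noteq> 0 \<and> gen_mult g1 g2 = Some g"
    proof (rule ccontr)
      assume "\<not> ?thesis"
      then have "(if gen_mult g1 g2 = Some g then a $ g1 * b $ g2 else 0) = 0" for g1 g2 by auto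
      then have "(a \<star> b) $ g = 0" unfolding alg_mult_def by (simp only: vec_lambda_beta sum.neutral_const)
      then show False using that by simp
    qed
    then obtain g1 g2 where "a $ g1 \<noteq> 0" "b $ g2 \<noteq> 0" "gen_mult g1 g2 = Some g" by blast
    moreover have "deg g = deg g1 + deg g2" using \<open>gen_mult g1 g2 = Some g\<close>
      by (cases g1; cases g2; auto)
    ultimately show ?thesis using assms by (auto simp: homogeneous_def)
  qed
  then show ?thesis by (simp add: homogeneous_def)
qed

lemma fam_mu2: "fam 2 mu2"
  unfolding fam_def
proof (intro conjI allI impI mlin_mu2)
  fix ds xs assume h: "list_all2 homogeneous ds (xs :: 'a alg list)"
  show "homogeneous (sum_list ds + 2 - int (length xs)) (mu2 xs)"
  proof (cases "length xs = 2")
    case True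
    then obtain x y where "xs = [x, y]" by (auto simp: length_Suc_conv numeral_2_eq_2)
    then show ?thesis using h
      by (auto simp: list_all2_Cons2 mu2_pair intro!: homogeneous_uminus homogeneous_mult homogeneous_sign_by)
  qed (simp add: mu2_eq_0)
qed

lemma mu2_mu2: "ins tau mu2 mu2 xs = 0"
proof (cases "length xs = 3")
  case True
  then obtain x y z where xs: "xs = [x, y, z]" by (auto simp: length_Suc_conv numeral_3_eq_3)
  show ?thesis
    by (simp add: xs ins_mu2 mu2_simps(1,2,3) mu2_pair lin_uminus[OF lin_sign_by] alg_mult_uminus
        tau_mult alg_mult_assoc lin_0[OF lin_alg_mult_left])
next
  case False
  have "mu2 [mu2 us, unit_map (map tau vs)] = 0" "mu2 [unit_map us, mu2 vs] = 0" if "us @ vs = xs" for us vs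
  proof -
    have "length us \<noteq> 2 \<or> length vs \<noteq> 1" "length vs \<noteq> 2 \<or> length us \<noteq> 1" using that False by auto
    then show "mu2 [mu2 us, unit_map (map tau vs)] = 0" "mu2 [unit_map us, mu2 vs] = 0"
      using mu2_eq_0[of us] mu2_eq_0[of vs] unit_map_eq_0[of us] unit_map_eq_0[of "map tau vs"] by auto
  qed
  then show ?thesis unfolding ins_mu2 by (intro trans[OF ssum_cong[OF refl] ssum_zero]) simp
qed

lemma str_mu2: "str mu2"
  by (simp add: str_def fam_mu2 mu2_simps(1,2) mu2_mu2)

lemma ins_mu2_unit:
  assumes "normalized \<phi>" "fam n \<phi>"
  shows "ins (sg n) mu2 \<phi> (us @ alg_one # ws) = (- 1) powi (n - 1) *s unit_value \<phi> us ws"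
proof -
  have z: "\<phi> (as @ alg_one # bs) = 0" for as bs using assms(1) by (simp add: normalized_def)
  have o: "sg n alg_one = (- 1) powi (n - 1) *s (alg_one :: 'a alg)"
    by (cases "even n") (simp_all add: sg_even sg_odd tau_alg_one neg_one_powi)
  have u: "unit_map (as @ alg_one # bs) = (if as = [] \<and> bs = [] then alg_one else 0)"
    for as bs :: "'a alg list"
    by (cases as) (auto simp: unit_map_Cons)
  have u': "unit_map (map (sg n) (as @ alg_one # bs)) =
      (if as = [] \<and> bs = [] then (- 1) powi (n - 1) *s alg_one else 0)"
    for as bs :: "'a alg list"
    by (cases as) (auto simp: unit_map_Cons o)
  have s: "mu2 [x, c *s alg_one] = c *s x" for x :: "'a alg" and c
    using lin_scale[OF mlin_lin[OF mlin_mu2, of "[x]" "[]"], of c alg_one] by (simp add: mu2_unit)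
  have "ssum (\<lambda>as bs. mu2 [\<phi> as, unit_map (map (sg n) (bs @ alg_one # ws))]) us =
      (if ws = [] then (- 1) powi (n - 1) *s \<phi> us else 0)"
    unfolding u' by (rule trans[OF ssum_last]) (auto simp: s)
  moreover have "ssum (\<lambda>as bs. mu2 [unit_map (us @ alg_one # as), \<phi> bs]) ws =
      (if us = [] then - tau (\<phi> ws) else 0)"
    unfolding u by (rule trans[OF ssum_head]) (auto simp: mu2_unit)
  ultimately have "ins (sg n) mu2 \<phi> (us @ alg_one # ws) =
      (if ws = [] then (- 1) powi (n - 1) *s \<phi> us else 0) + (if us = [] then - tau (\<phi> ws) else 0)"
    by (simp add: ins_mu2 ssum_insert ssum_add z)
  moreover have "- tau (\<phi> ws) = - ((- 1) powi (n - 1) *s \<phi> (map tau ws))"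
    by (simp add: fam_tau[OF assms(2)])
  ultimately show ?thesis
    using fam_tau[OF assms(2), of "[]"]
    by (auto simp: unit_value_def vector_smult_rneg)
qed

lemma fam_sub_scale: "fam n F \<Longrightarrow> fam n (\<lambda>l. c *s F l)"
  by (auto simp: fam_def mlin_cmult homogeneous_scale)

text \<open>Both halves of the differential leave the same end terms \<open>unit_value\<close>, with
  opposite signs.\<close>

lemma hoch_diff_normalized:
  assumes "normalized \<phi>" "fam n \<phi>"
  shows "normalized (hoch_diff n \<phi>)"
  unfolding normalized_def
proof (intro allI impI)
  fix xs :: "'a alg list" assume "alg_one \<in> set xs"
  then obtain us ws where xs: "xs = us @ alg_one # ws" by (meson split_list)
  have "ins tau \<phi> mu2 xs = unit_value \<phi> us ws"
    unfolding xs by (rule ins_unit_value[OF fam_mlin[OF assms(2)] assms(1)]) (auto simp: mu2_simps(1,2))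
  then show "hoch_diff n \<phi> xs = 0" by (simp add: hoch_diff_ins xs ins_mu2_unit[OF assms])
qed

lemma hoch_diff_CC:
  assumes "\<phi> \<in> CC n s"
  shows "hoch_diff n \<phi> \<in> CC (n + 1) s"
proof -
  note \<phi> = CC_D[OF assms]
  have eq: "hoch_diff n \<phi> = (\<lambda>xs. ins (sg n) mu2 \<phi> xs - (- 1) powi (n - 1) *s ins tau \<phi> mu2 xs)"
    by (rule ext) (rule hoch_diff_ins)
  have "fam (n + 1) (hoch_diff n \<phi>)"
    unfolding eq
    using fam_ins[OF fam_mu2 \<phi>(1)] fam_ins[OF \<phi>(1) fam_mu2, of "\<lambda>k. k - 1"]
    by (intro fam_diff fam_sub_scale) (simp_all add: algebra_simps)
  moreover have "hoch_diff n \<phi> xs = 0" if "int (length xs) \<noteq> n + 1 - s" for xs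
    using hoch_diff_cong[OF \<phi>(2) mlin_zero, of xs n] \<phi>(3) that by (auto simp: hoch_diff_zero)
  ultimately show ?thesis using hoch_diff_normalized[OF \<phi>(4,1)] by (simp add: CC_iff)
qed

section \<open>Coboundaries and cohomology classes\<close>

lemma coboundaries_add:
  assumes "\<phi> \<in> coboundaries n s" "\<psi> \<in> coboundaries n s"
  shows "(\<lambda>xs. \<phi> xs + \<psi> xs) \<in> coboundaries n s"
proof -
  obtain a b where "a \<in> CC (n - 1) s" "\<phi> = hoch_diff (n - 1) a" "b \<in> CC (n - 1) s" "\<psi> = hoch_diff (n - 1) b"
    using assms by (auto simp: coboundaries_def)
  then show ?thesis
    unfolding coboundaries_def by (intro image_eqI[where x = "\<lambda>xs. a xs + b xs"] CC_add) (auto simp: fun_eq_iff hoch_diff_add)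
qed

lemma coboundaries_scale:
  assumes "\<phi> \<in> coboundaries n s"
  shows "(\<lambda>xs. c *s \<phi> xs) \<in> coboundaries n s"
proof -
  obtain a where "a \<in> CC (n - 1) s" "\<phi> = hoch_diff (n - 1) a"
    using assms by (auto simp: coboundaries_def)
  then show ?thesis
    unfolding coboundaries_def
    by (intro image_eqI[where x = "\<lambda>xs. c *s a xs"] CC_scale) (auto simp: fun_eq_iff hoch_diff_scale)
qed

lemma coboundaries_uminus: "\<phi> \<in> coboundaries n s \<Longrightarrow> (\<lambda>xs. - \<phi> xs) \<in> coboundaries n s"
  using coboundaries_scale[of \<phi> n s "-1"] by simp

lemma coboundaries_diff:
  "\<phi> \<in> coboundaries n s \<Longrightarrow> \<psi> \<in> coboundaries n s \<Longrightarrow> (\<lambda>xs. \<phi> xs - \<psi> xs) \<in> coboundaries n s"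
  using coboundaries_add[of \<phi> n s, OF _ coboundaries_uminus] by simp

lemma coboundaries_zero: "(\<lambda>xs. 0) \<in> coboundaries n s"
  unfolding coboundaries_def by (intro image_eqI[where x = "\<lambda>xs. 0"] CC_zero) (auto simp: hoch_diff_zero)

lemma HH_class_eq_iff:
  "HH_class n s \<phi> = HH_class n s \<psi> \<longleftrightarrow> (\<lambda>xs. \<phi> xs - \<psi> xs) \<in> coboundaries n s"
proof
  assume "HH_class n s \<phi> = HH_class n s \<psi>"
  moreover have "\<phi> \<in> HH_class n s \<phi>" by (simp add: HH_class_def coboundaries_zero)
  ultimately show "(\<lambda>xs. \<phi> xs - \<psi> xs) \<in> coboundaries n s" by (simp add: HH_class_def)
next
  assume 1: "(\<lambda>xs. \<phi> xs - \<psi> xs) \<in> coboundaries n s"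
  show "HH_class n s \<phi> = HH_class n s \<psi>"
    unfolding HH_class_def
  proof (intro Collect_cong)
    fix \<theta>
    show "(\<lambda>xs. \<theta> xs - \<phi> xs) \<in> coboundaries n s \<longleftrightarrow> (\<lambda>xs. \<theta> xs - \<psi> xs) \<in> coboundaries n s"
      using coboundaries_add[of "\<lambda>xs. \<theta> xs - \<phi> xs", OF _ 1]
        coboundaries_diff[of "\<lambda>xs. \<theta> xs - \<psi> xs", OF _ 1] by auto
  qed
qed

lemma HH_scale_class:
  "HH_scale n s t (HH_class n s \<phi>) = HH_class n s (\<lambda>xs. t *s \<phi> xs)"
proof -
  have "HH_class n s (\<lambda>xs. t *s \<psi> xs) = HH_class n s (\<lambda>xs. t *s \<phi> xs)" if "\<psi> \<in> HH_class n s \<phi>" for \<psi>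
  proof -
    have "(\<lambda>xs. \<psi> xs - \<phi> xs) \<in> coboundaries n s" using that by (simp add: HH_class_def)
    then show ?thesis
      unfolding HH_class_eq_iff
      using coboundaries_scale[of "\<lambda>xs. \<psi> xs - \<phi> xs" n s t]
      by (simp add: vec.scale_right_diff_distrib)
  qed
  moreover have "\<phi> \<in> HH_class n s \<phi>" by (simp add: HH_class_def coboundaries_zero)
  ultimately show ?thesis unfolding HH_scale_def by blast
qed


subsection \<open>The Hochschild complex on basis elements\<close>

text \<open>
  The vectors \<open>e0, u, v, uv = f1, vu = e1\<close> span a complement of the unit which is closed under
  multiplication, so that a normalized cochain is an arbitrary function on words in these five
  letters. The left action on the coefficients is a parameter, because it is twisted
  by the exchange of the two objects each time the arity is lowered by two.
\<close>

datatype ib = Ie | Iu | Iv | Iuv | Ivu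

lemma UNIV_ib: "(UNIV :: ib set) = {Ie, Iu, Iv, Iuv, Ivu}"
  using ib.exhaust by blast

instance ib :: finite
  by standard (simp add: UNIV_ib)

fun im :: "ib \<Rightarrow> ib \<Rightarrow> ib option" where
  "im Ie Ie = Some Ie"
| "im Ie Iv = Some Iv"
| "im Ie Ivu = Some Ivu"
| "im Iu Ie = Some Iu"
| "im Ivu Ie = Some Ivu"
| "im Iu Iv = Some Iuv"
| "im Iv Iu = Some Ivu"
| "im _ _ = None"

type_synonym 'k action = "ib \<Rightarrow> 'k alg \<Rightarrow> 'k alg"
type_synonym 'k word_cochain = "ib list \<Rightarrow> 'k alg"

definition mfun :: "'k::field word_cochain \<Rightarrow> ib \<Rightarrow> ib \<Rightarrow> 'k word_cochain" where
  "mfun f x y zs = (case im x y of None \<Rightarrow> 0 | Some z \<Rightarrow> f (z # zs))"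

text \<open>All of the bar differential but the left action, with the opposite sign. It squares to
  zero by itself and commutes with left actions, so that the left coefficients may be exchanged
  freely.\<close>

fun DR :: "'k::field action \<Rightarrow> 'k word_cochain \<Rightarrow> 'k word_cochain" where
  "DR R f [] = 0"
| "DR R f [x] = R x (f [])"
| "DR R f (x # y # zs) = mfun f x y zs - DR R (\<lambda>l. f (x # l)) (y # zs)"

definition dd :: "'k::field action \<Rightarrow> 'k action \<Rightarrow> 'k word_cochain \<Rightarrow> 'k word_cochain" where
  "dd L R f zs = (case zs of [] \<Rightarrow> 0 | x # ys \<Rightarrow> L x (f ys) - DR R f zs)"

lemma dd_simps:
  "dd L R f [] = 0"
  "dd L R f [x] = L x (f []) - R x (f [])"
  "dd L R f (x # y # zs) = L x (f (y # zs)) - mfun f x y zs + DR R (\<lambda>l. f (x # l)) (y # zs)"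
  by (simp_all add: dd_def)

text \<open>The left action composed with the automorphism that exchanges \<open>e0\<close> with
  \<open>f0 = 1 - e0\<close> and \<open>u\<close> with \<open>v\<close>. It does not preserve
  degrees; \<open>dgk\<close> accounts for this later.\<close>

definition swp :: "'k::field action \<Rightarrow> 'k action" where
  "swp L x = (case x of Ie \<Rightarrow> (\<lambda>m. m - L Ie m) | Iu \<Rightarrow> L Iv | Iv \<Rightarrow> L Iu | Iuv \<Rightarrow> L Ivu | Ivu \<Rightarrow> L Iuv)"

text \<open>Dual of a comparison map from the bar resolution to the minimal one. Two composable
  letters of total length three or four form a path ending in the relation \<open>uvu\<close> or
  \<open>vuv\<close>. The relation selects the part \<open>f0 g\<close> or \<open>e0 g\<close>, and
  for length four the first arrow of the path acts on it.\<close>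

fun Sh :: "'k::field action \<Rightarrow> 'k word_cochain \<Rightarrow> 'k word_cochain" where
  "Sh L g (Iu # Ivu # ws) = g ws - L Ie (g ws)"
| "Sh L g (Iv # Iuv # ws) = L Ie (g ws)"
| "Sh L g (Iuv # Iu # ws) = g ws - L Ie (g ws)"
| "Sh L g (Ivu # Iv # ws) = L Ie (g ws)"
| "Sh L g (Iuv # Iuv # ws) = L Iu (g ws)"
| "Sh L g (Ivu # Ivu # ws) = L Iv (g ws)"
| "Sh L g _ = 0"

definition ar :: "nat \<Rightarrow> 'k::field word_cochain \<Rightarrow> bool" where
  "ar r f \<longleftrightarrow> (\<forall>zs. length zs \<noteq> r \<longrightarrow> f zs = 0)"

text \<open>A normal form in the first two slots only, since one shift removes two letters. The
  first two conditions make the cochain relative to the span of the idempotents; the third makes it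
  live on pairs whose paths have total length at least three.\<close>

definition nf :: "'k::field word_cochain \<Rightarrow> bool" where
  "nf f \<longleftrightarrow> (\<forall>zs. f (Ie # zs) = 0) \<and> (\<forall>x zs. f (x # Ie # zs) = 0) \<and>
     (\<forall>x y zs. x \<in> {Iu, Iv} \<longrightarrow> y \<in> {Iu, Iv} \<longrightarrow> f (x # y # zs) = 0)"

lemma mfun_lin: "lin h \<Longrightarrow> mfun (\<lambda>l. h (f l)) x y zs = h (mfun f x y zs)"
  by (simp add: mfun_def lin_0 split: option.split)

lemma mfun_add: "mfun (\<lambda>l. f l + g l) x y zs = mfun f x y zs + mfun g x y zs"
  and mfun_diff: "mfun (\<lambda>l. f l - g l) x y zs = mfun f x y zs - mfun g x y zs"
  by (simp_all add: mfun_def split: option.split)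

locale bimodule =
  fixes L R :: "'k::field action"
  assumes lin_L: "lin (L x)" and lin_R: "lin (R x)"
    and L_L: "L x (L y m) = (case im x y of None \<Rightarrow> 0 | Some z \<Rightarrow> L z m)"
    and R_R: "R y (R x m) = (case im x y of None \<Rightarrow> 0 | Some z \<Rightarrow> R z m)"
    and L_R: "L x (R y m) = R y (L x m)"
begin

abbreviation D where "D \<equiv> DR R"
abbreviation d where "d \<equiv> dd L R"

lemmas L_simps = lin_add[OF lin_L] lin_diff[OF lin_L] lin_uminus[OF lin_L] lin_0[OF lin_L]
lemmas R_simps = lin_add[OF lin_R] lin_diff[OF lin_R] lin_uminus[OF lin_R] lin_0[OF lin_R]

lemma bimodule_swp: "bimodule (swp L) R"
proof
  show "lin (swp L x)" for x
    by (cases x) (auto simp: swp_def lin_L intro: lin_minus)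
  show "swp L x (swp L y m) = (case im x y of None \<Rightarrow> 0 | Some z \<Rightarrow> swp L z m)" for x y m
    by (cases x; cases y) (simp_all add: swp_def L_simps L_L)
  show "swp L x (R y m) = R y (swp L x m)" for x y m
    by (cases x) (simp_all add: swp_def L_R R_simps)
qed (simp_all add: lin_R R_R)

lemma D_add: "D (\<lambda>l. f l + g l) zs = D f zs + D g zs"
  by (induction zs arbitrary: f g rule: induct_list012) (simp_all add: mfun_add R_simps)

lemma D_diff: "D (\<lambda>l. f l - g l) zs = D f zs - D g zs"
  by (induction zs arbitrary: f g rule: induct_list012) (simp_all add: mfun_diff R_simps)

lemma D_zero [simp]: "D (\<lambda>l. 0) zs = 0"
  using D_diff[of "\<lambda>l. 0" "\<lambda>l. 0" zs] by simp

lemma D_lin: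
  assumes h: "lin h" "\<And>x m. h (R x m) = R x (h m)"
  shows "D (\<lambda>l. h (f l)) zs = h (D f zs)"
proof (induction zs arbitrary: f rule: induct_list012)
  case (3 x y zs)
  show ?case using "3.IH"(2)[of "\<lambda>l. f (x # l)"] by (simp add: mfun_lin[OF h(1)] lin_diff[OF h(1)])
qed (simp_all add: h lin_0)

lemma D_L: "D (\<lambda>l. L x (f l)) zs = L x (D f zs)"
  by (rule D_lin[OF lin_L L_R])

lemma D_cong: "(\<And>ys. length ys + 1 = length zs \<Longrightarrow> f ys = g ys) \<Longrightarrow> D f zs = D g zs"
proof (induction zs arbitrary: f g rule: induct_list012)
  case (3 x y zs)
  have "D (\<lambda>l. f (x # l)) (y # zs) = D (\<lambda>l. g (x # l)) (y # zs)"
    by (rule "3.IH"(2)) (simp add: "3.prems")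
  moreover have "mfun f x y zs = mfun g x y zs"
    using "3.prems" by (simp add: mfun_def split: option.split)
  ultimately show ?case by simp
qed simp_all

lemma mfun_assoc:
  "(case im x y of None \<Rightarrow> 0 | Some w \<Rightarrow> mfun f w z zs) =
   (case im y z of None \<Rightarrow> 0 | Some w \<Rightarrow> mfun f x w zs)"
  by (cases x; cases y; cases z) (simp_all add: mfun_def)

lemma D_D: "D (D f) zs = 0"
proof (induction zs arbitrary: f rule: length_induct)
  case (1 zs)
  consider "zs = []" | x where "zs = [x]" | x y where "zs = [x, y]" | x y z ws where "zs = x # y # z # ws"
    by (cases zs rule: remdups_adj.cases) (auto, metis list.exhaust)
  then show ?case
  proof cases
    case 3
    then show ?thesis by (simp add: mfun_def R_R split: option.split)
  next
    case (4 x y z ws)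
    \<comment> \<open>\<open>k\<close> merges \<open>x\<close> with the first letter of its
      argument. Splitting it off leaves a term that the induction hypothesis kills, and what remains
      cancels by associativity, \<open>mfun_assoc\<close>.\<close>
    define k where "k = (\<lambda>l. case l of [] \<Rightarrow> 0 | a # l' \<Rightarrow> mfun f x a l')"
    have "D (\<lambda>l. D f (x # l)) (y # z # ws) = D (\<lambda>l. k l - D (\<lambda>l. f (x # l)) l) (y # z # ws)"
      by (rule D_cong) (auto simp: k_def neq_Nil_conv length_Suc_conv)
    also have "\<dots> = D k (y # z # ws)"
      using 1[rule_format, of "y # z # ws" "\<lambda>l. f (x # l)"] 4 by (simp only: D_diff) simp
    also have "\<dots> = (case im y z of None \<Rightarrow> 0 | Some w \<Rightarrow> mfun f x w ws) -
        (case im x y of None \<Rightarrow> 0 | Some w \<Rightarrow> D (\<lambda>l. f (w # l)) (z # ws))"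
    proof -
      have "(\<lambda>l. k (y # l)) = (\<lambda>l. case im x y of None \<Rightarrow> 0 | Some w \<Rightarrow> f (w # l))"
        by (simp add: k_def mfun_def)
      then have "D (\<lambda>l. k (y # l)) (z # ws) = (case im x y of None \<Rightarrow> 0 | Some w \<Rightarrow> D (\<lambda>l. f (w # l)) (z # ws))"
        by (simp split: option.split)
      moreover have "mfun k y z ws = (case im y z of None \<Rightarrow> 0 | Some w \<Rightarrow> mfun f x w ws)"
        by (simp add: k_def mfun_def split: option.split)
      ultimately show ?thesis by simp
    qed
    finally show ?thesis
      using mfun_assoc[where f = f and x = x and y = y and z = z and zs = ws]
      by (simp add: 4 mfun_def[of "D f"] split: option.splits)
  qed (simp_all add: R_simps)
qed

lemma d_add: "d (\<lambda>l. f l + g l) zs = d f zs + d g zs"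
  and d_diff: "d (\<lambda>l. f l - g l) zs = d f zs - d g zs"
  by (cases zs; simp add: dd_def D_add D_diff L_simps)+

lemma d_uminus: "d (\<lambda>l. - f l) zs = - d f zs"
  using d_diff[of "\<lambda>l. 0" f zs] d_diff[of "\<lambda>l. 0" "\<lambda>l. 0" zs] by simp

lemma d_zero: "d (\<lambda>l. 0) zs = 0"
  using d_diff[of "\<lambda>l. 0" "\<lambda>l. 0" zs] by simp

lemma d_cong: "(\<And>ys. length ys + 1 = length zs \<Longrightarrow> f ys = g ys) \<Longrightarrow> d f zs = d g zs"
  using D_cong[of zs f g] by (cases zs) (simp_all add: dd_def)

lemma d_d: "d (d f) zs = 0"
proof (cases zs rule: remdups_adj.cases)
  case (3 x y ws)
  define h where "h = (\<lambda>l. case l of [] \<Rightarrow> 0 | a # l' \<Rightarrow> L a (f l'))"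
  have "D (d f) (x # y # ws) = D (\<lambda>l. h l - D f l) (x # y # ws)"
    by (rule D_cong) (auto simp: dd_def h_def split: list.split)
  also have "\<dots> = D h (x # y # ws)" by (simp only: D_diff D_D) simp
  also have "\<dots> = mfun h x y ws - L x (D f (y # ws))"
    using D_L[of x f "y # ws"] by (simp add: h_def)
  also have "mfun h x y ws = L x (L y (f ws))" by (simp add: mfun_def h_def L_L split: option.split)
  finally have "D (d f) (x # y # ws) = L x (d f (y # ws))" by (simp add: dd_def[of L R f "y # ws"] L_simps del: DR.simps(3))
  then show ?thesis unfolding 3 by (simp add: dd_def[of L R "d f"])
qed (simp_all add: dd_def L_simps R_simps)

section \<open>Normal forms relative to the idempotents\<close>

lemma norm_head:
  assumes "\<And>zs. d f (Ie # Ie # zs) = 0"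
  obtains \<psi> where "\<And>zs. f (Ie # zs) + d \<psi> (Ie # zs) = 0"
proof
  define g where "g = (\<lambda>l. f (Ie # l))"
  have "D g (Ie # zs) = g zs - L Ie (g zs)" for zs
    using assms[of zs] by (simp add: dd_simps mfun_def g_def algebra_simps eq_neg_iff_add_eq_0)
  note Dg = this
  \<comment> \<open>This is \<open>f0 g - e0 g\<close>. On \<open>Ie # zs\<close> the map
    \<open>D\<close> turns it into \<open>f0 g\<close>, while the left action of \<open>e0\<close>
    turns it into \<open>- e0 g\<close>; with the sign of \<open>D\<close> in the differential the
    two add up to \<open>- g\<close>.\<close>
  let ?\<psi> = "\<lambda>l. g l - (L Ie (g l) + L Ie (g l))"
  have "L Ie (g zs - L Ie (g zs)) = 0" for zs by (simp add: L_simps L_L)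
  then have "D ?\<psi> (Ie # zs) = g zs - L Ie (g zs)" for zs
    by (simp only: D_diff D_add D_L Dg add_0_right diff_zero)
  moreover have "L Ie (?\<psi> zs) = - L Ie (g zs)" for zs
    by (simp only: L_simps L_L im.simps option.case) simp
  ultimately show "f (Ie # zs) + d ?\<psi> (Ie # zs) = 0" for zs
    by (simp only: dd_def list.case) (simp add: g_def)
qed

lemma norm_second:
  assumes "\<And>zs. f (Ie # zs) = 0" "\<And>y zs. d f (Ie # y # zs) = 0" "\<And>x zs. d f (x # Ie # Ie # zs) = 0"
  obtains \<psi> where "\<And>zs. f (Ie # zs) + d \<psi> (Ie # zs) = 0" "\<And>x zs. f (x # Ie # zs) + d \<psi> (x # Ie # zs) = 0"
proof
  define G where "G = (\<lambda>o' l. case o' of None \<Rightarrow> 0 | Some x \<Rightarrow> f (x # Ie # l))"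
  \<comment> \<open>The value is \<open>f (x # Ie # as)\<close> with sign plus if
    \<open>x e0 = x\<close> and minus if \<open>x e0 = 0\<close>: the choice of
    \<open>norm_head\<close>, now for the idempotent to the right of \<open>x\<close>.\<close>
  define \<psi> where "\<psi> = (\<lambda>l. case l of [] \<Rightarrow> 0
      | x # as \<Rightarrow> G (im x Ie) as + G (im x Ie) as - f (x # Ie # as))"
  have \<psi>e: "\<psi> (Ie # as) = 0" for as using assms(1) by (simp add: \<psi>_def G_def)
  have z: "(\<lambda>l. f (Ie # l)) = (\<lambda>l. 0)" using assms(1) by simp
  have left: "L Ie (f (y # zs)) = mfun f Ie y zs" for y zs
    using assms(2)[of y zs] by (simp add: dd_simps z)
  have "L Ie (\<psi> (y # zs)) = mfun \<psi> Ie y zs" for y zs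
    by (cases y) (simp_all add: \<psi>_def G_def mfun_def left L_simps split: option.split)
  then have "d \<psi> (Ie # zs) = 0" for zs
    using \<psi>e by (cases zs) (simp_all add: dd_simps \<psi>_def[THEN fun_cong, of "[]"] L_simps R_simps)
  then show "f (Ie # zs) + d \<psi> (Ie # zs) = 0" for zs using assms(1) by simp
  have Dg: "D (\<lambda>l. f (x # Ie # l)) (Ie # as) = f (x # Ie # as) - G (im x Ie) as" for x as
    using assms(3)[of x as] assms(1)
    by (cases x) (simp_all add: dd_simps mfun_def G_def L_simps algebra_simps eq_neg_iff_add_eq_0)
  have DG: "D (G (im x Ie)) (Ie # as) = 0" for x as
    using Dg[of x as] assms(1) by (cases x) (simp_all add: G_def)
  have "(\<lambda>l. \<psi> (x # l)) = (\<lambda>l. G (im x Ie) l + G (im x Ie) l - f (x # Ie # l))" for x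
    by (simp only: \<psi>_def list.case)
  then have "D (\<lambda>l. \<psi> (x # l)) (Ie # as) = G (im x Ie) as - f (x # Ie # as)" for x as
    by (simp only: D_add D_diff Dg DG) simp
  moreover have "mfun \<psi> x Ie as = G (im x Ie) as" for x as
    by (cases x) (simp_all add: mfun_def \<psi>_def G_def)
  ultimately show "f (x # Ie # zs) + d \<psi> (x # Ie # zs) = 0" for x zs
    by (simp add: dd_simps \<psi>e L_simps)
qed

text \<open>Closedness with \<open>e0\<close> in the first or second slot says that a cochain
  normalized there is balanced over the span of the idempotents. It therefore vanishes if the first
  two letters do not compose, which is \<open>balanced_zero\<close>.\<close>

lemma balanced:
  assumes "\<And>zs. f (Ie # zs) = 0" "\<And>x zs. f (x # Ie # zs) = 0"
    and "\<And>zs. d f (Ie # zs) = 0" "\<And>x zs. d f (x # Ie # zs) = 0"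
  shows "L Ie (f (y # zs)) = mfun f Ie y zs"
    and "mfun f x Ie (y # zs) = mfun (\<lambda>l. f (x # l)) Ie y zs"
proof -
  have z: "(\<lambda>l. f (Ie # l)) = (\<lambda>l. 0)" "(\<lambda>l. f (x # Ie # l)) = (\<lambda>l. 0)" using assms by auto
  show "L Ie (f (y # zs)) = mfun f Ie y zs"
    using assms(3)[of "y # zs"] by (simp add: dd_simps z)
  show "mfun f x Ie (y # zs) = mfun (\<lambda>l. f (x # l)) Ie y zs"
    using assms(4)[of x "y # zs"] assms(1) by (simp add: dd_simps z L_simps)
qed

lemma balanced_zero:
  assumes "\<And>zs. f (Ie # zs) = 0" "\<And>x zs. f (x # Ie # zs) = 0"
    and "\<And>zs. d f (Ie # zs) = 0" "\<And>x zs. d f (x # Ie # zs) = 0"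
  shows "f (Iu # Iu # zs) = 0" "f (Iv # Iv # zs) = 0" "f (Iu # Iuv # zs) = 0" "f (Iv # Ivu # zs) = 0"
    "f (Iuv # Iv # zs) = 0" "f (Ivu # Iu # zs) = 0" "f (Iuv # Ivu # zs) = 0" "f (Ivu # Iuv # zs) = 0"
  using balanced(2)[OF assms, of Iu Iu zs] balanced(2)[OF assms, of Iv Iv zs]
    balanced(2)[OF assms, of Iu Iuv zs] balanced(2)[OF assms, of Iv Ivu zs]
    balanced(2)[OF assms, of Iuv Iv zs] balanced(2)[OF assms, of Ivu Iu zs]
    balanced(2)[OF assms, of Iuv Ivu zs] balanced(2)[OF assms, of Ivu Iuv zs]
  by (simp_all add: mfun_def)

lemma norm_third:
  assumes f: "\<And>zs. f (Ie # zs) = 0" "\<And>x zs. f (x # Ie # zs) = 0" and df: "nf (d f)"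
  obtains \<psi> where "nf (\<lambda>l. f l + d \<psi> l)"
proof
  \<comment> \<open>On the pair \<open>u, v\<close> the differential of \<open>\<psi>\<close> is
    \<open>- \<psi>\<close> on the product \<open>uv\<close>, so prescribing \<open>\<psi>\<close>
    on \<open>uv\<close> and \<open>vu\<close> clears the composable pairs of arrows. The pairs
    \<open>u, u\<close> and \<open>v, v\<close> vanish by \<open>balanced_zero\<close>.\<close>
  define \<psi> where "\<psi> = (\<lambda>l. case l of [] \<Rightarrow> 0 | x # as \<Rightarrow>
    (case x of Iuv \<Rightarrow> f (Iu # Iv # as) | Ivu \<Rightarrow> f (Iv # Iu # as) | _ \<Rightarrow> 0))"
  have df': "\<And>zs. d f (Ie # zs) = 0" "\<And>x zs. d f (x # Ie # zs) = 0"
    "\<And>x y zs. x \<in> {Iu, Iv} \<Longrightarrow> y \<in> {Iu, Iv} \<Longrightarrow> d f (x # y # zs) = 0"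
    using df by (auto simp: nf_def)
  note bal = balanced[OF f df'(1,2)] and zero = balanced_zero[OF f df'(1,2)]
  have \<psi>: "\<psi> [] = 0" "\<psi> (Ie # as) = 0" "\<psi> (Iu # as) = 0" "\<psi> (Iv # as) = 0"
    "\<psi> (Iuv # as) = f (Iu # Iv # as)" "\<psi> (Ivu # as) = f (Iv # Iu # as)" for as
    by (simp_all add: \<psi>_def)
  have D0: "D (\<lambda>l. \<psi> (x # l)) zs = 0" if "x \<in> {Ie, Iu, Iv}" for x zs
  proof -
    have "(\<lambda>l. \<psi> (x # l)) = (\<lambda>l. 0)" using that by (auto simp: \<psi>)
    then show ?thesis by simp
  qed
  have 1: "d \<psi> (Ie # zs) = 0" for zs
  proof (cases zs)
    case (Cons y ws)
    show ?thesis
      using bal(1)[of Iu "Iv # ws"] bal(1)[of Iv "Iu # ws"]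
      by (cases y) (simp_all add: Cons dd_simps mfun_def D0 \<psi> L_simps)
  qed (simp add: dd_simps \<psi> L_simps R_simps)
  have Duv: "D (\<lambda>l. f (Iu # Iv # l)) (Ie # zs) = 0" for zs
    using df'(3)[of Iu Iv "Ie # zs"] f by (simp add: dd_simps mfun_def L_simps)
  have Dvu: "D (\<lambda>l. f (Iv # Iu # l)) (Ie # zs) = f (Iv # Iu # zs)" for zs
    using df'(3)[of Iv Iu "Ie # zs"] f
    by (simp add: dd_simps mfun_def L_simps)
  have 2: "d \<psi> (x # Ie # zs) = 0" for x zs
    by (cases x) (simp_all add: dd_simps mfun_def D0 \<psi> L_simps Duv Dvu)
  have 3: "f (x # y # zs) + d \<psi> (x # y # zs) = 0" if "x \<in> {Iu, Iv}" "y \<in> {Iu, Iv}" for x y zs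
    using that zero by (auto simp: dd_simps mfun_def D0 \<psi> L_simps)
  show "nf (\<lambda>l. f l + d \<psi> l)"
    unfolding nf_def using f 1 2 3 by simp
qed

text \<open>Only the differential of \<open>f\<close> has to be normal, not zero: in
  \<open>shift_injective\<close> the cochain is a primitive of a shifted one.\<close>

lemma norm_exists:
  assumes "nf (d f)"
  obtains \<psi> where "nf (\<lambda>l. f l + d \<psi> l)"
proof -
  have df: "d f (Ie # zs) = 0" "d f (x # Ie # zs) = 0" for x zs using assms by (auto simp: nf_def)
  obtain \<psi>1 where 1: "\<And>zs. f (Ie # zs) + d \<psi>1 (Ie # zs) = 0" using norm_head df by metis
  let ?f1 = "\<lambda>l. f l + d \<psi>1 l"
  have d1: "d ?f1 zs = d f zs" for zs by (simp add: d_add d_d)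
  obtain \<psi>2 where 2: "\<And>zs. ?f1 (Ie # zs) + d \<psi>2 (Ie # zs) = 0"
      "\<And>x zs. ?f1 (x # Ie # zs) + d \<psi>2 (x # Ie # zs) = 0"
    using norm_second[of ?f1] 1 d1 df by metis
  let ?f2 = "\<lambda>l. ?f1 l + d \<psi>2 l"
  have "d ?f2 zs = d f zs" for zs by (simp add: d_add d_d)
  then have "nf (d ?f2)" using assms by (simp add: nf_def)
  then obtain \<psi>3 where 3: "nf (\<lambda>l. ?f2 l + d \<psi>3 l)" using norm_third[of ?f2] 2 by metis
  have "nf (\<lambda>l. f l + d (\<lambda>l. \<psi>1 l + \<psi>2 l + \<psi>3 l) l)"
    using 3 by (simp add: d_add add.assoc)
  then show ?thesis by (rule that)
qed

section \<open>Lowering the arity by two\<close>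

lemma d_restrict: "d (\<lambda>l. if length l = r then f l else 0) zs = (if length zs = Suc r then d f zs else 0)"
proof (cases "length zs = Suc r")
  case True
  then show ?thesis using d_cong[of zs "\<lambda>l. if length l = r then f l else 0" f] by simp
next
  case False
  then show ?thesis
    using d_cong[of zs "\<lambda>l. if length l = r then f l else 0" "\<lambda>l. 0"] by (simp add: d_zero)
qed

lemma norm_exists_ar:
  assumes "nf (d f)" "ar (Suc r) f"
  obtains \<psi> where "ar r \<psi>" "nf (\<lambda>l. f l + d \<psi> l)"
proof -
  obtain \<psi> where \<psi>: "nf (\<lambda>l. f l + d \<psi> l)" using norm_exists[OF assms(1)] by blast
  let ?\<psi> = "\<lambda>l. if length l = r then \<psi> l else 0"
  have "f l + d ?\<psi> l = (if length l = Suc r then f l + d \<psi> l else 0)" for l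
    using assms(2) by (simp add: d_restrict ar_def)
  then have "nf (\<lambda>l. f l + d ?\<psi> l)" using \<psi> by (simp add: nf_def)
  then show ?thesis using that[of ?\<psi>] by (simp add: ar_def)
qed

text \<open>Normality of \<open>d f\<close> on pairs of arrows expresses all values of
  \<open>f\<close> through those on \<open>u, vu\<close> and \<open>v, uv\<close>. These lie in the
  \<open>f0\<close> part and the \<open>e0\<close> part, so their sum \<open>g\<close> remembers
  both. Moving a letter from the right to the left of a relation exchanges \<open>u\<close> and
  \<open>v\<close>, as in \<open>(vuv) u = v (uvu)\<close>, which is why \<open>g\<close> belongs to
  the left action \<open>swp L\<close>.\<close>

lemma shift_decompose:
  assumes f: "nf f" "nf (d f)" "ar (Suc (Suc r)) f"
  defines "g \<equiv> \<lambda>ws. f (Iu # Ivu # ws) + f (Iv # Iuv # ws)"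
  shows "f = Sh L g" "ar r g"
    "dd (swp L) R g (w # ws) = d f (Iu # Ivu # w # ws) + d f (Iv # Iuv # w # ws)"
proof -
  have f': "\<And>zs. f (Ie # zs) = 0" "\<And>x zs. f (x # Ie # zs) = 0"
    "\<And>x y zs. x \<in> {Iu, Iv} \<Longrightarrow> y \<in> {Iu, Iv} \<Longrightarrow> f (x # y # zs) = 0"
    using f(1) by (auto simp: nf_def)
  have df': "\<And>zs. d f (Ie # zs) = 0" "\<And>x zs. d f (x # Ie # zs) = 0"
    "\<And>x y zs. x \<in> {Iu, Iv} \<Longrightarrow> y \<in> {Iu, Iv} \<Longrightarrow> d f (x # y # zs) = 0"
    using f(2) by (auto simp: nf_def)
  note bal = balanced[OF f'(1,2) df'(1,2)] and zero = balanced_zero[OF f'(1,2) df'(1,2)]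
  have D0: "D (\<lambda>l. f (x # y # l)) zs = 0" if "x \<in> {Iu, Iv}" "y \<in> {Iu, Iv}" for x y zs
  proof -
    have "(\<lambda>l. f (x # y # l)) = (\<lambda>l. 0)" using f'(3)[OF that] by auto
    then show ?thesis by simp
  qed
  have e1: "L Ie (f (Iu # zs)) = 0" "L Ie (f (Iv # zs)) = f (Iv # zs)" for zs
    using bal(1)[of Iu zs] bal(1)[of Iv zs] by (simp_all add: mfun_def)
  have e2: "L x (f (Iv # zs)) = 0" if "im x Ie = None" for x zs
    using L_L[of x Ie "f (Iv # zs)"] that by (simp add: e1)
  have e3: "L x (f (Iu # zs)) = 0" if "im x Ie = Some x" for x zs
    using L_L[of x Ie "f (Iu # zs)"] that by (simp add: e1 L_simps)
  have r1: "f (Iuv # Iu # zs) = f (Iu # Ivu # zs)" for zs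
    using df'(3)[of Iu Iv "Iu # zs"] f'(3) by (simp add: dd_simps mfun_def L_simps D0)
  have r2: "f (Ivu # Iv # zs) = f (Iv # Iuv # zs)" for zs
    using df'(3)[of Iv Iu "Iv # zs"] f'(3) by (simp add: dd_simps mfun_def L_simps D0)
  have r3: "f (Iuv # Iuv # zs) = L Iu (f (Iv # Iuv # zs))" for zs
    using df'(3)[of Iu Iv "Iuv # zs"] by (simp add: dd_simps mfun_def D0)
  have r4: "f (Ivu # Ivu # zs) = L Iv (f (Iu # Ivu # zs))" for zs
    using df'(3)[of Iv Iu "Ivu # zs"] by (simp add: dd_simps mfun_def D0)
  have small: "f [] = 0" "f [x] = 0" for x using f(3) by (auto simp: ar_def)
  have g: "L Ie (g zs) = f (Iv # Iuv # zs)" "g zs - L Ie (g zs) = f (Iu # Ivu # zs)"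
    "L Iu (g zs) = L Iu (f (Iv # Iuv # zs))" "L Iv (g zs) = L Iv (f (Iu # Ivu # zs))"
    "L Iuv (g zs) = L Iuv (f (Iu # Ivu # zs))" "L Ivu (g zs) = L Ivu (f (Iv # Iuv # zs))" for zs
    unfolding g_def by (simp_all add: L_simps e1 e2 e3)
  have "f zs = Sh L g zs" for zs
  proof (cases zs rule: remdups_adj.cases)
    case (3 x y ws)
    show ?thesis unfolding 3
      by (cases x; cases y) (simp_all add: f' zero g_def L_simps e1 e2 e3 r1 r2 r3 r4)
  qed (simp_all add: small)
  then show "f = Sh L g" by auto
  show "ar r g" using f(3) by (auto simp: ar_def g_def)
  have lw: "d f (x # p # w # ws) =
      L x (f (p # w # ws)) + mfun (\<lambda>l. f (x # l)) p w ws - D (\<lambda>l. f (x # p # l)) (w # ws)"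
    if "im x p = None" for x p
    using that by (simp add: dd_simps mfun_def)
  have "d f (Iu # Ivu # w # ws) + d f (Iv # Iuv # w # ws) =
      (L Iu (f (Ivu # w # ws)) + mfun (\<lambda>l. f (Iu # l)) Ivu w ws +
       L Iv (f (Iuv # w # ws)) + mfun (\<lambda>l. f (Iv # l)) Iuv w ws) - D g (w # ws)"
    by (simp add: lw g_def D_add)
  also have "L Iu (f (Ivu # w # ws)) + mfun (\<lambda>l. f (Iu # l)) Ivu w ws +
       L Iv (f (Iuv # w # ws)) + mfun (\<lambda>l. f (Iv # l)) Iuv w ws = swp L w (g ws)"
    by (cases w) (simp_all add: mfun_def swp_def zero f' r1 r2 r3 r4 g_def e1 e2 e3 L_simps L_L)
  finally show "dd (swp L) R g (w # ws) = d f (Iu # Ivu # w # ws) + d f (Iv # Iuv # w # ws)"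
    by (simp add: dd_def)
qed

lemma Sh_zero: "\<lbrakk>g ws = 0\<rbrakk> \<Longrightarrow> Sh L g (x # y # ws) = 0"
  by (cases x; cases y) (simp_all add: L_simps)

lemma nf_Sh: "nf (Sh L g)"
  unfolding nf_def
proof (intro conjI allI impI)
  show "Sh L g (Ie # zs) = 0" for zs by (cases zs) auto
  show "Sh L g (x # Ie # zs) = 0" for x zs by (cases x) auto
  show "Sh L g (x # y # zs) = 0" if "x \<in> {Iu, Iv}" "y \<in> {Iu, Iv}" for x y zs using that by auto
qed

lemma ar_Sh: "ar r g \<Longrightarrow> ar (Suc (Suc r)) (Sh L g)"
  unfolding ar_def
proof (intro allI impI)
  fix zs :: "ib list"
  assume "\<forall>zs. length zs \<noteq> r \<longrightarrow> g zs = 0" "length zs \<noteq> Suc (Suc r)"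
  then show "Sh L g zs = 0" by (cases zs rule: remdups_adj.cases) (auto intro: Sh_zero)
qed

lemma Sh_add: "Sh L (\<lambda>l. f l + g l) zs = Sh L f zs + Sh L g zs"
proof (cases zs rule: remdups_adj.cases)
  case (3 x y ws)
  show ?thesis unfolding 3 by (cases x; cases y) (simp_all add: L_simps)
qed simp_all

lemma d_Sh: "d (Sh L g) zs = Sh L (dd (swp L) R g) zs"
proof -
  consider "length zs \<le> 2" | x y z ws where "zs = x # y # z # ws"
    by (cases zs rule: remdups_adj.cases) (auto, metis list.exhaust list.size(3,4) One_nat_def Suc_1 le_refl)
  then show ?thesis
  proof cases
    case 1
    then consider "zs = []" | x where "zs = [x]" | x y where "zs = [x, y]"
      by (cases zs rule: remdups_adj.cases) auto
    then show ?thesis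
    proof cases
      case (3 x y)
      then show ?thesis
        by (simp add: dd_simps mfun_def L_simps R_simps Sh_zero split: option.split)
    qed (simp_all add: dd_simps L_simps R_simps)
  next
    case (2 x y z ws)
    have 1: "D (\<lambda>l. Sh L g (x # y # l)) (z # ws) = Sh L (D g) (x # y # z # ws)"
    proof -
      have 2: "D (\<lambda>l. g l - L Ie (g l)) (z # ws) = D g (z # ws) - L Ie (D g (z # ws))"
        by (simp only: D_diff D_L)
      show ?thesis
        by (cases x; cases y) (simp_all only: Sh.simps 2 D_L D_zero)
    qed
    have "d (Sh L g) zs = L x (Sh L g (y # z # ws)) - mfun (Sh L g) x y (z # ws) +
        mfun (\<lambda>l. Sh L g (x # l)) y z ws - Sh L (D g) (x # y # z # ws)"
      by (simp add: 2 dd_simps flip: 1)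
    also have "\<dots> = Sh L (dd (swp L) R g) zs"
      unfolding 2
      by (cases x; cases y; cases z)
        (simp_all add: mfun_def dd_def swp_def L_simps L_L)
    finally show ?thesis .
  qed
qed

lemma shift_reduce:
  assumes "\<And>zs. d f zs = 0" "ar (Suc (Suc r)) f"
  obtains g \<psi> where "ar r g" "\<And>zs. dd (swp L) R g zs = 0" "ar (Suc r) \<psi>"
    "\<And>zs. f zs = Sh L g zs + d \<psi> zs"
proof -
  have "nf (d f)" using assms(1) by (simp add: nf_def)
  then obtain \<psi> where \<psi>: "ar (Suc r) \<psi>" "nf (\<lambda>l. f l + d \<psi> l)"
    using norm_exists_ar assms(2) by blast
  let ?f = "\<lambda>l. f l + d \<psi> l"
  let ?g = "\<lambda>ws. ?f (Iu # Ivu # ws) + ?f (Iv # Iuv # ws)"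
  have df: "d ?f zs = 0" for zs by (simp add: d_add d_d assms(1))
  have "d \<psi> zs = 0" if "length zs \<noteq> Suc (Suc r)" for zs
    using d_cong[of zs \<psi> "\<lambda>l. 0"] \<psi>(1) that by (auto simp: ar_def d_zero)
  then have ar: "ar (Suc (Suc r)) ?f" using assms(2) by (simp add: ar_def)
  have nfd: "nf (d ?f)" by (simp add: nf_def df)
  note s = shift_decompose[OF \<psi>(2) nfd ar]
  show ?thesis
  proof (rule that)
    show "ar r ?g" by (rule s(2))
    show "dd (swp L) R ?g zs = 0" for zs
    proof (cases zs)
      case (Cons w ws)
      show ?thesis unfolding Cons s(3) by (simp only: df) simp
    qed (simp add: dd_simps)
    show "ar (Suc r) (\<lambda>l. - \<psi> l)" using \<psi>(1) by (simp add: ar_def)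
    show "f zs = Sh L ?g zs + d (\<lambda>l. - \<psi> l) zs" for zs
      using fun_cong[OF s(1), of zs] by (simp add: d_uminus algebra_simps)
  qed
qed

text \<open>The normal form is applied to the primitive, whose differential \<open>Sh L g\<close> is
  already normal; the values of this differential on \<open>u, vu\<close> and \<open>v, uv\<close>
  add up to \<open>f0 g + e0 g = g\<close>. The primitive must have arity at least two, so the last
  shift of a constant needs the separate argument \<open>no_low_arity1\<close>.\<close>

lemma shift_injective:
  assumes "\<And>zs. Sh L g zs = d \<psi> zs" "ar (Suc (Suc r)) \<psi>" "ar (Suc r) g"
  obtains \<phi> where "ar r \<phi>" "\<And>zs. g zs = dd (swp L) R \<phi> zs"
proof -
  have eq: "d \<psi> = Sh L g" using assms(1) by auto
  have "nf (d \<psi>)" unfolding eq by (rule nf_Sh)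
  then obtain \<theta> where \<theta>: "ar (Suc r) \<theta>" "nf (\<lambda>l. \<psi> l + d \<theta> l)"
    using norm_exists_ar assms(2) by blast
  let ?f = "\<lambda>l. \<psi> l + d \<theta> l"
  let ?h = "\<lambda>ws. ?f (Iu # Ivu # ws) + ?f (Iv # Iuv # ws)"
  have df: "d ?f zs = Sh L g zs" for zs by (simp add: d_add d_d eq)
  have "d \<theta> zs = 0" if "length zs \<noteq> Suc (Suc r)" for zs
    using d_cong[of zs \<theta> "\<lambda>l. 0"] \<theta>(1) that by (auto simp: ar_def d_zero)
  then have ar: "ar (Suc (Suc r)) ?f" using assms(2) by (simp add: ar_def)
  have nfd: "nf (d ?f)" using nf_Sh[of g] by (simp add: nf_def df)
  note s = shift_decompose[OF \<theta>(2) nfd ar]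
  show ?thesis
  proof (rule that)
    show "ar r ?h" by (rule s(2))
    show "g zs = dd (swp L) R ?h zs" for zs
    proof (cases zs)
      case Nil
      then show ?thesis using assms(3) by (simp add: ar_def dd_simps)
    next
      case (Cons w ws)
      show ?thesis unfolding Cons s(3) by (simp only: df) simp
    qed
  qed
qed

end


section \<open>The algebra as a bimodule, with exchanged left action and signed right action\<close>

fun gn :: "ib \<Rightarrow> gen" where
  "gn Ie = E0"
| "gn Iu = U"
| "gn Iv = V"
| "gn Iuv = F1"
| "gn Ivu = E1"

definition bas :: "ib \<Rightarrow> 'k::field alg" where
  "bas x = axis (gn x) 1"

definition L0 :: "'k::field action" where
  "L0 x m = bas x \<star> m"

text \<open>The factor is the Koszul sign of a map of internal degree \<open>s\<close> and the
  letter \<open>x\<close>.\<close>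

definition R0 :: "int \<Rightarrow> 'k::field action" where
  "R0 s x m = (- 1) powi (s * deg (gn x)) *s (m \<star> bas x)"

definition Lk :: "nat \<Rightarrow> 'k::field action" where
  "Lk k = (swp ^^ k) L0"

lemma vec_eq_gen: "a = b \<longleftrightarrow> (\<forall>g::gen. a $ g = b $ g)"
  by (simp add: vec_eq_iff)

lemma all_gen: "(\<forall>g. P g) \<longleftrightarrow> P E0 \<and> P F0 \<and> P V \<and> P U \<and> P E1 \<and> P F1"
  by (metis gen.exhaust)

lemma bas_mult: "bas x \<star> bas y = (case im x y of None \<Rightarrow> 0 | Some z \<Rightarrow> bas z)"
  by (cases x; cases y) (simp_all add: vec_eq_gen all_gen bas_def alg_mult_nth axis_def)

lemma deg_im: "im x y = Some z \<Longrightarrow> deg (gn z) = deg (gn x) + deg (gn y)"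
  by (cases x; cases y) auto

lemma bimodule_0: "bimodule L0 (R0 s)"
proof
  show "lin (L0 x)" for x unfolding L0_def by (rule lin_alg_mult_right)
  show "lin (R0 s x)" for x unfolding R0_def by (intro lin_cmult lin_alg_mult_left)
  show "L0 x (L0 y m) = (case im x y of None \<Rightarrow> 0 | Some z \<Rightarrow> L0 z m)" for x y m
    by (simp add: L0_def alg_mult_assoc[symmetric] bas_mult lin_0[OF lin_alg_mult_left] split: option.split)
  show "R0 s y (R0 s x m) = (case im x y of None \<Rightarrow> 0 | Some z \<Rightarrow> R0 s z m)" for x y m
  proof -
    have "R0 s y (R0 s x m) =
        ((- 1) powi (s * deg (gn y)) * (- 1) powi (s * deg (gn x))) *s (m \<star> (bas x \<star> bas y))"
      by (simp add: R0_def lin_scale[OF lin_alg_mult_left] alg_mult_assoc vector_smult_assoc)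
    then show ?thesis
      using deg_im[of x y]
      by (auto simp: bas_mult R0_def lin_0[OF lin_alg_mult_right] power_int_add[symmetric] algebra_simps
          split: option.split)
  qed
  show "L0 x (R0 s y m) = R0 s y (L0 x m)" for x y m
    by (simp add: L0_def R0_def lin_scale[OF lin_alg_mult_right] alg_mult_assoc)
qed

lemma bimodule_k: "bimodule (Lk k) (R0 s)"
  by (induction k) (simp_all add: Lk_def bimodule_0 bimodule.bimodule_swp)

lemma swp_swp: "swp (swp L) = L"
proof (rule ext)
  show "swp (swp L) x = L x" for x by (cases x) (simp_all add: swp_def)
qed

lemma Lk_parity: "Lk k = (if even k then L0 else swp L0)"
proof (induction k)
  case (Suc k)
  then show ?case by (simp add: Lk_def swp_swp)
qed (simp add: Lk_def)

lemma Lk_Suc: "Lk (Suc k) = swp (Lk k)"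
  by (simp add: Lk_def)

lemma R0_simps:
  "R0 s Ie m = m \<star> bas Ie" "R0 s Iv m = m \<star> bas Iv" "R0 s Iu m = (- 1) powi s *s (m \<star> bas Iu)"
  "R0 s Iuv m = (- 1) powi s *s (m \<star> bas Iuv)" "R0 s Ivu m = (- 1) powi s *s (m \<star> bas Ivu)"
  by (simp_all add: R0_def)

lemmas coord_simps = vec_eq_gen all_gen Lk_parity swp_def L0_def R0_simps bas_def alg_mult_nth axis_def


subsection \<open>Degrees\<close>

definition prj :: "(gen \<Rightarrow> int) \<Rightarrow> int \<Rightarrow> 'k::field alg \<Rightarrow> 'k alg" where
  "prj dg n m = (\<chi> g. if dg g = n then m $ g else 0)"

definition wt :: "ib list \<Rightarrow> int" where
  "wt zs = (\<Sum>z\<leftarrow>zs. deg (gn z))"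

definition pr :: "(gen \<Rightarrow> int) \<Rightarrow> 'k::field word_cochain \<Rightarrow> 'k word_cochain" where
  "pr dg f zs = prj dg (wt zs) (f zs)"

text \<open>The internal degree of a value, corrected by \<open>s\<close> and by the degree of the
  path of length \<open>3 k\<close> that has been stripped from the front of the word. Two relations
  together have degree 3; for odd \<open>k\<close> one more remains, \<open>vuv\<close> of degree 1
  for values in \<open>e0 A\<close> and \<open>uvu\<close> of degree 2 for values in
  \<open>f0 A\<close>.\<close>

definition dgk :: "int \<Rightarrow> nat \<Rightarrow> gen \<Rightarrow> int" where
  "dgk s k g = deg g - s - 3 * int (k div 2) -
     (if even k then 0 else if g \<in> {E0, V, E1} then 1 else 2)"

lemma wt_simps: "wt [] = 0" "wt (z # zs) = deg (gn z) + wt zs"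
  by (simp_all add: wt_def)

lemma prj_nth: "prj dg n m $ g = (if dg g = n then m $ g else 0)"
  by (simp add: prj_def)

lemma lin_prj: "lin (prj dg n)"
  by (simp add: lin_def vec_eq_iff prj_nth)

lemma Lk_prj: "Lk k x (prj (dgk s k) n m) = prj (dgk s k) (deg (gn x) + n) (Lk k x m)"
  by (cases x; cases "even k") (auto simp: coord_simps prj_nth dgk_def)

lemma R0_prj: "R0 s x (prj (dgk s k) n m) = prj (dgk s k) (deg (gn x) + n) (R0 s x m)"
  by (cases x; cases "even k") (auto simp: coord_simps prj_nth dgk_def)

lemma DR_prj:
  "DR (R0 s) (\<lambda>l. prj (dgk s k) (c + wt l) (f l)) zs = prj (dgk s k) (c + wt zs) (DR (R0 s) f zs)"
proof (induction zs arbitrary: f c rule: induct_list012)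
  case (3 x y zs)
  have "DR (R0 s) (\<lambda>l. prj (dgk s k) ((c + deg (gn x)) + wt l) (f (x # l))) (y # zs) =
      prj (dgk s k) ((c + deg (gn x)) + wt (y # zs)) (DR (R0 s) (\<lambda>l. f (x # l)) (y # zs))"
    by (rule "3.IH"(2))
  then show ?case
    using deg_im[of x y]
    by (auto simp: mfun_def wt_simps lin_diff[OF lin_prj] lin_0[OF lin_prj] algebra_simps
        split: option.split)
qed (simp_all add: lin_0[OF lin_prj] wt_simps R0_prj algebra_simps)

lemma dd_pr: "dd (Lk k) (R0 s) (pr (dgk s k) f) zs = pr (dgk s k) (dd (Lk k) (R0 s) f) zs"
proof (cases zs)
  case (Cons x ys)
  have "pr (dgk s k) f = (\<lambda>l. prj (dgk s k) (0 + wt l) (f l))" by (simp add: pr_def fun_eq_iff)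
  then have "DR (R0 s) (pr (dgk s k) f) zs = prj (dgk s k) (wt zs) (DR (R0 s) f zs)"
    by (simp only: DR_prj) simp
  then show ?thesis
    by (simp add: Cons dd_def pr_def wt_simps Lk_prj lin_diff[OF lin_prj])
qed (simp add: dd_def pr_def lin_0[OF lin_prj])

lemma Sh_pr: "Sh (Lk k) (pr (dgk s (Suc k)) g) zs = pr (dgk s k) (Sh (Lk k) g) zs"
proof (cases zs rule: remdups_adj.cases)
  case (3 x y ws)
  have e: "prj (dgk s k) (1 + n) (Lk k Ie m) = Lk k Ie (prj (dgk s (Suc k)) n m)"
    "prj (dgk s k) (2 + n) (m - Lk k Ie m) = prj (dgk s (Suc k)) n m - Lk k Ie (prj (dgk s (Suc k)) n m)"
    "prj (dgk s k) (2 + n) (Lk k Iu m) = Lk k Iu (prj (dgk s (Suc k)) n m)"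
    "prj (dgk s k) (2 + n) (Lk k Iv m) = Lk k Iv (prj (dgk s (Suc k)) n m)" for n m
    by (cases "even k"; auto simp: coord_simps prj_nth dgk_def elim!: oddE evenE)+
  show ?thesis unfolding 3
    by (cases x; cases y) (simp_all add: pr_def wt_simps lin_0[OF lin_prj] e)
qed (simp_all add: pr_def lin_0[OF lin_prj])

section \<open>Iterated shifts\<close>

fun Sit :: "nat \<Rightarrow> 'k::field word_cochain \<Rightarrow> 'k word_cochain" where
  "Sit 0 g = g"
| "Sit (Suc m) g = Sit m (Sh (Lk m) g)"

lemma Sit_ar: "ar r g \<Longrightarrow> ar (r + 2 * m) (Sit m g)"
proof (induction m arbitrary: r g)
  case (Suc m)
  then show ?case using Suc.IH[OF bimodule.ar_Sh[OF bimodule_k Suc.prems]] by simp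
qed simp

lemma Sit_add: "Sit m (\<lambda>l. f l + g l) zs = Sit m f zs + Sit m g zs"
proof (induction m arbitrary: f g)
  case (Suc m)
  have "Sh (Lk m) (\<lambda>l. f l + g l) = (\<lambda>l. Sh (Lk m) f l + Sh (Lk m) g l)"
    by (rule ext) (rule bimodule.Sh_add[OF bimodule_k])
  then show ?case by (simp add: Suc)
qed simp

lemma Sh_scale: "Sh (Lk k) (\<lambda>l. c *s f l) zs = c *s Sh (Lk k) f zs"
proof (cases zs rule: remdups_adj.cases)
  case (3 x y ws)
  show ?thesis unfolding 3
    by (cases x; cases y)
      (simp_all add: lin_scale[OF bimodule.lin_L[OF bimodule_k]] vec.scale_right_diff_distrib)
qed simp_all

lemma Sit_scale: "Sit m (\<lambda>l. c *s f l) zs = c *s Sit m f zs"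
proof (induction m arbitrary: f)
  case (Suc m)
  have "Sh (Lk m) (\<lambda>l. c *s f l) = (\<lambda>l. c *s Sh (Lk m) f l)"
    by (rule ext) (rule Sh_scale)
  then show ?case by (simp add: Suc)
qed simp

lemma d_Sit: "dd (Lk 0) (R0 s) (Sit m g) zs = Sit m (dd (Lk m) (R0 s) g) zs"
proof (induction m arbitrary: g)
  case (Suc m)
  have "dd (Lk m) (R0 s) (Sh (Lk m) g) = Sh (Lk m) (dd (Lk (Suc m)) (R0 s) g)"
    by (rule ext) (simp add: bimodule.d_Sh[OF bimodule_k] Lk_Suc)
  then show ?case by (simp add: Suc)
qed simp

lemma Sit_pr: "Sit m (pr (dgk s m) g) zs = pr (dgk s 0) (Sit m g) zs"
proof (induction m arbitrary: g)
  case (Suc m)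
  have "Sh (Lk m) (pr (dgk s (Suc m)) g) = pr (dgk s m) (Sh (Lk m) g)"
    by (rule ext) (rule Sh_pr)
  then show ?case by (simp add: Suc)
qed simp

lemma Sit_zero: "(\<And>zs. g zs = 0) \<Longrightarrow> Sit m g zs = 0"
  using Sit_scale[of m 0 g zs] by (simp add: ext[of g "\<lambda>_. 0"])

lemma periodic_reduce:
  assumes "\<And>zs. dd (Lk 0) (R0 s) f zs = 0" "ar (r + 2 * m) f"
  obtains g \<psi> where "ar r g" "\<And>zs. dd (Lk m) (R0 s) g zs = 0"
    "\<And>zs. f zs = Sit m g zs + dd (Lk 0) (R0 s) \<psi> zs"
proof -
  have "\<exists>g \<psi>. ar r g \<and> (\<forall>zs. dd (Lk m) (R0 s) g zs = 0) \<and>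
      (\<forall>zs. f zs = Sit m g zs + dd (Lk 0) (R0 s) \<psi> zs)"
    using assms(2)
  proof (induction m arbitrary: r)
    case 0
    show ?case
      by (rule exI[of _ f], rule exI[of _ "\<lambda>_. 0"])
        (use 0 assms(1) bimodule.d_zero[OF bimodule_k] in auto)
  next
    case (Suc m)
    interpret b: bimodule "Lk m" "R0 s" by (rule bimodule_k)
    interpret b0: bimodule "Lk 0" "R0 s" by (rule bimodule_k)
    have "ar (Suc (Suc r) + 2 * m) f" using Suc.prems by simp
    then obtain g \<psi> where g: "ar (Suc (Suc r)) g" "\<And>zs. dd (Lk m) (R0 s) g zs = 0"
        "\<And>zs. f zs = Sit m g zs + dd (Lk 0) (R0 s) \<psi> zs"
      using Suc.IH by blast
    obtain h \<chi>' where h: "ar r h" "\<And>zs. dd (swp (Lk m)) (R0 s) h zs = 0"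
        "\<And>zs. g zs = Sh (Lk m) h zs + dd (Lk m) (R0 s) \<chi>' zs"
      using b.shift_reduce[OF g(2,1)] by metis
    have "g = (\<lambda>zs. Sh (Lk m) h zs + dd (Lk m) (R0 s) \<chi>' zs)" using h(3) by auto
    then have "Sit m g zs = Sit (Suc m) h zs + dd (Lk 0) (R0 s) (Sit m \<chi>') zs" for zs
      by (simp add: Sit_add d_Sit)
    then have "f zs = Sit (Suc m) h zs + dd (Lk 0) (R0 s) (\<lambda>l. Sit m \<chi>' l + \<psi> l) zs" for zs
      by (simp add: g(3) b0.d_add del: Sit.simps)
    then show ?case using h(1,2) by (metis Lk_Suc)
  qed
  then show ?thesis using that by blast
qed

lemma periodic_injective:
  assumes "\<And>zs. Sit m g zs = dd (Lk 0) (R0 s) \<psi> zs" "ar (r + 2 * m) \<psi>" "ar (Suc r) g"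
  obtains \<phi> where "ar r \<phi>" "\<And>zs. g zs = dd (Lk m) (R0 s) \<phi> zs"
proof -
  have "\<exists>\<phi>. ar r \<phi> \<and> (\<forall>zs. g zs = dd (Lk m) (R0 s) \<phi> zs)"
    using assms
  proof (induction m arbitrary: r g)
    case (Suc m)
    interpret b: bimodule "Lk m" "R0 s" by (rule bimodule_k)
    have "ar (Suc (Suc (Suc r))) (Sh (Lk m) g)" by (rule b.ar_Sh[OF Suc.prems(3)])
    then obtain \<phi> where "ar (Suc (Suc r)) \<phi>" "\<And>zs. Sh (Lk m) g zs = dd (Lk m) (R0 s) \<phi> zs"
      using Suc.IH[of "Sh (Lk m) g" "Suc (Suc r)"] Suc.prems by auto
    then show ?case using b.shift_injective[of g \<phi> r] Suc.prems(3) by (metis Lk_Suc)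
  qed auto
  then show ?thesis using that by blast
qed

definition wc :: "int \<Rightarrow> nat \<Rightarrow> 'k::field word_cochain \<Rightarrow> bool" where
  "wc s r f \<longleftrightarrow> ar r f \<and> pr (dgk s 0) f = f"

text \<open>The normal forms were built without regard to degrees. The projections \<open>pr\<close>
  commute with the differential and with the shifts, so projecting \<open>g\<close> and
  \<open>\<psi>\<close> at the end is enough.\<close>

lemma wc_reduce:
  assumes "wc s (r + 2 * m) f" "\<And>zs. dd (Lk 0) (R0 s) f zs = 0"
  obtains g \<psi> where "ar r g" "pr (dgk s m) g = g" "\<And>zs. dd (Lk m) (R0 s) g zs = 0"
    "\<And>zs. f zs = Sit m g zs + dd (Lk 0) (R0 s) \<psi> zs"
proof -
  obtain g \<psi> where g: "ar r g" "\<And>zs. dd (Lk m) (R0 s) g zs = 0"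
    "\<And>zs. f zs = Sit m g zs + dd (Lk 0) (R0 s) \<psi> zs"
    using periodic_reduce[OF assms(2)] assms(1) by (metis wc_def)
  have pp: "pr dg (pr dg h) = pr dg h" for dg and h :: "'a word_cochain"
    by (simp add: pr_def prj_def fun_eq_iff vec_eq_iff)
  show ?thesis
  proof (rule that[of "pr (dgk s m) g" "pr (dgk s 0) \<psi>"])
    show "ar r (pr (dgk s m) g)" using g(1) by (simp add: ar_def pr_def lin_0[OF lin_prj])
    show "dd (Lk m) (R0 s) (pr (dgk s m) g) zs = 0" for zs
      by (simp add: dd_pr pr_def[of _ "dd _ _ _"] g(2) lin_0[OF lin_prj])
    show "f zs = Sit m (pr (dgk s m) g) zs + dd (Lk 0) (R0 s) (pr (dgk s 0) \<psi>) zs" for zs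
    proof -
      have "f zs = prj (dgk s 0) (wt zs) (f zs)" using assms(1) by (simp add: wc_def pr_def fun_eq_iff)
      also have "\<dots> = prj (dgk s 0) (wt zs) (Sit m g zs) + prj (dgk s 0) (wt zs) (dd (Lk 0) (R0 s) \<psi> zs)"
        by (simp only: g(3) lin_add[OF lin_prj])
      finally show ?thesis by (simp only: Sit_pr dd_pr pr_def)
    qed
  qed (rule pp)
qed

lemma wc_exact:
  assumes "wc s (Suc r) f" "\<And>zs. f zs = dd (Lk 0) (R0 s) \<psi> zs"
  obtains \<phi> where "wc s r \<phi>" "\<And>zs. f zs = dd (Lk 0) (R0 s) \<phi> zs"
proof -
  interpret b0: bimodule "Lk 0" "R0 s" by (rule bimodule_k)
  let ?\<psi> = "\<lambda>l. if length l = r then \<psi> l else 0"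
  show ?thesis
  proof (rule that[of "pr (dgk s 0) ?\<psi>"])
    show "wc s r (pr (dgk s 0) ?\<psi>)"
      by (auto simp: wc_def ar_def pr_def prj_def fun_eq_iff vec_eq_iff)
    have "f zs = dd (Lk 0) (R0 s) ?\<psi> zs" for zs
      using assms by (simp add: b0.d_restrict wc_def ar_def)
    then have "f = dd (Lk 0) (R0 s) ?\<psi>" by auto
    then show "f zs = dd (Lk 0) (R0 s) (pr (dgk s 0) ?\<psi>) zs" for zs
      using assms(1) by (simp add: dd_pr wc_def)
  qed
qed


subsection \<open>The cohomology in the relevant degrees\<close>

lemma char_ne:
  assumes "CHAR('k::field) \<notin> {2, 3}"
  shows "(2::'k) \<noteq> 0" "(3::'k) \<noteq> 0"
proof -
  have "\<not> CHAR('k) dvd p" if p: "p \<in> {2, 3 :: nat}" for p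
  proof
    assume d: "CHAR('k) dvd p"
    then have "CHAR('k) \<le> 3" using p dvd_imp_le[OF d] by auto
    moreover have "CHAR('k) \<noteq> 0"
      using d p by (metis dvd_0_left empty_iff insert_iff zero_neq_numeral)
    moreover have "CHAR('k) \<noteq> 2" "CHAR('k) \<noteq> 3" "CHAR('k) \<noteq> 1" using assms by auto
    ultimately show False by linarith
  qed
  then show "(2::'k) \<noteq> 0" "(3::'k) \<noteq> 0"
    using of_nat_eq_0_iff_char_dvd[where 'a = 'k, of 2] of_nat_eq_0_iff_char_dvd[where 'a = 'k, of 3]
    by auto
qed

section \<open>Cocycles of arity zero and one\<close>

lemma pr_degree: "pr dg g = g \<Longrightarrow> g zs $ h \<noteq> 0 \<Longrightarrow> dg h = wt zs"
  by (metis pr_def prj_nth)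

lemma arity0_cocycle:
  assumes "\<And>zs. dd (Lk k) (R0 s) g zs = 0"
  shows "Lk k x (g []) = R0 s x (g [])"
  using assms[of "[x]"] by (simp add: dd_simps)

lemma arity1_cocycle:
  assumes "dd (Lk k) (R0 s) g [x, y] = 0"
  shows "Lk k x (g [y]) + R0 s y (g [x]) = (case im x y of None \<Rightarrow> 0 | Some z \<Rightarrow> g [z])"
  using assms by (simp add: dd_simps mfun_def algebra_simps split: option.splits)

lemma arity0_even:
  assumes "\<And>zs. dd (Lk k) (R0 s) g zs = 0" "even k"
  shows "g [] $ V = 0" "g [] $ U = 0" "g [] $ E0 = (- 1) powi s * g [] $ F0" "g [] $ F0 = g [] $ E0"
  using arity0_cocycle[OF assms(1), of Ie] arity0_cocycle[OF assms(1), of Iu]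
    arity0_cocycle[OF assms(1), of Iv] assms(2)
  by (simp_all add: coord_simps)

lemma arity0_odd:
  assumes "\<And>zs. dd (Lk k) (R0 s) g zs = 0" "odd k"
  shows "g [] $ E0 = 0" "g [] $ F0 = 0" "g [] $ E1 = 0" "g [] $ F1 = 0"
    "g [] $ U = (- 1) powi s * g [] $ V" "g [] $ V = g [] $ U"
  using arity0_cocycle[OF assms(1), of Ie] arity0_cocycle[OF assms(1), of Iu]
    arity0_cocycle[OF assms(1), of Iv] assms(2)
  by (simp_all add: coord_simps)

lemma arity1_sides:
  assumes c: "\<And>x y. x = Ie \<or> y = Ie \<Longrightarrow> dd (Lk k) (R0 s) g [x, y] = 0" and e: "g [Ie] = 0"
  shows "Lk k Ie (g [Iu]) = 0" "g [Iu] \<star> bas Ie = g [Iu]" "Lk k Ie (g [Iv]) = g [Iv]" "g [Iv] \<star> bas Ie = 0"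
  using arity1_cocycle[OF c, of Ie Iu] arity1_cocycle[OF c, of Ie Iv] arity1_cocycle[OF c, of Iu Ie]
    arity1_cocycle[OF c, of Iv Ie] e
  by (simp_all add: R0_simps bimodule.L_simps[OF bimodule_k] bimodule.R_simps[OF bimodule_k])

lemma arity1_even:
  assumes c: "\<And>x y. x = Ie \<or> y = Ie \<Longrightarrow> dd (Lk k) (R0 s) g [x, y] = 0" and e: "g [Ie] = 0" and k: "even k"
  shows "h \<noteq> U \<Longrightarrow> g [Iu] $ h = 0" "h \<noteq> V \<Longrightarrow> g [Iv] $ h = 0"
  using arity1_sides[OF c e] k by (cases h; simp add: coord_simps)+

lemma arity1_odd:
  assumes c: "\<And>x y. x = Ie \<or> y = Ie \<Longrightarrow> dd (Lk k) (R0 s) g [x, y] = 0" and e: "g [Ie] = 0" and k: "odd k"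
  shows "h \<notin> {E0, E1} \<Longrightarrow> g [Iu] $ h = 0" "h \<notin> {F0, F1} \<Longrightarrow> g [Iv] $ h = 0"
  using arity1_sides[OF c e] k by (cases h; simp add: coord_simps)+

lemma arity1_products:
  assumes "\<And>zs. dd (Lk k) (R0 s) g zs = 0"
  shows "g [Iuv] = Lk k Iu (g [Iv]) + R0 s Iv (g [Iu])" "g [Ivu] = Lk k Iv (g [Iu]) + R0 s Iu (g [Iv])"
    "Lk k Iu (g [Ivu]) + R0 s Ivu (g [Iu]) = 0" "Lk k Iv (g [Iuv]) + R0 s Iuv (g [Iv]) = 0"
  using arity1_cocycle[OF assms, of Iu Iv] arity1_cocycle[OF assms, of Iv Iu]
    arity1_cocycle[OF assms, of Iu Ivu] arity1_cocycle[OF assms, of Iv Iuv]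
  by simp_all

text \<open>A cocycle of arity one is a twisted derivation, so its values on \<open>uv\<close> and
  \<open>vu\<close> follow from those on the arrows.\<close>

lemma arity1_eqI:
  assumes g: "ar 1 g" "\<And>zs. dd (Lk k) (R0 s) g zs = 0" and h: "ar 1 h" "\<And>zs. dd (Lk k) (R0 s) h zs = 0"
    and eq: "g [Ie] = h [Ie]" "g [Iu] = h [Iu]" "g [Iv] = h [Iv]"
  shows "g zs = h zs"
proof (cases "length zs = 1")
  case True
  then obtain x where "zs = [x]" by (auto simp: length_Suc_conv)
  then show ?thesis
    using eq arity1_products[OF g(2)] arity1_products[OF h(2)] by (cases x) simp_all
qed (use g(1) h(1) in \<open>simp add: ar_def\<close>)

definition cst :: "'k::field alg \<Rightarrow> 'k word_cochain" where
  "cst w zs = (if zs = [] then w else 0)"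

lemma ar_cst: "ar 0 (cst w)"
  by (simp add: ar_def cst_def)

lemma ar0_eq_cst: "ar 0 g \<Longrightarrow> g = cst (g [])"
  by (auto simp: ar_def cst_def fun_eq_iff)

lemma ar_dd: "ar r f \<Longrightarrow> ar (Suc r) (dd (Lk k) (R0 s) f)"
  unfolding ar_def
proof (intro allI impI)
  interpret bimodule "Lk k" "R0 s" by (rule bimodule_k)
  fix zs :: "ib list" assume "\<forall>zs. length zs \<noteq> r \<longrightarrow> f zs = 0" "length zs \<noteq> Suc r"
  then show "d f zs = 0" using d_cong[of zs f "\<lambda>l. 0"] by (auto simp: d_zero)
qed

lemma dd_cst: "dd (Lk k) (R0 s) (cst w) zs = (case zs of [x] \<Rightarrow> Lk k x w - R0 s x w | _ \<Rightarrow> 0)"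
  using ar_dd[OF ar_cst[of w], of k s]
  by (cases zs rule: remdups_adj.cases) (auto simp: ar_def dd_simps(1,2) cst_def)

lemma wc_reduce1:
  assumes "wc s (Suc (2 * m)) f" "\<And>zs. dd (Lk 0) (R0 s) f zs = 0"
  obtains g \<psi> where "ar 1 g" "pr (dgk s m) g = g" "g [Ie] = 0" "\<And>zs. dd (Lk m) (R0 s) g zs = 0"
    "\<And>zs. f zs = Sit m g zs + dd (Lk 0) (R0 s) \<psi> zs"
proof -
  interpret b: bimodule "Lk m" "R0 s" by (rule bimodule_k)
  interpret b0: bimodule "Lk 0" "R0 s" by (rule bimodule_k)
  have "wc s (1 + 2 * m) f" using assms(1) by simp
  then obtain g \<psi> where g: "ar 1 g" "pr (dgk s m) g = g" "\<And>zs. dd (Lk m) (R0 s) g zs = 0"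
    "\<And>zs. f zs = Sit m g zs + dd (Lk 0) (R0 s) \<psi> zs"
    using wc_reduce[OF _ assms(2)] by metis
  have "nf (b.d g)" by (simp add: nf_def g(3))
  then obtain \<theta> where \<theta>: "ar 0 \<theta>" "nf (\<lambda>l. g l + b.d \<theta> l)"
    using b.norm_exists_ar[of g 0] g(1) by auto
  let ?\<theta> = "pr (dgk s m) \<theta>"
  let ?g = "\<lambda>l. g l + b.d ?\<theta> l"
  have eq: "?g l = prj (dgk s m) (wt l) (g l + b.d \<theta> l)" for l
    using fun_cong[OF g(2), of l] by (simp add: dd_pr pr_def lin_add[OF lin_prj])
  have \<theta>1: "ar 0 ?\<theta>" using \<theta>(1) by (simp add: ar_def pr_def lin_0[OF lin_prj])
  show ?thesis
  proof (rule that)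
    show "ar 1 ?g" using g(1) ar_dd[OF \<theta>1, of m s] by (simp add: ar_def)
    show "pr (dgk s m) ?g = ?g"
      unfolding eq by (simp add: pr_def prj_def fun_eq_iff vec_eq_iff)
    show "?g [Ie] = 0" unfolding eq using \<theta>(2) by (simp add: nf_def lin_0[OF lin_prj])
    show "dd (Lk m) (R0 s) ?g zs = 0" for zs by (simp add: b.d_add b.d_d g(3))
    have "Sit m ?g zs = Sit m g zs + b0.d (Sit m ?\<theta>) zs" for zs by (simp add: Sit_add d_Sit)
    then show "f zs = Sit m ?g zs + b0.d (\<lambda>l. \<psi> l - Sit m ?\<theta> l) zs" for zs
      by (simp add: g(4) b0.d_diff)
  qed
qed

lemma exact_of_reduced:
  assumes "\<And>zs. f zs = Sit m g zs + dd (Lk 0) (R0 s) \<psi> zs" "\<And>zs. g zs = dd (Lk m) (R0 s) \<theta> zs"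
  shows "\<exists>\<phi>. \<forall>zs. f zs = dd (Lk 0) (R0 s) \<phi> zs"
proof -
  have "g = dd (Lk m) (R0 s) \<theta>" using assms(2) by auto
  then have "f zs = dd (Lk 0) (R0 s) (\<lambda>l. Sit m \<theta> l + \<psi> l) zs" for zs
    by (simp add: assms(1) bimodule.d_add[OF bimodule_k] d_Sit)
  then show ?thesis by blast
qed

lemma exact_zero:
  assumes "\<And>zs. f zs = Sit m g zs + dd (Lk 0) (R0 s) \<psi> zs" "\<And>zs. g zs = 0"
  shows "\<exists>\<phi>. \<forall>zs. f zs = dd (Lk 0) (R0 s) \<phi> zs"
  by (rule exact_of_reduced[OF assms(1), of "\<lambda>_. 0"])
    (simp add: assms(2) bimodule.d_zero[OF bimodule_k])

text \<open>Degree 1 serves the leading terms of gauge transformations, degree 2 reduction and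
  uniqueness, degree 3 the obstructions, which start in arity 10.\<close>

definition exact_range :: "int \<Rightarrow> int \<Rightarrow> bool" where
  "exact_range n s \<longleftrightarrow> (n = 1 \<and> s \<le> -1) \<or> (n = 2 \<and> s \<le> -1 \<and> s \<noteq> -4 \<and> s \<noteq> -6) \<or> (n = 3 \<and> s \<le> -7)"

section \<open>Exactness in the relevant range\<close>

context
  fixes ty :: "'k::field itself"
  assumes ch: "CHAR('k) \<notin> {2, 3}"
begin

lemma ch2: "(2::'k) \<noteq> 0" and ch3: "(3::'k) \<noteq> 0"
  using char_ne[OF ch] by auto

lemma ch4: "(4::'k) \<noteq> 0"
proof -
  have "(4::'k) = 2 * 2" by simp
  then show ?thesis using ch2 by (metis mult_eq_0_iff)
qed

lemma ch9: "(9::'k) \<noteq> 0"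
proof -
  have "(9::'k) = 3 * 3" by simp
  then show ?thesis using ch3 by (metis mult_eq_0_iff)
qed

lemma ch27: "(27::'k) \<noteq> 0"
proof -
  have "(27::'k) = 3 * 9" by simp
  then show ?thesis using ch3 ch9 by (metis mult_eq_0_iff)
qed

lemma double_eq_0: "x + x = 0 \<longleftrightarrow> x = (0::'k)" "x = - x \<longleftrightarrow> x = (0::'k)"
proof -
  have "x + x = 2 * x" by simp
  then show 1: "x + x = 0 \<longleftrightarrow> x = 0" using ch2 by simp
  show "x = - x \<longleftrightarrow> x = (0::'k)" using 1 by (simp add: eq_neg_iff_add_eq_0)
qed

text \<open>The cocycle is a multiple \<open>c\<close> of the unit plus a combination of
  \<open>e1\<close> and \<open>f1\<close>. For the unit, degrees force \<open>j = n\<close>, hence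
  \<open>s = - 3 n\<close>, which is odd as \<open>(2, -6)\<close> is excluded; then commuting with
  \<open>u\<close> gives \<open>c = - c\<close>. For \<open>e1\<close> and \<open>f1\<close> they
  force \<open>j = n - 1\<close>, which leaves only \<open>(2, -2)\<close>.\<close>

lemma base_even0:
  fixes g :: "'k word_cochain"
  assumes g: "pr (dgk s (2 * j)) g = g" "\<And>zs. dd (Lk (2 * j)) (R0 s) g zs = 0"
    and r: "exact_range n s" "s = n - 4 * int j" "(n, s) \<noteq> (2, -2)"
  shows "g [] = 0"
proof -
  have "even (2 * j)" by simp
  note c = arity0_even[OF g(2) this]
  have d: "deg h = n - int j" if "g [] $ h \<noteq> 0" for h
    using pr_degree[OF g(1) that] r(2) by (simp add: dgk_def wt_simps)
  have 0: "g [] $ F0 = 0"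
  proof (rule ccontr)
    assume nz: "g [] $ F0 \<noteq> 0"
    then have "n = int j" using d by fastforce
    then have "s = - 3 * n" using r(2) by simp
    then have "odd s" using r(1) by (auto simp: exact_range_def)
    then have "g [] $ F0 = - g [] $ F0" using c(3) unfolding c(4)[symmetric] by (simp add: neg_one_powi)
    then show False using nz double_eq_0 by blast
  qed
  have 1: "g [] $ h = 0" if "deg h = 1" for h
  proof (rule ccontr)
    assume "g [] $ h \<noteq> 0"
    then have "int j = n - 1" using d that by fastforce
    then show False using r by (auto simp: exact_range_def)
  qed
  have "g [] $ E0 = 0" using c(4) 0 by simp
  then show ?thesis using 0 1 c(1,2) by (simp add: vec_eq_gen all_gen)
qed

text \<open>Closed constants are multiples \<open>c (u + v)\<close>. Degrees force
  \<open>j = n - 1\<close> and \<open>s = 2 - 3 n\<close>, odd as \<open>(2, -4)\<close> is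
  excluded, and then the sign in the right action gives \<open>c = - c\<close>.\<close>

lemma base_odd0:
  fixes g :: "'k word_cochain"
  assumes g: "pr (dgk s (2 * j + 1)) g = g" "\<And>zs. dd (Lk (2 * j + 1)) (R0 s) g zs = 0"
    and r: "exact_range n s" "s = n - 4 * int j - 2"
  shows "g [] = 0"
proof -
  have "odd (2 * j + 1)" by simp
  note c = arity0_odd[OF g(2) this]
  have "g [] $ V = 0"
  proof (rule ccontr)
    assume nz: "g [] $ V \<noteq> 0"
    have "int j = n - 1" using pr_degree[OF g(1) nz] r(2) by (simp add: dgk_def wt_simps)
    then have "s = 2 - 3 * n" using r(2) by simp
    then have "odd s" using r(1) by (auto simp: exact_range_def)
    then have "g [] $ V = - g [] $ V" using c(5) unfolding c(6)[symmetric] by (simp add: neg_one_powi)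
    then show False using nz double_eq_0 by blast
  qed
  then have "g [] $ V = 0 \<and> g [] $ U = 0" using c(6) by simp
  then show ?thesis using c(1-4) by (simp add: vec_eq_gen all_gen)
qed

text \<open>The cocycle is a derivation scaling \<open>u\<close> and \<open>v\<close>. Its degree
  forces \<open>j = n - 1\<close> and \<open>s = 3 - 3 n\<close>; within the range this is only
  \<open>(2, -3)\<close>.\<close>

lemma base_even1:
  fixes g :: "'k word_cochain"
  assumes g: "ar 1 g" "pr (dgk s (2 * j)) g = g" "g [Ie] = 0" "\<And>zs. dd (Lk (2 * j)) (R0 s) g zs = 0"
    and r: "exact_range n s" "s = n - 4 * int j - 1" "(n, s) \<noteq> (2, -3)"
  shows "g zs = 0"
proof -
  note c = arity1_even[OF g(4,3), simplified]
  have "g [Iu] $ U = 0"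
  proof (rule ccontr)
    assume nz: "g [Iu] $ U \<noteq> 0"
    have "int j = n - 1" using pr_degree[OF g(2) nz] r(2) by (simp add: dgk_def wt_simps)
    then show False using r by (auto simp: exact_range_def)
  qed
  then have u: "g [Iu] = 0" using c by (simp add: vec_eq_gen all_gen)
  have "g [Iv] $ V = 0"
  proof (rule ccontr)
    assume nz: "g [Iv] $ V \<noteq> 0"
    have "int j = n - 1" using pr_degree[OF g(2) nz] r(2) by (simp add: dgk_def wt_simps)
    then show False using r by (auto simp: exact_range_def)
  qed
  then have v: "g [Iv] = 0" using c by (simp add: vec_eq_gen all_gen)
  show ?thesis
    using arity1_eqI[OF g(1,4) _ bimodule.d_zero[OF bimodule_k]] g(3) u v
    by (simp add: ar_def)
qed

text \<open>For the values \<open>\<alpha> e0\<close> on \<open>u\<close> and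
  \<open>\<beta> f0\<close> on \<open>v\<close>, the derivation rule on the relations of length
  three gives for even \<open>s\<close> the system
  \<open>2 \<alpha> + \<beta> = 0 = \<alpha> + 2 \<beta>\<close> of determinant 3; for odd
  \<open>s\<close> the terms cancel to \<open>\<beta> = 0\<close> and
  \<open>\<alpha> = 0\<close>.\<close>

lemma odd1_head:
  fixes g :: "'k word_cochain"
  assumes g: "g [Ie] = 0" "\<And>zs. dd (Lk (2 * j + 1)) (R0 s) g zs = 0"
  shows "g [Iu] $ E0 = 0" "g [Iv] $ F0 = 0"
proof -
  let ?\<alpha> = "g [Iu] $ E0" and ?\<beta> = "g [Iv] $ F0" and ?\<epsilon> = "(- 1) powi s :: 'k"
  have rel: "?\<alpha> + ?\<epsilon> * ?\<beta> + ?\<epsilon> * ?\<alpha> = 0" "?\<alpha> + ?\<beta> + ?\<epsilon> * ?\<beta> = 0"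
    using arity1_products[OF g(2)] by (simp_all add: coord_simps algebra_simps)
  have "?\<alpha> = 0 \<and> ?\<beta> = 0"
  proof (cases "even s")
    case True
    then have r: "?\<alpha> + ?\<beta> + ?\<alpha> = 0" "?\<alpha> + ?\<beta> + ?\<beta> = 0" using rel
      by (simp_all add: neg_one_powi)
    have "3 * ?\<alpha> = 2 * (?\<alpha> + ?\<beta> + ?\<alpha>) - (?\<alpha> + ?\<beta> + ?\<beta>)"
      "3 * ?\<beta> = 2 * (?\<alpha> + ?\<beta> + ?\<beta>) - (?\<alpha> + ?\<beta> + ?\<alpha>)" by (simp_all add: algebra_simps)
    then have "3 * ?\<alpha> = 0" "3 * ?\<beta> = 0" unfolding r by simp_all
    then show ?thesis using ch3 by simp
  next
    case False
    then show ?thesis using rel by (simp add: neg_one_powi)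
  qed
  then show "?\<alpha> = 0" "?\<beta> = 0" by auto
qed

text \<open>What \<open>odd1_head\<close> leaves are values in the lines of \<open>e1\<close> and
  \<open>f1\<close>; degrees force \<open>j = n - 2\<close> and \<open>s = 5 - 3 n\<close>, within
  the range only \<open>(2, -1)\<close>.\<close>

lemma base_odd1:
  fixes g :: "'k word_cochain"
  assumes g: "ar 1 g" "pr (dgk s (2 * j + 1)) g = g" "g [Ie] = 0"
    "\<And>zs. dd (Lk (2 * j + 1)) (R0 s) g zs = 0"
    and r: "exact_range n s" "s = n - 4 * int j - 3" "(n, s) \<noteq> (2, -1)"
  shows "g zs = 0"
proof -
  note c = arity1_odd[OF g(4,3), simplified]
  have "g [Iu] $ E1 = 0"
  proof (rule ccontr)
    assume nz: "g [Iu] $ E1 \<noteq> 0"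
    have "int j = n - 2" using pr_degree[OF g(2) nz] r(2) by (simp add: dgk_def wt_simps)
    then show False using r by (auto simp: exact_range_def)
  qed
  then have u: "g [Iu] = 0" using c odd1_head[OF g(3,4)] by (simp add: vec_eq_gen all_gen)
  have "g [Iv] $ F1 = 0"
  proof (rule ccontr)
    assume nz: "g [Iv] $ F1 \<noteq> 0"
    have "int j = n - 2" using pr_degree[OF g(2) nz] r(2) by (simp add: dgk_def wt_simps)
    then show False using r by (auto simp: exact_range_def)
  qed
  then have v: "g [Iv] = 0" using c odd1_head[OF g(3,4)] by (simp add: vec_eq_gen all_gen)
  show ?thesis
    using arity1_eqI[OF g(1,4) _ bimodule.d_zero[OF bimodule_k]] g(3) u v
    by (simp add: ar_def)
qed

lemma special_3:
  fixes g :: "'k word_cochain"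
  assumes g: "ar 1 g" "g [Ie] = 0" "\<And>zs. dd (Lk 2) (R0 (-3)) g zs = 0"
  shows "\<exists>\<theta>. \<forall>zs. g zs = dd (Lk 2) (R0 (-3)) \<theta> zs"
proof -
  note c = arity1_even[OF g(3,2), simplified]
  let ?\<alpha> = "g [Iu] $ U" and ?\<beta> = "g [Iv] $ V"
  \<comment> \<open>For odd \<open>s\<close> the right action changes sign at \<open>u\<close> but
    not at \<open>v\<close>. The constant \<open>a e0 + b f0\<close> has differential
    \<open>(a + b) u\<close> on \<open>u\<close> and \<open>(b - a) v\<close> on \<open>v\<close>;
    the halves solve for \<open>a\<close> and \<open>b\<close>.\<close>
  define w where "w = ((?\<alpha> - ?\<beta>) / 2) *s axis E0 1 + ((?\<alpha> + ?\<beta>) / 2) *s axis F0 1"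
  have half: "(a - b) / 2 + (a + b) / 2 = a" "(a + b) / 2 - (a - b) / 2 = b" for a b :: 'k
    using ch2 ch4 by (simp_all add: field_simps)
  have w: "dd (Lk 2) (R0 (-3)) (cst w) [Ie] = 0" "dd (Lk 2) (R0 (-3)) (cst w) [Iu] = g [Iu]"
    "dd (Lk 2) (R0 (-3)) (cst w) [Iv] = g [Iv]"
    unfolding dd_cst using c half[of ?\<alpha> ?\<beta>] by (simp_all add: coord_simps w_def neg_one_powi)
  have "g zs = dd (Lk 2) (R0 (-3)) (cst w) zs" for zs
    by (rule arity1_eqI[OF g(1,3)])
      (use w g(2) ar_dd[OF ar_cst[of w], of 2 "-3"] bimodule.d_d[OF bimodule_k] in auto)
  then show ?thesis by blast
qed

lemma special_1:
  fixes g :: "'k word_cochain"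
  assumes g: "ar 1 g" "g [Ie] = 0" "\<And>zs. dd (Lk 1) (R0 (-1)) g zs = 0"
  shows "\<exists>\<theta>. \<forall>zs. g zs = dd (Lk 1) (R0 (-1)) \<theta> zs"
proof -
  have "dd (Lk (2 * 0 + 1)) (R0 (-1)) g zs = 0" for zs using g(3) by simp
  note h = odd1_head[OF g(2) this]
  note c = arity1_odd[OF g(3,2), simplified]
  let ?\<alpha> = "g [Iu] $ E1" and ?\<beta> = "g [Iv] $ F1"
  \<comment> \<open>The system of \<open>special_3\<close> again, now for the constant
    \<open>a u + b v\<close> and the exchanged left action: the differential is
    \<open>(a + b) e1\<close> on \<open>u\<close> and \<open>(b - a) f1\<close> on
    \<open>v\<close>.\<close>
  define w where "w = ((?\<alpha> - ?\<beta>) / 2) *s axis U 1 + ((?\<alpha> + ?\<beta>) / 2) *s axis V 1"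
  have half: "(a - b) / 2 + (a + b) / 2 = a" "(a + b) / 2 - (a - b) / 2 = b" for a b :: 'k
    using ch2 ch4 by (simp_all add: field_simps)
  have w: "dd (Lk 1) (R0 (-1)) (cst w) [Ie] = 0" "dd (Lk 1) (R0 (-1)) (cst w) [Iu] = g [Iu]"
    "dd (Lk 1) (R0 (-1)) (cst w) [Iv] = g [Iv]"
    unfolding dd_cst using c h half[of ?\<alpha> ?\<beta>] by (simp_all add: coord_simps w_def neg_one_powi)
  have "g zs = dd (Lk 1) (R0 (-1)) (cst w) zs" for zs
    by (rule arity1_eqI[OF g(1,3)])
      (use w g(2) ar_dd[OF ar_cst[of w], of 1 "-1"] bimodule.d_d[OF bimodule_k] in auto)
  then show ?thesis by blast
qed

text \<open>A nonzero constant is never a coboundary in its own complex, so the primitive is sought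
  one shift earlier, in arity one with exchanged coefficients.\<close>

lemma special_2:
  fixes g :: "'k word_cochain"
  assumes g: "ar 0 g" "pr (dgk (-2) 2) g = g" "\<And>zs. dd (Lk 2) (R0 (-2)) g zs = 0"
  shows "\<exists>\<theta>. \<forall>zs. Sh (Lk 1) g zs = dd (Lk 1) (R0 (-2)) \<theta> zs"
proof -
  interpret bimodule "Lk 1" "R0 (-2)" by (rule bimodule_k)
  note c = arity0_even[OF g(3), simplified]
  have z: "g [] $ E0 = 0" "g [] $ F0 = 0"
    using pr_degree[OF g(2), of "[]" E0] pr_degree[OF g(2), of "[]" F0] by (auto simp: dgk_def wt_simps)
  let ?l = "g [] $ E1" and ?m = "g [] $ F1"
  \<comment> \<open>The solution of \<open>2 \<alpha> + \<beta> = ?l\<close> and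
    \<open>\<alpha> + 2 \<beta> = ?m\<close>, the inhomogeneous form of the system in
    \<open>odd1_head\<close>.\<close>
  define \<alpha> \<beta> where "\<alpha> = (2 * ?l - ?m) / 3" and "\<beta> = (2 * ?m - ?l) / 3"
  have ab: "?l = \<alpha> + (\<alpha> + \<beta>)" "?m = \<beta> + (\<alpha> + \<beta>)"
    unfolding \<alpha>_def \<beta>_def using ch3 ch9 ch27 by (simp_all add: field_simps)
  \<comment> \<open>The values on \<open>uv\<close> and \<open>vu\<close> are forced by those on the
    arrows: the differential must vanish on the pairs \<open>u, v\<close> and \<open>v, u\<close>,
    where a shifted cochain is zero.\<close>
  define \<theta> :: "'k word_cochain" where "\<theta> = (\<lambda>zs. case zs of [x] \<Rightarrow>
      (case x of Ie \<Rightarrow> 0 | Iu \<Rightarrow> \<alpha> *s axis E0 1 | Iv \<Rightarrow> \<beta> *s axis F0 1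
        | Iuv \<Rightarrow> (\<alpha> + \<beta>) *s axis V 1 | Ivu \<Rightarrow> (\<alpha> + \<beta>) *s axis U 1) | _ \<Rightarrow> 0)"
  have \<theta>: "ar 1 \<theta>" by (auto simp: ar_def \<theta>_def split: list.split)
  have "Sh (Lk 1) g zs = d \<theta> zs" for zs
  proof (cases "length zs = 2")
    case True
    then obtain x y where zs: "zs = [x, y]" by (auto simp: length_Suc_conv numeral_2_eq_2)
    show ?thesis unfolding zs
      by (cases x; cases y; simp add: dd_simps mfun_def \<theta>_def coord_simps neg_one_powi c(1,2) z ab algebra_simps)
  next
    case False
    then show ?thesis using ar_dd[OF \<theta>, of 1 "-2"] ar_Sh[OF g(1)] by (simp add: ar_def)
  qed
  then show ?thesis by blast
qed

theorem word_exact: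
  fixes f :: "'k word_cochain"
  assumes r: "exact_range n s" "int r = n - s" and f: "wc s r f" "\<And>zs. dd (Lk 0) (R0 s) f zs = 0"
  shows "\<exists>\<psi>. \<forall>zs. f zs = dd (Lk 0) (R0 s) \<psi> zs"
proof -
  \<comment> \<open>\<open>m\<close> shifts leave arity 0 or 1, and the parity of \<open>m\<close>
    decides whether the left action is exchanged; hence four cases by \<open>r\<close> modulo
    4.\<close>
  define m where "m = r div 2"
  define j where "j = m div 2"
  have "(r = 4 * j \<and> m = 2 * j) \<or> (r = 4 * j + 2 \<and> m = 2 * j + 1) \<or>
      (r = 4 * j + 1 \<and> m = 2 * j) \<or> (r = 4 * j + 3 \<and> m = 2 * j + 1)"
    unfolding j_def m_def by presburger
  then consider "r = 4 * j" "m = 2 * j" | "r = 4 * j + 2" "m = 2 * j + 1"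
    | "r = 4 * j + 1" "m = 2 * j" | "r = 4 * j + 3" "m = 2 * j + 1"
    by blast
  then show ?thesis
  proof cases
    case 1
    then have "wc s (0 + 2 * m) f" using f(1) by simp
    then obtain g \<psi> where g: "ar 0 g" "pr (dgk s m) g = g" "\<And>zs. dd (Lk m) (R0 s) g zs = 0"
        "\<And>zs. f zs = Sit m g zs + dd (Lk 0) (R0 s) \<psi> zs"
      using wc_reduce[OF _ f(2)] by metis
    show ?thesis
    proof (cases "(n, s) = (2, -2)")
      case True
      then have m: "m = Suc 1" "s = -2" using 1 r(2) by auto
      have "\<exists>\<theta>. \<forall>zs. Sh (Lk 1) g zs = dd (Lk 1) (R0 s) \<theta> zs"
        using special_2[of g] g m by (simp add: numeral_2_eq_2)
      then obtain \<theta> where "\<And>zs. Sh (Lk 1) g zs = dd (Lk 1) (R0 s) \<theta> zs" by blast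
      then show ?thesis by (intro exact_of_reduced[of f 1 "Sh (Lk 1) g"]) (use g(4) m in auto)
    next
      case False
      have "g [] = 0" using base_even0[of s j g n] g 1 r False by simp
      then have "g zs = 0" for zs using g(1) by (cases zs) (simp_all add: ar_def)
      then show ?thesis using exact_zero g(4) by blast
    qed
  next
    case 2
    then have "wc s (0 + 2 * m) f" using f(1) by simp
    then obtain g \<psi> where g: "ar 0 g" "pr (dgk s m) g = g" "\<And>zs. dd (Lk m) (R0 s) g zs = 0"
        "\<And>zs. f zs = Sit m g zs + dd (Lk 0) (R0 s) \<psi> zs"
      using wc_reduce[OF _ f(2)] by metis
    have "s = n - 4 * int j - 2" using 2 r(2) by simp
    then have "g [] = 0"
      by (rule base_odd0[OF g(2)[unfolded 2(2)] g(3)[unfolded 2(2)] r(1)])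
    then have "g zs = 0" for zs using g(1) by (cases zs) (simp_all add: ar_def)
    then show ?thesis using exact_zero g(4) by blast
  next
    case 3
    then have "wc s (Suc (2 * m)) f" using f(1) by simp
    then obtain g \<psi> where g: "ar 1 g" "pr (dgk s m) g = g" "g [Ie] = 0" "\<And>zs. dd (Lk m) (R0 s) g zs = 0"
        "\<And>zs. f zs = Sit m g zs + dd (Lk 0) (R0 s) \<psi> zs"
      using wc_reduce1[OF _ f(2)] by metis
    show ?thesis
    proof (cases "(n, s) = (2, -3)")
      case True
      then have "m = 2" "s = -3" using 3 r(2) by auto
      then obtain \<theta> where "\<And>zs. g zs = dd (Lk m) (R0 s) \<theta> zs" using special_3[of g] g by auto
      then show ?thesis using exact_of_reduced[OF g(5)] by blast
    next
      case False
      have sj: "s = n - 4 * int j - 1" using 3 r(2) by simp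
      have "g zs = 0" for zs
        by (rule base_even1[OF g(1) g(2)[unfolded 3(2)] g(3) g(4)[unfolded 3(2)] r(1) sj False])
      then show ?thesis using exact_zero g(5) by blast
    qed
  next
    case 4
    then have "Suc (2 * m) = r" by simp
    then have "wc s (Suc (2 * m)) f" using f(1) by (simp only:)
    then obtain g \<psi> where g: "ar 1 g" "pr (dgk s m) g = g" "g [Ie] = 0" "\<And>zs. dd (Lk m) (R0 s) g zs = 0"
        "\<And>zs. f zs = Sit m g zs + dd (Lk 0) (R0 s) \<psi> zs"
      using wc_reduce1[OF _ f(2)] by metis
    show ?thesis
    proof (cases "(n, s) = (2, -1)")
      case True
      then have "m = 1" "s = -1" using 4 r(2) by auto
      then obtain \<theta> where "\<And>zs. g zs = dd (Lk m) (R0 s) \<theta> zs" using special_1[of g] g by auto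
      then show ?thesis using exact_of_reduced[OF g(5)] by blast
    next
      case False
      have sj: "s = n - 4 * int j - 3" using 4 r(2) by simp
      have "g zs = 0" for zs
        by (rule base_odd1[OF g(1) g(2)[unfolded 4(2)] g(3) g(4)[unfolded 4(2)] r(1) sj False])
      then show ?thesis using exact_zero g(5) by blast
    qed
  qed
qed

end

text \<open>This closes the gap at the last shift, where the primitive has arity one. After
  normalization at \<open>e0\<close>, degrees kill its values on \<open>u\<close> and
  \<open>v\<close>, closedness on pairs of arrows kills those on \<open>uv\<close> and
  \<open>vu\<close>, and evaluating at \<open>u, vu\<close> and \<open>v, uv\<close> leaves
  \<open>f0 g = 0\<close> and \<open>e0 g = 0\<close>.\<close>

lemma no_low_arity1:
  fixes g :: "'k::field word_cochain"
  assumes \<theta>: "ar 1 \<theta>" and sh: "\<And>zs. Sh (Lk k) g zs = dd (Lk k) (R0 s) \<theta> zs"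
    and s: "(k, s) \<in> {(2, -4), (3, -6)}" and g: "pr (dgk s (Suc k)) g = g"
  shows "g [] = 0"
proof -
  interpret b: bimodule "Lk k" "R0 s" by (rule bimodule_k)
  have eq: "b.d \<theta> = Sh (Lk k) g" using sh by auto
  have "nf (b.d \<theta>)" unfolding eq by (rule b.nf_Sh)
  then obtain \<eta> where \<eta>: "ar 0 \<eta>" "nf (\<lambda>l. \<theta> l + b.d \<eta> l)"
    using b.norm_exists_ar[of \<theta> 0] \<theta> by auto
  define h where "h = pr (dgk s k) (\<lambda>l. \<theta> l + b.d \<eta> l)"
  have he: "h [Ie] = 0" using \<eta>(2) by (simp add: h_def nf_def pr_def lin_0[OF lin_prj])
  have hp: "pr (dgk s k) h = h" by (simp add: h_def pr_def prj_def fun_eq_iff vec_eq_iff)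
  have "b.d (\<lambda>l. \<theta> l + b.d \<eta> l) = Sh (Lk k) g" by (rule ext) (simp add: b.d_add b.d_d sh)
  then have dh: "b.d h zs = Sh (Lk k) g zs" for zs
    using Sh_pr[of k s g zs] by (simp add: h_def dd_pr g)
  have c: "b.d h [x, y] = 0" if "x = Ie \<or> y = Ie" for x y
    unfolding dh using that by (cases x; cases y) auto
  have uv: "h [Iu] = 0 \<and> h [Iv] = 0"
  proof -
    have "h [x] $ i = 0" if "dgk s k i \<noteq> deg (gn x)" for x i
      using pr_degree[OF hp, of "[x]" i] that by (auto simp: wt_simps)
    then show ?thesis
      using s arity1_even[OF c he] arity1_odd[OF c he]
      by (auto simp: vec_eq_gen all_gen dgk_def)
  qed
  have "b.d h [Iu, Iv] = 0" "b.d h [Iv, Iu] = 0" by (simp_all add: dh)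
  then have "h [Iuv] = 0" "h [Ivu] = 0"
    using arity1_cocycle[of k s h Iu Iv] arity1_cocycle[of k s h Iv Iu] uv
    by (simp_all add: b.L_simps b.R_simps)
  then have "b.d h [Iu, Ivu] = 0" "b.d h [Iv, Iuv] = 0"
    using uv by (simp_all add: dd_simps mfun_def b.L_simps b.R_simps)
  then have "g [] - Lk k Ie (g []) = 0" "Lk k Ie (g []) = 0" by (simp_all add: dh)
  then show ?thesis by simp
qed


subsection \<open>Comparison with the normalized Hochschild complex\<close>

text \<open>The sign of suspending the arguments: a letter with \<open>j\<close> letters to its left
  contributes its degree \<open>j\<close> times. It turns the signs of \<open>hoch_diff\<close>,
  which use shifted degrees, into the alternating signs of \<open>dd\<close>, up to a global
  \<open>(- 1) powi s\<close>.\<close>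

fun esg :: "ib list \<Rightarrow> 'k::field" where
  "esg [] = 1"
| "esg (z # zs) = (- 1) powi (wt zs) * esg zs"

definition hat :: "'k::field cochain \<Rightarrow> 'k word_cochain" where
  "hat \<phi> zs = esg zs *s \<phi> (map bas zs)"

lemma powi_cancel: "(- 1 :: 'k::field) powi m * ((- 1) powi m * x) = x"
  "(- 1 :: 'k::field) powi m * (- 1) powi m = 1"
  by (simp_all add: neg_one_powi)

lemma esg_sq: "esg zs * esg zs = (1 :: 'k::field)"
proof (induction zs)
  case (Cons z zs)
  have "esg (z # zs) * esg (z # zs) = ((- 1 :: 'k) powi wt zs * (- 1) powi wt zs) * (esg zs * esg zs)"
    by (simp add: ac_simps)
  then show ?case using Cons by (simp only: powi_cancel mult_1)
qed simp

lemma esg_snoc: "esg (ws @ [y]) = esg ws * (- 1 :: 'k::field) powi (int (length ws) * deg (gn y))"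
proof (induction ws)
  case (Cons w ws)
  have "wt (ws @ [y]) = wt ws + deg (gn y)" by (simp add: wt_def)
  then show ?case using Cons by (simp add: power_int_add algebra_simps)
qed (simp add: wt_simps)

lemma tau_bas: "tau (bas x) = (- 1) powi (deg (gn x) - 1) *s bas x"
  by (simp add: bas_def tau_axis)

lemma mlin_tau_bas:
  assumes "multilinear F"
  shows "F (us @ map tau (map bas zs)) =
    (- 1 :: 'k::field) powi (wt zs - int (length zs)) *s F (us @ map bas zs)"
proof -
  have "(\<Sum>z\<leftarrow>zs. deg (gn z) - 1) = wt zs - int (length zs)"
    by (induction zs) (simp_all add: wt_simps)
  then show ?thesis
    using mlin_map_scale[OF assms, of us "map (\<lambda>z. ((- 1) powi (deg (gn z) - 1), bas z)) zs"]
    by (simp add: comp_def tau_bas) (metis (no_types, lifting) prod_list_powi map_map comp_def map_eq_conv)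
qed

lemma mu2_bas:
  "mu2 [bas x, bas y] = (- 1) powi (deg (gn y)) *s (case im x y of None \<Rightarrow> 0 | Some z \<Rightarrow> bas z)"
  by (auto simp: mu2_pair tau_bas lin_scale[OF lin_alg_mult_right] bas_mult neg_one_powi split: option.split)

abbreviation D0 :: "'k::field word_cochain \<Rightarrow> 'k word_cochain" where
  "D0 \<equiv> DR (\<lambda>x m. 0)"

lemma D0_sign: "D0 (\<lambda>l. (- 1) powi (c + wt l) *s f l) zs = (- 1) powi (c + wt zs) *s D0 f zs"
proof (induction zs arbitrary: f c rule: induct_list012)
  case (3 x y zs)
  have "D0 (\<lambda>l. (- 1) powi ((c + deg (gn x)) + wt l) *s f (x # l)) (y # zs) =
      (- 1) powi ((c + deg (gn x)) + wt (y # zs)) *s D0 (\<lambda>l. f (x # l)) (y # zs)"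
    by (rule "3.IH"(2))
  then show ?case
    using deg_im[of x y]
    by (auto simp: mfun_def wt_simps vec.scale_right_diff_distrib algebra_simps split: option.split)
qed simp_all

text \<open>The right action enters \<open>DR\<close> only at the end of the recursion. Isolating it
  lets \<open>hat_inner\<close> deal with the products inside the word alone.\<close>

lemma DR_snoc:
  "(\<And>x. lin (R x)) \<Longrightarrow> DR R f (ws @ [x]) = D0 f (ws @ [x]) + (- 1) powi (int (length ws)) *s R x (f ws)"
proof (induction ws arbitrary: f)
  case (Cons w ws)
  have "DR R (\<lambda>l. f (w # l)) (ws @ [x]) =
      D0 (\<lambda>l. f (w # l)) (ws @ [x]) + (- 1) powi (int (length ws)) *s R x (f (w # ws))"
    by (rule Cons.IH[OF Cons.prems])
  moreover have "(- 1 :: 'a) powi (1 + int (length ws)) = - ((- 1) powi (int (length ws)))"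
    by (simp add: neg_one_powi)
  ultimately show ?case by (cases ws) (simp_all add: vector_sneg_minus1[symmetric])
qed simp

lemma hat_inner:
  assumes "multilinear \<phi>"
  shows "esg zs *s ins tau \<phi> mu2 (map bas zs) = (- 1) powi (int (length zs)) *s D0 (hat \<phi>) zs"
  using assms
proof (induction zs arbitrary: \<phi> rule: induct_list012)
  case (3 x y zs)
  note m = "3.prems"
  let ?b = "\<lambda>x. bas x :: 'a alg"
  have "ssum (\<lambda>vs ws. \<phi> (mu2 (?b x # vs) # map tau ws)) (?b y # map ?b zs) =
      \<phi> (mu2 [?b x, ?b y] # map tau (map ?b zs))"
  proof -
    have "ssum (\<lambda>vs ws. \<phi> (mu2 (?b x # ?b y # vs) # map tau ws)) (map ?b zs) =
        \<phi> (mu2 [?b x, ?b y] # map tau (map ?b zs))"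
      by (rule ssum_head) (auto simp: neq_Nil_conv mu2_simps(3) mlin_0_Cons[OF m])
    then show ?thesis by (simp add: mu2_simps(2) mlin_0_Cons[OF m])
  qed
  moreover have "\<phi> (mu2 [?b x, ?b y] # map tau (map ?b zs)) =
      (- 1) powi (deg (gn y) + wt zs - int (length zs)) *s
        (case im x y of None \<Rightarrow> 0 | Some z \<Rightarrow> \<phi> (map ?b (z # zs)))"
    using mlin_tau_bas[OF m, of "[mu2 [?b x, ?b y]]" zs]
    by (auto simp: mu2_bas lin_scale[OF mlin_lin_Cons[OF m]] mlin_0_Cons[OF m] vector_smult_assoc
        power_int_add[symmetric] algebra_simps split: option.split)
  ultimately have 1: "esg (x # y # zs) *s ssum (\<lambda>vs ws. \<phi> (mu2 (?b x # vs) # map tau ws)) (?b y # map ?b zs) =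
      (- 1) powi (int (length zs)) *s mfun (hat \<phi>) x y zs"
    by (auto simp: mfun_def hat_def vector_smult_assoc wt_simps neg_one_powi split: option.split)
  have hx: "hat \<phi> (x # l) = (- 1) powi (0 + wt l) *s hat (\<lambda>l. \<phi> (?b x # l)) l" for l
    by (simp add: hat_def vector_smult_assoc)
  have "esg (y # zs) *s ins tau (\<lambda>l. \<phi> (?b x # l)) mu2 (map ?b (y # zs)) =
      (- 1) powi (int (length (y # zs))) *s D0 (hat (\<lambda>l. \<phi> (?b x # l))) (y # zs)"
    by (rule "3.IH"(2)[OF mlin_Cons[OF m]])
  then have "esg (x # y # zs) *s ins tau (\<lambda>l. \<phi> (?b x # l)) mu2 (map ?b (y # zs)) =
      (- 1) powi (wt (y # zs)) *s ((- 1) powi (int (length (y # zs))) *s D0 (hat (\<lambda>l. \<phi> (?b x # l))) (y # zs))"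
    by (simp only: esg.simps vector_smult_assoc[symmetric])
  also have "\<dots> = (- 1) powi (int (length (y # zs))) *s D0 (\<lambda>l. hat \<phi> (x # l)) (y # zs)"
    unfolding hx D0_sign by (simp add: vector_smult_assoc mult.commute)
  finally have 2: "esg (x # y # zs) *s ins tau (\<lambda>l. \<phi> (?b x # l)) mu2 (map ?b (y # zs)) =
      (- 1) powi (int (length (y # zs))) *s D0 (\<lambda>l. hat \<phi> (x # l)) (y # zs)" .
  have "esg (x # y # zs) *s ins tau \<phi> mu2 (map ?b (x # y # zs)) =
      (- 1) powi (int (length zs)) *s mfun (hat \<phi>) x y zs +
      (- 1) powi (int (length (y # zs))) *s D0 (\<lambda>l. hat \<phi> (x # l)) (y # zs)"
    unfolding 1[symmetric] 2[symmetric]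
    by (simp add: ins_Cons'[where N = mu2, OF m mu2_simps(1)] vector_add_ldistrib)
  then show ?case
    by (simp add: neg_one_powi vector_sneg_minus1[symmetric])
qed (simp_all add: ins_Nil ins_Cons mu2_simps(1,2) mlin_0_Cons[OF assms] mlin_0[OF assms] mlin_0_Cons
    mlin_0[of _ "[_]" "[]", simplified])

lemma hat_hoch_diff:
  assumes \<phi>: "\<phi> \<in> CC n s"
  shows "hat (hoch_diff n \<phi>) zs = (- 1 :: 'k::field) powi s *s dd (Lk 0) (R0 s) (hat \<phi>) zs"
proof -
  interpret bimodule "Lk 0" "R0 s :: 'k action" by (rule bimodule_k)
  note \<phi>' = CC_D[OF \<phi>]
  let ?b = "\<lambda>x. bas x :: 'k alg"
  show ?thesis
  proof (cases "int (length zs) = n - s + 1")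
    case False
    then have "hoch_diff n \<phi> (map ?b zs) = 0"
      using CC_D(3)[OF hoch_diff_CC[OF \<phi>], of "map ?b zs"] by simp
    moreover have "d (hat \<phi>) zs = d (\<lambda>l. 0) zs"
      by (rule d_cong) (use False \<phi>'(3) in \<open>auto simp: hat_def\<close>)
    ultimately show ?thesis by (simp add: hat_def d_zero)
  next
    case True
    show ?thesis
    proof (cases "zs = []")
      case True
      then show ?thesis
        by (simp add: hat_def dd_simps hoch_diff_ins ins_Nil mu2_simps mlin_0_Cons[OF \<phi>'(2)])
    next
      case False
      then obtain x ys where x: "zs = x # ys" by (cases zs) auto
      obtain ws y where y: "zs = ws @ [y]" using False by (metis rev_exhaust)
      have ys: "int (length ys) = n - s" using True by (simp add: x)
      have ws: "int (length ws) = n - s" using True by (simp add: y)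
      have left: "ssum (\<lambda>us vs. mu2 [unit_map us, \<phi> vs]) (map ?b zs) = mu2 [?b x, \<phi> (map ?b ys)]"
        unfolding x by (simp, rule trans[OF ssum_head]) (auto simp: unit_map_Cons)
      have right: "ssum (\<lambda>us vs. mu2 [\<phi> us, unit_map (map (sg n) vs)]) (map ?b zs) =
          mu2 [\<phi> (map ?b ws), sg n (?b y)]"
      proof -
        have "ssum (\<lambda>us vs. mu2 [\<phi> us, unit_map (map (sg n) (vs @ [?b y]))]) (map ?b ws) =
            mu2 [\<phi> (map ?b ws), sg n (?b y)]"
          by (rule trans[OF ssum_last]) (auto simp: unit_map_eq_0)
        then show ?thesis
          using ssum_insert[of "\<lambda>us vs. mu2 [\<phi> us, unit_map (map (sg n) vs)]" "map ?b ws" "?b y" "[]"]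
          by (simp add: y)
      qed
      have "list_all2 homogeneous (map (\<lambda>z. deg (gn z)) ys) (map ?b ys)"
        by (simp add: list_all2_conv_all_nth bas_def homogeneous_axis)
      then have "homogeneous (wt ys + n - int (length ys)) (\<phi> (map ?b ys))"
        using \<phi>'(1) unfolding fam_def wt_def by fastforce
      then have "tau (\<phi> (map ?b ys)) = (- 1) powi (wt ys + s - 1) *s \<phi> (map ?b ys)"
        using ys by (simp add: sign_by_homogeneous)
      then have l: "esg zs *s mu2 [?b x, \<phi> (map ?b ys)] = (- 1) powi s *s Lk 0 x (hat \<phi> ys)"
        by (simp add: x mu2_pair Lk_parity L0_def hat_def lin_scale[OF lin_alg_mult_right] vector_smult_assoc
            neg_one_powi)
      have "sg n (?b y) = (- 1) powi ((n - 1) * (deg (gn y) - 1)) *s ?b y"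
        unfolding bas_def by (rule sign_by_homogeneous[OF homogeneous_axis])
      then have "mu2 [\<phi> (map ?b ws), sg n (?b y)] =
          (- 1) powi ((n - 1) * (deg (gn y) - 1) + deg (gn y)) *s (\<phi> (map ?b ws) \<star> ?b y)"
        by (simp add: mu2_pair tau_bas lin_scale[OF lin_sign_by] lin_scale[OF lin_alg_mult_right]
            vector_smult_assoc neg_one_powi)
      then have r: "esg zs *s mu2 [\<phi> (map ?b ws), sg n (?b y)] = (- 1) powi (n - 1) *s R0 s y (hat \<phi> ws)"
        by (simp add: y esg_snoc ws R0_def hat_def lin_scale[OF lin_alg_mult_left] vector_smult_assoc
            neg_one_powi)
      have i: "esg zs *s ins tau \<phi> mu2 (map ?b zs) = (- 1) powi (n - s + 1) *s D0 (hat \<phi>) zs"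
        using hat_inner[OF \<phi>'(2), of zs] True by simp
      have e: "ins (sg n) mu2 \<phi> (map ?b zs) = mu2 [\<phi> (map ?b ws), sg n (?b y)] + mu2 [?b x, \<phi> (map ?b ys)]"
        by (simp only: ins_mu2 ssum_add left right)
      have "hat (hoch_diff n \<phi>) zs = (- 1) powi (n - 1) *s R0 s y (hat \<phi> ws) + (- 1) powi s *s Lk 0 x (hat \<phi> ys)
          - (- 1) powi (n - 1) *s ((- 1) powi (n - s + 1) *s D0 (hat \<phi>) zs)"
        unfolding l[symmetric] r[symmetric] i[symmetric]
        unfolding hat_def[of "hoch_diff n \<phi>"] hoch_diff_ins e vector_add_ldistrib vec.scale_right_diff_distrib
          vec.scale_left_commute[of "esg zs"] by (rule refl)
      moreover have "d (hat \<phi>) zs = Lk 0 x (hat \<phi> ys) - (D0 (hat \<phi>) zs + (- 1) powi (n - s) *s R0 s y (hat \<phi> ws))"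
        using DR_snoc[of "R0 s" "hat \<phi>" ws y, OF lin_R] by (simp add: dd_def x[symmetric] ws y[symmetric])
          (simp add: x)
      ultimately show ?thesis
        by (simp add: vec.scale_right_diff_distrib vector_add_ldistrib vector_smult_assoc neg_one_powi
            vector_sneg_minus1[symmetric])
    qed
  qed
qed

text \<open>Coordinates modulo the unit: since \<open>f0 = alg_one - e0\<close>, the coordinate at
  \<open>e0\<close> is a difference. Normalized cochains see nothing else.\<close>

definition crd :: "'k::field alg \<Rightarrow> ib \<Rightarrow> 'k" where
  "crd x i = (if i = Ie then x $ E0 - x $ F0 else x $ gn i)"

lemma crd_expand: "x = x $ F0 *s alg_one + (\<Sum>i\<in>UNIV. crd x i *s bas i)"
  by (simp add: vec_eq_gen all_gen UNIV_ib crd_def alg_one_def bas_def axis_def)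

lemma crd_bas: "crd (bas j) i = (if i = j then 1 else 0)"
  by (cases i; cases j) (simp_all add: crd_def bas_def axis_def)

lemma crd_alg_one: "crd alg_one i = 0"
  by (cases i) (simp_all add: crd_def alg_one_def axis_def)

lemma crd_lin: "crd (x + y) i = crd x i + crd y i" "crd (c *s x) i = c * crd x i"
  by (simp_all add: crd_def algebra_simps)

lemma crd_homogeneous: "homogeneous d x \<Longrightarrow> crd x i \<noteq> 0 \<Longrightarrow> d = deg (gn i)"
proof (cases i)
  case Ie
  assume "homogeneous d x" "crd x i \<noteq> 0"
  moreover have "x $ E0 \<noteq> 0 \<or> x $ F0 \<noteq> 0" using \<open>crd x i \<noteq> 0\<close> Ie by (auto simp: crd_def)
  ultimately show ?thesis using Ie unfolding homogeneous_def by fastforce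
qed (auto simp: homogeneous_def crd_def)

lemma hat_inject:
  assumes "multilinear \<phi>" "normalized \<phi>" "multilinear \<psi>" "normalized \<psi>" "\<And>zs. hat \<phi> zs = hat \<psi> zs"
  shows "\<phi> = \<psi>"
proof
  fix xs
  have ex: "F (map bas is @ x # xs) = (\<Sum>i\<in>UNIV. crd x i *s F (map bas (is @ [i]) @ xs))"
    if "multilinear F" "normalized F" for F :: "'a cochain" and "is" x xs
  proof -
    have "F (map bas is @ x # xs) =
        F (map bas is @ (x $ F0 *s alg_one + (\<Sum>i\<in>UNIV. crd x i *s bas i)) # xs)"
      using crd_expand[of x] by simp
    also have "\<dots> = x $ F0 *s F (map bas is @ alg_one # xs) + (\<Sum>i\<in>UNIV. crd x i *s F (map bas is @ bas i # xs))"
      by (simp only: lin_add[OF mlin_lin[OF that(1)]] lin_sum[OF mlin_lin[OF that(1)]]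
          lin_scale[OF mlin_lin[OF that(1)]])
    finally show ?thesis using that(2) by (simp add: normalized_def)
  qed
  have "\<phi> (map bas is @ xs) = \<psi> (map bas is @ xs)" for "is"
  proof (induction xs arbitrary: "is")
    case Nil
    have "esg is *s (esg is *s \<phi> (map bas is)) = esg is *s (esg is *s \<psi> (map bas is))"
      using assms(5)[of "is"] by (simp add: hat_def)
    then show ?case by (simp add: vector_smult_assoc esg_sq)
  next
    case (Cons x xs)
    show ?case by (simp only: ex[OF assms(1,2)] ex[OF assms(3,4)] Cons.IH)
  qed
  from this[of "[]"] show "\<phi> xs = \<psi> xs" by simp
qed

fun ext :: "'k::field word_cochain \<Rightarrow> 'k cochain" where
  "ext f [] = f []"
| "ext f (x # xs) = (\<Sum>i\<in>UNIV. crd x i *s ext (\<lambda>l. f (i # l)) xs)"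

lemma mlin_ext: "multilinear (ext f)"
  unfolding multilinear_iff_lin
proof (intro allI)
  show "lin (\<lambda>x. ext f (us @ x # ws))" for us ws
  proof (induction us arbitrary: f)
    case Nil
    show ?case
      by (rule linI) (simp_all add: crd_lin vec.scale_left_distrib sum.distrib vec.scale_sum_right vector_smult_assoc)
  next
    case (Cons u us)
    show ?case using Cons.IH by (auto intro!: lin_sumI lin_cmult)
  qed
qed

lemma ext_one: "alg_one \<in> set xs \<Longrightarrow> ext f xs = 0"
  by (induction xs arbitrary: f) (auto simp: crd_alg_one)

lemma ext_bas: "ext f (map bas zs) = f zs"
proof (induction zs arbitrary: f)
  case (Cons z zs)
  have "crd (bas z) i *s ext (\<lambda>l. f (i # l)) (map bas zs) = (if i = z then f (z # zs) else 0)" for i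
    by (simp add: crd_bas Cons)
  then show ?case by simp
qed simp

lemma ext_arity: "ar r f \<Longrightarrow> length xs \<noteq> r \<Longrightarrow> ext f xs = 0"
proof (induction xs arbitrary: f r)
  case (Cons x xs)
  have "ext (\<lambda>l. f (i # l)) xs = 0" for i
  proof (cases r)
    case 0
    then have "(\<lambda>l. f (i # l)) = (\<lambda>l. 0)" using Cons.prems by (auto simp: ar_def)
    moreover have "ext (\<lambda>l. 0) ys = 0" for ys :: "'a alg list" by (induction ys) simp_all
    ultimately show ?thesis by simp
  next
    case (Suc r')
    then show ?thesis using Cons.prems by (intro Cons.IH[of r']) (auto simp: ar_def)
  qed
  then show ?case by simp
qed (simp add: ar_def)

lemma ext_homogeneous:
  assumes "list_all2 homogeneous ds xs" "\<And>zs. homogeneous (wt zs + s) (f zs)"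
  shows "homogeneous (sum_list ds + s) (ext f xs)"
  using assms
proof (induction xs arbitrary: f ds s rule: list.induct)
  case (Cons x xs)
  then obtain d ds' where ds: "ds = d # ds'" "homogeneous d x" "list_all2 homogeneous ds' xs"
    by (auto simp: list_all2_Cons2)
  have "homogeneous (sum_list ds + s) (crd x i *s ext (\<lambda>l. f (i # l)) xs)" for i
  proof (cases "crd x i = 0")
    case False
    then have d: "d = deg (gn i)" using crd_homogeneous ds(2) by blast
    have "homogeneous (wt zs + (deg (gn i) + s)) (f (i # zs))" for zs
      using Cons.prems(2)[of "i # zs"] by (simp add: wt_simps algebra_simps)
    then have "homogeneous (sum_list ds' + (deg (gn i) + s)) (ext (\<lambda>l. f (i # l)) xs)"
      by (rule Cons.IH[OF ds(3)])
    then show ?thesis by (intro homogeneous_scale) (simp add: ds(1) d algebra_simps)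
  qed simp
  then show ?case by (simp add: homogeneous_sum)
next
  case Nil
  then show ?case using Nil.prems(2)[of "[]"] by (simp add: wt_simps)
qed

section \<open>Passage between cochains and their values on words\<close>

lemma wc_homogeneous: "wc s r f \<Longrightarrow> homogeneous (wt zs + s) (f zs)"
  unfolding homogeneous_def
proof (intro allI impI)
  fix g assume "wc s r f" "f zs $ g \<noteq> 0"
  then have "dgk s 0 g = wt zs" by (intro pr_degree[of _ f]) (simp_all add: wc_def)
  then show "deg g = wt zs + s" by (simp add: dgk_def)
qed

lemma unhat:
  assumes "wc s r f" "int r = n - s"
  obtains \<phi> where "\<phi> \<in> CC n s" "hat \<phi> = f"
proof
  let ?f = "\<lambda>zs. esg zs *s f zs"
  show "ext ?f \<in> CC n s"
    unfolding CC_iff fam_def normalized_def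
  proof (intro conjI allI impI)
    show "multilinear (ext ?f)" by (rule mlin_ext)
    have a: "ar r ?f" using assms(1) by (simp add: wc_def ar_def)
    show z: "ext ?f xs = 0" if "int (length xs) \<noteq> n - s" for xs
      by (rule ext_arity[OF a]) (use that assms(2) in auto)
    show "ext ?f xs = 0" if "alg_one \<in> set xs" for xs using that by (rule ext_one)
    fix ds and xs :: "'a alg list" assume h: "list_all2 homogeneous ds xs"
    show "homogeneous (sum_list ds + n - int (length xs)) (ext ?f xs)"
    proof (cases "int (length xs) = n - s")
      case True
      have "homogeneous (sum_list ds + s) (ext ?f xs)"
        by (rule ext_homogeneous[OF h]) (intro homogeneous_scale wc_homogeneous[OF assms(1)])
      moreover have "sum_list ds + n - int (length xs) = sum_list ds + s" using True by simp
      ultimately show ?thesis by (simp only:)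
    qed (simp add: z)
  qed
  show "hat (ext ?f) = f" by (rule ext) (simp add: hat_def ext_bas vector_smult_assoc esg_sq)
qed

lemma wc_hat:
  assumes "\<phi> \<in> CC n s" "int r = n - s"
  shows "wc s r (hat \<phi>)"
  unfolding wc_def ar_def
proof (intro conjI allI impI)
  note \<phi> = CC_D[OF assms(1)]
  show z: "hat \<phi> zs = 0" if "length zs \<noteq> r" for zs
    using \<phi>(3)[of "map bas zs"] that assms(2) by (auto simp: hat_def)
  have "prj (dgk s 0) (wt zs) (hat \<phi> zs) = hat \<phi> zs" for zs
  proof (cases "length zs = r")
    case True
    have "list_all2 homogeneous (map (\<lambda>z. deg (gn z)) zs) (map bas zs :: 'a alg list)"
      by (simp add: list_all2_conv_all_nth bas_def homogeneous_axis)
    then have "homogeneous (wt zs + n - int (length zs)) (\<phi> (map bas zs))"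
      using \<phi>(1) unfolding fam_def wt_def by fastforce
    then show ?thesis
      using True assms(2) by (auto simp: hat_def vec_eq_iff prj_nth dgk_def homogeneous_def)
  qed (simp add: z lin_0[OF lin_prj])
  then show "pr (dgk s 0) (hat \<phi>) = hat \<phi>" by (simp add: pr_def fun_eq_iff)
qed

text \<open>The primitive \<open>\<psi>\<close> is arbitrary, neither homogeneous nor of one arity;
  \<open>wc_exact\<close> cuts it down before it is turned back into a cochain.\<close>

lemma coboundary_of_word:
  assumes \<phi>: "\<phi> \<in> CC n s" and r: "int (Suc r) = n - s"
    and ex: "\<And>zs. hat \<phi> zs = dd (Lk 0) (R0 s) \<psi> zs"
  shows "\<phi> \<in> coboundaries n s"
proof -
  have "wc s (Suc r) (hat \<phi>)" by (rule wc_hat[OF \<phi> r])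
  then obtain \<theta> where \<theta>: "wc s r \<theta>" "\<And>zs. hat \<phi> zs = dd (Lk 0) (R0 s) \<theta> zs"
    using wc_exact ex by blast
  have "int r = (n - 1) - s" using r by simp
  then obtain \<eta> where \<eta>: "\<eta> \<in> CC (n - 1) s" "hat \<eta> = \<theta>" using unhat[OF \<theta>(1)] by blast
  let ?\<eta> = "\<lambda>xs. (- 1) powi s *s \<eta> xs"
  have \<eta>': "?\<eta> \<in> CC (n - 1) s" by (rule CC_scale[OF \<eta>(1)])
  have "hat (hoch_diff (n - 1) ?\<eta>) zs = (- 1) powi s *s hat (hoch_diff (n - 1) \<eta>) zs" for zs
    by (simp add: hat_def hoch_diff_scale vector_smult_assoc mult.commute)
  then have "hat (hoch_diff (n - 1) ?\<eta>) zs = hat \<phi> zs" for zs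
    using hat_hoch_diff[OF \<eta>(1)] by (simp add: \<eta>(2) \<theta>(2) vector_smult_assoc powi_cancel)
  moreover have "hoch_diff (n - 1) ?\<eta> \<in> CC n s" using hoch_diff_CC[OF \<eta>'] by simp
  ultimately have "hoch_diff (n - 1) ?\<eta> = \<phi>"
    using CC_D[OF \<phi>] CC_D[of "hoch_diff (n - 1) ?\<eta>" n s] by (intro hat_inject) auto
  then show ?thesis using \<eta>' unfolding coboundaries_def by (metis image_eqI)
qed

lemma word_of_coboundary:
  assumes "\<phi> \<in> coboundaries n s"
  obtains \<psi> where "\<And>zs. hat \<phi> zs = dd (Lk 0) (R0 s) \<psi> zs"
proof -
  obtain \<eta> where \<eta>: "\<eta> \<in> CC (n - 1) s" "\<phi> = hoch_diff (n - 1) \<eta>"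
    using assms by (auto simp: coboundaries_def)
  let ?\<eta> = "\<lambda>xs. (- 1) powi s *s \<eta> xs"
  have "?\<eta> \<in> CC (n - 1) s" by (rule CC_scale[OF \<eta>(1)])
  from hat_hoch_diff[OF this] have "(- 1) powi s *s hat \<phi> zs = (- 1) powi s *s dd (Lk 0) (R0 s) (hat ?\<eta>) zs" for zs
    by (simp add: \<eta>(2) hat_def hoch_diff_scale vector_smult_assoc mult.commute)
  then have "(- 1) powi s *s ((- 1) powi s *s hat \<phi> zs) =
      (- 1) powi s *s ((- 1) powi s *s dd (Lk 0) (R0 s) (hat ?\<eta>) zs)" for zs by simp
  then have "hat \<phi> zs = dd (Lk 0) (R0 s) (hat ?\<eta>) zs" for zs
    by (simp add: vector_smult_assoc powi_cancel)
  then show ?thesis by (rule that)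
qed

lemma word_of_cocycle: "\<phi> \<in> cocycles n s \<Longrightarrow> dd (Lk 0) (R0 s) (hat \<phi>) zs = 0"
proof -
  assume "\<phi> \<in> cocycles n s"
  then have "(- 1) powi s *s dd (Lk 0) (R0 s) (hat \<phi>) zs = 0"
    using hat_hoch_diff[of \<phi> n s zs] by (simp add: cocycles_def hat_def)
  then show ?thesis by (simp add: neg_one_powi split: if_splits)
qed

theorem HH_vanishing:
  assumes "CHAR('k::field) \<notin> {2, 3}" "exact_range n s" "\<phi> \<in> cocycles n s"
  shows "(\<phi> :: 'k cochain) \<in> coboundaries n s"
proof -
  define r where "r = nat (n - s) - 1"
  have r: "int (Suc r) = n - s" using assms(2) by (auto simp: r_def exact_range_def)
  have \<phi>: "\<phi> \<in> CC n s" using assms(3) by (simp add: cocycles_def)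
  obtain \<psi> where "\<And>zs. hat \<phi> zs = dd (Lk 0) (R0 s) \<psi> zs"
    using word_exact[OF assms(1,2) r wc_hat[OF \<phi> r] word_of_cocycle[OF assms(3)]] by blast
  then show ?thesis by (rule coboundary_of_word[OF \<phi> r])
qed

section \<open>The one-dimensional groups\<close>

lemma one_dimensionalI:
  fixes w :: "'k::field word_cochain"
  assumes r: "int (Suc r) = n - s" and w: "wc s (Suc r) w" "\<And>zs. dd (Lk 0) (R0 s) w zs = 0"
    and gen: "\<And>f. wc s (Suc r) f \<Longrightarrow> (\<And>zs. dd (Lk 0) (R0 s) f zs = 0) \<Longrightarrow>
      \<exists>t \<psi>. \<forall>zs. f zs = t *s w zs + dd (Lk 0) (R0 s) \<psi> zs"
    and ne: "\<And>t \<psi>. (\<And>zs. t *s w zs = dd (Lk 0) (R0 s) \<psi> zs) \<Longrightarrow> t = 0"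
  shows "HH_one_dimensional TYPE('k) n s"
proof -
  obtain \<gamma> where \<gamma>: "\<gamma> \<in> CC n s" "hat \<gamma> = w" using unhat[OF w(1) r] by blast
  have "hat (hoch_diff n \<gamma>) zs = 0" for zs using hat_hoch_diff[OF \<gamma>(1), of zs] w(2) \<gamma>(2) by simp
  moreover have h: "hoch_diff n \<gamma> \<in> CC (n + 1) s" by (rule hoch_diff_CC[OF \<gamma>(1)])
  ultimately have "hoch_diff n \<gamma> = (\<lambda>_. 0)"
    using CC_D[OF h] by (intro hat_inject) (auto simp: hat_def normalized_def)
  then have \<gamma>c: "\<gamma> \<in> cocycles n s" using \<gamma>(1) by (simp add: cocycles_def)
  have hs: "hat (\<lambda>xs. \<phi> xs - t *s \<psi> xs) zs = hat \<phi> zs - t *s hat \<psi> zs" for \<phi> \<psi> :: "'k cochain" and t zs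
    by (simp add: hat_def vec.scale_right_diff_distrib vector_smult_assoc mult.commute)
  have ex: "\<exists>t. HH_class n s \<phi> = HH_class n s (\<lambda>xs. t *s \<gamma> xs)" if coc: "\<phi> \<in> cocycles n s" for \<phi>
  proof -
    have \<phi>: "\<phi> \<in> CC n s" using coc by (simp add: cocycles_def)
    obtain t \<psi> where t: "\<And>zs. hat \<phi> zs = t *s w zs + dd (Lk 0) (R0 s) \<psi> zs"
      using gen[OF wc_hat[OF \<phi> r] word_of_cocycle[OF coc]] by blast
    have "(\<lambda>xs. \<phi> xs - t *s \<gamma> xs) \<in> coboundaries n s"
      by (rule coboundary_of_word[OF _ r, where \<psi> = \<psi>])
        (intro CC_diff CC_scale \<phi> \<gamma>(1), simp add: hs \<gamma>(2) t)
    then show ?thesis by (auto simp: HH_class_eq_iff)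
  qed
  have uniq: "t = t'" if "HH_class n s (\<lambda>xs. t *s \<gamma> xs) = HH_class n s (\<lambda>xs. t' *s \<gamma> xs)" for t t'
  proof -
    have "(\<lambda>xs. t *s \<gamma> xs - t' *s \<gamma> xs) \<in> coboundaries n s" using that by (simp add: HH_class_eq_iff)
    then have "(\<lambda>xs. (t - t') *s \<gamma> xs) \<in> coboundaries n s" by (simp add: vec.scale_left_diff_distrib)
    then obtain \<psi> where "\<And>zs. hat (\<lambda>xs. (t - t') *s \<gamma> xs) zs = dd (Lk 0) (R0 s) \<psi> zs"
      using word_of_coboundary by blast
    moreover have "hat (\<lambda>xs. (t - t') *s \<gamma> xs) zs = (t - t') *s w zs" for zs
      unfolding \<gamma>(2)[symmetric] hat_def by (rule vec.scale_left_commute)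
    ultimately have "t - t' = 0" using ne by metis
    then show ?thesis by simp
  qed
  show ?thesis
    unfolding HH_one_dimensional_def
  proof (intro bexI[of _ "HH_class n s \<gamma>"] ballI)
    show "HH_class n s \<gamma> \<in> HH n s" using \<gamma>c by (simp add: HH_def)
    fix x :: "'k cochain set" assume "x \<in> HH n s"
    then obtain \<phi> where "\<phi> \<in> cocycles n s" "x = HH_class n s \<phi>" by (auto simp: HH_def)
    then show "\<exists>!t. x = HH_scale n s t (HH_class n s \<gamma>)"
      using ex uniq by (metis HH_scale_class)
  qed
qed

text \<open>The generator is the \<open>(m + 1)\<close>-fold shift of the constant \<open>v\<close>.
  If a nonzero multiple were exact, \<open>periodic_injective\<close> would undo \<open>m\<close>
  shifts and \<open>no_low_arity1\<close> would exclude the last one.\<close>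

lemma one_dimensional_aux:
  fixes v :: "'k::field alg"
  assumes s: "(m, s) \<in> {(2, -4), (3, -6)}" and r: "r = 2 * m + 1"
    and v: "\<And>x. Lk (Suc m) x v = R0 s x v" "v \<noteq> 0" "prj (dgk s (Suc m)) 0 v = v"
    and gen: "\<And>g. pr (dgk s (Suc m)) g = g \<Longrightarrow> (\<And>zs. dd (Lk (Suc m)) (R0 s) g zs = 0) \<Longrightarrow>
      \<exists>t. g [] = t *s v"
  shows "HH_one_dimensional TYPE('k) 2 s"
proof -
  let ?w = "Sit (Suc m) (cst v)"
  have cv: "dd (Lk (Suc m)) (R0 s) (cst v) zs = 0" for zs
    by (simp add: dd_cst v(1) split: list.split)
  have pc: "pr (dgk s (Suc m)) (cst v) = cst v"
    by (auto simp: pr_def cst_def fun_eq_iff wt_simps v(3) lin_0[OF lin_prj])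
  have r': "int (Suc r) = 2 - s" using s r by auto
  have r2: "Suc r = 0 + 2 * Suc m" using r by simp
  show ?thesis
  proof (rule one_dimensionalI[OF r'])
    show "wc s (Suc r) ?w"
      unfolding wc_def
    proof
      show "ar (Suc r) ?w" unfolding r2 by (rule Sit_ar[OF ar_cst])
      have "pr (dgk s 0) ?w zs = ?w zs" for zs using Sit_pr[of "Suc m" s "cst v" zs] by (simp only: pc)
      then show "pr (dgk s 0) ?w = ?w" by auto
    qed
    show "dd (Lk 0) (R0 s) ?w zs = 0" for zs
      unfolding d_Sit by (rule Sit_zero) (rule cv)
    show "\<exists>t \<psi>. \<forall>zs. f zs = t *s ?w zs + dd (Lk 0) (R0 s) \<psi> zs"
      if f: "wc s (Suc r) f" "\<And>zs. dd (Lk 0) (R0 s) f zs = 0" for f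
    proof -
      obtain g \<psi> where g: "ar 0 g" "pr (dgk s (Suc m)) g = g" "\<And>zs. dd (Lk (Suc m)) (R0 s) g zs = 0"
          "\<And>zs. f zs = Sit (Suc m) g zs + dd (Lk 0) (R0 s) \<psi> zs"
        using wc_reduce[OF f(1)[unfolded r2] f(2)] by metis
      obtain t where "g [] = t *s v" using gen[OF g(2,3)] by blast
      then have "g = (\<lambda>l. t *s cst v l)" using ar0_eq_cst[OF g(1)] by (auto simp: cst_def fun_eq_iff)
      then have "f zs = t *s ?w zs + dd (Lk 0) (R0 s) \<psi> zs" for zs
        using g(4)[of zs] by (simp only: Sit_scale)
      then show ?thesis by blast
    qed
    show "t = 0" if ex: "\<And>zs. t *s ?w zs = dd (Lk 0) (R0 s) \<psi> zs" for t \<psi>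
    proof -
      let ?g = "\<lambda>l. t *s cst v l"
      have ag: "ar 0 ?g" by (simp add: ar_def cst_def)
      have "wc s (Suc r) (\<lambda>zs. t *s ?w zs)"
        unfolding wc_def
      proof
        have "ar (Suc r) (Sit (Suc m) ?g)" unfolding r2 by (rule Sit_ar[OF ag])
        then show "ar (Suc r) (\<lambda>zs. t *s ?w zs)" by (simp only: ar_def Sit_scale)
        have "pr (dgk s 0) (\<lambda>zs. t *s ?w zs) zs = t *s ?w zs" for zs
          using Sit_pr[of "Suc m" s "cst v" zs] by (simp only: pc) (simp only: pr_def lin_scale[OF lin_prj])
        then show "pr (dgk s 0) (\<lambda>zs. t *s ?w zs) = (\<lambda>zs. t *s ?w zs)" by auto
      qed
      then obtain \<phi> where \<phi>: "wc s r \<phi>" "\<And>zs. t *s ?w zs = dd (Lk 0) (R0 s) \<phi> zs"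
        using wc_exact ex by blast
      have 1: "Sit m (Sh (Lk m) ?g) zs = dd (Lk 0) (R0 s) \<phi> zs" for zs
        using \<phi>(2)[of zs] Sit_scale[of "Suc m" t "cst v" zs] by simp
      have "ar (1 + 2 * m) \<phi>" using \<phi>(1) r by (simp add: wc_def)
      moreover have "ar (Suc 1) (Sh (Lk m) ?g)"
        using bimodule.ar_Sh[OF bimodule_k ag] by simp
      ultimately obtain \<theta> where \<theta>: "ar 1 \<theta>" "\<And>zs. Sh (Lk m) ?g zs = dd (Lk m) (R0 s) \<theta> zs"
        using periodic_injective[OF 1] by blast
      have pg: "pr (dgk s (Suc m)) ?g = ?g"
        using fun_cong[OF pc] by (simp add: pr_def fun_eq_iff lin_scale[OF lin_prj])
      have "?g [] = 0" by (rule no_low_arity1[OF \<theta> s pg])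
      then show ?thesis using v(2) by (simp add: cst_def)
    qed
  qed
qed

text \<open>Arity 6 is reached after three shifts, with exchanged left action. There
  \<open>u + v\<close> is central: acting by \<open>u\<close> from the left means multiplying by
  \<open>v\<close>, and \<open>v (u + v) = vu = (u + v) u\<close>.\<close>

theorem HH_one_dimensional_4: "HH_one_dimensional TYPE('k::field) 2 (-4)"
proof (rule one_dimensional_aux[of 2 _ 5 "axis U 1 + axis V 1"])
  show "Lk (Suc 2) x (axis U 1 + axis V 1) = R0 (-4) x (axis U 1 + axis V 1 :: 'k alg)" for x
    by (cases x) (simp_all add: coord_simps)
  show "axis U 1 + axis V 1 \<noteq> (0 :: 'k alg)" by (simp add: vec_eq_gen all_gen axis_def)
  show "prj (dgk (-4) (Suc 2)) 0 (axis U 1 + axis V 1) = (axis U 1 + axis V 1 :: 'k alg)"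
    by (simp add: vec_eq_gen all_gen prj_nth axis_def dgk_def)
  show "\<exists>t. g [] = t *s (axis U 1 + axis V 1)"
    if "\<And>zs. dd (Lk (Suc 2)) (R0 (-4)) g zs = 0" for g :: "'k word_cochain"
    by (rule exI[of _ "g [] $ V"])
      (use arity0_odd(1-4)[OF that] arity0_odd(6)[OF that] in \<open>simp add: vec_eq_gen all_gen axis_def\<close>)
qed simp_all

text \<open>Arity 8 is reached after four shifts, where the left action is the original one and the
  unit is central because \<open>s\<close> is even. Degrees exclude \<open>e1\<close> and
  \<open>f1\<close>.\<close>

theorem HH_one_dimensional_6: "HH_one_dimensional TYPE('k::field) 2 (-6)"
proof (rule one_dimensional_aux[of 3 _ 7 "axis E0 1 + axis F0 1"])
  show "Lk (Suc 3) x (axis E0 1 + axis F0 1) = R0 (-6) x (axis E0 1 + axis F0 1 :: 'k alg)" for x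
    by (cases x) (simp_all add: coord_simps)
  show "axis E0 1 + axis F0 1 \<noteq> (0 :: 'k alg)" by (simp add: vec_eq_gen all_gen axis_def)
  show "prj (dgk (-6) (Suc 3)) 0 (axis E0 1 + axis F0 1) = (axis E0 1 + axis F0 1 :: 'k alg)"
    by (simp add: vec_eq_gen all_gen prj_nth axis_def dgk_def)
  show "\<exists>t. g [] = t *s (axis E0 1 + axis F0 1)"
    if p: "pr (dgk (-6) (Suc 3)) g = g" and "\<And>zs. dd (Lk (Suc 3)) (R0 (-6)) g zs = 0"
    for g :: "'k word_cochain"
  proof (rule exI[of _ "g [] $ E0"])
    have "g [] $ E1 = 0" "g [] $ F1 = 0"
      using pr_degree[OF p, of "[]" E1] pr_degree[OF p, of "[]" F1] by (auto simp: dgk_def wt_simps)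
    then show "g [] = g [] $ E0 *s (axis E0 1 + axis F0 1)"
      using arity0_even(1,2)[OF that(2)] arity0_even(4)[OF that(2)]
      by (simp add: vec_eq_gen all_gen axis_def)
  qed
qed simp_all


subsection \<open>Obstruction theory\<close>

definition ord :: "nat \<Rightarrow> 'k::field cochain \<Rightarrow> bool" where
  "ord d G \<longleftrightarrow> (\<forall>xs. length xs \<le> d \<longrightarrow> G xs = unit_map xs)"

definition agree :: "nat \<Rightarrow> 'k::field cochain \<Rightarrow> 'k cochain \<Rightarrow> bool" where
  "agree d M N \<longleftrightarrow> (\<forall>xs. length xs \<le> d \<longrightarrow> M xs = N xs)"

definition geq :: "'k::field cochain \<Rightarrow> 'k cochain \<Rightarrow> bool" where
  "geq M N \<longleftrightarrow> (\<exists>G. gau G \<and> hom G M N)"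

lemma geq_refl: "str M \<Longrightarrow> geq M M"
  using gau_unit_map hom_unit by (auto simp: geq_def)

lemma geq_trans: "geq M N \<Longrightarrow> geq N P \<Longrightarrow> str M \<Longrightarrow> str N \<Longrightarrow> str P \<Longrightarrow> geq M P"
  using hom_compose gau_blocks unfolding geq_def by blast

lemma geq_sym:
  assumes "geq M N" "str M" "str N"
  shows "geq N M"
proof -
  obtain G where G: "gau G" "hom G M N" using assms(1) by (auto simp: geq_def)
  obtain H where "gau H" "blocks G H = unit_map" "blocks H G = unit_map" using gau_inverse[OF G(1)] by blast
  then show ?thesis using hom_inverse[OF G(2,1)] assms(2,3) by (auto simp: geq_def)
qed

lemma str_agree_2: "str M \<Longrightarrow> agree 2 M mu2"
  unfolding agree_def
proof (intro allI impI)
  fix xs :: "'a alg list" assume "str M" "length xs \<le> 2"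
  then show "M xs = mu2 xs"
    by (cases xs rule: remdups_adj.cases) (auto simp: strD mu2_simps(1,2))
qed

text \<open>A block longer than \<open>d\<close> together with at least \<open>k - 1\<close> other
  arguments of \<open>E\<close> takes at least \<open>d + k\<close> letters.\<close>

lemma blocks_agree:
  assumes "multilinear E" "\<And>ys. length ys < k \<Longrightarrow> E ys = 0" "ord d G" "length xs + 1 \<le> d + k"
  shows "blocks E G xs = E xs"
  using assms(1,2,4)
proof (induction xs arbitrary: E k rule: length_induct)
  case (1 xs)
  note E = 1(2,3)
  show ?case
  proof (cases xs)
    case (Cons x ys)
    have "blocks (\<lambda>l. E (G (x # bs) # l)) G rs = E (unit_map (x # bs) # rs)" if b: "bs @ rs = ys" for bs rs
    proof -
      have l: "length (x # bs) + length rs = length xs" using b Cons by auto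
      have "blocks (\<lambda>l. E (G (x # bs) # l)) G rs = E (G (x # bs) # rs)"
        by (rule 1(1)[rule_format, of rs "\<lambda>l. E (G (x # bs) # l)" "k - 1"]) (use l 1(4) mlin_Cons[OF E(1)] E(2) in auto)
      moreover have "E (G (x # bs) # rs) = E (unit_map (x # bs) # rs)"
      proof (cases "length rs < k - 1")
        case True
        then show ?thesis by (simp add: E(2))
      next
        case False
        then have "length (x # bs) \<le> d" using l 1(4) by auto
        then show ?thesis using assms(3) by (simp add: ord_def)
      qed
      ultimately show ?thesis by simp
    qed
    then have "blocks E G xs = ssum (\<lambda>bs rs. E (unit_map (x # bs) # rs)) ys"
      unfolding Cons blocks.simps by (intro ssum_cong refl)
    also have "\<dots> = E (x # ys)"
      by (rule trans[OF ssum_head]) (auto simp: unit_map_Cons mlin_0_Cons[OF E(1)])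
    finally show ?thesis by (simp add: Cons)
  qed simp
qed

lemma blocks_cong_left:
  "(\<And>ys. length ys \<le> length xs \<Longrightarrow> F ys = F' ys) \<Longrightarrow> blocks F G xs = blocks F' G xs"
proof (induction xs arbitrary: F F' rule: length_induct)
  case (1 xs)
  show ?case
  proof (cases xs)
    case (Cons x ys)
    have "blocks (\<lambda>l. F (G (x # bs) # l)) G rs = blocks (\<lambda>l. F' (G (x # bs) # l)) G rs"
      if "bs @ rs = ys" for bs rs
      by (rule 1(1)[rule_format]) (use that Cons 1(2) in auto)
    then show ?thesis unfolding Cons blocks.simps by (intro ssum_cong refl)
  qed (use 1(2) in simp)
qed

lemma ins_cong:
  assumes "\<And>ys. length ys \<le> length xs + 1 \<Longrightarrow> F ys = F' ys" "\<And>ys. length ys \<le> length xs \<Longrightarrow> N ys = N' ys"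
  shows "ins S F N xs = ins S F' N' xs"
  unfolding ins_def by (intro ssum_cong refl) (use assms in auto)

text \<open>A non-zero composite needs at least \<open>a + b - 1\<close> arguments.\<close>

lemma ins_vanish:
  assumes "multilinear F" "\<And>ys. length ys < a \<Longrightarrow> F ys = 0" "\<And>ys. length ys < b \<Longrightarrow> N ys = 0"
    and "length xs + 1 < a + b"
  shows "ins S F N xs = 0"
proof -
  have "F (us @ N vs # map S ws) = 0" if "us @ vs @ ws = xs" for us vs ws
  proof (cases "length vs < b")
    case True
    then show ?thesis by (simp add: assms(3) mlin_0[OF assms(1)])
  next
    case False
    then show ?thesis using that assms(4) by (intro assms(2)) auto
  qed
  then show ?thesis unfolding ins_def
    by (intro trans[OF ssum_cong[OF refl] ssum_zero] trans[OF ssum_cong[OF refl] ssum_zero]) auto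
qed

text \<open>The two bounds exclude the non-linear terms: a higher map of arity at least
  \<open>k\<close> with an argument of arity above \<open>d\<close> starts in arity
  \<open>d + k\<close>, and the product of two values of \<open>?X\<close> starts in arity
  \<open>2 d + 2\<close>.\<close>

lemma step_eq:
  assumes M: "str M" and N: "str N" and G: "gau G" "hom G M N" "ord d G"
    and k: "agree (k - 1) M mu2" "agree (k - 1) N mu2" "k \<ge> 3"
    and xs: "length xs + 1 \<le> d + k" "length xs \<le> 2 * d + 1"
  shows "N xs = M xs - hoch_diff 1 (\<lambda>l. G l - unit_map l) xs"
proof -
  note M' = strD[OF M] and N' = strD[OF N] and G' = gauD[OF G(1)]
  let ?X = "\<lambda>l. G l - unit_map l"
  have mX: "multilinear ?X" by (rule gau_minus_unit(3)[OF G(1)])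
  have X0: "?X ys = 0" if "length ys \<le> d" for ys using G(3) that by (simp add: ord_def)
  have kM: "M ys - mu2 ys = 0" if "length ys < k" for ys using k(1) that by (auto simp: agree_def)
  have kN: "N ys - mu2 ys = 0" if "length ys < k" for ys using k(2) that by (auto simp: agree_def)
  have l2: "lin (\<lambda>z. mu2 [z, y])" "lin (\<lambda>z. mu2 [y, z])" for y :: "'a alg"
    using mlin_lin_Cons[OF mlin_mu2] mlin_lin[OF mlin_mu2, of "[y]" "[]"] by auto
  have "blocks N G xs = blocks (\<lambda>l. N l - mu2 l) G xs + blocks mu2 G xs"
    by (simp add: blocks_diff_left)
  also have "blocks (\<lambda>l. N l - mu2 l) G xs = N xs - mu2 xs"
    by (rule blocks_agree[where k = k and d = d])
      (use kN xs G(3) in \<open>auto intro: mlin_minus N'(2) mlin_mu2\<close>)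
  also have "blocks mu2 G xs = ssum (\<lambda>us vs. mu2 [unit_map us, unit_map vs] +
      (mu2 [?X us, unit_map vs] + mu2 [unit_map us, ?X vs])) xs"
    unfolding blocks_mu2[where G = G, OF G'(3)]
  proof (intro ssum_cong refl)
    fix us vs assume uv: "us @ vs = xs"
    have "mu2 [G us, G vs] = mu2 [unit_map us + ?X us, unit_map vs + ?X vs]" by simp
    also have "\<dots> = mu2 [unit_map us, unit_map vs] + mu2 [unit_map us, ?X vs] +
        (mu2 [?X us, unit_map vs] + mu2 [?X us, ?X vs])"
      by (simp only: lin_add[OF l2(1)] lin_add[OF l2(2)] add_ac)
    also have "mu2 [?X us, ?X vs] = 0"
    proof (cases "length us \<le> d")
      case True
      then show ?thesis by (simp only: X0 mu2_0)
    next
      case False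
      then have "length vs \<le> d" using uv xs(2) by auto
      then show ?thesis by (simp only: X0 mu2_0)
    qed
    finally show "mu2 [G us, G vs] = mu2 [unit_map us, unit_map vs] +
      (mu2 [?X us, unit_map vs] + mu2 [unit_map us, ?X vs])" by (simp only: add_ac) simp
  qed
  also have "\<dots> = mu2 xs + ins id mu2 ?X xs"
    using blocks_mu2[of unit_map xs] by (simp add: ssum_add ins_mu2 blocks_unit_right[OF mlin_mu2])
  finally have L: "blocks N G xs = N xs + ins id mu2 ?X xs" by simp
  have "ins tau G M xs = ins tau (\<lambda>l. unit_map l + ?X l) M xs" by simp
  also have "\<dots> = M xs + ins tau ?X M xs"
    by (simp only: ins_add_left ins_unit_left[where N = M, OF M'(3)])
  also have "ins tau ?X M xs = ins tau ?X mu2 xs + ins tau ?X (\<lambda>l. M l - mu2 l) xs"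
    by (simp add: ins_diff_right[OF mX])
  also have "ins tau ?X (\<lambda>l. M l - mu2 l) xs = 0"
    by (rule ins_vanish[OF mX, where a = "Suc d" and b = k]) (use X0 kM xs(1) in auto)
  finally have "ins tau G M xs = M xs + ins tau ?X mu2 xs" by simp
  then show ?thesis
    using L G(2) by (simp add: hom_def hoch_diff_odd algebra_simps)
qed

lemma gauge_modify:
  assumes M: "str M" and \<psi>: "\<psi> \<in> CC 1 (1 - int d)" and d: "d \<ge> 2"
  obtains N G where "str N" "gau G" "hom G M N" "ord (d - 1) G" "agree d N M"
    "\<And>xs. length xs = Suc d \<Longrightarrow> N xs = M xs - hoch_diff 1 \<psi> xs"
proof -
  note \<psi>' = CC_D[OF \<psi>]
  define G where "G = (\<lambda>l. unit_map l + \<psi> l)"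
  have z: "\<psi> xs = 0" if "length xs \<noteq> d" for xs using \<psi>'(3) that by simp
  have G: "gau G"
    unfolding gau_def G_def using \<psi>' z d by (auto simp: fam_add fam_unit_map)
  obtain N where N: "str N" "hom G M N" using transfer[OF G M] by blast
  have o: "ord (d - 1) G" using z d by (auto simp: ord_def G_def)
  have X: "(\<lambda>l. G l - unit_map l) = \<psi>" by (simp add: G_def)
  have eq: "N xs = M xs - hoch_diff 1 \<psi> xs" if "length xs \<le> Suc d" for xs
    using step_eq[OF M N(1) G N(2) o, of 3 xs] str_agree_2[OF M] str_agree_2[OF N(1)] that d
    by (simp add: X)
  have "agree d N M"
    unfolding agree_def
  proof (intro allI impI)
    fix xs :: "'a alg list" assume l: "length xs \<le> d"
    then have "hoch_diff 1 \<psi> xs = 0" using CC_D(3)[OF hoch_diff_CC[OF \<psi>], of xs] by simp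
    then show "N xs = M xs" using eq[of xs] l by simp
  qed
  then show ?thesis using that[OF N(1) G N(2) o] eq by simp
qed

text \<open>The defining equations of a structure become the Maurer-Cartan equation for
  \<open>M - mu2\<close>.\<close>

lemma ins_str_expand:
  assumes "multilinear M"
  shows "ins tau M M xs = hoch_diff 2 (\<lambda>l. M l - mu2 l) xs + ins tau (\<lambda>l. M l - mu2 l) (\<lambda>l. M l - mu2 l) xs"
proof -
  have "multilinear (\<lambda>l. M l - mu2 l)" by (intro mlin_minus assms mlin_mu2)
  then show ?thesis
    by (simp add: hoch_diff_even ins_diff_left ins_diff_right mlin_mu2 assms mu2_mu2)
qed

lemma hoch_diff_str:
  assumes "str M"
  shows "hoch_diff 2 (\<lambda>l. M l - mu2 l) xs = - ins tau (\<lambda>l. M l - mu2 l) (\<lambda>l. M l - mu2 l) xs"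
  using ins_str_expand[OF strD(2)[OF assms], of xs] strD(7)[OF assms, of xs]
  by (simp add: eq_neg_iff_add_eq_0)

lemma str_E:
  assumes "str M"
  shows "fam 2 (\<lambda>l. M l - mu2 l)" "normalized (\<lambda>l. M l - mu2 l)" "multilinear (\<lambda>l. M l - mu2 l)"
  using strD[OF assms] by (auto simp: fam_diff fam_mu2 normalized_def mlin_minus mlin_mu2)

text \<open>In the difference of the two Maurer-Cartan equations each quadratic term contains a
  factor \<open>M - N\<close> of arity above \<open>d\<close> and one of arity at least 3, which
  together exceed arity \<open>d + 2\<close>.\<close>

lemma diff_cocycle:
  assumes M: "str M" and N: "str N" and d: "d \<ge> 2" "agree d M N"
  shows "piece (Suc d) (\<lambda>l. M l - N l) \<in> cocycles 2 (1 - int d)"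
proof -
  let ?D = "\<lambda>l. M l - N l" and ?E = "\<lambda>l. M l - mu2 l" and ?F = "\<lambda>l. N l - mu2 l"
  have fD: "fam 2 ?D" by (intro fam_diff strD(1) M N)
  have mD: "multilinear ?D" by (rule fam_mlin[OF fD])
  have CC: "piece (Suc d) ?D \<in> CC 2 (1 - int d)"
    by (rule piece_CC[OF fD]) (auto simp: strD(6)[OF M] strD(6)[OF N])
  have E0: "?E ys = 0" "?F ys = 0" if "length ys < 3" for ys
    using str_agree_2[OF M] str_agree_2[OF N] that by (auto simp: agree_def)
  have D0: "?D ys = 0" if "length ys < Suc d" for ys using d(2) that by (simp add: agree_def)
  have "hoch_diff 2 ?D xs = 0" if xs: "length xs = Suc (Suc d)" for xs
  proof -
    have "hoch_diff 2 ?D xs = hoch_diff 2 (\<lambda>l. ?E l - ?F l) xs" by simp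
    also have "\<dots> = ins tau ?F ?F xs - ins tau ?E ?E xs"
      by (simp only: hoch_diff_diff[of 2 ?E ?F] hoch_diff_str[OF M] hoch_diff_str[OF N]) simp
    also have "ins tau ?E ?E xs = ins tau ?F ?F xs + (ins tau ?F ?D xs + ins tau ?D ?E xs)"
    proof -
      have "ins tau ?E ?E xs = ins tau (\<lambda>l. ?F l + ?D l) ?E xs" by simp
      also have "\<dots> = ins tau ?F (\<lambda>l. ?F l + ?D l) xs + ins tau ?D ?E xs"
        using ins_add_left[of tau ?F ?D ?E xs] by simp
      finally show ?thesis by (simp only: ins_add_right[OF str_E(3)[OF N]] add.assoc)
    qed
    also have "ins tau ?F ?D xs = 0"
      by (rule ins_vanish[OF str_E(3)[OF N], where a = 3 and b = "Suc d"]) (use E0 D0 xs in auto)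
    also have "ins tau ?D ?E xs = 0"
      by (rule ins_vanish[OF mD, where b = 3 and a = "Suc d"]) (use E0 D0 xs in auto)
    finally show ?thesis by simp
  qed
  then show ?thesis using CC by (simp add: cocycles_def hoch_diff_piece[OF mD])
qed

lemma kill_step:
  assumes M: "str M" and N: "str N" and d: "d \<ge> 2" "agree d M N"
    and c: "piece (Suc d) (\<lambda>l. M l - N l) \<in> coboundaries 2 (1 - int d)"
  obtains P K where "str P" "gau K" "hom K M P" "ord (d - 1) K" "agree (Suc d) P N"
proof -
  obtain \<psi> where \<psi>: "\<psi> \<in> CC 1 (1 - int d)" "piece (Suc d) (\<lambda>l. M l - N l) = hoch_diff 1 \<psi>"
    using c by (auto simp: coboundaries_def)
  obtain P K where P: "str P" "gau K" "hom K M P" "ord (d - 1) K" "agree d P M"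
    "\<And>xs. length xs = Suc d \<Longrightarrow> P xs = M xs - hoch_diff 1 \<psi> xs"
    using gauge_modify[OF M \<psi>(1) d(1)] by blast
  have "agree (Suc d) P N"
    unfolding agree_def
  proof (intro allI impI)
    fix xs :: "'a alg list" assume "length xs \<le> Suc d"
    then consider "length xs \<le> d" | "length xs = Suc d" by linarith
    then show "P xs = N xs"
    proof cases
      case 1
      then show ?thesis using P(5) d(2) by (simp add: agree_def)
    next
      case 2
      then show ?thesis using P(6)[OF 2] fun_cong[OF \<psi>(2)[symmetric], of xs] 2 by (simp add: piece_def)
    qed
  qed
  then show ?thesis using that P(1-4) by blast
qed

lemma agree_mono: "agree d M N \<Longrightarrow> e \<le> d \<Longrightarrow> agree e M N"
  by (simp add: agree_def)

text \<open>An infinite composition of gauge transformations: the one that corrects arity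
  \<open>d + n + 1\<close> is the identity up to arity \<open>d + n - 1\<close>, so on a fixed list
  the partial composites become constant.\<close>

lemma geq_limit:
  assumes M: "str M" and N: "str N" and d: "d \<ge> 2" "agree d M N"
    and c: "\<And>P e. str P \<Longrightarrow> e \<ge> d \<Longrightarrow> agree e P N \<Longrightarrow>
      piece (Suc e) (\<lambda>l. P l - N l) \<in> coboundaries 2 (1 - int e)"
  shows "geq M N"
proof -
  define A where "A = (\<lambda>i (P, G). str P \<and> gau G \<and> hom G M P \<and> agree (d + i) P N)"
  define B where "B = (\<lambda>i (P :: 'a cochain, G :: 'a cochain) (P' :: 'a cochain, G' :: 'a cochain). agree (d + i - 1) G G')"
  have "\<exists>y. A (Suc n) y \<and> B n x y" if "A n x" for n x
  proof -
    obtain P G where x: "x = (P, G)" by force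
    have P: "str P" "gau G" "hom G M P" "agree (d + n) P N" using that by (auto simp: A_def x)
    have "d + n \<ge> 2" using d(1) by simp
    then obtain Q K where Q: "str Q" "gau K" "hom K P Q" "ord (d + n - 1) K" "agree (Suc (d + n)) Q N"
      using kill_step[OF P(1) N _ P(4) c[OF P(1) _ P(4)]] by (metis le_add1)
    have "agree (d + n - 1) G (blocks K G)"
      unfolding agree_def
    proof (intro allI impI)
      fix xs :: "'a alg list" assume "length xs \<le> d + n - 1"
      then have "blocks K G xs = blocks unit_map G xs"
        using Q(4) by (intro blocks_cong_left) (auto simp: ord_def)
      then show "G xs = blocks K G xs" by (simp add: blocks_unit_left gauD[OF P(2)])
    qed
    then have "A (Suc n) (Q, blocks K G) \<and> B n x (Q, blocks K G)"
      using Q P hom_compose[OF P(3) Q(3) P(2) Q(2) M P(1) Q(1)] gau_blocks[OF Q(2) P(2)]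
      by (auto simp: A_def B_def x)
    then show ?thesis by blast
  qed
  moreover have "A 0 (M, unit_map)"
    using M d(2) by (simp add: A_def gau_unit_map hom_unit)
  ultimately obtain f where f: "\<And>n. A n (f n)" "\<And>n. B n (f n) (f (Suc n))"
    using dependent_nat_choice[of A B] by metis
  define P where "P = (\<lambda>n. fst (f n))"
  define G where "G = (\<lambda>n. snd (f n))"
  have P: "str (P n)" "gau (G n)" "hom (G n) M (P n)" "agree (d + n) (P n) N" for n
    using f(1)[of n] by (auto simp: A_def P_def G_def case_prod_beta)
  have GG: "G n xs = G (Suc n) xs" if "length xs \<le> n + 1" for n xs
    using f(2)[of n] that d(1) by (auto simp: B_def G_def case_prod_beta agree_def)
  have stable: "G m xs = G n xs" if "length xs \<le> n + 1" "n \<le> m" for m n xs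
    using that(2)
  proof (induction m rule: dec_induct)
    case (step m)
    then show ?case using GG[of xs m] that(1) by simp
  qed simp
  \<comment> \<open>A diagonal choice: on a list \<open>xs\<close> the composites are constant from
    index \<open>length xs - 1\<close> on.\<close>
  define H where "H = (\<lambda>xs. G (length xs) xs)"
  have H: "H xs = G n xs" if "length xs \<le> n + 1" for n xs
  proof (cases "length xs \<le> n")
    case True
    then show ?thesis using stable[of xs "length xs" n] by (simp add: H_def)
  next
    case False
    then show ?thesis using stable[of xs n "length xs"] that by (simp add: H_def)
  qed
  have "fam 1 H"
  proof (rule fam_of_trunc)
    fix n
    have "trunc n H = trunc n (G n)" using H by (auto simp: trunc_def fun_eq_iff)
    then show "fam 1 (trunc n H)" using fam_trunc[OF gauD(1)[OF P(2)]] by simp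
  qed
  then have "gau H"
    using gauD[OF P(2)] by (simp add: gau_def H_def)
  moreover have "hom H M N"
    unfolding hom_def
  proof
    fix xs :: "'a alg list"
    let ?n = "length xs"
    have "blocks N H xs = blocks N (G ?n) xs" by (rule blocks_cong_le) (rule H, simp)
    also have "\<dots> = blocks (P ?n) (G ?n) xs"
      using P(4)[of ?n] by (intro blocks_cong_left) (simp add: agree_def)
    also have "\<dots> = ins tau (G ?n) M xs" using P(3)[of ?n] by (simp add: hom_def)
    also have "\<dots> = ins tau H M xs" by (rule ins_cong) (rule H[symmetric], simp, rule refl)
    finally show "blocks N H xs = ins tau H M xs" .
  qed
  ultimately show ?thesis by (auto simp: geq_def)
qed

definition red :: "'k::field cochain \<Rightarrow> bool" where
  "red M \<longleftrightarrow> str M \<and> agree 5 M mu2"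

text \<open>Quadratic terms of \<open>M - mu2\<close> start in arity 11, while closedness of the
  component of arity \<open>d\<close> is an equation in arity \<open>d + 1\<close>, at most
  10.\<close>

lemma red_cocycle:
  assumes "red M" "d \<in> {6..9}"
  shows "piece d M \<in> cocycles 2 (2 - int d)"
proof -
  have M: "str M" "agree 5 M mu2" using assms(1) by (auto simp: red_def)
  let ?E = "\<lambda>l. M l - mu2 l"
  have E0: "?E ys = 0" if "length ys < 6" for ys using M(2) that by (simp add: agree_def)
  have eq: "piece d M = piece d ?E"
    using assms(2) by (auto simp: piece_def fun_eq_iff mu2_eq_0)
  have "hoch_diff 2 ?E xs = 0" if "length xs = Suc d" for xs
    unfolding hoch_diff_str[OF M(1)] neg_equal_0_iff_equal
    by (rule ins_vanish[OF str_E(3)[OF M(1)], where a = 6 and b = 6]) (use E0 assms(2) that in auto)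
  moreover have "piece d ?E \<in> CC 2 (2 - int d)"
    using str_E(1,2)[OF M(1)] by (intro piece_CC) (auto simp: normalized_def)
  ultimately show ?thesis unfolding eq by (simp add: cocycles_def hoch_diff_piece[OF str_E(3)[OF M(1)]])
qed

text \<open>\<open>T\<close> consumes \<open>d\<close> of at most \<open>d + 1\<close> letters, so
  at most one other letter is present; \<open>K\<close> acts on it as the identity, and of
  \<open>M\<close> only \<open>mu2\<close> is reached.\<close>

lemma homotopy_leading:
  assumes T: "T \<in> CC 0 (- int d)" "d \<ge> 1" and M: "str M" and K: "gau K"
    and xs: "length xs \<le> Suc d"
  shows "tw K T M xs + ins tau T M xs = hoch_diff 0 T xs"
proof -
  note T' = CC_D[OF T(1)] and M' = strD[OF M]
  have Tz: "T ys = 0" if "length ys \<noteq> d" for ys using T'(3) that by simp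
  have "ins tau T M xs = ins tau T mu2 xs + ins tau T (\<lambda>l. M l - mu2 l) xs"
    by (simp add: ins_diff_right[OF T'(2)])
  also have "ins tau T (\<lambda>l. M l - mu2 l) xs = 0"
    by (rule ins_vanish[OF T'(2), where a = d and b = 3])
      (use Tz xs str_agree_2[OF M] in \<open>auto simp: agree_def\<close>)
  finally have 1: "ins tau T M xs = ins tau T mu2 xs" by simp
  have "blocks (\<lambda>l. M (l @ T vs # map tau ws)) K us = mu2 (us @ T vs # map tau ws)"
    if s: "us @ vs @ ws = xs" for us vs ws
  proof (cases "length vs = d")
    case False
    then show ?thesis by (simp add: Tz mlin_0[OF M'(2)] mlin_0[OF mlin_mu2])
  next
    case True
    then have l: "length us + length ws \<le> 1" using s xs by auto
    have M2: "M ys = mu2 ys" if "length ys \<le> 2" for ys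
      using str_agree_2[OF M] that by (simp add: agree_def)
    show ?thesis
    proof (cases us)
      case Nil
      then show ?thesis using l by (simp add: M2)
    next
      case (Cons y us')
      then have "us' = []" "ws = []" using l by auto
      then show ?thesis by (simp add: Cons blocks.simps gauD(4)[OF K] M2)
    qed
  qed
  then have "tw K T M xs = ins tau mu2 T xs"
    unfolding tw_def ins_def by (intro ssum_cong refl) auto
  then show ?thesis using 1 by (simp add: hoch_diff_even)
qed

section \<open>Invariance and completeness of the two classes\<close>

context
  fixes ty :: "'k::field itself"
  assumes ch: "CHAR('k) \<notin> {2, 3}"
begin

text \<open>The leading term of \<open>G\<close>, in arity \<open>d + 1\<close>, is closed because
  both structures vanish in arity \<open>d + 2\<close>, hence equals \<open>hoch_diff 0 T\<close>.
  The automorphism of \<open>M\<close> built from \<open>T\<close> starts with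
  \<open>unit_map - hoch_diff 0 T\<close>, so composing \<open>G\<close> with it removes the leading
  term and keeps source and target.\<close>

lemma kill_gauge:
  fixes M N :: "'k cochain"
  assumes M: "str M" and N: "str N" and G: "gau G" "hom G M N" "ord d G" and d: "d \<ge> 1"
    and z: "\<And>xs. length xs = d + 2 \<Longrightarrow> M xs = 0 \<and> N xs = 0"
  obtains H where "gau H" "hom H M N" "ord (Suc d) H"
proof -
  let ?X = "\<lambda>l. G l - unit_map l"
  note X = gau_minus_unit[OF G(1)]
  have "hoch_diff 1 ?X xs = 0" if "length xs = Suc (Suc d)" for xs
    using step_eq[OF M N G, of 3 xs] str_agree_2[OF M] str_agree_2[OF N] z[of xs] that d by simp
  moreover have "piece (Suc d) ?X \<in> CC 1 (- int d)"
    by (rule piece_CC[OF X(1)]) (use X(2) in \<open>auto simp: normalized_def\<close>)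
  ultimately have "piece (Suc d) ?X \<in> cocycles 1 (- int d)"
    by (simp add: cocycles_def hoch_diff_piece[OF X(3)])
  then have "piece (Suc d) ?X \<in> coboundaries 1 (- int d)"
    by (rule HH_vanishing[OF ch, rotated]) (use d in \<open>simp add: exact_range_def\<close>)
  then obtain T where T: "T \<in> CC 0 (- int d)" "piece (Suc d) ?X = hoch_diff 0 T"
    by (auto simp: coboundaries_def)
  note T' = CC_D[OF T(1)]
  have "T [] = 0" using T'(3)[of "[]"] d by simp
  then obtain K where K: "gau K" "hom K M M" "\<And>xs. K xs = unit_map xs - tw K T M xs - ins tau T M xs"
    using homotopy_automorphism[OF M T'(1,4)] by blast
  have K': "K xs = unit_map xs - hoch_diff 0 T xs" if "length xs \<le> Suc d" for xs
    using K(3)[of xs] homotopy_leading[OF T(1) d M K(1) that]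
    by (metis diff_diff_eq)
  have Td: "hoch_diff 0 T xs = ?X xs" if "length xs = Suc d" for xs
    using fun_cong[OF T(2), of xs] that by (simp add: piece_def)
  have T0: "hoch_diff 0 T xs = 0" if "length xs \<noteq> Suc d" for xs
    using fun_cong[OF T(2), of xs] that by (simp add: piece_def)
  have oK: "ord d K" using K' T0 by (simp add: ord_def)
  have "ord (Suc d) (blocks G K)"
    unfolding ord_def
  proof (intro allI impI)
    fix xs :: "'k alg list" assume l: "length xs \<le> Suc d"
    have "blocks ?X K xs = ?X xs"
      by (rule blocks_agree[OF X(3) _ oK, where k = "Suc d"])
        (use G(3) l d in \<open>auto simp: ord_def\<close>)
    then have "blocks G K xs = ?X xs + K xs"
      using blocks_minus_unit[of K G xs] gauD(3)[OF K(1)] by simp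
    also have "\<dots> = unit_map xs"
      using K'[OF l] Td[of xs] T0[of xs] G(3) l by (cases "length xs = Suc d") (auto simp: ord_def)
    finally show "blocks G K xs = unit_map xs" .
  qed
  moreover have "hom (blocks G K) M N" by (rule hom_compose[OF K(2) G(2) K(1) G(1) M M N])
  ultimately show ?thesis using that gau_blocks[OF G(1) K(1)] by blast
qed

lemma red_geq_classes:
  fixes M N :: "'k cochain"
  assumes M: "red M" and N: "red N" and g: "geq M N" and d: "d \<in> {6..9}"
  shows "(\<lambda>xs. piece d M xs - piece d N xs) \<in> coboundaries 2 (2 - int d)"
proof -
  have M': "str M" "agree 5 M mu2" and N': "str N" "agree 5 N mu2" using M N by (auto simp: red_def)
  have z: "M xs = 0 \<and> N xs = 0" if "length xs = e + 2" "e \<in> {1, 2, 3}" for xs e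
    using M'(2) N'(2) that by (auto simp: agree_def mu2_eq_0)
  obtain G1 where G1: "gau G1" "hom G1 M N" using g by (auto simp: geq_def)
  have o1: "ord 1 G1"
    unfolding ord_def
  proof (intro allI impI)
    fix xs :: "'k alg list" assume "length xs \<le> 1"
    then show "G1 xs = unit_map xs" using gauD[OF G1(1)] by (cases xs) auto
  qed
  obtain G2 where G2: "gau G2" "hom G2 M N" "ord 2 G2"
    using kill_gauge[OF M'(1) N'(1) G1 o1] z[of _ 1] by (auto simp: numeral_2_eq_2)
  obtain G3 where G3: "gau G3" "hom G3 M N" "ord 3 G3"
    using kill_gauge[OF M'(1) N'(1) G2] z[of _ 2] by (auto simp: numeral_3_eq_3)
  obtain G where G: "gau G" "hom G M N" "ord 4 G"
    using kill_gauge[OF M'(1) N'(1) G3] z[of _ 3] by auto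
  let ?X = "\<lambda>l. G l - unit_map l"
  note X = gau_minus_unit[OF G(1)]
  \<comment> \<open>Order 4 and the absence of maps in arities 3 to 5, that is \<open>k = 6\<close>,
    make both bounds of \<open>step_eq\<close> reach arity 9; with order 3 the second would stop at
    arity 7.\<close>
  have eq: "N xs = M xs - hoch_diff 1 ?X xs" if "length xs = d" for xs
    using step_eq[OF M'(1) N'(1) G, of 6 xs] M'(2) N'(2) that d by simp
  have pX: "piece (d - 1) ?X \<in> CC 1 (2 - int d)"
    by (rule piece_CC[OF X(1)]) (use X(2) d in \<open>auto simp: normalized_def\<close>)
  have "(\<lambda>xs. piece d M xs - piece d N xs) = hoch_diff 1 (piece (d - 1) ?X)"
  proof (rule ext)
    show "piece d M xs - piece d N xs = hoch_diff 1 (piece (d - 1) ?X) xs" for xs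
      by (subst hoch_diff_piece[OF X(3)]) (use eq[of xs] d in \<open>auto simp: piece_def\<close>)
  qed
  then show ?thesis using pX by (simp add: coboundaries_def)
qed

lemma kill_vanishing:
  fixes M N :: "'k cochain"
  assumes M: "str M" and N: "str N" and d: "d \<ge> 2" "agree d M N" "d \<noteq> 5" "d \<noteq> 7"
  shows "piece (Suc d) (\<lambda>l. M l - N l) \<in> coboundaries 2 (1 - int d)"
  by (rule HH_vanishing[OF ch _ diff_cocycle[OF M N d(1,2)]])
    (use d in \<open>auto simp: exact_range_def\<close>)

text \<open>Arities 3, 4 and 5 belong to the internal degrees -1, -2 and -3, where the second
  cohomology vanishes.\<close>

lemma red_exists:
  fixes M :: "'k cochain"
  assumes M: "str M"
  obtains N where "red N" "geq M N"
proof -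
  have step: "\<exists>P. str P \<and> geq M P \<and> agree (Suc d) P mu2"
    if h: "str N" "geq M N" "agree d N mu2" "d \<in> {2, 3, 4}" for N d
  proof -
    have d: "d \<ge> 2" "d \<noteq> 5" "d \<noteq> 7" using h(4) by auto
    obtain P K where P: "str P" "gau K" "hom K N P" "agree (Suc d) P mu2"
      using kill_step[OF h(1) str_mu2 d(1) h(3) kill_vanishing[OF h(1) str_mu2 d(1) h(3) d(2,3)]]
      by blast
    have "geq N P" using P by (auto simp: geq_def)
    then show ?thesis using P geq_trans[OF h(2) _ M h(1) P(1)] by blast
  qed
  obtain M3 where M3: "str M3" "geq M M3" "agree (Suc 2) M3 mu2"
    using step[OF M geq_refl[OF M] str_agree_2[OF M]] by auto
  obtain M4 where M4: "str M4" "geq M M4" "agree (Suc 3) M4 mu2"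
    using step[OF M3(1,2), of 3] M3(3) by (auto simp: numeral_3_eq_3 numeral_2_eq_2)
  obtain M5 where M5: "str M5" "geq M M5" "agree (Suc 4) M5 mu2"
    using step[OF M4(1,2), of 4] M4(3) by auto
  then show ?thesis using that by (simp add: red_def)
qed

lemma classes_geq:
  fixes M N :: "'k cochain"
  assumes M: "red M" and N: "red N"
    and c6: "(\<lambda>xs. piece 6 M xs - piece 6 N xs) \<in> coboundaries 2 (-4)"
    and c8: "(\<lambda>xs. piece 8 M xs - piece 8 N xs) \<in> coboundaries 2 (-6)"
  shows "geq M N"
proof -
  have M': "str M" "agree 5 M mu2" and N': "str N" "agree 5 N mu2" using M N by (auto simp: red_def)
  have pd: "piece d (\<lambda>l. P l - Q l) = (\<lambda>xs. piece d P xs - piece d Q xs)" for d and P Q :: "'k cochain"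
    by (simp add: piece_def fun_eq_iff)
  have "agree 5 M N" using M' N' by (simp add: agree_def)
  moreover have "piece (Suc 5) (\<lambda>l. M l - N l) \<in> coboundaries 2 (1 - int 5)" using c6 by (simp add: pd)
  ultimately obtain P1 K1 where P1: "str P1" "gau K1" "hom K1 M P1" "agree (Suc 5) P1 N"
    using kill_step[OF M'(1) N'(1), of 5 thesis] by simp
  have "piece (Suc 6) (\<lambda>l. P1 l - N l) \<in> coboundaries 2 (1 - int 6)"
    using kill_vanishing[OF P1(1) N'(1), of 6] P1(4) by simp
  then obtain P2 K2 where P2: "str P2" "gau K2" "hom K2 P1 P2" "agree (Suc 6) P2 N"
    using kill_step[OF P1(1) N'(1), of 6 thesis] P1(4) by simp
  have g2: "geq M P2"
    using P1 P2 geq_trans[of M P1 P2] M'(1) by (auto simp: geq_def)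
  have "agree 5 P2 mu2" using agree_mono[OF P2(4), of 5] N'(2) by (simp add: agree_def)
  then have "red P2" using P2(1) by (simp add: red_def)
  \<comment> \<open>Correcting arities 6 and 7 may change the component of arity 8, but not its
    class, so \<open>c8\<close> still applies after subtracting a coboundary.\<close>
  then have "(\<lambda>xs. piece 8 M xs - piece 8 P2 xs) \<in> coboundaries 2 (-6)"
    using red_geq_classes[OF M _ g2, of 8] by simp
  from coboundaries_diff[OF c8 this]
  have "piece (Suc 7) (\<lambda>l. P2 l - N l) \<in> coboundaries 2 (1 - int 7)" by (simp add: pd)
  then obtain P3 K3 where P3: "str P3" "gau K3" "hom K3 P2 P3" "agree (Suc 7) P3 N"
    using kill_step[OF P2(1) N'(1), of 7 thesis] P2(4) by simp
  have "geq P3 N"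
    by (rule geq_limit[OF P3(1) N'(1), of 8]) (use P3(4) N'(1) kill_vanishing in auto)
  moreover have "geq P2 P3" using P3 by (auto simp: geq_def)
  ultimately show ?thesis
    using g2 geq_trans[of M P2 P3] geq_trans[of M P3 N] M'(1) N'(1) P2(1) P3(1) by blast
qed

end


section \<open>Realization of prescribed classes\<close>

lemma ins_normalized:
  assumes "multilinear F" "normalized F" "normalized N"
  shows "normalized (ins tau F N)"
  unfolding normalized_def
proof (intro allI impI)
  fix xs :: "'a alg list" assume one: "alg_one \<in> set xs"
  have "F (us @ N vs # map tau ws) = 0" if s: "us @ vs @ ws = xs" for us vs ws
  proof -
    have "alg_one \<in> set us \<or> alg_one \<in> set vs \<or> alg_one \<in> set ws"
      using one unfolding s[symmetric] by simp
    then consider "alg_one \<in> set us" | "alg_one \<in> set vs" | "alg_one \<in> set ws" by blast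
    then show ?thesis
    proof cases
      case 1
      then show ?thesis using assms(2) by (simp add: normalized_def)
    next
      case 2
      then show ?thesis using assms(3) by (simp add: normalized_def mlin_0[OF assms(1)])
    next
      case 3
      then obtain as bs where "ws = as @ alg_one # bs" by (meson split_list)
      then show ?thesis
        using lin_uminus[OF mlin_lin[OF assms(1), of "us @ N vs # map tau as"]] assms(2)
        by (simp add: tau_alg_one normalized_def)
    qed
  qed
  then show "ins tau F N xs = 0" unfolding ins_def
    by (intro trans[OF ssum_cong[OF refl] ssum_zero] trans[OF ssum_cong[OF refl] ssum_zero]) auto
qed

text \<open>The first open equation is the one in arity \<open>d + 2\<close>; it can still be
  repaired by a change of the component of arity \<open>d + 1\<close>, which leaves the earlier
  equations intact.\<close>

definition pre :: "nat \<Rightarrow> 'k::field cochain \<Rightarrow> bool" where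
  "pre d M \<longleftrightarrow> fam 2 M \<and> agree 2 M mu2 \<and> normalized (\<lambda>l. M l - mu2 l) \<and>
     (\<forall>xs. length xs \<le> Suc d \<longrightarrow> ins tau M M xs = 0)"

text \<open>Bianchi identity: by \<open>ins_square\<close> the defect satisfies
  \<open>ins tau ?P M = ins id M ?P\<close>, and the lowest part of this equation is closedness of
  the leading term of \<open>?P\<close>.\<close>

lemma pre_obstruction:
  assumes "pre d M"
  shows "piece (d + 2) (ins tau M M) \<in> cocycles 3 (1 - int d)"
proof -
  let ?P = "ins tau M M" and ?E = "\<lambda>l. M l - mu2 l"
  have M: "fam 2 M" "normalized ?E" using assms by (auto simp: pre_def)
  have mM: "multilinear M" by (rule fam_mlin[OF M(1)])
  have fE: "fam 2 ?E" by (intro fam_diff M fam_mu2)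
  have mE: "multilinear ?E" by (rule fam_mlin[OF fE])
  have E0: "?E ys = 0" if "length ys < 3" for ys using assms that by (simp add: pre_def agree_def)
  have M0: "M [] = 0" using E0[of "[]"] by (simp add: mu2_simps)
  have P0: "?P ys = 0" if "length ys < d + 2" for ys using assms that by (simp add: pre_def)
  have fP: "fam 3 ?P" using fam_ins[OF M(1) M(1)] by simp
  have mP: "multilinear ?P" by (rule fam_mlin[OF fP])
  have "?P xs = 0" if "alg_one \<in> set xs" for xs
    using hoch_diff_normalized[OF M(2) fE] ins_normalized[OF mE M(2) M(2)] that
    by (simp add: ins_str_expand[OF mM] normalized_def)
  then have CC: "piece (d + 2) ?P \<in> CC 3 (1 - int d)" by (intro piece_CC[OF fP]) auto
  have "hoch_diff 3 ?P xs = 0" if xs: "length xs = d + 3" for xs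
  proof -
    have "ins tau ?P M xs = ins id M ?P xs" by (rule ins_square[OF mM M(1) M0])
    moreover have "ins tau ?P ?E xs = 0"
      by (rule ins_vanish[OF mP, where a = "d + 2" and b = 3]) (use P0 E0 xs in auto)
    moreover have "ins id ?E ?P xs = 0"
      by (rule ins_vanish[OF mE, where a = 3 and b = "d + 2"]) (use P0 E0 xs in auto)
    ultimately show ?thesis
      using ins_diff_right[OF mP, of tau M mu2 xs] ins_diff_left[of id M mu2 ?P xs]
      by (simp add: hoch_diff_odd)
  qed
  then show ?thesis using CC by (simp add: cocycles_def hoch_diff_piece[OF mP])
qed

lemma pre_step:
  fixes M :: "'k::field cochain"
  assumes ch: "CHAR('k) \<notin> {2, 3}" and M: "pre d M" and d: "d \<ge> 8"
  obtains N where "pre (Suc d) N" "agree d N M"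
proof -
  let ?P = "ins tau M M" and ?E = "\<lambda>l. M l - mu2 l"
  have M': "fam 2 M" "normalized ?E" using M by (auto simp: pre_def)
  have mM: "multilinear M" by (rule fam_mlin[OF M'(1)])
  have mE: "multilinear ?E" by (intro mlin_minus mM mlin_mu2)
  have E0: "?E ys = 0" if "length ys < 3" for ys using M that by (simp add: pre_def agree_def)
  \<comment> \<open>The bound \<open>d \<ge> 8\<close> puts the obstruction in internal degree
    \<open>1 - d\<close> at most -7, inside the vanishing range.\<close>
  have "piece (d + 2) ?P \<in> coboundaries 3 (1 - int d)"
    by (rule HH_vanishing[OF ch _ pre_obstruction[OF M]]) (use d in \<open>simp add: exact_range_def\<close>)
  then obtain \<eta> where \<eta>: "\<eta> \<in> CC 2 (1 - int d)" "piece (d + 2) ?P = hoch_diff 2 \<eta>"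
    by (auto simp: coboundaries_def)
  note \<eta>' = CC_D[OF \<eta>(1)]
  have \<eta>0: "\<eta> ys = 0" if "length ys \<noteq> Suc d" for ys using \<eta>'(3) that by simp
  define N where "N = (\<lambda>l. M l - \<eta> l)"
  have fN: "fam 2 N" unfolding N_def by (rule fam_diff[OF M'(1) \<eta>'(1)])
  have N_E: "N l - mu2 l = ?E l - \<eta> l" for l by (simp add: N_def)
  have "ins tau N N xs = 0" if xs: "length xs \<le> Suc (Suc d)" for xs
  proof -
    have z: "ins tau ?E \<eta> xs = 0" "ins tau \<eta> (\<lambda>l. ?E l - \<eta> l) xs = 0"
      by (rule ins_vanish[OF mE, where a = 3 and b = "Suc d"], use E0 \<eta>0 xs in auto)
        (rule ins_vanish[OF \<eta>'(2), where a = "Suc d" and b = 3], use E0 \<eta>0 xs d in auto)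
    have "ins tau N N xs = hoch_diff 2 (\<lambda>l. ?E l - \<eta> l) xs + ins tau (\<lambda>l. ?E l - \<eta> l) (\<lambda>l. ?E l - \<eta> l) xs"
      using ins_str_expand[OF fam_mlin[OF fN], of xs] by (simp only: N_E)
    also have "\<dots> = (hoch_diff 2 ?E xs + ins tau ?E ?E xs) - hoch_diff 2 \<eta> xs"
      using z hoch_diff_diff[of 2 ?E \<eta> xs] ins_diff_left[of tau ?E \<eta> "\<lambda>l. ?E l - \<eta> l" xs]
        ins_diff_right[OF mE, of tau ?E \<eta> xs] by simp
    also have "\<dots> = ?P xs - hoch_diff 2 \<eta> xs" by (simp only: ins_str_expand[OF mM])
    also have "\<dots> = 0"
      using fun_cong[OF \<eta>(2), of xs] M xs by (cases "length xs = d + 2") (auto simp: piece_def pre_def)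
    finally show ?thesis .
  qed
  then have "pre (Suc d) N"
    using fN M \<eta>0 d \<eta>'(4) by (auto simp: pre_def agree_def N_def normalized_def)
  moreover have "agree d N M" using \<eta>0 by (simp add: agree_def N_def)
  ultimately show ?thesis by (rule that)
qed

theorem red_realize:
  fixes \<phi> \<psi> :: "'k::field cochain"
  assumes ch: "CHAR('k) \<notin> {2, 3}" and \<phi>: "\<phi> \<in> cocycles 2 (-4)" and \<psi>: "\<psi> \<in> cocycles 2 (-6)"
  obtains M where "red M" "piece 6 M = \<phi>" "piece 8 M = \<psi>"
proof -
  have \<phi>C: "\<phi> \<in> CC 2 (-4)" and \<psi>C: "\<psi> \<in> CC 2 (-6)" using \<phi> \<psi> by (auto simp: cocycles_def)
  note \<phi>' = CC_D[OF \<phi>C] and \<psi>' = CC_D[OF \<psi>C]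
  have \<phi>0: "\<phi> ys = 0" if "length ys \<noteq> 6" for ys using \<phi>'(3) that by simp
  have \<psi>0: "\<psi> ys = 0" if "length ys \<noteq> 8" for ys using \<psi>'(3) that by simp
  let ?e = "\<lambda>l. \<phi> l + \<psi> l"
  define M0 where "M0 = (\<lambda>l. mu2 l + ?e l)"
  have fM0: "fam 2 M0" unfolding M0_def by (intro fam_add fam_mu2 \<phi>' \<psi>')
  have E: "(\<lambda>l. M0 l - mu2 l) = ?e" by (simp add: M0_def)
  \<comment> \<open>\<open>\<phi>\<close> and \<open>\<psi>\<close> compose in arity 11 at the
    earliest, so closedness alone gives the equations through arity 9. The later corrections, from
    \<open>d = 8\<close> on, leave arities up to 8 untouched, so both cochains survive.\<close>
  have "ins tau M0 M0 xs = 0" if "length xs \<le> Suc 8" for xs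
  proof -
    have "ins tau ?e ?e xs = 0"
      by (rule ins_vanish[where a = 6 and b = 6]) (use \<phi>0 \<psi>0 \<phi>' \<psi>' that in \<open>auto intro: mlin_plus\<close>)
    moreover have "hoch_diff 2 ?e xs = 0"
      using \<phi> \<psi> by (simp add: hoch_diff_add cocycles_def)
    ultimately show ?thesis by (simp add: ins_str_expand[OF fam_mlin[OF fM0]] E)
  qed
  then have pre0: "pre (8 + 0) M0"
    using fM0 \<phi>0 \<psi>0 \<phi>'(4) \<psi>'(4) by (auto simp: pre_def agree_def M0_def normalized_def)
  have "\<exists>N. pre (8 + Suc n) N \<and> agree (8 + n) N M" if "pre (8 + n) M" for n and M :: "'k cochain"
    using pre_step[OF ch that] by auto
  then obtain f where f: "\<And>n. pre (8 + n) (f n)" "\<And>n. agree (8 + n) (f (Suc n)) (f n)" "f 0 = M0"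
    using dependent_nat_choice[of "\<lambda>n M. pre (8 + n) M \<and> (n = 0 \<longrightarrow> M = M0)" "\<lambda>n M N. agree (8 + n) N M"] pre0
    by auto
  have stable: "f m xs = f n xs" if "length xs \<le> n + 8" "n \<le> m" for m n xs
    using that(2)
  proof (induction m rule: dec_induct)
    case (step m)
    then show ?case using f(2)[of m] that(1) by (simp add: agree_def)
  qed simp
  define M where "M = (\<lambda>xs. f (length xs) xs)"
  have M: "M xs = f n xs" if "length xs \<le> n + 8" for n xs
  proof (cases "length xs \<le> n")
    case True
    then show ?thesis using stable[of xs "length xs" n] by (simp add: M_def)
  next
    case False
    then show ?thesis using stable[of xs n "length xs"] that by (simp add: M_def)
  qed
  have M8: "M xs = M0 xs" if "length xs \<le> 8" for xs using M[of xs 0] that f(3) by simp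
  have "fam 2 M"
  proof (rule fam_of_trunc)
    fix n
    have "trunc n M = trunc n (f n)" using M by (auto simp: trunc_def fun_eq_iff)
    then show "fam 2 (trunc n M)" using fam_trunc[of 2 "f n" n] f(1)[of n] by (simp add: pre_def)
  qed
  moreover have "ins tau M M xs = 0" for xs
  proof -
    have "ins tau M M xs = ins tau (f (length xs)) (f (length xs)) xs"
      by (rule ins_cong) (rule M, simp)+
    then show ?thesis using f(1)[of "length xs"] by (simp add: pre_def)
  qed
  moreover have "M xs = mu2 xs" if "alg_one \<in> set xs" for xs
    using f(1)[of "length xs"] that by (simp add: M_def pre_def normalized_def)
  moreover have "agree 5 M mu2"
    using M8 \<phi>0 \<psi>0 by (simp add: agree_def M0_def)
  ultimately have "red M"
    by (auto simp: red_def str_def agree_def mu2_simps(1,2))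
  moreover have "piece 6 M = \<phi>" "piece 8 M = \<psi>"
    using M8 \<phi>0 \<psi>0 by (auto simp: piece_def fun_eq_iff M0_def mu2_eq_0)
  ultimately show ?thesis by (rule that)
qed


subsection \<open>Structures as families\<close>

definition whole :: "'k::field family \<Rightarrow> 'k cochain" where
  "whole \<mu> xs = \<mu> (length xs) xs"

definition pieces :: "'k::field cochain \<Rightarrow> 'k family" where
  "pieces M d = piece d M"

lemma whole_pieces: "whole (pieces M) = M"
  by (simp add: whole_def pieces_def piece_def fun_eq_iff)

lemma pieces_whole: "(\<And>d xs. length xs \<noteq> d \<Longrightarrow> \<mu> d xs = 0) \<Longrightarrow> pieces (whole \<mu>) = \<mu>"
  by (auto simp: whole_def pieces_def piece_def fun_eq_iff)

lemma fam_whole: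
  assumes "\<mu> 0 = (\<lambda>_. 0)" "\<And>d. d \<ge> 1 \<Longrightarrow> \<mu> d \<in> graded_maps (int d) (n - int d)"
  shows "fam n (whole \<mu>)" "length xs \<noteq> d \<Longrightarrow> \<mu> d xs = 0"
proof -
  have "\<mu> d xs = 0" if "length xs \<noteq> d" for d xs
    using assms(1) assms(2)[of d] that by (cases "d = 0") (auto simp: graded_maps_def)
  then show "length xs \<noteq> d \<Longrightarrow> \<mu> d xs = 0" by blast
  have m: "multilinear (\<mu> d)" for d
    using assms(1) assms(2)[of d] by (cases "d = 0") (auto simp: graded_maps_def)
  have "multilinear (whole \<mu>)"
    unfolding multilinear_iff_lin whole_def using mlin_lin[OF m] by simp
  moreover have "homogeneous (sum_list ds + n - int (length xs)) (whole \<mu> xs)"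
    if h: "list_all2 homogeneous ds xs" for ds xs
  proof (cases "xs = []")
    case True
    then show ?thesis using assms(1) by (simp add: whole_def)
  next
    case False
    then have "\<mu> (length xs) \<in> graded_maps (int (length xs)) (n - int (length xs))"
      by (intro assms(2)) (simp add: Suc_le_eq)
    then have "homogeneous (sum_list ds + (n - int (length xs))) (\<mu> (length xs) xs)"
      using h unfolding graded_maps_def by blast
    then show ?thesis by (simp add: whole_def algebra_simps)
  qed
  ultimately show "fam n (whole \<mu>)" by (simp add: fam_def)
qed

lemma piece_graded: "fam n F \<Longrightarrow> s = n - int d \<Longrightarrow> piece d F \<in> graded_maps (int d) s"
proof -
  assume F: "fam n F" and s: "s = n - int d"
  have "homogeneous (sum_list ds + s) (piece d F xs)" if h: "list_all2 homogeneous ds xs" for ds xs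
  proof (cases "length xs = d")
    case True
    have "homogeneous (sum_list ds + n - int (length xs)) (F xs)" using F h by (auto simp: fam_def)
    then show ?thesis using True by (simp add: piece_def s algebra_simps)
  qed (simp add: piece_def)
  then show ?thesis using fam_mlin[OF fam_piece[OF F]] by (auto simp: graded_maps_def piece_def)
qed

lemma ins_whole:
  "(\<Sum>(us, vs, ws)\<in>{(us, vs, ws). us @ vs @ ws = xs}.
     F (length us + 1 + length ws) (us @ \<mu> (length vs) vs # map (sign_by (\<lambda>k. k - 1)) ws)) =
   ins tau (whole F) (whole \<mu>) xs"
  unfolding ins_def by (subst sum_triples[symmetric]) (simp add: whole_def)

lemma minimal_str:
  assumes "\<mu> \<in> minimal_structures"
  shows "str (whole \<mu>)" "pieces (whole \<mu>) = \<mu>"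
proof -
  have \<mu>: "\<mu> 0 = (\<lambda>_. 0)" "\<And>d. d \<ge> 1 \<Longrightarrow> \<mu> d \<in> graded_maps (int d) (2 - int d)"
    "\<And>d. d \<ge> 3 \<Longrightarrow> \<mu> d \<in> CC 2 (2 - int d)" "\<mu> 1 = (\<lambda>_. 0)" "\<mu> 2 = mu2"
    "\<And>xs. ins tau (whole \<mu>) (whole \<mu>) xs = 0"
    using assms unfolding minimal_structures_def ainf_structure_def ins_whole by auto
  show "pieces (whole \<mu>) = \<mu>" by (rule pieces_whole) (rule fam_whole(2)[OF \<mu>(1,2)])
  have "whole \<mu> xs = mu2 xs" if "alg_one \<in> set xs" for xs
  proof -
    consider "length xs = 0" | "length xs = 1" | "length xs = 2" | "length xs \<ge> 3" by linarith
    then show ?thesis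
    proof cases
      case 4
      then have "\<mu> (length xs) \<in> CC 2 (2 - int (length xs))" by (rule \<mu>(3))
      then show ?thesis using that 4 by (simp add: whole_def CC_def mu2_eq_0)
    qed (use \<mu> in \<open>auto simp: whole_def mu2_eq_0\<close>)
  qed
  then show "str (whole \<mu>)"
    using fam_whole(1)[OF \<mu>(1,2)] \<mu>(1,4,5,6)
    by (auto simp: str_def) (auto simp: whole_def numeral_2_eq_2)
qed

lemma str_minimal:
  assumes "str M"
  shows "pieces M \<in> minimal_structures"
proof -
  note M = strD[OF assms]
  have eq: "piece 0 M = (\<lambda>_. 0)" "piece 1 M = (\<lambda>_. 0)" "piece 2 M = mu2"
    using M(3-5) by (auto simp: piece_def fun_eq_iff length_Suc_conv numeral_2_eq_2 mu2_eq_0)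
  have "piece d M \<in> CC 2 (2 - int d)" if "d \<ge> 3" for d
    by (rule piece_CC[OF M(1)]) (use M(6) that in \<open>auto simp: mu2_eq_0\<close>)
  then show ?thesis
    unfolding minimal_structures_def ainf_structure_def ins_whole whole_pieces
    using piece_graded[OF M(1)] eq M(7) by (simp add: whole_pieces) (simp add: pieces_def)
qed

lemma gauge_gau: "gauge_transformation G \<Longrightarrow> gau (whole G)"
proof -
  assume "gauge_transformation G"
  then have G: "G 0 = (\<lambda>_. 0)" "G 1 = unit_map" "\<And>d. d \<ge> 2 \<Longrightarrow> G d \<in> CC 1 (1 - int d)"
    by (auto simp: gauge_transformation_def unit_map_def fun_eq_iff)
  have "G d \<in> graded_maps (int d) (1 - int d)" if "d \<ge> 1" for d
  proof (cases "d = 1")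
    case True
    have "piece 1 unit_map = (unit_map :: 'a cochain)"
      by (auto simp: piece_def fun_eq_iff unit_map_eq_0)
    moreover have "piece 1 (unit_map :: 'a cochain) \<in> graded_maps (int 1) 0"
      by (rule piece_graded[OF fam_unit_map]) simp
    ultimately show ?thesis using True G(2) by simp
  next
    case False
    then show ?thesis using G(3)[of d] that by (simp add: CC_def)
  qed
  then have f: "fam 1 (whole G)" by (rule fam_whole(1)[where \<mu> = G, OF G(1)])
  have "whole G xs = unit_map xs" if "alg_one \<in> set xs" for xs
  proof -
    consider "length xs = 0" | "length xs = 1" | "length xs \<ge> 2" by linarith
    then show ?thesis
    proof cases
      case 3
      then have "G (length xs) \<in> CC 1 (1 - int (length xs))" by (rule G(3))
      then show ?thesis using that 3 by (simp add: whole_def CC_def unit_map_eq_0)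
    qed (use G in \<open>auto simp: whole_def\<close>)
  qed
  then show ?thesis using f G(1,2) by (auto simp: gau_def whole_def)
qed

lemma gau_gauge: "gau G \<Longrightarrow> gauge_transformation (pieces G)"
proof -
  assume "gau G"
  note G = gauD[OF this]
  have "piece d G \<in> CC 1 (1 - int d)" if "d \<ge> 2" for d
    by (rule piece_CC[OF G(1)]) (use G(5) that in \<open>auto simp: unit_map_eq_0\<close>)
  moreover have "piece 0 G = (\<lambda>_. 0)" "piece 1 G = unit_map"
    using G(3,4) by (auto simp: piece_def fun_eq_iff length_Suc_conv unit_map_eq_0)
  ultimately show ?thesis
    by (simp add: gauge_transformation_def pieces_def unit_map_def[abs_def])
qed

section \<open>Sums over decompositions into nonempty blocks\<close>

definition block_lists :: "'a list \<Rightarrow> 'a list list set" where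
  "block_lists xs = {bs. concat bs = xs \<and> [] \<notin> set bs}"

lemma block_lists_Nil: "block_lists [] = {[]}"
proof -
  have "bs = []" if "concat bs = []" "[] \<notin> set bs" for bs :: "'a list list"
    using that by (cases bs) auto
  then show ?thesis by (auto simp: block_lists_def)
qed

lemma block_lists_Cons:
  "block_lists (x # ys) = (\<Union>(u, r)\<in>{(u, r). u @ r = ys}. (\<lambda>bs. (x # u) # bs) ` block_lists r)"
proof (intro equalityI subsetI)
  fix bs assume "bs \<in> block_lists (x # ys)"
  then obtain c cs where "bs = c # cs" "c \<noteq> []" "c @ concat cs = x # ys" "[] \<notin> set cs"
    by (cases bs) (auto simp: block_lists_def)
  then show "bs \<in> (\<Union>(u, r)\<in>{(u, r). u @ r = ys}. (\<lambda>bs. (x # u) # bs) ` block_lists r)"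
    by (cases c) (auto simp: block_lists_def)
qed (auto simp: block_lists_def)

lemma finite_block_lists: "finite (block_lists xs)"
proof (induction xs rule: length_induct)
  case (1 xs)
  then show ?case
    by (cases xs) (auto simp: block_lists_Nil block_lists_Cons finite_splits intro!: finite_UN_I)
qed

lemma blocks_eq_sum: "(\<Sum>bs\<in>block_lists xs. F (map G bs)) = blocks F G xs"
proof (induction xs arbitrary: F rule: length_induct)
  case (1 xs)
  show ?case
  proof (cases xs)
    case (Cons x ys)
    let ?S = "{(u, r). u @ r = ys}"
    let ?A = "\<lambda>(u, r). (\<lambda>bs. (x # u) # bs) ` block_lists r"
    have "(\<Sum>bs\<in>block_lists xs. F (map G bs)) = (\<Sum>p\<in>?S. \<Sum>bs\<in>?A p. F (map G bs))"
      unfolding Cons block_lists_Cons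
      by (rule sum.UNION_disjoint) (auto simp: finite_splits finite_block_lists)
    also have "\<dots> = (\<Sum>(u, r)\<in>?S. blocks (\<lambda>l. F (G (x # u) # l)) G r)"
    proof (intro sum.cong refl)
      fix p assume "p \<in> ?S"
      then obtain u r where p: "p = (u, r)" "u @ r = ys" by auto
      have "(\<Sum>bs\<in>?A p. F (map G bs)) = (\<Sum>bs\<in>block_lists r. F (G (x # u) # map G bs))"
        by (simp add: p sum.reindex inj_on_def)
      also have "\<dots> = blocks (\<lambda>l. F (G (x # u) # l)) G r"
        using 1[rule_format, of r "\<lambda>l. F (G (x # u) # l)"] p Cons by auto
      finally show "(\<Sum>bs\<in>?A p. F (map G bs)) = (case p of (u, r) \<Rightarrow> blocks (\<lambda>l. F (G (x # u) # l)) G r)"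
        by (simp add: p)
    qed
    finally show ?thesis by (simp add: Cons blocks.simps ssum_eq_sum)
  qed (simp add: block_lists_Nil)
qed

lemma ainf_hom_iff: "ainf_hom G \<mu> \<nu> \<longleftrightarrow> hom (whole G) (whole \<mu>) (whole \<nu>)"
proof -
  have "(\<Sum>bs\<in>{bs. concat bs = xs \<and> [] \<notin> set bs}. \<nu> (length bs) (map (\<lambda>b. G (length b) b) bs)) =
      blocks (whole \<nu>) (whole G) xs" for xs
    using blocks_eq_sum[of "whole \<nu>" "whole G" xs]
    by (simp add: block_lists_def whole_def[abs_def])
  then show ?thesis unfolding ainf_hom_def hom_def ins_whole by (simp only:)
qed

lemma gauge_rel_iff:
  "(\<mu>, \<nu>) \<in> gauge_rel \<longleftrightarrow>
     \<mu> \<in> minimal_structures \<and> \<nu> \<in> minimal_structures \<and> geq (whole \<mu>) (whole \<nu>)"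
proof -
  have "(\<exists>G. gauge_transformation G \<and> ainf_hom G \<mu> \<nu>) \<longleftrightarrow> geq (whole \<mu>) (whole \<nu>)"
    unfolding geq_def ainf_hom_iff
    using gauge_gau gau_gauge whole_pieces by metis
  then show ?thesis by (simp add: gauge_rel_def)
qed

lemma equiv_gauge_rel: "equiv minimal_structures gauge_rel"
proof (rule equivI)
  show "gauge_rel \<subseteq> minimal_structures \<times> minimal_structures" by (auto simp: gauge_rel_def)
  show "refl_on minimal_structures gauge_rel"
    by (auto simp: refl_on_def gauge_rel_iff geq_refl minimal_str(1))
  show "sym gauge_rel"
    by (auto simp: sym_def gauge_rel_iff geq_sym minimal_str(1))
  show "trans gauge_rel"
    unfolding trans_def gauge_rel_iff using geq_trans minimal_str(1) by blast
qed

lemma reduced_form_iff: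
  "reduced_form \<mu> \<mu>' \<longleftrightarrow> (\<mu>, \<mu>') \<in> gauge_rel \<and> red (whole \<mu>')"
proof -
  have "(\<forall>d\<in>{1, 3, 4, 5}. \<mu>' d = (\<lambda>_. 0)) \<longleftrightarrow> agree 5 (whole \<mu>') mu2" if m: "\<mu>' \<in> minimal_structures"
  proof
    note s = minimal_str[OF m]
    assume z: "\<forall>d\<in>{1, 3, 4, 5}. \<mu>' d = (\<lambda>_. 0)"
    show "agree 5 (whole \<mu>') mu2"
      unfolding agree_def
    proof (intro allI impI)
      fix xs :: "'a alg list" assume "length xs \<le> 5"
      then have "length xs \<le> 2 \<or> length xs = 3 \<or> length xs = 4 \<or> length xs = 5" by linarith
      then show "whole \<mu>' xs = mu2 xs"
        using z str_agree_2[OF s(1)] by (auto simp: agree_def whole_def mu2_eq_0)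
    qed
  next
    note s = minimal_str[OF m]
    assume a: "agree 5 (whole \<mu>') mu2"
    have "pieces (whole \<mu>') d = (\<lambda>_. 0)" if "d \<in> {1, 3, 4, 5}" for d
      using a that by (auto simp: pieces_def piece_def fun_eq_iff agree_def mu2_eq_0)
    then show "\<forall>d\<in>{1, 3, 4, 5}. \<mu>' d = (\<lambda>_. 0)" by (simp add: s(2))
  qed
  then show ?thesis
    using minimal_str(1) by (auto simp: reduced_form_def red_def gauge_rel_iff)
qed

lemma piece_whole: "\<mu> \<in> minimal_structures \<Longrightarrow> piece d (whole \<mu>) = \<mu> d"
  using minimal_str(2)[of \<mu>] by (metis pieces_def)


subsection \<open>Rescaling\<close>

text \<open>\<open>c\<close> is -2 for structures and -1 for gauge transformations; with these
  values a rescaled gauge transformation intertwines the rescaled structures.\<close>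

definition rsc :: "'k::field \<Rightarrow> int \<Rightarrow> 'k cochain \<Rightarrow> 'k cochain" where
  "rsc t c F = (\<lambda>xs. t powi (int (length xs) + c) *s F xs)"

lemma mlin_rsc: "multilinear F \<Longrightarrow> multilinear (rsc t c F)"
  unfolding multilinear_iff_lin rsc_def by (auto intro!: lin_cmult)

lemma fam_rsc: "fam n F \<Longrightarrow> fam n (rsc t c F)"
  using mlin_rsc[of F t c] by (auto simp: fam_def) (auto simp: rsc_def intro: homogeneous_scale)

lemma powi_mult: "t \<noteq> 0 \<Longrightarrow> a + b = c \<Longrightarrow> t powi a * t powi b = t powi c" for t :: "'k::field"
  by (simp add: power_int_add[symmetric])

lemma blocks_rsc:
  assumes "t \<noteq> 0"
  shows "multilinear F \<Longrightarrow> blocks (rsc t c F) (rsc t (-1) G) xs = rsc t c (blocks F G) xs"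
proof (induction xs arbitrary: F c rule: length_induct)
  case (1 xs)
  note F = 1(2)
  show ?case
  proof (cases xs)
    case (Cons x ys)
    have "blocks (\<lambda>l. rsc t c F (rsc t (-1) G (x # bs) # l)) (rsc t (-1) G) rs =
        t powi (int (length xs) + c) *s blocks (\<lambda>l. F (G (x # bs) # l)) G rs" if b: "bs @ rs = ys" for bs rs
    proof -
      have "(\<lambda>l. rsc t c F (rsc t (-1) G (x # bs) # l)) =
          rsc t (c + 1 + int (length bs)) (\<lambda>l. F (G (x # bs) # l))"
        unfolding rsc_def lin_scale[OF mlin_lin_Cons[OF F]] vector_smult_assoc
        by (intro ext arg_cong[where f = "\<lambda>c. c *s _"] powi_mult[OF assms]) simp
      then have "blocks (\<lambda>l. rsc t c F (rsc t (-1) G (x # bs) # l)) (rsc t (-1) G) rs =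
          rsc t (c + 1 + int (length bs)) (blocks (\<lambda>l. F (G (x # bs) # l)) G) rs"
        using 1(1) mlin_Cons[OF F] b Cons by auto
      moreover have "int (length rs) + (c + 1 + int (length bs)) = int (length xs) + c"
        using b Cons by auto
      ultimately show ?thesis by (simp add: rsc_def)
    qed
    then have "blocks (rsc t c F) (rsc t (-1) G) xs =
        ssum (\<lambda>bs rs. t powi (int (length xs) + c) *s blocks (\<lambda>l. F (G (x # bs) # l)) G rs) ys"
      unfolding Cons blocks.simps by (intro ssum_cong refl) simp
    then show ?thesis
      by (simp add: rsc_def Cons blocks.simps lin_ssum[of "(*s) (t powi (1 + int (length ys) + c))"] lin_cmult)
  qed (simp add: rsc_def)
qed

lemma ins_rsc:
  assumes "t \<noteq> 0" "multilinear F"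
  shows "ins S (rsc t a F) (rsc t b N) xs = rsc t (a + b + 1) (ins S F N) xs"
proof -
  have "rsc t a F (us @ rsc t b N vs # map S ws) =
      t powi (int (length xs) + (a + b + 1)) *s F (us @ N vs # map S ws)" if "us @ vs @ ws = xs" for us vs ws
  proof -
    have "int (length us + 1 + length ws) + a + (int (length vs) + b) = int (length xs) + (a + b + 1)"
      using that by auto
    then show ?thesis
      unfolding rsc_def lin_scale[OF mlin_lin[OF assms(2)]] vector_smult_assoc
      by (intro arg_cong[where f = "\<lambda>c. c *s _"] powi_mult[OF assms(1)]) simp
  qed
  then have "ins S (rsc t a F) (rsc t b N) xs =
      ssum (\<lambda>us rs. ssum (\<lambda>vs ws. t powi (int (length xs) + (a + b + 1)) *s F (us @ N vs # map S ws)) rs) xs"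
    unfolding ins_def by (intro ssum_cong refl) auto
  then show ?thesis
    by (simp add: rsc_def ins_def lin_ssum[of "(*s) (t powi (int (length xs) + (a + b + 1)))"] lin_cmult)
qed

lemma str_rsc:
  assumes "t \<noteq> 0" "str M"
  shows "str (rsc t (-2) M)"
proof -
  note M = strD[OF assms(2)]
  have "rsc t (-2) M xs = mu2 xs" if "alg_one \<in> set xs" for xs
    using M(6)[OF that] by (cases "length xs = 2") (auto simp: rsc_def mu2_eq_0)
  then show ?thesis
    using M ins_rsc[OF assms(1) M(2), of tau "-2" "-2" M]
    by (simp add: str_def fam_rsc) (simp add: rsc_def)
qed

lemma gau_rsc:
  assumes "gau G"
  shows "gau (rsc t (-1) G)"
proof -
  note G = gauD[OF assms]
  have "rsc t (-1) G xs = unit_map xs" if "alg_one \<in> set xs" for xs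
    using G(5)[OF that] by (cases "length xs = 1") (auto simp: rsc_def unit_map_eq_0)
  then show ?thesis using G by (simp add: gau_def fam_rsc) (simp add: rsc_def)
qed

lemma geq_rsc:
  assumes "t \<noteq> 0" "str M" "str N" "geq M N"
  shows "geq (rsc t (-2) M) (rsc t (-2) N)"
proof -
  obtain G where G: "gau G" "hom G M N" using assms(4) by (auto simp: geq_def)
  have "hom (rsc t (-1) G) (rsc t (-2) M) (rsc t (-2) N)"
    unfolding hom_def blocks_rsc[OF assms(1) strD(2)[OF assms(3)]] ins_rsc[OF assms(1) gauD(2)[OF G(1)]]
    using G(2) by (simp add: hom_def rsc_def)
  then show ?thesis using gau_rsc[OF G(1)] by (auto simp: geq_def)
qed

lemma whole_rescale: "whole (rescale t \<mu>) = rsc t (-2) (whole \<mu>)"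
  by (simp add: whole_def rescale_def rsc_def fun_eq_iff)

lemma rescale_minimal:
  assumes "t \<noteq> 0" "\<mu> \<in> minimal_structures"
  shows "rescale t \<mu> \<in> minimal_structures"
proof -
  have "\<mu> d xs = 0" if "length xs \<noteq> d" for d xs
    using piece_whole[OF assms(2), of d] that by (metis piece_def)
  then have "pieces (whole (rescale t \<mu>)) = rescale t \<mu>"
    by (intro pieces_whole) (simp add: rescale_def)
  then show ?thesis
    using str_minimal[OF str_rsc[OF assms(1) minimal_str(1)[OF assms(2)]]]
    by (simp add: whole_rescale)
qed

lemma rescale_reduced:
  assumes "t \<noteq> 0" "reduced_form \<mu> \<mu>'"
  shows "reduced_form (rescale t \<mu>) (rescale t \<mu>')"
proof -
  have m: "\<mu> \<in> minimal_structures" "\<mu>' \<in> minimal_structures" "geq (whole \<mu>) (whole \<mu>')" "red (whole \<mu>')"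
    using assms(2) by (auto simp: reduced_form_iff gauge_rel_iff)
  have "rsc t (-2) (whole \<mu>') xs = mu2 xs" if "length xs \<le> 5" for xs
    using m(4) that by (cases "length xs = 2") (auto simp: red_def agree_def rsc_def mu2_eq_0)
  then have "red (whole (rescale t \<mu>'))"
    using str_rsc[OF assms(1)] m(4) by (simp add: red_def whole_rescale agree_def)
  then show ?thesis
    using m geq_rsc[OF assms(1) minimal_str(1)[OF m(1)] minimal_str(1)[OF m(2)] m(3)]
      rescale_minimal[OF assms(1) m(1)] rescale_minimal[OF assms(1) m(2)]
    by (simp add: reduced_form_iff gauge_rel_iff whole_rescale)
qed

lemma class_pair_rescale:
  "class_pair (rescale t \<mu>) =
     (HH_scale 2 (-4) (t ^ 4) (fst (class_pair \<mu>)), HH_scale 2 (-6) (t ^ 6) (snd (class_pair \<mu>)))"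
  by (simp add: class_pair_def HH_scale_class rescale_def[abs_def])

section \<open>The parametrization by pairs of classes\<close>

theorem theorem5:
  assumes "CHAR('k::field) \<notin> {2, 3}"
  shows
    "(\<forall>\<mu> \<in> (minimal_structures :: 'k family set). \<exists>\<mu>'. reduced_form \<mu> \<mu>') \<and>
     (\<forall>\<mu> \<in> (minimal_structures :: 'k family set). \<forall>\<mu>'. reduced_form \<mu> \<mu>' \<longrightarrow>
        \<mu>' 6 \<in> cocycles 2 (-4) \<and> \<mu>' 8 \<in> cocycles 2 (-6)) \<and>
     (\<forall>\<mu> \<in> (minimal_structures :: 'k family set). \<forall>\<nu> \<in> minimal_structures. \<forall>\<mu>' \<nu>'.
        reduced_form \<mu> \<mu>' \<longrightarrow> reduced_form \<nu> \<nu>' \<longrightarrow>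
        ((\<mu>, \<nu>) \<in> gauge_rel \<longleftrightarrow> class_pair \<mu>' = class_pair \<nu>')) \<and>
     (\<forall>p \<in> (HH 2 (-4) \<times> HH 2 (-6) :: ('k cochain set \<times> 'k cochain set) set).
        \<exists>\<mu> \<in> minimal_structures. \<exists>\<mu>'. reduced_form \<mu> \<mu>' \<and> class_pair \<mu>' = p) \<and>
     HH_one_dimensional TYPE('k) 2 (-4) \<and>
     HH_one_dimensional TYPE('k) 2 (-6) \<and>
     equiv (minimal_structures :: 'k family set) gauge_rel \<and>
     (\<exists>\<Phi>. bij_betw \<Phi> ((minimal_structures :: 'k family set) // gauge_rel)
                     (HH 2 (-4) \<times> HH 2 (-6)) \<and>
          (\<forall>\<mu> \<in> minimal_structures. \<forall>\<mu>'. reduced_form \<mu> \<mu>' \<longrightarrow>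
             \<Phi> (gauge_rel `` {\<mu>}) = class_pair \<mu>') \<and>
          (\<forall>t. t \<noteq> 0 \<longrightarrow> (\<forall>\<mu> \<in> minimal_structures.
             rescale t \<mu> \<in> minimal_structures \<and>
             (\<forall>\<alpha> \<beta>. \<Phi> (gauge_rel `` {\<mu>}) = (\<alpha>, \<beta>) \<longrightarrow>
                \<Phi> (gauge_rel `` {rescale t \<mu>}) =
                  (HH_scale 2 (-4) (t ^ 4) \<alpha>, HH_scale 2 (-6) (t ^ 6) \<beta>)))))"
proof -
  let ?M = "minimal_structures :: 'k family set"
  have eqv: "equiv ?M gauge_rel" by (rule equiv_gauge_rel)
  have ex: "\<exists>\<mu>'. reduced_form \<mu> \<mu>'" if m: "\<mu> \<in> ?M" for \<mu>
  proof -
    obtain N where N: "red N" "geq (whole \<mu>) N"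
      using red_exists[OF assms minimal_str(1)[OF m]] by blast
    have "pieces N \<in> ?M" by (rule str_minimal) (use N in \<open>simp add: red_def\<close>)
    then show ?thesis using N m
      by (intro exI[of _ "pieces N"]) (simp add: reduced_form_iff gauge_rel_iff whole_pieces)
  qed
  have coc: "\<mu>' 6 \<in> cocycles 2 (-4) \<and> \<mu>' 8 \<in> cocycles 2 (-6)" if r: "reduced_form \<mu> \<mu>'" for \<mu> \<mu>' :: "'k family"
  proof -
    have "\<mu>' \<in> ?M" "red (whole \<mu>')" using r by (auto simp: reduced_form_iff gauge_rel_iff)
    then show ?thesis
      using red_cocycle[of "whole \<mu>'" 6] red_cocycle[of "whole \<mu>'" 8] by (simp add: piece_whole)
  qed
  have cls: "(\<mu>, \<nu>) \<in> gauge_rel \<longleftrightarrow> class_pair \<mu>' = class_pair \<nu>'"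
    if r: "reduced_form \<mu> \<mu>'" "reduced_form \<nu> \<nu>'" for \<mu> \<nu> \<mu>' \<nu>' :: "'k family"
  proof -
    have m: "(\<mu>, \<mu>') \<in> gauge_rel" "(\<nu>, \<nu>') \<in> gauge_rel" "\<mu>' \<in> ?M" "\<nu>' \<in> ?M"
      and rd: "red (whole \<mu>')" "red (whole \<nu>')"
      using r by (auto simp: reduced_form_iff gauge_rel_iff)
    have "(\<mu>, \<nu>) \<in> gauge_rel \<longleftrightarrow> (\<mu>', \<nu>') \<in> gauge_rel"
      using m(1,2) eqv by (meson equivE symE transE)
    also have "\<dots> \<longleftrightarrow> geq (whole \<mu>') (whole \<nu>')" using m by (simp add: gauge_rel_iff)
    also have "\<dots> \<longleftrightarrow> class_pair \<mu>' = class_pair \<nu>'"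
      using red_geq_classes[OF assms rd, of 6] red_geq_classes[OF assms rd, of 8]
        classes_geq[OF assms rd] m(3,4)
      by (auto simp: class_pair_def HH_class_eq_iff piece_whole)
    finally show ?thesis .
  qed
  have real: "\<exists>\<mu> \<in> ?M. \<exists>\<mu>'. reduced_form \<mu> \<mu>' \<and> class_pair \<mu>' = p" if p: "p \<in> HH 2 (-4) \<times> HH 2 (-6)" for p
  proof -
    obtain \<phi> \<psi> where \<phi>: "\<phi> \<in> cocycles 2 (-4)" "\<psi> \<in> cocycles 2 (-6)"
      "p = (HH_class 2 (-4) \<phi>, HH_class 2 (-6) \<psi>)"
      using p by (auto simp: HH_def)
    obtain M where M: "red M" "piece 6 M = \<phi>" "piece 8 M = \<psi>"
      using red_realize[OF assms \<phi>(1,2)] by blast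
    have s: "str M" using M(1) by (simp add: red_def)
    have "reduced_form (pieces M) (pieces M)"
      using str_minimal[OF s] geq_refl[OF s] M(1) by (simp add: reduced_form_iff gauge_rel_iff whole_pieces)
    moreover have "class_pair (pieces M) = p" using M \<phi>(3) by (simp add: class_pair_def pieces_def)
    ultimately show ?thesis using str_minimal[OF s] by blast
  qed
  \<comment> \<open>By \<open>cls\<close> the pair of classes depends neither on the reduced form
    chosen here nor on the representative chosen for \<open>\<Phi>\<close> below.\<close>
  define cl where "cl \<mu> = class_pair (SOME \<mu>'. reduced_form \<mu> \<mu>')" for \<mu> :: "'k family"
  have cl: "cl \<mu> = class_pair \<mu>'" if r: "reduced_form \<mu> \<mu>'" for \<mu> \<mu>'
  proof -
    have "reduced_form \<mu> (SOME \<mu>'. reduced_form \<mu> \<mu>')" using r by (rule someI[of "reduced_form \<mu>"])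
    moreover have "(\<mu>, \<mu>) \<in> gauge_rel"
      using r by (auto simp: reduced_form_iff gauge_rel_iff geq_refl minimal_str(1))
    ultimately show ?thesis using cls[OF _ r] by (simp add: cl_def)
  qed
  have cl_iff: "(\<mu>, \<nu>) \<in> gauge_rel \<longleftrightarrow> cl \<mu> = cl \<nu>" if m: "\<mu> \<in> ?M" "\<nu> \<in> ?M" for \<mu> \<nu>
  proof -
    obtain \<mu>' \<nu>' where "reduced_form \<mu> \<mu>'" "reduced_form \<nu> \<nu>'" using ex m by blast
    then show ?thesis using cls cl by simp
  qed
  define \<Phi> where "\<Phi> C = cl (SOME \<mu>. \<mu> \<in> C)" for C :: "'k family set"
  have \<Phi>: "\<Phi> (gauge_rel `` {\<mu>}) = cl \<mu>" if m: "\<mu> \<in> ?M" for \<mu>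
  proof -
    have "\<mu> \<in> gauge_rel `` {\<mu>}" using m by (simp add: gauge_rel_iff geq_refl minimal_str(1))
    moreover define \<nu> where "\<nu> = (SOME \<nu>. \<nu> \<in> gauge_rel `` {\<mu>})"
    ultimately have "\<nu> \<in> gauge_rel `` {\<mu>}"
      by (simp only: someI[of "\<lambda>\<nu>. \<nu> \<in> gauge_rel `` {\<mu>}"])
    then have r: "(\<mu>, \<nu>) \<in> gauge_rel" by simp
    then have "\<nu> \<in> ?M" by (simp add: gauge_rel_iff)
    then have "cl \<mu> = cl \<nu>" using cl_iff[OF m] r by blast
    then show ?thesis unfolding \<Phi>_def \<nu>_def by (rule sym)
  qed
  have clHH: "cl \<mu> \<in> HH 2 (-4) \<times> HH 2 (-6)" if m: "\<mu> \<in> ?M" for \<mu>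
  proof -
    obtain \<mu>' where r: "reduced_form \<mu> \<mu>'" using ex[OF m] by blast
    show ?thesis using coc[OF r] by (auto simp: cl[OF r] class_pair_def HH_def)
  qed
  have bij: "bij_betw \<Phi> (?M // gauge_rel) (HH 2 (-4) \<times> HH 2 (-6))"
    unfolding bij_betw_def
  proof
    show "inj_on \<Phi> (?M // gauge_rel)"
    proof (rule inj_onI)
      fix C D assume "C \<in> ?M // gauge_rel" "D \<in> ?M // gauge_rel" and e: "\<Phi> C = \<Phi> D"
      then obtain \<mu> \<nu> where m: "\<mu> \<in> ?M" "\<nu> \<in> ?M" "C = gauge_rel `` {\<mu>}" "D = gauge_rel `` {\<nu>}"
        by (auto elim!: quotientE)
      then have "(\<mu>, \<nu>) \<in> gauge_rel" using e \<Phi> cl_iff by simp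
      then show "C = D" using m(3,4) equiv_class_eq[OF eqv] by simp
    qed
    show "\<Phi> ` (?M // gauge_rel) = HH 2 (-4) \<times> HH 2 (-6)"
    proof (intro equalityI subsetI)
      fix p assume "p \<in> \<Phi> ` (?M // gauge_rel)"
      then obtain \<mu> where "\<mu> \<in> ?M" "p = \<Phi> (gauge_rel `` {\<mu>})" by (auto elim!: quotientE)
      then show "p \<in> HH 2 (-4) \<times> HH 2 (-6)" using \<Phi> clHH by simp
    next
      fix p :: "'k cochain set \<times> 'k cochain set" assume "p \<in> HH 2 (-4) \<times> HH 2 (-6)"
      then obtain \<mu> \<mu>' where "\<mu> \<in> ?M" "reduced_form \<mu> \<mu>'" "class_pair \<mu>' = p" using real by blast
      then have "p = \<Phi> (gauge_rel `` {\<mu>})" using \<Phi> cl by simp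
      then show "p \<in> \<Phi> ` (?M // gauge_rel)" using \<open>\<mu> \<in> ?M\<close> by (simp add: quotientI)
    qed
  qed
  have resc: "cl (rescale t \<mu>) = (HH_scale 2 (-4) (t ^ 4) \<alpha>, HH_scale 2 (-6) (t ^ 6) \<beta>)"
    if t: "t \<noteq> 0" "\<mu> \<in> ?M" "cl \<mu> = (\<alpha>, \<beta>)" for t \<mu> \<alpha> \<beta>
  proof -
    obtain \<mu>' where r: "reduced_form \<mu> \<mu>'" using ex[OF t(2)] by blast
    then have "class_pair \<mu>' = (\<alpha>, \<beta>)" using t(3) by (simp add: cl)
    then show ?thesis by (simp add: cl[OF rescale_reduced[OF t(1) r]] class_pair_rescale)
  qed
  show ?thesis
  proof (intro conjI)
    show "\<exists>\<Phi>. bij_betw \<Phi> (?M // gauge_rel) (HH 2 (-4) \<times> HH 2 (-6)) \<and>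
          (\<forall>\<mu> \<in> minimal_structures. \<forall>\<mu>'. reduced_form \<mu> \<mu>' \<longrightarrow>
             \<Phi> (gauge_rel `` {\<mu>}) = class_pair \<mu>') \<and>
          (\<forall>t. t \<noteq> 0 \<longrightarrow> (\<forall>\<mu> \<in> minimal_structures.
             rescale t \<mu> \<in> minimal_structures \<and>
             (\<forall>\<alpha> \<beta>. \<Phi> (gauge_rel `` {\<mu>}) = (\<alpha>, \<beta>) \<longrightarrow>
                \<Phi> (gauge_rel `` {rescale t \<mu>}) =
                  (HH_scale 2 (-4) (t ^ 4) \<alpha>, HH_scale 2 (-6) (t ^ 6) \<beta>))))"
      by (intro exI[of _ \<Phi>] conjI bij ballI allI impI)
        (simp_all add: \<Phi> cl rescale_minimal resc)
  qed (use ex coc cls real eqv HH_one_dimensional_4 HH_one_dimensional_6 in blast)+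
qed

end
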